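(* Let $X \subset \mathbb{P}^5$ be a surface of maximal sectional regularity of degree $d > 5$ which is of type I, so that $X$ is a divisor on a smooth $3$-fold scroll $W = S(1,1,1)\subset\mathbb{P}^5$ linearly equivalent to $H+(d-3)F$, where $H$ is the hyperplane divisor and $F$ a ruling plane of $W$. Then: (a) $\mathbb{F}^+(X) = \mathbb{F}(X) = W = S(1,1,1)$. (b) ${}^*\Sigma(X) = \Sigma(X)$. (c) The image $\psi\big(\Sigma(X)\big)$ of $\Sigma(X)$ under the Plücker embedding $\psi : \mathbb{G}(1,\mathbb{P}^5) \to \mathbb{P}^{14}$ is a Veronese surface in a subspace $\mathbb{P}^5 \subset \mathbb{P}^{14}$.
   Context: $\Bbbk$ is an algebraically closed field, $\mathbb{G}(k,\mathbb{P}^5)$ is the Grassmannian of $k$-dimensional linear subspaces of $\mathbb{P}^5$. A non-degenerate irreducible projective surface $X\subset\mathbb{P}^5$ of degree $d>5$ is of maximal sectional regularity if the Castelnuovo-Mumford regularity of a general hyperplane section curve takes the maximally possible value $d-2$. It is of type I if it is a divisor on the smooth rational normal scroll $W=S(1,1,1)$ (Segre embedding of $\mathbb{P}^1\times\mathbb{P}^2$) linearly equivalent to $H+(d-3)F$; such $X$ is smooth. (The only other possibility, type II, is that some plane $\mathbb{F}\subset\mathbb{P}^5$ meets $X$ in a pure curve of degree $d-2$.) The extremal secant locus is $\Sigma(X):=\overline{\{\mathbb{L}\in\mathbb{G}(1,\mathbb{P}^5)\mid d-2\le\mathrm{length}(X\cap\mathbb{L})<\infty\}}$. Let $\mathcal{U}(X)$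 be the largest open subset of $\mathbb{G}(4,\mathbb{P}^5)$ such that for every $\Lambda\in\mathcal{U}(X)$ the section $\mathcal{C}_\Lambda=X\cap\Lambda\subset\Lambda=\mathbb{P}^4$ is an integral curve of maximal regularity $d-2$; for such $\Lambda$ let $\mathbb{L}_\Lambda$ be the unique $(d-2)$-secant line of $\mathcal{C}_\Lambda$ in $\Lambda$. The special extremal secant locus is ${}^*\Sigma(X):=\overline{\{\mathbb{L}_\Lambda\mid\Lambda\in\mathcal{U}(X)\}}\subseteq\Sigma(X)$. The extremal variety and the extended extremal variety are $\mathbb{F}(X):=\overline{\bigcup_{\Lambda\in\mathcal{U}(X)}\mathbb{L}_\Lambda}$ and $\mathbb{F}^+(X):=\overline{\bigcup_{\mathbb{L}\in\Sigma(X)}\mathbb{L}}$. *)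

theory Defs
  imports "HOL-Analysis.Analysis" "HOL-Library.Poly_Mapping"
    "HOL-Computational_Algebra.Computational_Algebra"
begin

section \<open>Polynomials in finitely many variables\<close>

type_synonym ('n, 'a) mpoly = "('n \<Rightarrow>\<^sub>0 nat) \<Rightarrow>\<^sub>0 'a"

text \<open>Image of a polynomial under the map that is \<open>h\<close> on coefficients and sends the variable
  \<open>i\<close> to \<open>x i\<close>.\<close>

definition mp_eval :: "('a \<Rightarrow> 'b) \<Rightarrow> ('n \<Rightarrow> 'b) \<Rightarrow> ('n::finite, 'a::zero) mpoly \<Rightarrow> 'b::comm_semiring_1" where
  "mp_eval h x f =
     (\<Sum>m\<in>Poly_Mapping.keys f. h (Poly_Mapping.lookup f m) * (\<Prod>i\<in>UNIV. x i ^ Poly_Mapping.lookup m i))"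

definition mp_value :: "('n::finite, 'a::comm_semiring_1) mpoly \<Rightarrow> 'a ^ 'n \<Rightarrow> 'a" where
  "mp_value f v = mp_eval (\<lambda>c. c) (\<lambda>i. v $ i) f"

definition mp_const :: "'a \<Rightarrow> ('n, 'a::zero) mpoly" where
  "mp_const c = Poly_Mapping.single 0 c"

definition mp_var :: "'n \<Rightarrow> ('n, 'a::zero_neq_one) mpoly" where
  "mp_var i = Poly_Mapping.single (Poly_Mapping.single i 1) 1"

text \<open>Pullback of a polynomial along the linear map \<open>y \<mapsto> A *v y\<close>.\<close>

definition mp_pullback :: "'a ^ 'm ^ 'n \<Rightarrow> ('n::finite, 'a::comm_ring_1) mpoly \<Rightarrow> ('m::finite, 'a) mpoly" where
  "mp_pullback A f = mp_eval mp_const (\<lambda>i. \<Sum>j\<in>UNIV. mp_const (A $ i $ j) * mp_var j) f"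

definition forms :: "nat \<Rightarrow> ('n::finite, 'a::zero) mpoly set" where
  "forms n = {f. \<forall>m\<in>Poly_Mapping.keys f. (\<Sum>i\<in>UNIV. Poly_Mapping.lookup m i) = n}"

definition homogeneous :: "('n::finite, 'a::zero) mpoly \<Rightarrow> bool" where
  "homogeneous f \<longleftrightarrow> (\<exists>n. f \<in> forms n)"

text \<open>\<open>ideal.subspace\<close> says that a set is an ideal, \<open>ideal.span\<close> generates ideals.\<close>

global_interpretation ideal: module "(*) :: 'r::comm_ring_1 \<Rightarrow> 'r \<Rightarrow> 'r"
  by unfold_locales (simp_all add: algebra_simps)

global_interpretation mpoly: vector_space "\<lambda>(c::'a::field) (f::('n::finite, 'a) mpoly). mp_const c * f"
proof unfold_locales
  fix a b :: 'a and f g :: "('n, 'a) mpoly"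
  show "mp_const a * (f + g) = mp_const a * f + mp_const a * g"
    by (rule distrib_left)
  show "mp_const (a + b) * f = mp_const a * f + mp_const b * f"
    by (simp add: mp_const_def single_add distrib_right)
  show "mp_const a * (mp_const b * f) = mp_const (a * b) * f"
    by (simp add: mp_const_def mult_single flip: mult.assoc)
  show "mp_const 1 * f = f"
    by (simp add: mp_const_def)
qed

definition prime_ideal :: "'r::comm_ring_1 set \<Rightarrow> bool" where
  "prime_ideal I \<longleftrightarrow> ideal.subspace I \<and> I \<noteq> UNIV \<and> (\<forall>f g. f * g \<in> I \<longrightarrow> f \<in> I \<or> g \<in> I)"

fun ideal_power :: "'r::comm_ring_1 set \<Rightarrow> nat \<Rightarrow> 'r set" where
  "ideal_power I 0 = UNIV"
| "ideal_power I (Suc n) = ideal.span {f * g | f g. f \<in> I \<and> g \<in> ideal_power I n}"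

section \<open>Projective space, Grassmannians and the Zariski topology\<close>

text \<open>A \<open>k\<close>-dimensional linear subspace of the projective space of \<open>'a ^ 'n\<close> is a vector subspace
  of dimension \<open>k + 1\<close>. In particular a point is a one-dimensional vector subspace.\<close>

definition Gr :: "nat \<Rightarrow> ('a::field ^ 'n) set set" where
  "Gr k = {V. vec.subspace V \<and> vec.dim V = k + 1}"

abbreviation proj_space :: "('a::field ^ 'n) set set" where
  "proj_space \<equiv> Gr 0"

definition points :: "('a::field ^ 'n) set \<Rightarrow> ('a ^ 'n) set set" where
  "points V = {p \<in> proj_space. p \<subseteq> V}"

definition nonvanishing :: "('n::finite, 'a::field) mpoly \<Rightarrow> ('a ^ 'n) set set" where
  "nonvanishing f = {p \<in> proj_space. \<exists>v\<in>p. mp_value f v \<noteq> 0}"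

definition zariski :: "('a::field ^ 'n) set topology" where
  "zariski = topology_generated_by {nonvanishing f | f. homogeneous f}"

definition irreducible_closed :: "'p topology \<Rightarrow> 'p set \<Rightarrow> bool" where
  "irreducible_closed T Z \<longleftrightarrow> closedin T Z \<and> Z \<noteq> {} \<and>
     (\<forall>A B. closedin T A \<and> closedin T B \<and> Z \<subseteq> A \<union> B \<longrightarrow> Z \<subseteq> A \<or> Z \<subseteq> B)"

definition krull_dim :: "'p topology \<Rightarrow> 'p set \<Rightarrow> enat" where
  "krull_dim T Z = Sup {enat n | n. \<exists>c :: nat \<Rightarrow> 'p set.
     (\<forall>i\<le>n. irreducible_closed T (c i) \<and> c i \<subseteq> Z) \<and> (\<forall>i<n. c i \<subset> c (Suc i))}"

definition vanishing_ideal :: "('a::field ^ 'n) set set \<Rightarrow> ('n::finite, 'a) mpoly set" where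
  "vanishing_ideal Z = ideal.span {f. homogeneous f \<and> (\<forall>p\<in>Z. \<forall>v\<in>p. mp_value f v = 0)}"

definition nondegenerate :: "('a::field ^ 'n) set set \<Rightarrow> bool" where
  "nondegenerate Z \<longleftrightarrow> \<not> (\<exists>V. vec.subspace V \<and> V \<noteq> UNIV \<and> Z \<subseteq> points V)"

text \<open>The Grassmannian of lines in \<open>\<P>\<^sup>5\<close> with its topology from the Pluecker embedding into
  \<open>\<P>\<^sup>1\<^sup>4\<close>; the fifteen Pluecker coordinates are indexed by the pairs \<open>i < j\<close>.\<close>

typedef plucker_index = "{(i :: 6, j :: 6). i < j}"
proof -
  have "(0 :: 6) < 1 \<or> (1 :: 6) < 0"
    by (simp flip: neq_iff)
  then show ?thesis
    by blast
qed

instance plucker_index :: finite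
proof
  have "(UNIV :: plucker_index set) = Abs_plucker_index ` {(i, j). i < j}"
    using type_definition.Abs_image[OF type_definition_plucker_index] by simp
  then show "finite (UNIV :: plucker_index set)"
    by (metis finite finite_imageI)
qed

lemma CARD_plucker_index: "CARD(plucker_index) = 15"
proof -
  let ?A = "{(i :: 6, j :: 6). i < j}"
  let ?B = "{(i :: 6, j :: 6). j < i}"
  let ?D = "{(i :: 6, j :: 6). i = j}"
  have "card ?B = card ?A"
    by (rule bij_betw_same_card[of prod.swap]) (auto simp: bij_betw_def inj_on_def)
  moreover have "?D = (\<lambda>i. (i, i)) ` UNIV"
    by auto
  then have "card ?D = 6"
    by (simp add: card_image inj_on_def)
  moreover have "(UNIV :: (6 \<times> 6) set) = ?A \<union> (?B \<union> ?D)"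
    by auto
  then have "card (UNIV :: (6 \<times> 6) set) = card (?A \<union> (?B \<union> ?D))"
    by simp
  then have "36 = card (?A \<union> (?B \<union> ?D))"
    by (simp add: card_cartesian_product flip: UNIV_Times_UNIV)
  moreover have "card (?A \<union> (?B \<union> ?D)) = card ?A + (card ?B + card ?D)"
    by (subst card_Un_disjoint, simp, simp, force, subst card_Un_disjoint) auto
  ultimately have "card ?A = 15"
    by linarith
  then show ?thesis
    using type_definition.card[OF type_definition_plucker_index] by simp
qed

definition plucker_coords :: "'a::field ^ 6 \<Rightarrow> 'a ^ 6 \<Rightarrow> 'a ^ plucker_index" where
  "plucker_coords u v =
     (\<chi> k. case Rep_plucker_index k of (i, j) \<Rightarrow> u $ i * v $ j - u $ j * v $ i)"

definition plucker :: "('a::field ^ 6) set \<Rightarrow> ('a ^ plucker_index) set" where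
  "plucker L = vec.span {plucker_coords u v | u v. u \<in> L \<and> v \<in> L}"

definition line_topology :: "('a::field ^ 6) set topology" where
  "line_topology = pullback_topology (Gr 1) plucker zariski"

text \<open>The Grassmannian of hyperplanes, identified with the dual projective space.\<close>

definition annihilator :: "('a::field ^ 'n) set \<Rightarrow> ('a ^ 'n) set" where
  "annihilator V = {a. \<forall>x\<in>V. (\<Sum>i\<in>UNIV. a $ i * x $ i) = 0}"

definition hyperplane_topology :: "('a::field ^ 6) set topology" where
  "hyperplane_topology = pullback_topology (Gr 4) annihilator zariski"

section \<open>Closed subschemes of projective space\<close>

text \<open>A closed subscheme is represented by a homogeneous ideal; ideals with the same saturation
  represent the same subscheme. A closed subset carries its reduced structure, given by
  \<open>vanishing_ideal\<close>.\<close>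

definition saturation :: "('n::finite, 'a::comm_ring_1) mpoly set \<Rightarrow> ('n, 'a) mpoly set" where
  "saturation I = {f. \<exists>N. \<forall>i. mp_var i ^ N * f \<in> I}"

definition scheme_inter ::
    "('n::finite, 'a::comm_ring_1) mpoly set \<Rightarrow> ('n, 'a) mpoly set \<Rightarrow> ('n, 'a) mpoly set" where
  "scheme_inter I J = saturation (ideal.span (I \<union> J))"

definition support :: "('n::finite, 'a::field) mpoly set \<Rightarrow> ('a ^ 'n) set set" where
  "support I = {p \<in> proj_space. \<forall>f\<in>I. homogeneous f \<longrightarrow> (\<forall>v\<in>p. mp_value f v = 0)}"

definition hilbert_function :: "('n::finite, 'a::field) mpoly set \<Rightarrow> nat \<Rightarrow> nat" where
  "hilbert_function I n = mpoly.dim (forms n :: ('n, 'a) mpoly set) - mpoly.dim (forms n \<inter> I)"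

text \<open>The degree is \<open>r!\<close> times the leading coefficient of the Hilbert polynomial, \<open>r\<close> being the
  dimension.\<close>

definition has_degree :: "('n::finite, 'a::field) mpoly set \<Rightarrow> nat \<Rightarrow> bool" where
  "has_degree I d \<longleftrightarrow> (\<exists>P :: rat poly.
     (\<forall>\<^sub>F n in sequentially. of_nat (hilbert_function I n) = poly P (of_nat n)) \<and>
     of_nat d = fact (degree P) * lead_coeff P)"

text \<open>The subscheme is finite of length \<open>l\<close>: its Hilbert polynomial is the constant \<open>l\<close>.\<close>

definition has_length :: "('n::finite, 'a::field) mpoly set \<Rightarrow> nat \<Rightarrow> bool" where
  "has_length I l \<longleftrightarrow> (\<forall>\<^sub>F n in sequentially. hilbert_function I n = l)"

text \<open>A closed subscheme is integral iff its saturated homogeneous ideal is prime.\<close>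

definition integral_curve :: "('n::finite, 'a::field) mpoly set \<Rightarrow> bool" where
  "integral_curve I \<longleftrightarrow> prime_ideal (saturation I) \<and> krull_dim zariski (support I) = 1"

section \<open>Castelnuovo-Mumford regularity\<close>

text \<open>The cohomology of the twists of the ideal sheaf of a homogeneous ideal \<open>J\<close> is computed by
  the alternating Cech complex of the standard affine covering. The sections of the \<open>m\<close>-th twist
  over the set where all the variables in \<open>\<sigma>\<close> are nonzero are the elements of degree \<open>m\<close> of the
  localization of \<open>J\<close> at these variables, viewed inside the ring of Laurent polynomials.\<close>

type_synonym ('n, 'a) laurent = "('n \<Rightarrow>\<^sub>0 int) \<Rightarrow>\<^sub>0 'a"

definition laurent_of :: "('n::finite, 'a::comm_ring_1) mpoly \<Rightarrow> ('n, 'a) laurent" where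
  "laurent_of f = (\<Sum>m\<in>Poly_Mapping.keys f.
     Poly_Mapping.single (Poly_Mapping.map int m) (Poly_Mapping.lookup f m))"

definition ideal_sections ::
    "('n::finite, 'a::comm_ring_1) mpoly set \<Rightarrow> int \<Rightarrow> 'n set \<Rightarrow> ('n, 'a) laurent set" where
  "ideal_sections J m \<sigma> =
     {g. (\<forall>k\<in>Poly_Mapping.keys g. (\<Sum>i\<in>UNIV. Poly_Mapping.lookup k i) = m) \<and>
         (\<exists>N. laurent_of (\<Prod>i\<in>\<sigma>. mp_var i ^ N) * g \<in> laurent_of ` J)}"

definition cech_cochains :: "('n::finite, 'a::comm_ring_1) mpoly set \<Rightarrow> int \<Rightarrow> nat \<Rightarrow>
    ('n set \<Rightarrow> ('n, 'a) laurent) set" where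
  "cech_cochains J m p = {s. \<forall>\<sigma>. card \<sigma> = p + 1 \<longrightarrow> s \<sigma> \<in> ideal_sections J m \<sigma>}"

definition cech_d :: "('n set \<Rightarrow> ('n, 'a) laurent) \<Rightarrow>
    'n::{finite,linorder} set \<Rightarrow> ('n, 'a::comm_ring_1) laurent" where
  "cech_d s \<sigma> = (\<Sum>i\<in>\<sigma>. (-1) ^ card {j\<in>\<sigma>. j < i} * s (\<sigma> - {i}))"

text \<open>Vanishing of the \<open>p\<close>-th cohomology of the \<open>m\<close>-th twist, for \<open>p \<ge> 1\<close>.\<close>

definition cohomology_vanishes ::
    "('n::{finite,linorder}, 'a::comm_ring_1) mpoly set \<Rightarrow> nat \<Rightarrow> int \<Rightarrow> bool" where
  "cohomology_vanishes J p m \<longleftrightarrow>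
     (\<forall>s\<in>cech_cochains J m p. (\<forall>\<sigma>. card \<sigma> = p + 2 \<longrightarrow> cech_d s \<sigma> = 0) \<longrightarrow>
        (\<exists>t\<in>cech_cochains J m (p - 1). \<forall>\<sigma>. card \<sigma> = p + 1 \<longrightarrow> s \<sigma> = cech_d t \<sigma>))"

definition m_regular :: "('n::{finite,linorder}, 'a::comm_ring_1) mpoly set \<Rightarrow> int \<Rightarrow> bool" where
  "m_regular J m \<longleftrightarrow> (\<forall>p\<ge>1. cohomology_vanishes J p (m - int p))"

definition has_regularity :: "('n::{finite,linorder}, 'a::comm_ring_1) mpoly set \<Rightarrow> int \<Rightarrow> bool" where
  "has_regularity J r \<longleftrightarrow> m_regular J r \<and> (\<forall>m. m_regular J m \<longrightarrow> r \<le> m)"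

text \<open>Regularity of a subscheme of a hyperplane \<open>\<Lambda>\<close> of \<open>\<P>\<^sup>5\<close>, taken in \<open>\<Lambda> = \<P>\<^sup>4\<close>.\<close>

definition has_regularity_in ::
    "('a::field ^ 6) set \<Rightarrow> (6, 'a) mpoly set \<Rightarrow> int \<Rightarrow> bool" where
  "has_regularity_in \<Lambda> J r \<longleftrightarrow>
     (\<exists>A :: 'a ^ 5 ^ 6. range ((*v) A) = \<Lambda> \<and> inj ((*v) A) \<and> has_regularity (mp_pullback A ` J) r)"

section \<open>Weil divisors\<close>

text \<open>A Weil divisor on a variety \<open>W\<close> is represented by its multiplicity function on the prime
  divisors, extended by zero.\<close>

definition prime_divisor :: "('a::field ^ 'n) set set \<Rightarrow> ('a ^ 'n) set set \<Rightarrow> bool" where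
  "prime_divisor W Y \<longleftrightarrow>
     irreducible_closed zariski Y \<and> Y \<subseteq> W \<and> krull_dim zariski Y + 1 = krull_dim zariski W"

definition single_divisor :: "'y \<Rightarrow> 'y \<Rightarrow> int" where
  "single_divisor Y = (\<lambda>Z. if Z = Y then 1 else 0)"

text \<open>Order of vanishing of a form along a prime divisor \<open>Y\<close> of a smooth variety \<open>W\<close>: the largest
  \<open>n\<close> such that the form lies in the \<open>n\<close>-th power of the maximal ideal of the local ring of \<open>W\<close>
  at the generic point of \<open>Y\<close>, a discrete valuation ring. The factor \<open>s\<close> is the denominator.\<close>

definition ord_along ::
    "('a::field ^ 'n) set set \<Rightarrow> ('a ^ 'n) set set \<Rightarrow> ('n::finite, 'a) mpoly \<Rightarrow> nat" where
  "ord_along W Y g = (GREATEST n. \<exists>s. homogeneous s \<and> s \<notin> vanishing_ideal Y \<and>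
     s * g \<in> ideal.span (ideal_power (vanishing_ideal Y) n \<union> vanishing_ideal W))"

definition form_divisor ::
    "('a::field ^ 'n) set set \<Rightarrow> ('n::finite, 'a) mpoly \<Rightarrow> ('a ^ 'n) set set \<Rightarrow> int" where
  "form_divisor W g = (\<lambda>Y. if prime_divisor W Y then int (ord_along W Y g) else 0)"

text \<open>The difference of linearly equivalent divisors is the divisor of a rational function
  \<open>g / h\<close>.\<close>

definition linearly_equivalent :: "('a::field ^ 'n) set set \<Rightarrow>
    (('a ^ 'n) set set \<Rightarrow> int) \<Rightarrow> (('a ^ 'n) set set \<Rightarrow> int) \<Rightarrow> bool" where
  "linearly_equivalent W D E \<longleftrightarrow>
     (\<exists>k g h. g \<in> forms k - vanishing_ideal W \<and> h \<in> forms k - vanishing_ideal W \<and>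
       (\<forall>Y. D Y - E Y = form_divisor W g Y - form_divisor W h Y))"

section \<open>Surfaces of maximal sectional regularity\<close>

definition hyperplane_section :: "('a::field ^ 6) set set \<Rightarrow> ('a ^ 6) set \<Rightarrow> (6, 'a) mpoly set" where
  "hyperplane_section X \<Lambda> = scheme_inter (vanishing_ideal X) (vanishing_ideal (points \<Lambda>))"

definition surface_of_degree :: "('a::field ^ 6) set set \<Rightarrow> nat \<Rightarrow> bool" where
  "surface_of_degree X d \<longleftrightarrow> irreducible_closed zariski X \<and> krull_dim zariski X = 2 \<and>
     nondegenerate X \<and> has_degree (vanishing_ideal X) d"

definition maximal_sectional_regularity :: "('a::field ^ 6) set set \<Rightarrow> nat \<Rightarrow> bool" where
  "maximal_sectional_regularity X d \<longleftrightarrow> surface_of_degree X d \<and> d > 5 \<and>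
     (\<exists>U. openin hyperplane_topology U \<and> U \<noteq> {} \<and>
        (\<forall>\<Lambda>\<in>U. has_regularity_in \<Lambda> (hyperplane_section X \<Lambda>) (int d - 2)))"

text \<open>The scroll \<open>S(1,1,1)\<close>: the union of the planes spanned by corresponding points of three lines,
  parametrized by \<open>s *s a i + t *s b i\<close>, which together span \<open>\<P>\<^sup>5\<close>.\<close>

definition ruling_plane :: "(3 \<Rightarrow> 'a::field ^ 6) \<Rightarrow> (3 \<Rightarrow> 'a ^ 6) \<Rightarrow> 'a \<Rightarrow> 'a \<Rightarrow> ('a ^ 6) set set" where
  "ruling_plane a b s t = points (vec.span (range (\<lambda>i. s *s a i + t *s b i)))"

definition is_scroll_111 ::
    "(3 \<Rightarrow> 'a::field ^ 6) \<Rightarrow> (3 \<Rightarrow> 'a ^ 6) \<Rightarrow> ('a ^ 6) set set \<Rightarrow> bool" where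
  "is_scroll_111 a b W \<longleftrightarrow> vec.span (range a \<union> range b) = UNIV \<and>
     W = (\<Union>(s, t)\<in>{(s, t). (s, t) \<noteq> (0, 0)}. ruling_plane a b s t)"

text \<open>\<open>X\<close> is a divisor on the scroll \<open>W\<close>, linearly equivalent to \<open>H + (d - 3) F\<close>.\<close>

definition type_I :: "('a::field ^ 6) set set \<Rightarrow> nat \<Rightarrow> ('a ^ 6) set set \<Rightarrow> bool" where
  "type_I X d W \<longleftrightarrow> (\<exists>a b s t l.
     is_scroll_111 a b W \<and> prime_divisor W X \<and>
     (s, t) \<noteq> (0, 0) \<and> l \<in> forms 1 - vanishing_ideal W \<and>
     linearly_equivalent W (single_divisor X)
       (\<lambda>Y. form_divisor W l Y + (int d - 3) * single_divisor (ruling_plane a b s t) Y))"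

section \<open>Extremal loci\<close>

definition extremal_secant_locus :: "('a::field ^ 6) set set \<Rightarrow> nat \<Rightarrow> ('a ^ 6) set set" where
  "extremal_secant_locus X d = line_topology closure_of
     {L \<in> Gr 1. \<exists>l\<ge>d - 2. has_length (scheme_inter (vanishing_ideal X) (vanishing_ideal (points L))) l}"

definition extremal_hyperplanes :: "('a::field ^ 6) set set \<Rightarrow> nat \<Rightarrow> ('a ^ 6) set set" where
  "extremal_hyperplanes X d = \<Union>{U. openin hyperplane_topology U \<and>
     (\<forall>\<Lambda>\<in>U. integral_curve (hyperplane_section X \<Lambda>) \<and>
             has_regularity_in \<Lambda> (hyperplane_section X \<Lambda>) (int d - 2))}"

definition extremal_line :: "('a::field ^ 6) set set \<Rightarrow> nat \<Rightarrow> ('a ^ 6) set \<Rightarrow> ('a ^ 6) set" where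
  "extremal_line X d \<Lambda> = (THE L. L \<in> Gr 1 \<and> L \<subseteq> \<Lambda> \<and>
     has_length (scheme_inter (hyperplane_section X \<Lambda>) (vanishing_ideal (points L))) (d - 2))"

definition special_extremal_secant_locus :: "('a::field ^ 6) set set \<Rightarrow> nat \<Rightarrow> ('a ^ 6) set set" where
  "special_extremal_secant_locus X d =
     line_topology closure_of (extremal_line X d ` extremal_hyperplanes X d)"

definition extremal_variety :: "('a::field ^ 6) set set \<Rightarrow> nat \<Rightarrow> ('a ^ 6) set set" where
  "extremal_variety X d =
     zariski closure_of (\<Union>\<Lambda>\<in>extremal_hyperplanes X d. points (extremal_line X d \<Lambda>))"

definition extended_extremal_variety :: "('a::field ^ 6) set set \<Rightarrow> nat \<Rightarrow> ('a ^ 6) set set" where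
  "extended_extremal_variety X d =
     zariski closure_of (\<Union>L\<in>extremal_secant_locus X d. points L)"

section \<open>Veronese surfaces\<close>

definition veronese :: "'a::field ^ 3 \<Rightarrow> 'a ^ 6" where
  "veronese x = vector [x$1 * x$1, x$1 * x$2, x$1 * x$3, x$2 * x$2, x$2 * x$3, x$3 * x$3]"

text \<open>\<open>Z\<close> is a Veronese surface in the five-dimensional projective subspace \<open>V\<close>, that is, the image
  of the standard one under a linear isomorphism of \<open>\<P>\<^sup>5\<close> onto \<open>V\<close>.\<close>

definition is_veronese_surface :: "('a::field ^ 'n) set \<Rightarrow> ('a ^ 'n::finite) set set \<Rightarrow> bool" where
  "is_veronese_surface V Z \<longleftrightarrow> (\<exists>B :: 'a ^ 6 ^ 'n. inj ((*v) B) \<and> range ((*v) B) = V \<and>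
     Z = {vec.span {B *v veronese x} | x. x \<noteq> 0})"

end

theory Submission
  imports Defs "HOL-Library.Option_ord" "Berlekamp_Zassenhaus.Unique_Factorization_Poly"
    "Jordan_Normal_Form.Determinant"
begin

text \<open>The map \<open>(s, t, x) \<mapsto> \<Sum>j. x j *s (s *s a j + t *s b j)\<close> parametrizes \<open>W\<close> by \<open>\<P>\<^sup>1 \<times> \<P>\<^sup>2\<close>. Pulling
  back along it identifies the forms of degree \<open>n\<close> modulo the ideal of \<open>W\<close> with the bihomogeneous
  forms of bidegree \<open>(n, n)\<close>, the prime divisors of \<open>W\<close> with the prime bihomogeneous forms, and orders of
  vanishing with multiplicities of prime factors. Hence \<open>X\<close> is the zero set of a prime form \<open>f\<close> of
  bidegree \<open>(d - 2, 1)\<close>.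

  A line that has at least three points in common with \<open>X\<close>, but only finitely many, lies in \<open>W\<close>, since
  \<open>W\<close> is cut out by quadrics. It is not contained in a ruling plane, which \<open>X\<close> meets in a line, so it is
  one of the lines \<open>\<P>\<^sup>1 \<times> {x}\<close>, and this line is \<open>(d - 2)\<close>-secant for generic \<open>x\<close>. Its Pluecker
  coordinates are independent quadratic forms in \<open>x\<close>, which gives the Veronese surface.

  Write the equation of a hyperplane on \<open>\<P>\<^sup>1 \<times> \<P>\<^sup>2\<close> as \<open>h(s, t) \<bullet> x\<close> with
  \<open>h(s, t) = s \<alpha> + t \<beta>\<close>, and \<open>f\<close> as \<open>f(s, t) \<bullet> x\<close>. The hyperplane section is integral iff the cross
  product of \<open>f(s, t)\<close> and \<open>h(s, t)\<close> has no zero on \<open>\<P>\<^sup>1\<close>, in which case this cross product parametrizes the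
  section, and its extremal secant line is given by \<open>x = \<alpha> \<times> \<beta>\<close>. By elimination theory such
  hyperplanes contain a nonempty open set, so the \<open>x\<close> that arise are dense.\<close>

no_notation fps_nth (infixl "$" 75)
no_notation Matrix.vec_index (infixl "$" 100)
declare ideal.scale_scale [simp del]

section \<open>Evaluation and gradings of polynomials\<close>

text \<open>The recurring obstacle is the bidegree: only forms of bidegree (n, n) lift to forms on
  P^5. A form of unequal bidegree is therefore multiplied by powers of variables, or of a linear
  form in x, that do not vanish at the point or along the line in question; the auxiliary
  polynomials \<open>h\<close>, \<open>r\<close>, \<open>lam\<close>, \<open>L\<close> and
  \<open>Z\<close> all serve this purpose. Factoriality and a Nullstellensatz for a single equation
  are obtained by regarding the five variables as iterated univariate polynomials. The dimension of
  the scroll is not computed: it is 3 because X is a prime divisor of dimension 2, and then strict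
  inclusions inside the scroll bound all other dimensions. Lengths on a line come from Euclidean
  division in the polynomial ring of the line. Regularity enters through the nonempty open set of
  hyperplanes on which it takes the value d - 2; as affine space is irreducible, this set meets
  every other nonempty open condition on the hyperplane.\<close>

lemma mp_eval_superset:
  assumes "finite S" "Poly_Mapping.keys f \<subseteq> S" "h 0 = 0"
  shows "mp_eval h x f = (\<Sum>m\<in>S. h (Poly_Mapping.lookup f m) * (\<Prod>i\<in>UNIV. x i ^ Poly_Mapping.lookup m i))"
  unfolding mp_eval_def
  by (rule sum.mono_neutral_left) (use assms in \<open>auto simp: in_keys_iff\<close>)

lemma mp_eval_single:
  assumes "h 0 = 0"
  shows "mp_eval h x (Poly_Mapping.single m c) = h c * (\<Prod>i\<in>UNIV. x i ^ Poly_Mapping.lookup m i)"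
  by (subst mp_eval_superset[of "{m}"]) (use assms in auto)

lemma mp_eval_add:
  assumes "comm_ring_hom h"
  shows "mp_eval h x (f + g) = mp_eval h x f + mp_eval h x g"
proof -
  interpret comm_ring_hom h by fact
  let ?S = "Poly_Mapping.keys f \<union> Poly_Mapping.keys g"
  have "mp_eval h x (f + g) = (\<Sum>m\<in>?S. h (Poly_Mapping.lookup (f + g) m) * (\<Prod>i\<in>UNIV. x i ^ Poly_Mapping.lookup m i))"
    by (rule mp_eval_superset) (auto simp: hom_zero dest: subsetD[OF keys_add])
  also have "\<dots> = (\<Sum>m\<in>?S. h (Poly_Mapping.lookup f m) * (\<Prod>i\<in>UNIV. x i ^ Poly_Mapping.lookup m i))
      + (\<Sum>m\<in>?S. h (Poly_Mapping.lookup g m) * (\<Prod>i\<in>UNIV. x i ^ Poly_Mapping.lookup m i))"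
    by (simp add: lookup_add hom_add distrib_right sum.distrib)
  also have "\<dots> = mp_eval h x f + mp_eval h x g"
    by (simp add: mp_eval_superset[of ?S f] mp_eval_superset[of ?S g] hom_zero)
  finally show ?thesis .
qed

lemma mp_eval_zero: "mp_eval h x 0 = 0"
  by (simp add: mp_eval_def)

lemma mp_eval_sum:
  assumes "comm_ring_hom h"
  shows "mp_eval h x (\<Sum>k\<in>A. f k) = (\<Sum>k\<in>A. mp_eval h x (f k))"
  by (induction A rule: infinite_finite_induct) (auto simp: mp_eval_add[OF assms] mp_eval_zero)

lemma mpoly_sum_monomials: "f = (\<Sum>m\<in>Poly_Mapping.keys f. Poly_Mapping.single m (Poly_Mapping.lookup f m))"
proof (rule poly_mapping_eqI)
  fix k
  have "Poly_Mapping.lookup (\<Sum>m\<in>Poly_Mapping.keys f. Poly_Mapping.single m (Poly_Mapping.lookup f m)) k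
    = (\<Sum>m\<in>Poly_Mapping.keys f. if m = k then Poly_Mapping.lookup f m else 0)"
    by (simp add: lookup_sum lookup_single when_def)
  then show "Poly_Mapping.lookup f k = Poly_Mapping.lookup (\<Sum>m\<in>Poly_Mapping.keys f. Poly_Mapping.single m (Poly_Mapping.lookup f m)) k"
    by (simp add: in_keys_iff)
qed

lemma mp_eval_mult:
  assumes "comm_ring_hom h"
  shows "mp_eval h x (f * g) = mp_eval h x f * mp_eval h x g"
proof -
  interpret comm_ring_hom h by fact
  let ?s = "\<lambda>f m. Poly_Mapping.single m (Poly_Mapping.lookup f m)"
  have *: "mp_eval h x (Poly_Mapping.single m c * Poly_Mapping.single n d) =
      mp_eval h x (Poly_Mapping.single m c) * mp_eval h x (Poly_Mapping.single n d)" for m n c d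
    unfolding mult_single mp_eval_single[of h, OF hom_zero] hom_mult lookup_add power_add prod.distrib
    by (simp only: mult_ac)
  have "f * g = (\<Sum>m\<in>Poly_Mapping.keys f. ?s f m) * (\<Sum>n\<in>Poly_Mapping.keys g. ?s g n)"
    using mpoly_sum_monomials[of f] mpoly_sum_monomials[of g] by simp
  then have "f * g = (\<Sum>m\<in>Poly_Mapping.keys f. \<Sum>n\<in>Poly_Mapping.keys g. ?s f m * ?s g n)"
    by (simp add: sum_product)
  then have "mp_eval h x (f * g) = (\<Sum>m\<in>Poly_Mapping.keys f. \<Sum>n\<in>Poly_Mapping.keys g. mp_eval h x (?s f m * ?s g n))"
    by (simp add: mp_eval_sum[OF assms])
  also have "\<dots> = (\<Sum>m\<in>Poly_Mapping.keys f. \<Sum>n\<in>Poly_Mapping.keys g. mp_eval h x (?s f m) * mp_eval h x (?s g n))"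
    by (simp only: *)
  also have "\<dots> = mp_eval h x f * mp_eval h x g"
  proof -
    have *: "mp_eval h x q = (\<Sum>m\<in>Poly_Mapping.keys q. mp_eval h x (?s q m))" for q
      using mp_eval_sum[OF assms, of x "?s q" "Poly_Mapping.keys q"] by (simp only: flip: mpoly_sum_monomials)
    show ?thesis unfolding *[of f] *[of g] by (simp only: sum_product)
  qed
  finally show ?thesis .
qed

lemma mp_eval_hom:
  assumes "comm_ring_hom h"
  shows "comm_ring_hom (mp_eval h x)"
proof -
  interpret comm_ring_hom h by fact
  have "mp_eval h x 1 = 1"
    by (simp add: mp_eval_single hom_zero flip: single_one)
  then show ?thesis
    by unfold_locales (auto simp: mp_eval_add[OF assms] mp_eval_mult[OF assms] mp_eval_zero)
qed

lemma mp_eval_comp: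
  assumes "comm_ring_hom g"
  shows "g (mp_eval h x f) = mp_eval (\<lambda>c. g (h c)) (\<lambda>i. g (x i)) f"
proof -
  interpret comm_ring_hom g by fact
  show ?thesis
    by (simp add: mp_eval_def hom_sum hom_prod hom_mult hom_power)
qed

lemma mp_const_hom: "comm_ring_hom mp_const"
  by unfold_locales (auto simp: mp_const_def single_add mult_single)

lemma id_hom: "comm_ring_hom (\<lambda>c::'a::comm_ring_1. c)"
  by unfold_locales auto

lemma pCons_hom: "comm_ring_hom (\<lambda>c::'a::comm_ring_1. [:c:])"
  by unfold_locales (auto simp: one_pCons)

lemma hom_compose: "comm_ring_hom g \<Longrightarrow> comm_ring_hom h \<Longrightarrow> comm_ring_hom (\<lambda>c. g (h c))"
proof -
  assume "comm_ring_hom g" "comm_ring_hom h"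
  then interpret g: comm_ring_hom g + h: comm_ring_hom h by auto
  show ?thesis
    by unfold_locales (auto simp: g.hom_add h.hom_add g.hom_mult h.hom_mult)
qed

lemma mp_eval_const: "comm_ring_hom h \<Longrightarrow> mp_eval h x (mp_const c) = h c"
proof -
  assume "comm_ring_hom h"
  then interpret comm_ring_hom h .
  show ?thesis by (simp add: mp_const_def mp_eval_single hom_zero)
qed

lemma lookup_single_prod:
  fixes k :: "'n::finite"
  shows "(\<Prod>i\<in>UNIV. (x i :: 'b::comm_semiring_1) ^ Poly_Mapping.lookup (Poly_Mapping.single k n) i) = x k ^ n"
proof -
  have "(\<Prod>i\<in>UNIV. x i ^ Poly_Mapping.lookup (Poly_Mapping.single k n) i) = (\<Prod>i\<in>UNIV. if i = k then x k ^ n else 1)"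
    by (rule prod.cong) (auto simp: lookup_single when_def)
  also have "\<dots> = x k ^ n"
    by (subst prod.delta) auto
  finally show ?thesis .
qed

lemma mp_eval_var: "comm_ring_hom h \<Longrightarrow> mp_eval h x (mp_var i :: ('n::finite, 'a::comm_ring_1) mpoly) = x i"
proof -
  assume "comm_ring_hom h"
  then interpret comm_ring_hom h .
  show ?thesis
    by (simp add: mp_var_def mp_eval_single hom_zero lookup_single_prod)
qed

lemma prod_mp_var: "(\<Prod>i\<in>UNIV. mp_var i ^ Poly_Mapping.lookup m i) = (Poly_Mapping.single m 1 :: ('n::finite, 'a::comm_ring_1) mpoly)"
proof -
  have pow: "mp_var i ^ k = (Poly_Mapping.single (Poly_Mapping.single i k) 1 :: ('n, 'a) mpoly)" for i and k :: nat
    by (induction k) (auto simp: mp_var_def mult_single simp flip: single_add)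
  have prd: "(\<Prod>i\<in>A. Poly_Mapping.single (g i) 1) = (Poly_Mapping.single (\<Sum>i\<in>A. g i) 1 :: ('n, 'a) mpoly)" if "finite A" for A :: "'n set" and g
    using that by (induction A) (auto simp: mult_single)
  have "m = (\<Sum>i\<in>UNIV. Poly_Mapping.single i (Poly_Mapping.lookup m i))"
    by (rule poly_mapping_eqI) (simp add: lookup_sum lookup_single when_def)
  then show ?thesis by (simp add: pow prd)
qed

lemma mpoly_monomial: "Poly_Mapping.single m c = mp_const c * (\<Prod>i\<in>UNIV. mp_var i ^ Poly_Mapping.lookup m i)"
  for m :: "('n::finite) \<Rightarrow>\<^sub>0 nat" and c :: "'a::comm_ring_1"
  by (simp add: prod_mp_var mp_const_def mult_single)

lemma mp_eval_id: "mp_eval mp_const mp_var f = (f :: ('n::finite, 'a::comm_ring_1) mpoly)"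
  unfolding mp_eval_def by (simp only: mpoly_monomial[symmetric] mpoly_sum_monomials[symmetric])

abbreviation ev :: "('n::finite, 'a::comm_ring_1) mpoly \<Rightarrow> ('n \<Rightarrow> 'a) \<Rightarrow> 'a" where
  "ev f p \<equiv> mp_eval (\<lambda>c. c) p f"

lemma ev_hom: "comm_ring_hom (\<lambda>f. ev f p)"
  by (rule mp_eval_hom[OF id_hom])

lemma mp_value_ev: "mp_value f v = ev f (\<lambda>i. v $ i)"
  by (simp add: mp_value_def)

lemma ev_subst: "ev (mp_eval mp_const y f) p = ev f (\<lambda>i. ev (y i) p)"
  by (subst mp_eval_comp[OF ev_hom]) (simp add: mp_eval_const[OF id_hom])

lemma ev_simps [simp]:
  "ev (f + g) p = ev f p + ev g p" "ev (f * g) p = ev f p * ev g p" "ev (f - g) p = ev f p - ev g p"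
  "ev (- f) p = - ev f p" "ev 0 p = 0" "ev 1 p = 1" "ev (f ^ n) p = ev f p ^ n"
  "ev (sum F A) p = (\<Sum>k\<in>A. ev (F k) p)" "ev (prod F A) p = (\<Prod>k\<in>A. ev (F k) p)"
  "ev (mp_const c) p = c" "ev (mp_var i) p = p i"
proof -
  interpret comm_ring_hom "\<lambda>f. ev f p" by (rule ev_hom)
  show "ev (f + g) p = ev f p + ev g p" "ev (f * g) p = ev f p * ev g p" "ev (f - g) p = ev f p - ev g p"
  "ev (- f) p = - ev f p" "ev 0 p = 0" "ev 1 p = 1" "ev (f ^ n) p = ev f p ^ n"
  "ev (sum F A) p = (\<Sum>k\<in>A. ev (F k) p)" "ev (prod F A) p = (\<Prod>k\<in>A. ev (F k) p)"
    by (auto simp: hom_add hom_mult hom_minus hom_uminus hom_sum hom_prod hom_power)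
  show "ev (mp_const c) p = c" "ev (mp_var i) p = p i"
    by (rule mp_eval_const[OF id_hom], rule mp_eval_var[OF id_hom])
qed

section \<open>Weighted gradings\<close>

definition wdeg :: "('n::finite \<Rightarrow> nat) \<Rightarrow> ('n \<Rightarrow>\<^sub>0 nat) \<Rightarrow> nat" where
  "wdeg w m = (\<Sum>i\<in>UNIV. w i * Poly_Mapping.lookup m i)"

text \<open>Every grading in the proof is an instance: weight 1 gives \<open>forms\<close>,
  \<open>wS\<close> and \<open>wX\<close> the partial degrees on P^1 x P^2, weight 0 makes all
  polynomials homogeneous, and a mixture of \<open>wS\<close> and \<open>wX\<close> occurs in the
  pullback to a hyperplane section. The zero polynomial is homogeneous of every degree.\<close>

definition whom :: "('n::finite \<Rightarrow> nat) \<Rightarrow> nat \<Rightarrow> ('n, 'a::zero) mpoly \<Rightarrow> bool" where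
  "whom w n f \<longleftrightarrow> (\<forall>m\<in>Poly_Mapping.keys f. wdeg w m = n)"

text \<open>The action of the multiplicative group that defines the grading: the coefficients of the image
  are the homogeneous components.\<close>

definition grade :: "('n::finite \<Rightarrow> nat) \<Rightarrow> ('n, 'a::comm_ring_1) mpoly \<Rightarrow> ('n, 'a) mpoly poly" where
  "grade w = mp_eval (\<lambda>c. [:mp_const c:]) (\<lambda>i. monom (mp_var i) (w i))"

lemma grade_hom: "comm_ring_hom (grade w)"
  unfolding grade_def by (intro mp_eval_hom hom_compose[OF pCons_hom mp_const_hom])

lemma prod_monom: "(\<Prod>i\<in>A. monom (f i) (w i)) = monom (\<Prod>i\<in>A. f i) (\<Sum>i\<in>A. w i)"
  for f :: "'i \<Rightarrow> 'r::comm_ring_1"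
  by (induction A rule: infinite_finite_induct) (auto simp: mult_monom)

lemma grade_single: "grade w (Poly_Mapping.single m c) = monom (Poly_Mapping.single m c) (wdeg w m)"
  unfolding grade_def
  by (subst mp_eval_single)
    (simp_all add: mp_const_def mult.commute monom_power prod_monom wdeg_def prod_mp_var smult_monom mult_single)

lemma grade_conv: "grade w f = (\<Sum>m\<in>Poly_Mapping.keys f. monom (Poly_Mapping.single m (Poly_Mapping.lookup f m)) (wdeg w m))"
proof -
  interpret comm_ring_hom "grade w" by (rule grade_hom)
  show ?thesis
    using arg_cong[OF mpoly_sum_monomials[of f], of "grade w"] by (simp only: hom_sum grade_single)
qed

lemma lookup_grade: "Poly_Mapping.lookup (coeff (grade w f) k) m = (if wdeg w m = k then Poly_Mapping.lookup f m else 0)"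
proof -
  have "Poly_Mapping.lookup (coeff (grade w f) k) m =
     (\<Sum>m'\<in>Poly_Mapping.keys f. if m' = m then if wdeg w m = k then Poly_Mapping.lookup f m else 0 else 0)"
    unfolding grade_conv coeff_sum lookup_sum
    by (rule sum.cong) (auto simp: lookup_single when_def)
  then show ?thesis by (simp add: in_keys_iff)
qed

lemma whom_comp: "whom w k (coeff (grade w f) k)"
  by (auto simp: whom_def in_keys_iff lookup_grade split: if_splits)

lemma whom_iff_grade: "whom w n f \<longleftrightarrow> grade w f = monom f n"
proof
  assume "whom w n f"
  then show "grade w f = monom f n"
    by (intro poly_eqI poly_mapping_eqI) (auto simp: lookup_grade whom_def in_keys_iff when_def)
next
  assume "grade w f = monom f n"
  then show "whom w n f"
    by (metis whom_comp coeff_monom)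
qed

lemma grade_at_1: "poly (grade w f) 1 = f"
  unfolding grade_conv poly_sum poly_monom power_one mult_1_right by (rule mpoly_sum_monomials[symmetric])

lemma sum_comp: "f = (\<Sum>k\<le>degree (grade w f). coeff (grade w f) k)"
  using grade_at_1[of w f] by (simp add: poly_altdef)

lemma whom_0 [simp]: "whom w n 0"
  by (simp add: whom_def)

lemma whom_add: "whom w n f \<Longrightarrow> whom w n g \<Longrightarrow> whom w n (f + g)"
  by (auto simp: whom_def dest: subsetD[OF keys_add])

lemma whom_uminus: "whom w n f \<Longrightarrow> whom w n (- f)"
  for f :: "('n::finite, 'a::comm_ring_1) mpoly"
  by (auto simp: whom_def in_keys_iff)

lemma whom_diff: "whom w n f \<Longrightarrow> whom w n g \<Longrightarrow> whom w n (f - g)"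
  for f :: "('n::finite, 'a::comm_ring_1) mpoly"
  using whom_add[of w n f "- g"] whom_uminus[of w n g] by simp

lemma whom_sum: "(\<And>k. k \<in> A \<Longrightarrow> whom w n (f k)) \<Longrightarrow> whom w n (sum f A)"
  by (induction A rule: infinite_finite_induct) (auto intro: whom_add)

lemma whom_mult: "whom w n f \<Longrightarrow> whom w k g \<Longrightarrow> whom w (n + k) (f * g)"
  for f :: "('n::finite, 'a::comm_ring_1) mpoly"
proof -
  interpret comm_ring_hom "grade w :: ('n, 'a) mpoly \<Rightarrow> _" by (rule grade_hom)
  show "whom w n f \<Longrightarrow> whom w k g \<Longrightarrow> whom w (n + k) (f * g)"
    by (simp add: whom_iff_grade hom_mult mult_monom)
qed

lemma whom_single: "wdeg w m = n \<Longrightarrow> whom w n (Poly_Mapping.single m c)"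
  by (auto simp: whom_def)

lemma whom_const: "whom w 0 (mp_const c)"
  by (simp add: mp_const_def whom_single wdeg_def)

lemma whom_1: "whom w 0 (1 :: ('n::finite, 'a::comm_ring_1) mpoly)"
  using whom_const[of w "1::'a"] by (simp add: mp_const_def)

lemma whom_var: "w i = n \<Longrightarrow> whom w n (mp_var i)"
  unfolding mp_var_def
proof (rule whom_single)
  assume "w i = n"
  have "wdeg w (Poly_Mapping.single i 1) = (\<Sum>j\<in>UNIV. if j = i then w i else 0)"
    unfolding wdeg_def by (rule sum.cong) (auto simp: lookup_single when_def)
  with \<open>w i = n\<close> show "wdeg w (Poly_Mapping.single i 1) = n" by simp
qed

lemma whom_power: "whom w n f \<Longrightarrow> whom w (n * k) (f ^ k)"
  for f :: "('n::finite, 'a::comm_ring_1) mpoly"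
  by (induction k) (auto simp: whom_1 whom_mult)

lemma whom_prod: "(\<And>k. k \<in> A \<Longrightarrow> whom w (n k) (f k)) \<Longrightarrow> whom w (sum n A) (prod f A)"
  for f :: "'i \<Rightarrow> ('n::finite, 'a::comm_ring_1) mpoly"
  by (induction A rule: infinite_finite_induct) (auto simp: whom_1 intro: whom_mult)

lemma whom_unique: "whom w n f \<Longrightarrow> whom w k f \<Longrightarrow> f \<noteq> 0 \<Longrightarrow> n = k"
  unfolding whom_def by (metis keys_eq_empty all_not_in_conv)

text \<open>Over a domain the lowest terms of the factors multiply to the lowest term of the
  product, and so do the leading terms. For a monomial order and degree coincide, hence they
  coincide for both factors.\<close>

lemma monom_factors:
  fixes p q :: "'r::idom poly"
  assumes "p * q = monom c n" "c \<noteq> 0"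
  obtains a b i j where "p = monom a i" "q = monom b j" "i + j = n"
proof -
  have nz: "p \<noteq> 0" "q \<noteq> 0" using assms by auto
  define i where "i = (LEAST i. coeff p i \<noteq> 0)"
  define j where "j = (LEAST i. coeff q i \<noteq> 0)"
  have ex: "\<exists>i. coeff p i \<noteq> 0" "\<exists>i. coeff q i \<noteq> 0" using nz by (auto simp: poly_eq_iff)
  have i: "coeff p i \<noteq> 0" "\<And>k. k < i \<Longrightarrow> coeff p k = 0" and j: "coeff q j \<noteq> 0" "\<And>k. k < j \<Longrightarrow> coeff q k = 0"
    using LeastI_ex[OF ex(1)] LeastI_ex[OF ex(2)] not_less_Least unfolding i_def j_def by blast+
  have "coeff (p * q) (i + j) = (\<Sum>k\<le>i+j. if k = i then coeff p i * coeff q j else 0)"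
    unfolding coeff_mult
  proof (rule sum.cong)
    fix k assume "k \<in> {..i+j}"
    show "coeff p k * coeff q (i + j - k) = (if k = i then coeff p i * coeff q j else 0)"
      using i(2)[of k] j(2)[of "i + j - k"] \<open>k \<in> {..i+j}\<close> by (cases k i rule: linorder_cases) auto
  qed simp
  then have "coeff (p * q) (i + j) \<noteq> 0" using i j by simp
  then have "n = i + j" using assms by (auto split: if_splits)
  moreover have "degree p + degree q = n"
    using assms nz degree_mult_eq[of p q] by (simp add: degree_monom_eq)
  moreover have "i \<le> degree p" "j \<le> degree q" using i j by (auto intro: le_degree)
  ultimately have d: "i = degree p" "j = degree q" by auto
  have "p = monom (coeff p i) i"
    by (rule poly_eqI) (metis coeff_monom d(1) i(2) linorder_neqE_nat coeff_eq_0)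
  moreover have "q = monom (coeff q j) j"
    by (rule poly_eqI) (metis coeff_monom d(2) j(2) linorder_neqE_nat coeff_eq_0)
  ultimately show thesis using that \<open>n = i + j\<close> by blast
qed

text \<open>\<open>grade\<close> is a ring homomorphism that turns homogeneity into being a
  monomial, so \<open>monom_factors\<close> applies over the polynomial ring. The linear order on
  the variables makes that ring a domain.\<close>

lemma whom_factor:
  fixes f g :: "('n::{finite,linorder}, 'a::idom) mpoly"
  assumes "whom w n (f * g)" "f * g \<noteq> 0"
  obtains i j where "whom w i f" "whom w j g" "i + j = n"
proof -
  interpret comm_ring_hom "grade w :: ('n, 'a) mpoly \<Rightarrow> _" by (rule grade_hom)
  have "grade w f * grade w g = monom (f * g) n"
    using assms by (simp add: whom_iff_grade hom_mult)
  then obtain a b i j where *: "grade w f = monom a i" "grade w g = monom b j" "i + j = n"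
    by (rule monom_factors[OF _ assms(2)])
  have "whom w i f" "whom w j g"
    using * grade_at_1[of w f] grade_at_1[of w g] by (simp_all add: whom_iff_grade poly_monom)
  with * that show thesis by blast
qed

lemma whom_mp_eval:
  fixes y :: "'n::finite \<Rightarrow> ('m::finite, 'a::comm_ring_1) mpoly"
  assumes "f \<in> forms k" "\<And>i. whom w n (y i)"
  shows "whom w (n * k) (mp_eval mp_const y f)"
  unfolding mp_eval_def
proof (rule whom_sum)
  fix m assume "m \<in> Poly_Mapping.keys f"
  then have m: "(\<Sum>i\<in>UNIV. Poly_Mapping.lookup m i) = k" using assms by (auto simp: forms_def)
  have "whom w (\<Sum>i\<in>UNIV. n * Poly_Mapping.lookup m i) (\<Prod>i\<in>UNIV. y i ^ Poly_Mapping.lookup m i)"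
    by (intro whom_prod whom_power assms)
  then have "whom w (0 + n * k) (mp_const (Poly_Mapping.lookup f m) * (\<Prod>i\<in>UNIV. y i ^ Poly_Mapping.lookup m i))"
    using m by (intro whom_mult whom_const) (simp flip: sum_distrib_left)
  then show "whom w (n * k) (mp_const (Poly_Mapping.lookup f m) * (\<Prod>i\<in>UNIV. y i ^ Poly_Mapping.lookup m i))"
    by simp
qed

lemma forms_whom: "forms n = {f. whom (\<lambda>_. 1) n f}"
  by (auto simp: forms_def whom_def wdeg_def)

text \<open>The target ring is arbitrary because the scalar \<open>c\<close> is not always an
  element of the field: it is also a polynomial whose powers are pulled out of a
  substitution.\<close>

lemma whom_eval:
  fixes p :: "'n::finite \<Rightarrow> 'b::comm_ring_1"
  assumes "whom w n f"
  shows "mp_eval h (\<lambda>i. c ^ w i * p i) f = c ^ n * mp_eval h p f"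
proof -
  have "(\<Prod>i\<in>UNIV. (c ^ w i * p i) ^ Poly_Mapping.lookup m i) = c ^ n * (\<Prod>i\<in>UNIV. p i ^ Poly_Mapping.lookup m i)"
    if m: "m \<in> Poly_Mapping.keys f" for m
  proof -
    have "(\<Prod>i\<in>UNIV. (c ^ w i) ^ Poly_Mapping.lookup m i) = c ^ wdeg w m"
      by (simp add: wdeg_def power_sum power_mult)
    with m assms show ?thesis
      by (simp add: whom_def power_mult_distrib prod.distrib)
  qed
  then show ?thesis
    unfolding mp_eval_def sum_distrib_left
    by (intro sum.cong refl) (simp only: mult.left_commute)
qed

lemma whom_ev:
  assumes "whom w n f"
  shows "ev f (\<lambda>i. c ^ w i * p i) = c ^ n * ev f (p :: _ \<Rightarrow> 'a::comm_ring_1)"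
  by (rule whom_eval[OF assms])

lemma forms_scale: "f \<in> forms n \<Longrightarrow> mp_value f (c *s v) = c ^ n * mp_value f (v :: 'a::comm_ring_1 ^ 'n)"
  using whom_ev[of "\<lambda>_. 1" n f c "\<lambda>i. v $ i"] by (simp add: mp_value_ev forms_whom)

section \<open>Unique factorization and the Nullstellensatz for hypersurfaces\<close>

lemma infinite_alg_closed: "infinite (UNIV :: 'a::alg_closed_field set)"
proof
  assume fin: "finite (UNIV :: 'a set)"
  let ?p = "(\<Prod>a\<in>UNIV. [:- a, 1:]) + 1 :: 'a poly"
  have d: "degree (\<Prod>a\<in>(UNIV::'a set). [:- a, 1:]) = card (UNIV :: 'a set)"
    by (subst degree_prod_eq_sum_degree) auto
  have "card (UNIV :: 'a set) > 0" using fin by (simp add: card_gt_0_iff)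
  then have "degree ?p > 0" using d by (subst degree_add_eq_left) auto
  then obtain x where "poly ?p x = 0" using alg_closed_imp_poly_has_root by blast
  moreover have "poly (\<Prod>a\<in>UNIV. [:- a, 1:]) x = 0"
    using fin by (auto simp: poly_prod)
  ultimately show False by simp
qed

lemma poly_eq_0_of_infinite:
  fixes p :: "'a::idom poly"
  assumes "infinite A" "\<And>x. x \<in> A \<Longrightarrow> poly p x = 0"
  shows "p = 0"
proof (rule ccontr)
  assume "p \<noteq> 0"
  then have "finite {x. poly p x = 0}" by (rule poly_roots_finite)
  then have "finite A" by (rule finite_subset[rotated]) (use assms in auto)
  with assms show False by simp
qed

lemma ideal_comb: "c * (A' * p + B' * G) - (A * p + B * G) * q = (c * A' - A * q) * p + (c * B' - B * q) * G"
  for p :: "'r::comm_ring_1"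
  by (simp add: algebra_simps)

text \<open>An element of minimal degree in the ideal generated by \<open>p\<close> and \<open>G\<close> must be constant, since
  pseudo-division shows that it divides both up to constants.\<close>

lemma prime_elem_poly_bezout:
  fixes p G :: "'s::idom poly"
  assumes p: "prime_elem p" "degree p > 0" "\<not> p dvd G"
  obtains A B D where "A * p + B * G = [:D:]" "D \<noteq> 0"
proof -
  define Q where "Q n \<longleftrightarrow> (\<exists>A B. A * p + B * G \<noteq> 0 \<and> degree (A * p + B * G) = n)" for n
  have "Q (degree p)"
    unfolding Q_def using p by (intro exI[of _ 1] exI[of _ 0]) auto
  then have "Q (LEAST n. Q n)" and least: "\<And>n. Q n \<Longrightarrow> (LEAST n. Q n) \<le> n"
    by (auto intro: LeastI Least_le)
  then obtain A B where H: "A * p + B * G \<noteq> 0" "degree (A * p + B * G) = (LEAST n. Q n)"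
    unfolding Q_def by blast
  define H where "H = A * p + B * G"
  have divides: "\<exists>c q. c \<noteq> 0 \<and> smult c (A' * p + B' * G) = H * q" for A' B'
  proof -
    let ?K = "A' * p + B' * G"
    obtain q r where qr: "pseudo_divmod ?K H = (q, r)" by force
    define c where "c = coeff H (degree H) ^ (Suc (degree ?K) - degree H)"
    have "coeff H (degree H) \<noteq> 0" using H(1) unfolding H_def by (rule leading_coeff_neq_0)
    then have c: "c \<noteq> 0" unfolding c_def by (rule power_not_zero)
    have eq: "smult c ?K = H * q + r" and r: "r = 0 \<or> degree r < degree H"
      using pseudo_divmod[OF _ qr] H unfolding c_def H_def by auto
    have "r = [:c:] * ?K - H * q" using eq by simp
    also have "\<dots> = ([:c:] * A' - A * q) * p + ([:c:] * B' - B * q) * G"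
      unfolding H_def by (rule ideal_comb)
    finally have r': "r = ([:c:] * A' - A * q) * p + ([:c:] * B' - B * q) * G" .
    have "r = 0"
    proof (rule ccontr)
      assume "r \<noteq> 0"
      then have "Q (degree r)" unfolding Q_def using r' by blast
      then have "degree H \<le> degree r" using least H(2) H_def by metis
      with r \<open>r \<noteq> 0\<close> show False by simp
    qed
    with eq c show ?thesis by auto
  qed
  have "degree H = 0"
  proof (rule ccontr)
    assume dH: "degree H \<noteq> 0"
    obtain c q where c: "c \<noteq> 0" "smult c p = H * q" using divides[of 1 0] by auto
    obtain c' q' where c': "c' \<noteq> 0" "smult c' G = H * q'" using divides[of 0 1] by auto
    have "p dvd H * q" by (metis c(2) dvd_smult dvd_refl)
    then consider "p dvd H" | "p dvd q" using prime_elem_dvd_multD[OF p(1)] by blast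
    then show False
    proof cases
      \<comment> \<open>Here \<open>p\<close> divides a nonzero constant times \<open>G\<close> but
        not \<open>G\<close>, hence the constant, against its positive degree.\<close>
      case 1
      have "[:c':] * G = H * q'" using c'(2) by simp
      with 1 have "p dvd [:c':] * G" by (metis dvd_mult2)
      then have "p dvd [:c':]" using prime_elem_dvd_multD[OF p(1)] p(3) by blast
      then have "degree p \<le> degree [:c':]" using c' by (intro dvd_imp_degree_le) auto
      with p show False by simp
    next
      \<comment> \<open>Cancelling \<open>p\<close> leaves \<open>H\<close> as a divisor of the
        nonzero constant \<open>c\<close>, so its degree is 0 after all.\<close>
      case 2
      then obtain q1 where q1: "q = p * q1" by blast
      then have "p * [:c:] = p * (H * q1)" using c by (simp add: mult_ac)
      then have "[:c:] = H * q1" using p by (subst (asm) mult_left_cancel) auto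
      then have "degree H + degree q1 = 0"
        using c by (metis degree_mult_eq degree_pCons_0 mult_zero_left mult_zero_right pCons_eq_0_iff)
      with dH show False by simp
    qed
  qed
  then obtain D where "H = [:D:]" by (meson degree_eq_zeroE)
  with H that show thesis unfolding H_def by auto
qed

text \<open>A set \<open>E\<close> of points of a \<open>k\<close>-algebra, with structure map \<open>\<kappa>\<close>, that satisfies the
  Nullstellensatz for hypersurfaces.\<close>

definition nullstellensatz :: "('a \<Rightarrow> 's::idom) \<Rightarrow> ('s \<Rightarrow> 'a::alg_closed_field) set \<Rightarrow> bool" where
  "nullstellensatz \<kappa> E \<longleftrightarrow> (\<forall>e\<in>E. comm_ring_hom e \<and> (\<forall>c. e (\<kappa> c) = c)) \<and>
     (\<forall>D. (\<forall>e\<in>E. e D = 0) \<longrightarrow> D = 0) \<and>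
     (\<forall>p G. prime_elem p \<longrightarrow> (\<forall>e\<in>E. e p = 0 \<longrightarrow> e G = 0) \<longrightarrow> p dvd G)"

lemma nullstellensatz_hom: "nullstellensatz \<kappa> E \<Longrightarrow> e \<in> E \<Longrightarrow> comm_ring_hom e"
  and nullstellensatz_const: "nullstellensatz \<kappa> E \<Longrightarrow> e \<in> E \<Longrightarrow> e (\<kappa> c) = c"
  by (simp_all add: nullstellensatz_def)

lemma nullstellensatz_sep:
  assumes "nullstellensatz \<kappa> E" "\<And>e. e \<in> E \<Longrightarrow> e D = 0"
  shows "D = 0"
  using assms(1)[unfolded nullstellensatz_def, THEN conjunct2, THEN conjunct1, THEN spec[of _ D]] assms(2) by simp

lemma nullstellensatz_dvd:
  assumes "nullstellensatz \<kappa> E" "prime_elem p" "\<And>e. e \<in> E \<Longrightarrow> e p = 0 \<Longrightarrow> e G = 0"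
  shows "p dvd G"
  using assms(1)[unfolded nullstellensatz_def, THEN conjunct2, THEN conjunct2, THEN spec[of _ p], THEN spec[of _ G]]
    assms(2,3) by simp

text \<open>A field has no prime elements, so the divisibility clause is vacuous. This is the base
  of the induction on the number of variables.\<close>

lemma nullstellensatz_field: "nullstellensatz (\<lambda>c. c) {\<lambda>x::'a::alg_closed_field. x}"
  by (auto simp: nullstellensatz_def id_hom prime_elem_def dvd_field_iff)

lemma poly_map_poly_hom:
  assumes "comm_ring_hom h"
  shows "comm_ring_hom (\<lambda>F. poly (map_poly h F) v)"
proof -
  interpret h: comm_ring_hom h by fact
  interpret m: map_poly_comm_ring_hom h ..
  show ?thesis by unfold_locales (auto simp: m.hom_add m.hom_mult)
qed

lemma poly_map_poly_const: "comm_ring_hom h \<Longrightarrow> poly (map_poly h [:c:]) v = h c"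
proof -
  assume "comm_ring_hom h"
  then interpret h: comm_ring_hom h .
  show ?thesis by (cases "c = 0") (auto simp: map_poly_pCons h.hom_zero)
qed

lemma poly_map_poly_X: "comm_ring_hom h \<Longrightarrow> poly (map_poly h [:0, 1:]) v = v"
proof -
  assume "comm_ring_hom h"
  then interpret h: comm_ring_hom h .
  show ?thesis by (auto simp: map_poly_pCons h.hom_zero h.hom_one)
qed

text \<open>A constant \<open>p\<close> is treated coefficientwise, since a polynomial with
  infinitely many zeros is 0. If \<open>p\<close> has positive degree and does not divide
  \<open>G\<close>, the two generate a nonzero constant \<open>D\<close>. Whenever a specialization
  keeps the leading coefficient of \<open>p\<close>, the specialized \<open>p\<close> has a root,
  \<open>G\<close> vanishes there too, and so does \<open>D\<close>. Thus
  \<open>lead_coeff p * D\<close> vanishes at all specializations, a contradiction.\<close>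

lemma nullstellensatz_poly:
  assumes E: "nullstellensatz \<kappa> E"
  shows "nullstellensatz (\<lambda>c. [:\<kappa> c:]) {\<lambda>F. poly (map_poly e F) c | e c. e \<in> E}"
    (is "nullstellensatz _ ?E")
proof -
  have hom: "comm_ring_hom e" and cst: "e (\<kappa> c) = c" if "e \<in> E" for e c
    using E that by (auto simp: nullstellensatz_def)
  have sep: "D = 0" if "\<And>e. e \<in> E \<Longrightarrow> e D = 0" for D
    using E that by (auto simp: nullstellensatz_def)
  have NS: "p dvd G" if "prime_elem p" "\<And>e. e \<in> E \<Longrightarrow> e p = 0 \<Longrightarrow> e G = 0" for p G
    using E that by (auto simp: nullstellensatz_def)
  have coeff_map: "coeff (map_poly e F) i = e (coeff F i)" if "e \<in> E" for e F i
  proof -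
    interpret comm_ring_hom e by (rule hom[OF that])
    show ?thesis by (simp add: coeff_map_poly hom_zero)
  qed
  have all0: "e (coeff F i) = 0" if "e \<in> E" "\<And>c. poly (map_poly e F) c = 0" for e F i
  proof -
    have "map_poly e F = 0"
      by (rule poly_eq_0_of_infinite[OF infinite_alg_closed]) (use that in auto)
    with coeff_map[OF that(1), of F i] show ?thesis by simp
  qed
  have sep': "F = 0" if "\<And>e c. e \<in> E \<Longrightarrow> poly (map_poly e F) c = 0" for F
    by (rule poly_eqI) (auto intro!: sep all0 that)
  have NS': "p dvd G" if p: "prime_elem p" and v: "\<And>e c. e \<in> E \<Longrightarrow> poly (map_poly e p) c = 0 \<Longrightarrow> poly (map_poly e G) c = 0" for p G
  proof (cases "degree p = 0")
    case True
    then obtain q where q: "p = [:q:]" by (meson degree_eq_zeroE)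
    have "prime_elem q" using p unfolding q by (simp add: prime_elem_const_poly_iff)
    have "q dvd coeff G i" for i
    proof (rule NS[OF \<open>prime_elem q\<close>])
      fix e assume e: "e \<in> E" "e q = 0"
      show "e (coeff G i) = 0"
        by (rule all0[OF e(1)], rule v[OF e(1)]) (simp add: q poly_map_poly_const[OF hom[OF e(1)]] e)
    qed
    then show ?thesis by (simp add: q const_poly_dvd_iff)
  next
    case False
    show ?thesis
    proof (rule ccontr)
      assume ndvd: "\<not> p dvd G"
      have deg: "degree p > 0" using False by simp
      obtain A B D where D: "A * p + B * G = [:D:]" "D \<noteq> 0"
        by (rule prime_elem_poly_bezout[OF p deg ndvd])
      have "lead_coeff p * D = 0"
      proof (rule sep)
        fix e assume e: "e \<in> E"
        interpret e: comm_ring_hom e by (rule hom[OF e])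
        show "e (lead_coeff p * D) = 0"
        proof (cases "e (lead_coeff p) = 0")
          case True then show ?thesis by (simp add: e.hom_mult)
        next
          case nz: False
          have "degree (map_poly e p) > 0"
          proof -
            have "coeff (map_poly e p) (degree p) \<noteq> 0" using nz coeff_map[OF e] by simp
            then have "degree p \<le> degree (map_poly e p)" by (rule le_degree)
            with deg show ?thesis by simp
          qed
          then obtain c where c: "poly (map_poly e p) c = 0" using alg_closed_imp_poly_has_root by blast
          interpret k: comm_ring_hom "\<lambda>F. poly (map_poly e F) c" by (rule poly_map_poly_hom) (rule hom[OF e])
          have "poly (map_poly e [:D:]) c = 0"
            unfolding D(1)[symmetric] k.hom_add k.hom_mult using c v[OF e c] by simp
          then show ?thesis by (simp add: poly_map_poly_const[OF hom[OF e]] e.hom_mult)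
        qed
      qed
      with D False show False by auto
    qed
  qed
  show ?thesis
    unfolding nullstellensatz_def
  proof (intro conjI ballI allI impI)
    fix e' assume "e' \<in> ?E"
    then obtain e c where e: "e \<in> E" and e': "e' = (\<lambda>F. poly (map_poly e F) c)" by auto
    show "comm_ring_hom e'" unfolding e' by (rule poly_map_poly_hom[OF hom[OF e]])
    show "e' [:\<kappa> a:] = a" for a
      unfolding e' poly_map_poly_const[OF hom[OF e]] by (rule cst[OF e])
  next
    fix D assume "\<forall>e\<in>?E. e D = 0"
    then show "D = 0" by (intro sep') auto
  next
    fix p G assume p: "prime_elem p" and *: "\<forall>e\<in>?E. e p = 0 \<longrightarrow> e G = 0"
    show "p dvd G"
    proof (rule NS'[OF p])
      fix e c assume e: "e \<in> E" "poly (map_poly e p) c = 0"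
      then have "(\<lambda>F. poly (map_poly e F) c) \<in> ?E" by blast
      from bspec[OF * this] e show "poly (map_poly e G) c = 0" by simp
    qed
  qed
qed

text \<open>The coordinate ring of \<open>\<A>\<^sup>2 \<times> \<A>\<^sup>3\<close>; the bihomogeneous elements are the forms on
  \<open>\<P>\<^sup>1 \<times> \<P>\<^sup>2\<close>. The variables \<open>None\<close> and \<open>Some None\<close> are the coordinates of \<open>\<A>\<^sup>2\<close>.\<close>

type_synonym bvar = "3 option option"

abbreviation vS :: bvar where "vS \<equiv> None"
abbreviation vT :: bvar where "vT \<equiv> Some None"
abbreviation vX :: "3 \<Rightarrow> bvar" where "vX j \<equiv> Some (Some j)"

type_synonym 'a bipoly = "(bvar, 'a) mpoly"

definition nest_const :: "'a \<Rightarrow> 'a::comm_ring_1 poly poly poly poly poly" where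
  "nest_const c = [:[:[:[:[:c:]:]:]:]:]"

definition nest_var :: "bvar \<Rightarrow> 'a::comm_ring_1 poly poly poly poly poly" where
  "nest_var v = (case v of None \<Rightarrow> [:0, 1:] | Some None \<Rightarrow> [:[:0, 1:]:]
     | Some (Some j) \<Rightarrow> if j = 1 then [:[:[:0, 1:]:]:] else if j = 2 then [:[:[:[:0, 1:]:]:]:]
        else [:[:[:[:[:0, 1:]:]:]:]:])"

text \<open>An isomorphism onto iterated univariate polynomials, with s outermost and x_3 innermost.
  Factoriality and the Nullstellensatz, both available for one variable over a suitable ring, are
  transported along it.\<close>

definition nest :: "'a::comm_ring_1 bipoly \<Rightarrow> 'a poly poly poly poly poly" where
  "nest = mp_eval nest_const nest_var"

lemma nest_const_hom: "comm_ring_hom nest_const"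
  unfolding nest_const_def
  by (intro hom_compose[OF pCons_hom hom_compose[OF pCons_hom hom_compose[OF pCons_hom hom_compose[OF pCons_hom pCons_hom]]]])

lemma nest_hom: "comm_ring_hom nest"
  unfolding nest_def by (rule mp_eval_hom[OF nest_const_hom])

lemma hom_comp_nest:
  assumes "comm_ring_hom e"
  shows "e (nest f) = mp_eval (\<lambda>c. e (nest_const c)) (\<lambda>i. e (nest_var i)) f"
  unfolding nest_def by (rule mp_eval_comp[OF assms])

text \<open>A left inverse is built one variable at a time: each \<open>t\<close> evaluates its
  outermost variable at the corresponding generator of the polynomial ring.\<close>

lemma inj_nest: "inj nest"
proof -
  define t1 :: "'a poly \<Rightarrow> 'a bipoly" where "t1 = (\<lambda>F. poly (map_poly mp_const F) (mp_var (vX 3)))"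
  define t2 :: "'a poly poly \<Rightarrow> 'a bipoly" where "t2 = (\<lambda>F. poly (map_poly t1 F) (mp_var (vX 2)))"
  define t3 :: "'a poly poly poly \<Rightarrow> 'a bipoly" where "t3 = (\<lambda>F. poly (map_poly t2 F) (mp_var (vX 1)))"
  define t4 :: "'a poly poly poly poly \<Rightarrow> 'a bipoly" where "t4 = (\<lambda>F. poly (map_poly t3 F) (mp_var vT))"
  define t5 :: "'a poly poly poly poly poly \<Rightarrow> 'a bipoly" where "t5 = (\<lambda>F. poly (map_poly t4 F) (mp_var vS))"
  have h1: "comm_ring_hom t1" unfolding t1_def by (rule poly_map_poly_hom[OF mp_const_hom])
  have h2: "comm_ring_hom t2" unfolding t2_def by (rule poly_map_poly_hom[OF h1])
  have h3: "comm_ring_hom t3" unfolding t3_def by (rule poly_map_poly_hom[OF h2])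
  have h4: "comm_ring_hom t4" unfolding t4_def by (rule poly_map_poly_hom[OF h3])
  have h5: "comm_ring_hom t5" unfolding t5_def by (rule poly_map_poly_hom[OF h4])
  have c5: "t5 [:c:] = t4 c" "t5 [:0,1:] = mp_var vS" for c
    unfolding t5_def by (rule poly_map_poly_const[OF h4], rule poly_map_poly_X[OF h4])
  have c4: "t4 [:c:] = t3 c" "t4 [:0,1:] = mp_var vT" for c
    unfolding t4_def by (rule poly_map_poly_const[OF h3], rule poly_map_poly_X[OF h3])
  have c3: "t3 [:c:] = t2 c" "t3 [:0,1:] = mp_var (vX 1)" for c
    unfolding t3_def by (rule poly_map_poly_const[OF h2], rule poly_map_poly_X[OF h2])
  have c2: "t2 [:c:] = t1 c" "t2 [:0,1:] = mp_var (vX 2)" for c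
    unfolding t2_def by (rule poly_map_poly_const[OF h1], rule poly_map_poly_X[OF h1])
  have c1: "t1 [:c:] = mp_const c" "t1 [:0,1:] = mp_var (vX 3)" for c
    unfolding t1_def by (rule poly_map_poly_const[OF mp_const_hom], rule poly_map_poly_X[OF mp_const_hom])
  have "t5 (nest_const c) = mp_const c" for c
    by (simp add: nest_const_def c5 c4 c3 c2 c1)
  moreover have "t5 (nest_var i) = mp_var i" for i
  proof (cases i)
    case (Some v)
    then show ?thesis
    proof (cases v)
      case (Some j)
      with \<open>i = Some v\<close> exhaust_3[of j] show ?thesis
        by (auto simp: nest_var_def c5 c4 c3 c2 c1 c1(2)[simplified] c2(2)[simplified] c3(2)[simplified])
    qed (simp add: nest_var_def c5 c4 c4(2)[simplified])
  qed (simp add: nest_var_def c5(2)[simplified])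
  ultimately have "t5 (nest f) = f" for f
    by (simp add: hom_comp_nest[OF h5] mp_eval_id)
  then show ?thesis by (metis injI)
qed

lemma hom_image_poly_closed:
  assumes k: "comm_ring_hom k" and I: "\<And>x y. x \<in> I \<Longrightarrow> y \<in> I \<Longrightarrow> x + y \<in> I" "\<And>x y. x \<in> I \<Longrightarrow> y \<in> I \<Longrightarrow> x * y \<in> I"
    and c: "\<And>a. k [:a:] \<in> I" and X: "k [:0, 1:] \<in> I"
  shows "k F \<in> I"
proof (induction F)
  case 0 show ?case using c[of 0] by simp
next
  case (pCons a p)
  interpret comm_ring_hom k by fact
  have "pCons a p = [:a:] + [:0, 1:] * p" by simp
  then have "k (pCons a p) = k [:a:] + k [:0, 1:] * k p" by (metis hom_add hom_mult)
  with I c X pCons show ?case by metis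
qed

lemma surj_nest: "surj nest"
proof -
  interpret comm_ring_hom "nest :: 'a bipoly \<Rightarrow> _" by (rule nest_hom)
  let ?I = "range (nest :: 'a bipoly \<Rightarrow> _)"
  have add: "x + y \<in> ?I" and mult: "x * y \<in> ?I" if "x \<in> ?I" "y \<in> ?I" for x y
    using that hom_add hom_mult by (metis (no_types, lifting) image_iff rangeI)+
  have var: "nest_var i \<in> ?I" for i
    by (rule range_eqI[of _ _ "mp_var i"]) (simp add: nest_def mp_eval_var[OF nest_const_hom])
  have c0: "nest_const c \<in> ?I" for c
    by (rule range_eqI[of _ _ "mp_const c"]) (simp add: nest_def mp_eval_const[OF nest_const_hom])
  note h1 = pCons_hom and h2 = hom_compose[OF pCons_hom pCons_hom]
  note h3 = hom_compose[OF pCons_hom h2] note h4 = hom_compose[OF pCons_hom h3]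
  have c1: "[:[:[:[:F:]:]:]:] \<in> ?I" for F :: "'a poly"
    by (rule hom_image_poly_closed[OF h4 add mult]) (use c0 var[of "vX 3"] in \<open>auto simp: nest_const_def nest_var_def\<close>)
  have c2: "[:[:[:F:]:]:] \<in> ?I" for F :: "'a poly poly"
    by (rule hom_image_poly_closed[OF h3 add mult]) (use c1 var[of "vX 2"] in \<open>auto simp: nest_var_def\<close>)
  have c3: "[:[:F:]:] \<in> ?I" for F :: "'a poly poly poly"
    by (rule hom_image_poly_closed[OF h2 add mult]) (use c2 var[of "vX 1"] in \<open>auto simp: nest_var_def\<close>)
  have c4: "[:F:] \<in> ?I" for F :: "'a poly poly poly poly"
    by (rule hom_image_poly_closed[OF h1 add mult]) (use c3 var[of vT] in \<open>auto simp: nest_var_def\<close>)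
  have c5: "F \<in> ?I" for F :: "'a poly poly poly poly poly"
    by (rule hom_image_poly_closed[OF id_hom add mult]) (use c4 var[of vS] in \<open>auto simp: nest_var_def\<close>)
  then show ?thesis by blast
qed

lemma nest_dvd_iff: "nest f dvd nest g \<longleftrightarrow> f dvd g"
proof -
  interpret comm_ring_hom "nest :: 'a bipoly \<Rightarrow> _" by (rule nest_hom)
  show ?thesis
  proof
    assume "nest f dvd nest g"
    then obtain k where "nest g = nest f * k" by blast
    moreover obtain h where "k = nest h" using surj_nest by (metis surjD)
    ultimately have "nest g = nest (f * h)" by (simp add: hom_mult)
    then show "f dvd g" using inj_nest by (metis dvd_triv_left injD)
  qed (auto simp: hom_mult elim!: dvdE)
qed

lemma nest_0_iff: "nest f = 0 \<longleftrightarrow> f = 0"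
proof -
  interpret comm_ring_hom "nest :: 'a bipoly \<Rightarrow> _" by (rule nest_hom)
  show ?thesis using inj_nest by (metis hom_zero injD)
qed

lemma nest_prime_iff: "prime_elem (nest f) \<longleftrightarrow> prime_elem f"
proof -
  interpret comm_ring_hom "nest :: 'a bipoly \<Rightarrow> _" by (rule nest_hom)
  have 1: "nest f dvd 1 \<longleftrightarrow> f dvd 1" using nest_dvd_iff[of f 1] by (simp add: hom_one)
  have 2: "(\<forall>a b. nest f dvd a * b \<longrightarrow> nest f dvd a \<or> nest f dvd b) \<longleftrightarrow>
        (\<forall>a b. nest f dvd nest a * nest b \<longrightarrow> nest f dvd nest a \<or> nest f dvd nest b)"
    using surj_nest by (metis surjD)
  show ?thesis
    unfolding prime_elem_def 1 2 nest_0_iff by (simp add: nest_dvd_iff flip: hom_mult)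
qed

lemma
  fixes q G :: "'a::alg_closed_field bipoly"
  shows bipoly_nullstellensatz: "prime_elem q \<Longrightarrow> (\<And>p. ev q p = 0 \<Longrightarrow> ev G p = 0) \<Longrightarrow> q dvd G"
    and bipoly_separated: "(\<And>p. ev G p = 0) \<Longrightarrow> G = 0"
proof -
  note NS5 = nullstellensatz_poly[OF nullstellensatz_poly[OF nullstellensatz_poly[OF nullstellensatz_poly[OF nullstellensatz_poly[OF nullstellensatz_field[where 'a='a]]]]]]
  obtain E :: "('a poly poly poly poly poly \<Rightarrow> 'a) set" where E: "nullstellensatz nest_const E"
    using NS5 unfolding nest_const_def[abs_def] by blast
  \<comment> \<open>Composed with \<open>nest\<close>, each homomorphism in \<open>E\<close> is
    evaluation at the point whose coordinates are the images of the five variables.\<close>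
  have pt: "\<exists>p. \<forall>f. e (nest f) = ev f p" if "e \<in> E" for e
  proof (intro exI allI)
    fix f
    note nullstellensatz_hom[OF E that] nullstellensatz_const[OF E that]
    then show "e (nest f) = ev f (\<lambda>i. e (nest_var i))"
      by (simp add: hom_comp_nest)
  qed
  show "q dvd G" if q: "prime_elem q" "\<And>p. ev q p = 0 \<Longrightarrow> ev G p = 0"
  proof -
    have "prime_elem (nest q)" using q(1) by (simp only: nest_prime_iff)
    then have "nest q dvd nest G"
      by (rule nullstellensatz_dvd[OF E]) (use q(2) pt in metis)
    then show ?thesis by (simp add: nest_dvd_iff)
  qed
  show "G = 0" if "\<And>p. ev G p = 0"
  proof -
    have "nest G = 0" by (rule nullstellensatz_sep[OF E]) (use that pt in metis)
    then show ?thesis by (simp add: nest_0_iff)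
  qed
qed

section \<open>Unique factorization\<close>

lemma bipoly_prime_factors:
  fixes f :: "'a::alg_closed_field bipoly"
  assumes "f \<noteq> 0" "\<not> f dvd 1"
  shows "\<exists>F. (\<forall>q\<in>#F. prime_elem q) \<and> f = prod_mset F \<and> F \<noteq> {#}"
proof -
  interpret comm_ring_hom "nest :: 'a bipoly \<Rightarrow> _" by (rule nest_hom)
  have "nest f \<noteq> 0" "\<not> nest f dvd 1"
    using assms nest_dvd_iff[of f 1] by (auto simp: nest_0_iff hom_one)
  then obtain F where F: "mset_factors F (nest f)" using mset_factors_exist by blast
  define G where "G = image_mset (inv_into UNIV nest) F"
  have FG: "F = image_mset nest G"
    unfolding G_def by (simp add: multiset.map_comp o_def surj_f_inv_f[OF surj_nest])
  have "nest f = nest (prod_mset G)"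
    using F unfolding mset_factors_def FG by (simp only: hom_prod_mset)
  then have "f = prod_mset G" using inj_nest by (metis injD)
  moreover have "prime_elem q" if "q \<in># G" for q
    using F that unfolding mset_factors_def FG by (auto simp flip: nest_prime_iff)
  moreover have "G \<noteq> {#}" using F unfolding mset_factors_def FG by auto
  ultimately show ?thesis by (intro exI[of _ G]) simp
qed

lemma bipoly_irreducible_prime:
  fixes f :: "'a::alg_closed_field bipoly"
  assumes "irreducible f"
  shows "prime_elem f"
proof -
  have f0: "f \<noteq> 0" and fu: "\<not> f dvd 1" using assms by (auto simp: irreducible_def)
  obtain F where FF: "(\<forall>q\<in>#F. prime_elem q) \<and> f = prod_mset F \<and> F \<noteq> {#}"
    using bipoly_prime_factors[OF f0 fu] ..
  from FF have F: "\<forall>q\<in>#F. prime_elem q" "f = prod_mset F" "F \<noteq> {#}" by simp_all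
  obtain q G where G: "F = add_mset q G" using F(3) by (cases F) auto
  have q: "prime_elem q" using F(1) by (simp add: G)
  have f: "f = q * prod_mset G" using F(2) by (simp add: G)
  have "\<not> q dvd 1" using q by (simp add: prime_elem_def)
  then have "prod_mset G dvd 1" using irreducibleD[OF assms f] by blast
  then obtain v where v: "1 = prod_mset G * v" by (rule dvdE)
  have "q dvd f" by (simp add: f)
  have "f * v = q" by (simp only: f mult.assoc v[symmetric] mult_1_right)
  then have "f dvd q" by (metis dvd_triv_left)
  show ?thesis
    unfolding prime_elem_def
  proof (intro conjI allI impI)
    fix x y assume "f dvd x * y"
    with \<open>q dvd f\<close> have "q dvd x * y" by (rule dvd_trans)
    then have "q dvd x \<or> q dvd y" using q by (simp add: prime_elem_dvd_mult_iff)
    with \<open>f dvd q\<close> show "f dvd x \<or> f dvd y" using dvd_trans by blast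
  qed (fact f0, fact fu)
qed

lemma prime_power_dvd_cancel:
  fixes p q :: "'r::idom"
  assumes "prime_elem p" "\<not> p dvd q" "p ^ n dvd q * g"
  shows "p ^ n dvd g"
  using assms(3)
proof (induction n arbitrary: g)
  case (Suc n)
  have "p dvd q * g" using Suc.prems by (meson dvd_trans dvd_power zero_less_Suc)
  then have "p dvd g" using assms(1,2) by (simp add: prime_elem_dvd_mult_iff)
  then obtain h where h: "g = p * h" by blast
  have "p ^ Suc n dvd q * (p * h)" using Suc.prems h by (simp only:)
  then have "p * p ^ n dvd p * (q * h)" by (simp only: power_Suc mult.left_commute)
  moreover have "p \<noteq> 0" using assms(1) by (simp add: prime_elem_def)
  ultimately have "p ^ n dvd q * h" by (simp only: dvd_mult_cancel_left) simp
  then have "p ^ n dvd h" by (rule Suc.IH)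
  then show ?case unfolding h power_Suc by (rule mult_dvd_mono[OF dvd_refl])
qed simp

text \<open>Induction on the number of primes. When a factor \<open>q\<close> is split off, a prime
  \<open>p\<close> associated to \<open>q\<close> loses one from the exponent on both sides, and any
  other \<open>p\<close> can be cancelled against \<open>q\<close>.\<close>

lemma prod_mset_primes_dvd:
  fixes g :: "'r::idom"
  assumes "\<And>q. q \<in># F \<Longrightarrow> prime_elem q"
    and "\<And>p n. prime_elem p \<Longrightarrow> p ^ n dvd prod_mset F \<Longrightarrow> p ^ n dvd g"
  shows "prod_mset F dvd g"
  using assms
proof (induction F arbitrary: g)
  case (add q F)
  have q: "prime_elem q" using add.prems by auto
  have "q ^ 1 dvd g" by (rule add.prems(2)[OF q]) simp
  then obtain h where h: "g = q * h" by auto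
  have "prod_mset F dvd h"
  proof (rule add.IH)
    fix p n assume p: "prime_elem p" "p ^ n dvd prod_mset F"
    show "p ^ n dvd h"
    proof (cases "p dvd q")
      case True
      then obtain u where u: "q = p * u" by blast
      have "irreducible q" using q by (rule prime_elem_imp_irreducible)
      then have u1: "u dvd 1" using irreducibleD[OF _ u] p(1) by (auto simp: prime_elem_def)
      have "p ^ Suc n dvd prod_mset (add_mset q F)"
        using mult_dvd_mono[OF True p(2)] by simp
      then have "p ^ Suc n dvd g" by (rule add.prems(2)[OF p(1)])
      then have "p * p ^ n dvd p * (u * h)" by (simp only: h u power_Suc mult.assoc)
      moreover have "p \<noteq> 0" using p(1) by (simp add: prime_elem_def)
      ultimately have "p ^ n dvd u * h" by (simp only: dvd_mult_cancel_left) simp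
      then have "p ^ n dvd u * h * v" for v by (rule dvd_mult2)
      moreover obtain v where v: "1 = u * v" using u1 by (rule dvdE)
      have "u * h * v = h" by (simp only: mult.assoc mult.commute[of h v])
        (simp only: v[symmetric] mult_1_left flip: mult.assoc)
      ultimately show ?thesis by metis
    next
      case False
      have "p ^ n dvd prod_mset (add_mset q F)" using p by simp
      then have "p ^ n dvd q * h" using add.prems(2)[OF p(1)] h by simp
      then show ?thesis by (rule prime_power_dvd_cancel[OF p(1) False])
    qed
  qed (use add.prems in auto)
  then show ?case by (simp add: h)
qed simp

lemma bipoly_dvd_of_prime_powers:
  fixes f g :: "'a::alg_closed_field bipoly"
  assumes "f \<noteq> 0" "\<And>p n. prime_elem p \<Longrightarrow> p ^ n dvd f \<Longrightarrow> p ^ n dvd g"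
  shows "f dvd g"
proof (cases "f dvd 1")
  case False
  obtain F where FF: "(\<forall>q\<in>#F. prime_elem q) \<and> f = prod_mset F \<and> F \<noteq> {#}"
    using bipoly_prime_factors[OF assms(1) False] ..
  from FF have F: "\<forall>q\<in>#F. prime_elem q" "f = prod_mset F" by simp_all
  show ?thesis unfolding F(2)
    by (rule prod_mset_primes_dvd) (use assms(2) F in auto)
next
  case True
  then show ?thesis by (rule dvd_trans) (rule one_dvd)
qed

section \<open>Zariski topology and dimension\<close>

lemma proj_space_iff: "p \<in> proj_space \<longleftrightarrow> (\<exists>v. v \<noteq> 0 \<and> p = vec.span {v})"
proof
  assume "p \<in> proj_space"
  then have p: "vec.subspace p" "vec.dim p = 1" by (auto simp: Gr_def)
  obtain B where B: "B \<subseteq> p" "vec.independent B" "p \<subseteq> vec.span B" "card B = vec.dim p"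
    using vec.basis_exists by blast
  then obtain v where "B = {v}" using p by (auto simp: card_1_singleton_iff)
  moreover have "v \<noteq> 0" using B calculation vec.dependent_zero by auto
  moreover have "p = vec.span B" using B p by (metis vec.span_minimal subset_antisym)
  ultimately show "\<exists>v. v \<noteq> 0 \<and> p = vec.span {v}" by blast
qed (auto simp: Gr_def)

lemma proj_spaceE:
  assumes "p \<in> proj_space"
  obtains v where "v \<noteq> 0" "p = vec.span {v}"
  using assms by (auto simp: proj_space_iff)

lemma span_singleton_proj: "v \<noteq> 0 \<Longrightarrow> vec.span {v} \<in> proj_space"
  by (auto simp: proj_space_iff)

definition vanishes :: "('n::finite, 'a::field) mpoly \<Rightarrow> ('a ^ 'n) set set \<Rightarrow> bool" where
  "vanishes F Z \<longleftrightarrow> (\<forall>p\<in>Z. \<forall>v\<in>p. mp_value F v = 0)"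

lemma homogeneous_vanishes_point:
  assumes "homogeneous F"
  shows "(\<forall>w\<in>vec.span {v}. mp_value F w = 0) \<longleftrightarrow> mp_value F v = 0"
proof
  assume "mp_value F v = 0"
  moreover obtain n where "F \<in> forms n" using assms by (auto simp: homogeneous_def)
  ultimately show "\<forall>w\<in>vec.span {v}. mp_value F w = 0"
    by (auto simp: vec.span_singleton forms_scale)
qed (auto intro: vec.span_base)

lemma mp_value_simps [simp]:
  fixes v :: "'a::comm_ring_1 ^ 'n::finite"
  shows "mp_value (F + G) v = mp_value F v + mp_value G v" "mp_value (F * G) v = mp_value F v * mp_value G v"
  "mp_value (F - G) v = mp_value F v - mp_value G v" "mp_value (- F) v = - mp_value F v"
  "mp_value 0 v = 0" "mp_value 1 v = 1" "mp_value (F ^ n) v = mp_value F v ^ n"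
  "mp_value (sum f A) v = (\<Sum>k\<in>A. mp_value (f k) v)" "mp_value (prod f A) v = (\<Prod>k\<in>A. mp_value (f k) v)"
  "mp_value (mp_const c) v = c" "mp_value (mp_var i) v = v $ i"
  by (simp_all add: mp_value_ev)

lemma forms_mult: "F \<in> forms m \<Longrightarrow> G \<in> forms n \<Longrightarrow> F * G \<in> forms (m + n)"
  for F :: "('n::finite, 'a::comm_ring_1) mpoly"
  by (simp add: forms_whom whom_mult)

lemma homogeneous_mult: "homogeneous F \<Longrightarrow> homogeneous G \<Longrightarrow> homogeneous (F * G)"
  for F :: "('n::finite, 'a::comm_ring_1) mpoly"
  by (auto simp: homogeneous_def intro: forms_mult)

lemma homogeneous_1: "homogeneous (1 :: ('n::finite, 'a::comm_ring_1) mpoly)"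
  using whom_1 by (auto simp: homogeneous_def forms_whom)

lemma nonvanishing_1: "nonvanishing 1 = (proj_space :: ('a::field ^ 'n::finite) set set)"
proof -
  have "\<exists>v\<in>p. mp_value 1 v \<noteq> (0 :: 'a)" if p: "p \<in> proj_space" for p :: "('a ^ 'n) set"
  proof -
    obtain v where "v \<noteq> 0" "p = vec.span {v}" using p by (rule proj_spaceE)
    then have "0 \<in> p" by (simp add: vec.span_zero)
    then show ?thesis by (rule bexI[rotated]) simp
  qed
  then show ?thesis by (auto simp: nonvanishing_def)
qed

lemma topspace_zariski: "topspace zariski = (proj_space :: ('a::field ^ 'n::finite) set set)"
proof -
  have "\<Union>{nonvanishing f | f :: ('n, 'a) mpoly. homogeneous f} = proj_space"
  proof (rule antisym)
    have "nonvanishing (1 :: ('n, 'a) mpoly) \<in> {nonvanishing f | f. homogeneous f}"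
      using homogeneous_1 by blast
    then show "proj_space \<subseteq> \<Union>{nonvanishing f | f :: ('n, 'a) mpoly. homogeneous f}"
      unfolding nonvanishing_1 by (rule Union_upper)
  qed (auto simp: nonvanishing_def)
  then show ?thesis
    unfolding zariski_def topology_generated_by_topspace by blast
qed

text \<open>Finite intersections of the generating sets are again of this type, by multiplying the
  forms. Homogeneity allows nonvanishing to be tested at one generator of the point.\<close>

lemma openin_zariski_basis:
  fixes p :: "('a::field ^ 'n::finite) set"
  assumes "openin zariski U" "p \<in> U"
  obtains F where "homogeneous F" "p \<in> nonvanishing F" "nonvanishing F \<subseteq> U"
proof -
  have "generate_topology_on {nonvanishing f | f :: ('n, 'a) mpoly. homogeneous f} U"
    using assms by (simp add: zariski_def openin_topology_generated_by_iff)
  then have "\<exists>F. homogeneous F \<and> p \<in> nonvanishing F \<and> nonvanishing F \<subseteq> U"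
    using assms(2)
  proof induction
    case (Int U V)
    then obtain F G where FG: "homogeneous F" "p \<in> nonvanishing F" "nonvanishing F \<subseteq> U"
      "homogeneous G" "p \<in> nonvanishing G" "nonvanishing G \<subseteq> V" by auto
    obtain v where v: "p = vec.span {v}" "v \<noteq> 0" using FG by (auto simp: nonvanishing_def proj_space_iff)
    have "mp_value F v \<noteq> 0" "mp_value G v \<noteq> 0"
      using FG homogeneous_vanishes_point[of F v] homogeneous_vanishes_point[of G v]
      by (auto simp: nonvanishing_def v)
    then have "p \<in> nonvanishing (F * G)"
      using FG by (auto simp: nonvanishing_def v intro!: bexI[of _ v] vec.span_base)
    moreover have "nonvanishing (F * G) \<subseteq> U \<inter> V"
      using FG by (fastforce simp: nonvanishing_def)
    ultimately show ?case using FG homogeneous_mult by blast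
  next
    case (UN K) then show ?case by blast
  qed auto
  with that show thesis by blast
qed

lemma openin_nonvanishing: "homogeneous F \<Longrightarrow> openin zariski (nonvanishing F)"
  unfolding zariski_def by (rule topology_generated_by_Basis) auto

lemma closedin_zariski_zeros:
  assumes "\<And>F. F \<in> S \<Longrightarrow> homogeneous F"
  shows "closedin zariski {p \<in> proj_space. \<forall>F\<in>S. \<forall>v\<in>p. mp_value F v = 0}"
proof -
  have "openin zariski (\<Union>F\<in>S. nonvanishing F)"
    using assms openin_nonvanishing by blast
  moreover have "{p \<in> proj_space. \<forall>F\<in>S. \<forall>v\<in>p. mp_value F v = 0} = topspace zariski - (\<Union>F\<in>S. nonvanishing F)"
    by (auto simp: topspace_zariski nonvanishing_def)
  ultimately show ?thesis by auto
qed

lemma closedin_zariski_separate: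
  assumes "closedin zariski Z" "p \<in> proj_space" "p \<notin> Z"
  obtains F where "homogeneous F" "vanishes F Z" "\<exists>v\<in>p. mp_value F v \<noteq> 0"
proof -
  have "openin zariski (proj_space - Z)" "p \<in> proj_space - Z"
    using assms by (auto simp: closedin_def topspace_zariski)
  then obtain F where F: "homogeneous F" "p \<in> nonvanishing F" "nonvanishing F \<subseteq> proj_space - Z"
    using openin_zariski_basis by blast
  have "Z \<subseteq> proj_space" using assms closedin_subset by (metis topspace_zariski)
  with F show thesis by (intro that[of F]) (auto simp: nonvanishing_def vanishes_def)
qed

lemma closedin_zariski_subset: "closedin zariski Z \<Longrightarrow> Z \<subseteq> proj_space"
  by (metis closedin_subset topspace_zariski)

lemma vanishes_mult: "vanishes F A \<Longrightarrow> vanishes G B \<Longrightarrow> vanishes (F * G) (A \<union> B)"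
  by (auto simp: vanishes_def)

lemma vanishes_subset: "vanishes F A \<Longrightarrow> B \<subseteq> A \<Longrightarrow> vanishes F B"
  by (auto simp: vanishes_def)

text \<open>Closed sets can be replaced by forms: a point outside a closed set is separated from it
  by a form, and the product of two such forms vanishes on \<open>Z\<close>.\<close>

lemma irreducible_closedI:
  assumes "closedin zariski Z" "Z \<noteq> {}"
    and prime: "\<And>F G. homogeneous F \<Longrightarrow> homogeneous G \<Longrightarrow> vanishes (F * G) Z \<Longrightarrow> vanishes F Z \<or> vanishes G Z"
  shows "irreducible_closed zariski Z"
  unfolding irreducible_closed_def
proof (intro conjI assms allI impI)
  fix A B assume AB: "closedin zariski A \<and> closedin zariski B \<and> Z \<subseteq> A \<union> B"
  show "Z \<subseteq> A \<or> Z \<subseteq> B"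
  proof (rule ccontr)
    assume "\<not> ?thesis"
    then obtain p q where pq: "p \<in> Z" "p \<notin> A" "q \<in> Z" "q \<notin> B" by blast
    then have P: "p \<in> proj_space" "q \<in> proj_space" using assms(1) closedin_zariski_subset by blast+
    obtain F where F: "homogeneous F" "vanishes F A" "\<exists>v\<in>p. mp_value F v \<noteq> 0"
      using closedin_zariski_separate AB P pq by metis
    obtain G where G: "homogeneous G" "vanishes G B" "\<exists>v\<in>q. mp_value G v \<noteq> 0"
      using closedin_zariski_separate AB P pq by metis
    have "vanishes (F * G) Z" using vanishes_mult[OF F(2) G(2)] AB vanishes_subset by blast
    then have "vanishes F Z \<or> vanishes G Z" using prime F G by blast
    with F G pq show False by (auto simp: vanishes_def)
  qed
qed

lemma vanishing_ideal_vanishes: "F \<in> vanishing_ideal Z \<Longrightarrow> vanishes F Z"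
  unfolding vanishing_ideal_def
  by (induction rule: ideal.span_induct_alt) (auto simp: vanishes_def)

lemma vanishing_idealI: "homogeneous F \<Longrightarrow> vanishes F Z \<Longrightarrow> F \<in> vanishing_ideal Z"
  unfolding vanishing_ideal_def vanishes_def by (rule ideal.span_base) auto

section \<open>Krull dimension\<close>

lemma krull_dim_geI:
  assumes "\<And>i. i \<le> n \<Longrightarrow> irreducible_closed T (c i) \<and> c i \<subseteq> Z" "\<And>i. i < n \<Longrightarrow> c i \<subset> c (Suc i)"
  shows "enat n \<le> krull_dim T Z"
  unfolding krull_dim_def by (rule Sup_upper) (use assms in auto)

text \<open>A supremum need not be attained, so the chain is extracted from the strict inequality
  with \<open>n - 1\<close>. For \<open>n = 0\<close> the bound carries no information, as it holds
  for the empty set too.\<close>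

lemma krull_dim_geE:
  assumes "enat n \<le> krull_dim T Z" "n \<ge> 1"
  obtains c where "\<And>i. i \<le> n \<Longrightarrow> irreducible_closed T (c i) \<and> c i \<subseteq> Z" "\<And>i. i < n \<Longrightarrow> c i \<subset> c (Suc i)"
proof -
  have "enat (n - 1) < enat n" using assms by simp
  then have "enat (n - 1) < krull_dim T Z" using assms by (metis less_le_trans)
  then obtain k and c :: "nat \<Rightarrow> 'a set" where k: "enat (n - 1) < enat k"
    "\<forall>i\<le>k. irreducible_closed T (c i) \<and> c i \<subseteq> Z" "\<forall>i<k. c i \<subset> c (Suc i)"
    unfolding krull_dim_def less_Sup_iff by blast
  then have "n \<le> k" by simp
  with k show thesis by (intro that[of c]) auto
qed

lemma krull_dim_extend:
  assumes "irreducible_closed T B" "A \<subset> B" "enat n \<le> krull_dim T A" "n \<ge> 1"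
  shows "enat (Suc n) \<le> krull_dim T B"
proof -
  obtain c where c: "\<And>i. i \<le> n \<Longrightarrow> irreducible_closed T (c i) \<and> c i \<subseteq> A" "\<And>i. i < n \<Longrightarrow> c i \<subset> c (Suc i)"
    using krull_dim_geE assms by metis
  show ?thesis
  proof (rule krull_dim_geI[of _ _ "\<lambda>i. if i \<le> n then c i else B"])
    fix i assume "i \<le> Suc n"
    show "irreducible_closed T (if i \<le> n then c i else B) \<and> (if i \<le> n then c i else B) \<subseteq> B"
      using c(1)[of i] assms by auto
  next
    fix i assume "i < Suc n"
    then show "(if i \<le> n then c i else B) \<subset> (if Suc i \<le> n then c (Suc i) else B)"
      using c(2)[of i] c(1)[of i] assms by (cases "i = n") auto
  qed
qed

lemma span_scale:
  fixes v :: "'a::field ^ 'n"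
  assumes "c \<noteq> 0"
  shows "vec.span {c *s v} = vec.span {v}"
proof (rule antisym)
  have "c *s v \<in> vec.span {v}" by (intro vec.span_scale vec.span_base) simp
  then show "vec.span {c *s v} \<subseteq> vec.span {v}" by (intro vec.span_minimal vec.subspace_span) simp
  have "(1 / c) *s (c *s v) \<in> vec.span {c *s v}" by (intro vec.span_scale vec.span_base) simp
  moreover have "(1 / c) *s (c *s v) = v" using assms by (simp add: Finite_Cartesian_Product.vec_eq_iff)
  ultimately show "vec.span {v} \<subseteq> vec.span {c *s v}" by (intro vec.span_minimal vec.subspace_span) simp
qed

lemma span_eqE:
  fixes v w :: "'a::field ^ 'n"
  assumes "vec.span {v} = vec.span {w}" "v \<noteq> 0"
  obtains c where "c \<noteq> 0" "v = c *s w"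
proof -
  have "v \<in> vec.span {w}" using assms by (metis vec.span_base insertI1)
  then obtain c where "v = c *s w" by (auto simp: vec.span_singleton)
  with assms show thesis by (intro that[of c]) auto
qed

lemma closedin_point:
  fixes v :: "'a::field ^ 'n"
  assumes "v \<noteq> 0"
  shows "closedin zariski {vec.span {v}}"
proof -
  define S where "S = {mp_const (v $ i) * mp_var j - mp_const (v $ j) * mp_var i | i j. True} "
  have "homogeneous F" if "F \<in> S" for F
  proof -
    have "mp_const (v $ i) * mp_var j \<in> forms 1" for i j
      using whom_mult[OF whom_const whom_var, of "\<lambda>_. 1" j 1 "v $ i"] by (simp add: forms_whom)
    with that show ?thesis
      unfolding S_def homogeneous_def by (auto simp: forms_whom intro!: exI[of _ 1] whom_diff)
  qed
  then have "closedin zariski {p \<in> proj_space. \<forall>F\<in>S. \<forall>v\<in>p. mp_value F v = 0}"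
    by (rule closedin_zariski_zeros)
  moreover have "{p \<in> proj_space. \<forall>F\<in>S. \<forall>v\<in>p. mp_value F v = 0} = {vec.span {v}}"
  proof (intro equalityI subsetI)
    fix p assume p: "p \<in> {p \<in> proj_space. \<forall>F\<in>S. \<forall>v\<in>p. mp_value F v = 0}"
    then obtain w where w: "w \<noteq> 0" "p = vec.span {w}" by (auto simp: proj_space_iff)
    have eq: "v $ i * w $ j = v $ j * w $ i" for i j
    proof -
      have "mp_const (v $ i) * mp_var j - mp_const (v $ j) * mp_var i \<in> S" by (auto simp: S_def)
      then have "mp_value (mp_const (v $ i) * mp_var j - mp_const (v $ j) * mp_var i) w = 0"
        using p w vec.span_base[of w "{w}"] by blast
      then show ?thesis by simp
    qed
    obtain i where i: "w $ i \<noteq> 0" using w by (auto simp: Finite_Cartesian_Product.vec_eq_iff)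
    have "v = (v $ i / w $ i) *s w"
      using i eq[of i] by (auto simp: Finite_Cartesian_Product.vec_eq_iff field_simps)
    moreover have "v $ i / w $ i \<noteq> 0" using calculation assms by auto
    ultimately have "vec.span {v} = vec.span {w}"
      by (metis span_scale)
    then show "p \<in> {vec.span {v}}" using w by simp
  next
    fix p assume "p \<in> {vec.span {v}}"
    then have p: "p = vec.span {v}" by simp
    have "mp_value F w = 0" if "F \<in> S" "w \<in> p" for F w
    proof -
      obtain k where k: "w = k *s v" using \<open>w \<in> p\<close> by (auto simp: p vec.span_singleton)
      obtain i j where F: "F = mp_const (v $ i) * mp_var j - mp_const (v $ j) * mp_var i"
        using \<open>F \<in> S\<close> by (auto simp: S_def)
      show ?thesis unfolding F k by (simp add: algebra_simps)
    qed
    moreover have "p \<in> proj_space" unfolding p by (rule span_singleton_proj[OF assms])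
    ultimately show "p \<in> {p \<in> proj_space. \<forall>F\<in>S. \<forall>v\<in>p. mp_value F v = 0}" by simp
  qed
  ultimately show ?thesis by simp
qed

lemma irreducible_point:
  fixes v :: "'a::field ^ 'n"
  assumes "v \<noteq> 0"
  shows "irreducible_closed zariski {vec.span {v}}"
  using closedin_point[OF assms] by (auto simp: irreducible_closed_def)

section \<open>The bihomogeneous coordinates of the scroll\<close>

definition bp :: "'a \<Rightarrow> 'a \<Rightarrow> 'a ^ 3 \<Rightarrow> bvar \<Rightarrow> 'a" where
  "bp s t x v = (case v of None \<Rightarrow> s | Some None \<Rightarrow> t | Some (Some j) \<Rightarrow> x $ j)"

lemma bp_simps [simp]: "bp s t x vS = s" "bp s t x vT = t" "bp s t x (vX j) = x $ j"
  by (simp_all add: bp_def)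

lemma bp_surj: "p = bp (p vS) (p vT) (\<chi> j. p (vX j))"
  by (rule ext) (auto simp: bp_def split: option.split)

lemma sum_option: "(\<Sum>v\<in>UNIV. h v) = h None + (\<Sum>v\<in>UNIV. h (Some v))"
  for h :: "'c::finite option \<Rightarrow> 'b::comm_monoid_add"
  by (simp add: UNIV_option_conv sum.reindex)

lemma prod_option: "(\<Prod>v\<in>UNIV. h v) = h None * (\<Prod>v\<in>UNIV. h (Some v))"
  for h :: "'c::finite option \<Rightarrow> 'b::comm_monoid_mult"
  by (simp add: UNIV_option_conv prod.reindex)

lemma sum_bvar: "(\<Sum>v\<in>UNIV. g v) = g vS + g vT + (\<Sum>j\<in>UNIV. g (vX j))"
  for g :: "bvar \<Rightarrow> 'b::comm_monoid_add"
  by (simp add: sum_option add.assoc)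

lemma prod_bvar: "(\<Prod>v\<in>UNIV. g v) = g vS * g vT * (\<Prod>j\<in>UNIV. g (vX j))"
  for g :: "bvar \<Rightarrow> 'b::comm_monoid_mult"
  by (simp add: prod_option mult.assoc)

definition wS :: "bvar \<Rightarrow> nat" where
  "wS v = (case v of None \<Rightarrow> 1 | Some None \<Rightarrow> 1 | Some (Some j) \<Rightarrow> 0)"

definition wX :: "bvar \<Rightarrow> nat" where
  "wX v = (case v of None \<Rightarrow> 0 | Some None \<Rightarrow> 0 | Some (Some j) \<Rightarrow> 1)"

lemma w_simps [simp]: "wS vS = 1" "wS vT = 1" "wS (vX j) = 0" "wX vS = 0" "wX vT = 0" "wX (vX j) = 1"
  by (simp_all add: wS_def wX_def)

definition bih :: "nat \<Rightarrow> nat \<Rightarrow> 'a::zero bipoly \<Rightarrow> bool" where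
  "bih m n G \<longleftrightarrow> whom wS m G \<and> whom wX n G"

lemma bih_0 [simp]: "bih m n 0" by (simp add: bih_def)
lemma bih_mult: "bih m n F \<Longrightarrow> bih k l G \<Longrightarrow> bih (m + k) (n + l) (F * G)" for F :: "'a::comm_ring_1 bipoly"
  by (simp add: bih_def whom_mult)
lemma bih_add: "bih m n F \<Longrightarrow> bih m n G \<Longrightarrow> bih m n (F + G)" for F :: "'a::comm_ring_1 bipoly"
  by (simp add: bih_def whom_add)
lemma bih_diff: "bih m n F \<Longrightarrow> bih m n G \<Longrightarrow> bih m n (F - G)" for F :: "'a::comm_ring_1 bipoly"
  by (simp add: bih_def whom_diff)
lemma bih_sum: "(\<And>k. k \<in> A \<Longrightarrow> bih m n (f k)) \<Longrightarrow> bih m n (sum f A)" for f :: "'i \<Rightarrow> 'a::comm_ring_1 bipoly"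
  by (simp add: bih_def whom_sum)
lemma bih_power: "bih m n F \<Longrightarrow> bih (m * k) (n * k) (F ^ k)" for F :: "'a::comm_ring_1 bipoly"
  by (simp add: bih_def whom_power)
lemma bih_const: "bih 0 0 (mp_const c)" for c :: "'a::comm_ring_1"
  by (simp add: bih_def whom_const)
lemma bih_1: "bih 0 0 (1 :: 'a::comm_ring_1 bipoly)"
  by (simp add: bih_def whom_1)
lemma bih_cmult: "bih m n F \<Longrightarrow> bih m n (mp_const c * F)" for F :: "'a::comm_ring_1 bipoly"
  using bih_mult[OF bih_const, of m n F c] by simp
lemma bih_var: "bih 1 0 (mp_var vS :: 'a::comm_ring_1 bipoly)" "bih 1 0 (mp_var vT :: 'a bipoly)" "bih 0 1 (mp_var (vX j) :: 'a bipoly)"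
  by (simp_all add: bih_def whom_var)

lemma bih_factor:
  fixes f g :: "'a::idom bipoly"
  assumes "bih m n (f * g)" "f * g \<noteq> 0"
  obtains i j k l where "bih i j f" "bih k l g" "i + k = m" "j + l = n"
proof -
  obtain i k where "whom wS i f" "whom wS k g" "i + k = m"
    using assms whom_factor[of wS m f g] unfolding bih_def by blast
  moreover obtain j l where "whom wX j f" "whom wX l g" "j + l = n"
    using assms whom_factor[of wX n f g] unfolding bih_def by blast
  ultimately show thesis using that unfolding bih_def by blast
qed

lemma bih_unique: "bih m n F \<Longrightarrow> bih k l F \<Longrightarrow> F \<noteq> 0 \<Longrightarrow> m = k \<and> n = l"
  unfolding bih_def using whom_unique by blast

lemma ev_bih_scale:
  assumes "bih m n G"
  shows "ev G (bp (c * s) (c * t) (e *s x)) = c ^ m * e ^ n * ev G (bp s t x)"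
proof -
  have 1: "bp (c * s) (c * t) (e *s x) = (\<lambda>v. c ^ wS v * bp s t (e *s x) v)"
    by (rule ext) (auto simp: bp_def wS_def split: option.split)
  have 2: "bp s t (e *s x) = (\<lambda>v. e ^ wX v * bp s t x v)"
    by (rule ext) (auto simp: bp_def wX_def split: option.split)
  show ?thesis
    unfolding 1 2 using assms whom_ev[of wS m G c "\<lambda>v. e ^ wX v * bp s t x v"] whom_ev[of wX n G e "bp s t x"]
    by (simp add: bih_def mult.assoc)
qed

section \<open>Zeros of bihomogeneous forms\<close>

definition dehom :: "'a ^ 3 \<Rightarrow> 'a::comm_ring_1 bipoly \<Rightarrow> 'a poly" where
  "dehom x = mp_eval (\<lambda>c. [:c:]) (\<lambda>v. case v of None \<Rightarrow> [:0, 1:] | Some None \<Rightarrow> 1 | Some (Some j) \<Rightarrow> [:x $ j:])"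

lemma dehom_hom: "comm_ring_hom (dehom x)"
  unfolding dehom_def by (rule mp_eval_hom[OF pCons_hom])

text \<open>Inverse to setting t = 1 in a binary form of degree \<open>m\<close>. The degree of
  \<open>Q\<close> may be smaller than \<open>m\<close>; then (1, 0) is a zero.\<close>

definition bform :: "nat \<Rightarrow> 'a::comm_ring_1 poly \<Rightarrow> 'a \<Rightarrow> 'a \<Rightarrow> 'a" where
  "bform m Q s t = (\<Sum>i\<le>m. coeff Q i * s ^ i * t ^ (m - i))"

lemma dehom_single:
  "dehom x (Poly_Mapping.single \<mu> c) =
     monom (c * (\<Prod>j\<in>UNIV. x $ j ^ Poly_Mapping.lookup \<mu> (vX j))) (Poly_Mapping.lookup \<mu> vS)"
proof -
  have X: "[:0, 1:] ^ k = monom (1 :: 'a) k" for k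
    by (simp add: monom_altdef)
  have P: "(\<Prod>j\<in>A. [:g j:]) = [:\<Prod>j\<in>A. g j:]" for g :: "3 \<Rightarrow> 'a" and A
    by (induction A rule: infinite_finite_induct) auto
  have C: "(\<Prod>j\<in>UNIV. [:x $ j:] ^ Poly_Mapping.lookup \<mu> (vX j)) =
      [:\<Prod>j\<in>UNIV. x $ j ^ Poly_Mapping.lookup \<mu> (vX j):]"
    unfolding poly_const_pow by (rule P)
  have M: "[:c:] * (monom 1 i * 1 * [:K:]) = monom (c * K) i" for i and K :: 'a
    by (simp add: mult.commute[of "monom 1 i"] smult_monom)
  show ?thesis
    unfolding dehom_def
    by (subst mp_eval_single, simp, unfold prod_bvar option.case X C M power_one, rule refl)
qed

lemma dehom_bform:
  assumes "whom wS m G"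
  shows "degree (dehom x G) \<le> m" "ev G (bp s t x) = bform m (dehom x G) s t"
proof -
  interpret comm_ring_hom "dehom x" by (rule dehom_hom)
  let ?s = "\<lambda>\<mu>. Poly_Mapping.single \<mu> (Poly_Mapping.lookup G \<mu>)"
  have G: "G = (\<Sum>\<mu>\<in>Poly_Mapping.keys G. ?s \<mu>)" by (rule mpoly_sum_monomials)
  have deg: "Poly_Mapping.lookup \<mu> vS + Poly_Mapping.lookup \<mu> vT = m" if "\<mu> \<in> Poly_Mapping.keys G" for \<mu>
  proof -
    have "wdeg wS \<mu> = m" using that assms by (auto simp: whom_def)
    then show ?thesis unfolding wdeg_def sum_bvar w_simps by simp
  qed
  have dG: "dehom x G = (\<Sum>\<mu>\<in>Poly_Mapping.keys G. dehom x (?s \<mu>))"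
    by (subst G) (rule hom_sum)
  have "degree (dehom x (?s \<mu>)) \<le> m" if "\<mu> \<in> Poly_Mapping.keys G" for \<mu>
  proof -
    have "degree (dehom x (?s \<mu>)) \<le> Poly_Mapping.lookup \<mu> vS"
      unfolding dehom_single by (rule degree_monom_le)
    with deg[OF that] show ?thesis by simp
  qed
  then show "degree (dehom x G) \<le> m"
    unfolding dG by (intro degree_sum_le) auto
  have "ev (?s \<mu>) (bp s t x) = bform m (dehom x (?s \<mu>)) s t" if "\<mu> \<in> Poly_Mapping.keys G" for \<mu>
  proof -
    let ?i = "Poly_Mapping.lookup \<mu> vS"
    let ?C = "Poly_Mapping.lookup G \<mu> * (\<Prod>j\<in>UNIV. x $ j ^ Poly_Mapping.lookup \<mu> (vX j))"
    have "bform m (dehom x (?s \<mu>)) s t = (\<Sum>i\<le>m. if i = ?i then ?C * s ^ ?i * t ^ (m - ?i) else 0)"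
      unfolding bform_def dehom_single by (rule sum.cong) auto
    also have "\<dots> = ?C * s ^ ?i * t ^ (m - ?i)" using deg[OF that] by simp
    also have "\<dots> = ev (?s \<mu>) (bp s t x)"
      using deg[OF that] by (subst mp_eval_single) (auto simp: prod_bvar mult_ac)
    finally show ?thesis by simp
  qed
  moreover have "bform m (\<Sum>\<mu>\<in>A. Q \<mu>) s t = (\<Sum>\<mu>\<in>A. bform m (Q \<mu>) s t)" for A and Q :: "(bvar \<Rightarrow>\<^sub>0 nat) \<Rightarrow> 'a poly"
    unfolding bform_def coeff_sum sum_distrib_right by (rule sum.swap)
  moreover have "ev G (bp s t x) = (\<Sum>\<mu>\<in>Poly_Mapping.keys G. ev (?s \<mu>) (bp s t x))"
    using arg_cong[OF G, of "\<lambda>G. ev G (bp s t x)"] by (simp only: ev_simps)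
  ultimately show "ev G (bp s t x) = bform m (dehom x G) s t"
    unfolding dG by simp
qed

lemma bform_zero:
  fixes Q :: "'a::alg_closed_field poly"
  assumes "m \<ge> 1" "degree Q \<le> m"
  obtains s t where "(s, t) \<noteq> (0, 0)" "bform m Q s t = 0"
proof (cases "coeff Q m = 0")
  case True
  have "bform m Q 1 0 = (\<Sum>i\<le>m. if i = m then coeff Q m else 0)"
    unfolding bform_def by (rule sum.cong) (auto simp: power_0_left)
  with True show thesis by (intro that[of 1 0]) auto
next
  case False
  then have "degree Q = m" using assms le_degree by fastforce
  then obtain \<tau> where \<tau>: "poly Q \<tau> = 0" using assms alg_closed_imp_poly_has_root[of Q] by auto
  have "bform m Q \<tau> 1 = poly Q \<tau>" using \<open>degree Q = m\<close> by (simp add: bform_def poly_altdef)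
  with \<tau> show thesis by (intro that[of \<tau> 1]) auto
qed

lemma bih_zero_S:
  fixes G :: "'a::alg_closed_field bipoly"
  assumes "bih m n G" "m \<ge> 1"
  obtains s t where "(s, t) \<noteq> (0, 0)" "ev G (bp s t x) = 0"
proof -
  have w: "whom wS m G" using assms by (simp add: bih_def)
  from bform_zero[OF assms(2) dehom_bform(1)[OF w]] obtain s t where "(s, t) \<noteq> (0, 0)" "bform m (dehom x G) s t = 0" .
  then show thesis using that dehom_bform(2)[OF w] by metis
qed

definition restr :: "('n \<Rightarrow> 'a) \<Rightarrow> ('n \<Rightarrow> 'a) \<Rightarrow> ('n::finite, 'a::comm_ring_1) mpoly \<Rightarrow> 'a poly" where
  "restr p q = mp_eval (\<lambda>c. [:c:]) (\<lambda>i. [:p i, q i:])"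

lemma restr_hom: "comm_ring_hom (restr p q)"
  unfolding restr_def by (rule mp_eval_hom[OF pCons_hom])

lemma poly_hom: "comm_ring_hom (\<lambda>Q :: 'a::comm_ring_1 poly. poly Q \<tau>)"
  by unfold_locales auto

lemma poly_restr: "poly (restr p q G) \<tau> = ev G (\<lambda>i. p i + \<tau> * q i)"
  unfolding restr_def by (subst mp_eval_comp[OF poly_hom]) simp

text \<open>Let u, v be the two basis vectors. If G has no zero of the form u + c v, it is a
  constant k on these points, so G(v + c u) = k c^n by homogeneity, which vanishes at c = 0 because
  n is positive. The control over the support of the zero serves to produce distinct points on a
  curve.\<close>

lemma bih_zero_X:
  fixes G :: "'a::alg_closed_field bipoly"
  assumes "bih m n G" "n \<ge> 1" and ij: "i \<noteq> j"
  obtains x where "x \<noteq> 0" "\<And>k. k \<noteq> i \<Longrightarrow> k \<noteq> j \<Longrightarrow> x $ k = 0" "ev G (bp s t x) = 0"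
proof (rule ccontr)
  assume none: "\<not> thesis"
  define u v :: "'a ^ 3" where "u = axis i 1" and "v = axis j 1"
  have uv: "u + c *s v \<noteq> 0" "v + c *s u \<noteq> 0" for c
  proof -
    have "(u + c *s v) $ i = 1" "(v + c *s u) $ j = 1" using ij by (auto simp: u_def v_def axis_def)
    then have "(u + c *s v) $ i \<noteq> 0 $ i" "(v + c *s u) $ j \<noteq> 0 $ j" by simp_all
    then show "u + c *s v \<noteq> 0" "v + c *s u \<noteq> 0" by metis+
  qed
  have supp: "(u + c *s v) $ k = 0" "(v + c *s u) $ k = 0" if "k \<noteq> i" "k \<noteq> j" for c k
    using that by (auto simp: u_def v_def axis_def)
  let ?Q = "restr (bp s t u) (bp 0 0 v) G" and ?Q' = "restr (bp s t v) (bp 0 0 u) G"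
  have pt: "(\<lambda>l. bp s t y l + c * bp 0 0 z l) = bp s t (y + c *s z)" for y z c
    by (rule ext) (auto simp: bp_def split: option.split)
  have Q: "poly ?Q c = ev G (bp s t (u + c *s v))" "poly ?Q' c = ev G (bp s t (v + c *s u))" for c
    unfolding poly_restr pt by (rule refl)+
  have "poly ?Q c \<noteq> 0" for c
  proof
    assume "poly ?Q c = 0"
    then have "ev G (bp s t (u + c *s v)) = 0" by (simp only: Q)
    then show False using none that[of "u + c *s v"] uv(1)[of c] supp(1)[of _ c] by blast
  qed
  then have "degree ?Q = 0" using alg_closed_imp_poly_has_root by (metis gr0I)
  then obtain k where k: "?Q = [:k:]" by (meson degree_eq_zeroE)
  have "?Q' - monom k n = 0"
  proof (rule poly_eq_0_of_infinite[of "UNIV - {0}"])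
    fix c :: 'a assume "c \<in> UNIV - {0}"
    then have c: "c \<noteq> 0" by simp
    have "v + c *s u = c *s (u + (1 / c) *s v)" using c by (simp add: Finite_Cartesian_Product.vec_eq_iff field_simps)
    then have "poly ?Q' c = ev G (bp (1 * s) (1 * t) (c *s (u + (1 / c) *s v)))"
      by (simp only: Q(2) mult_1)
    also have "\<dots> = c ^ n * poly ?Q (1 / c)"
      by (subst ev_bih_scale[OF assms(1)]) (simp add: Q)
    finally show "poly (?Q' - monom k n) c = 0" using k by (simp add: poly_monom)
  qed (simp add: infinite_alg_closed)
  then have "poly ?Q' 0 = 0" using assms by (simp add: poly_monom power_0_left)
  then have "ev G (bp s t (v + 0 *s u)) = 0" by (simp only: Q(2))
  then show False using none that[of "v + 0 *s u"] uv(2)[of 0] supp(2)[of _ 0] by blast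
qed

lemma whom_subst:
  fixes y :: "'n::finite \<Rightarrow> ('m::finite, 'a::comm_ring_1) mpoly"
  assumes "whom w n f" "\<And>i. whom w' (w i) (y i)"
  shows "whom w' n (mp_eval mp_const y f)"
  unfolding mp_eval_def
proof (rule whom_sum)
  fix m assume "m \<in> Poly_Mapping.keys f"
  then have m: "(\<Sum>i\<in>UNIV. w i * Poly_Mapping.lookup m i) = n" using assms by (auto simp: whom_def wdeg_def)
  have "whom w' (\<Sum>i\<in>UNIV. w i * Poly_Mapping.lookup m i) (\<Prod>i\<in>UNIV. y i ^ Poly_Mapping.lookup m i)"
    by (intro whom_prod whom_power assms)
  then have "whom w' (0 + n) (mp_const (Poly_Mapping.lookup f m) * (\<Prod>i\<in>UNIV. y i ^ Poly_Mapping.lookup m i))"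
    unfolding m by (intro whom_mult whom_const)
  then show "whom w' n (mp_const (Poly_Mapping.lookup f m) * (\<Prod>i\<in>UNIV. y i ^ Poly_Mapping.lookup m i))"
    by simp
qed

lemma ev_cong_whom_0:
  assumes "whom w 0 f" "\<And>i. w i = 0 \<Longrightarrow> p i = q i"
  shows "ev f p = ev f (q :: _ \<Rightarrow> 'a::comm_ring_1)"
  unfolding mp_eval_def
proof (intro sum.cong refl arg_cong2[where f = "(*)"] prod.cong)
  fix m i assume "m \<in> Poly_Mapping.keys f"
  then have "w i * Poly_Mapping.lookup m i = 0" using assms(1) by (simp add: whom_def wdeg_def)
  then show "p i ^ Poly_Mapping.lookup m i = q i ^ Poly_Mapping.lookup m i"
    using assms(2)[of i] by auto
qed

lemma ev_bih_S0: "bih 0 n q \<Longrightarrow> ev q (bp s t x) = ev q (bp s' t' x)" for q :: "'a::comm_ring_1 bipoly"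
  by (rule ev_cong_whom_0[of wS]) (auto simp: bih_def bp_def wS_def split: option.splits)

lemma ev_bih_X0: "bih m 0 q \<Longrightarrow> ev q (bp s t x) = ev q (bp s t y)" for q :: "'a::comm_ring_1 bipoly"
  by (rule ev_cong_whom_0[of wX]) (auto simp: bih_def bp_def wX_def split: option.splits)

lemma bih_00_const:
  assumes "bih 0 0 (q :: 'a::comm_ring_1 bipoly)"
  obtains c where "q = mp_const c"
proof -
  have "m = 0" if "m \<in> Poly_Mapping.keys q" for m
  proof (rule poly_mapping_eqI)
    fix i
    have "wdeg wS m = 0" "wdeg wX m = 0" using that assms by (auto simp: bih_def whom_def)
    then have "wS i * Poly_Mapping.lookup m i = 0" "wX i * Poly_Mapping.lookup m i = 0" by (simp_all add: wdeg_def)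
    then show "Poly_Mapping.lookup m i = Poly_Mapping.lookup 0 i"
      by (auto simp: wS_def wX_def split: option.splits)
  qed
  then have "q = mp_const (Poly_Mapping.lookup q 0)"
    unfolding mp_const_def
    by (intro poly_mapping_eqI) (metis in_keys_iff lookup_single_eq lookup_single_not_eq)
  then show thesis by (rule that)
qed

lemma bih_00_unit: "bih 0 0 q \<Longrightarrow> q \<noteq> 0 \<Longrightarrow> q dvd 1" for q :: "'a::field bipoly"
proof -
  assume "bih 0 0 q" "q \<noteq> 0"
  then obtain c where c: "q = mp_const c" using bih_00_const by blast
  then have "c \<noteq> 0" using \<open>q \<noteq> 0\<close> by (auto simp: mp_const_def)
  then have "1 = q * mp_const (1 / c)"
    by (simp add: c mp_const_def mult_single)
  then show ?thesis by (rule dvdI)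
qed

lemma bih_unit: 
  fixes q :: "'a::field bipoly"
  assumes "bih m n q" "q dvd 1"
  shows "m = 0 \<and> n = 0"
proof -
  obtain r where r: "1 = q * r" using assms(2) by (rule dvdE)
  have "bih 0 0 (q * r)" "q * r \<noteq> 0" using bih_1 by (simp_all flip: r)
  then obtain i j k l where "bih i j q" "bih k l r" "i + k = 0" "j + l = 0" by (rule bih_factor)
  moreover have "q \<noteq> 0" using r by auto
  ultimately show ?thesis using bih_unique[OF assms(1)] by fastforce
qed

lemma bih_dvd:
  fixes q :: "'a::field bipoly"
  assumes "bih m n G" "G \<noteq> 0" "q dvd G"
  obtains i j where "bih i j q" "i \<le> m" "j \<le> n"
proof -
  obtain r where r: "G = q * r" using assms(3) by (rule dvdE)
  have "bih m n (q * r)" "q * r \<noteq> 0" using assms by (simp_all add: r)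
  then obtain i j k l where "bih i j q" "bih k l r" "i + k = m" "j + l = n" by (rule bih_factor)
  then show thesis by (intro that[of i j]) auto
qed

lemma bipoly_prime_factor:
  fixes G :: "'a::alg_closed_field bipoly"
  assumes "G \<noteq> 0" "\<not> G dvd 1"
  obtains q where "prime_elem q" "q dvd G"
proof -
  obtain F where FF: "(\<forall>q\<in>#F. prime_elem q) \<and> G = prod_mset F \<and> F \<noteq> {#}"
    using bipoly_prime_factors[OF assms] ..
  then obtain q where q: "q \<in># F" by (meson multiset_nonemptyE)
  with FF have "prime_elem q" "q dvd G" by (auto intro: dvd_prod_mset)
  then show thesis by (rule that)
qed

lemma bipoly_eqI:
  fixes F G :: "'a::alg_closed_field bipoly"
  assumes "\<And>s t x. ev F (bp s t x) = ev G (bp s t x)"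
  shows "F = G"
proof -
  have "F - G = 0"
  proof (rule bipoly_separated)
    fix p
    show "ev (F - G) p = 0" by (subst bp_surj) (simp add: assms)
  qed
  then show ?thesis by simp
qed

lemma forms_vanish_0: "F \<in> forms k \<Longrightarrow> mp_value F v = 0 \<Longrightarrow> mp_value F 0 = 0"
  for v :: "'a::comm_ring_1 ^ 'n"
  using forms_scale[of F k 0 v] by simp

lemma mp_var_nonzero: "mp_var v \<noteq> (0 :: ('n, 'a::zero_neq_one) mpoly)"
  by (metis lookup_single_eq lookup_zero mp_var_def zero_neq_one)

lemma vec3_eqI: "x $ 1 = y $ 1 \<Longrightarrow> x $ 2 = y $ 2 \<Longrightarrow> x $ 3 = y $ 3 \<Longrightarrow> x = (y :: 'a ^ 3)"
  by (simp add: Finite_Cartesian_Product.vec_eq_iff forall_3)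

lemma linear_form: "(\<Sum>i\<in>UNIV. mp_const (c i) * mp_var i) \<in> (forms 1 :: ('n::finite, 'a::comm_ring_1) mpoly set)"
  unfolding forms_whom mem_Collect_eq
proof (rule whom_sum)
  fix i :: 'n
  show "whom (\<lambda>_. 1) 1 (mp_const (c i) * mp_var i)"
    using whom_mult[OF whom_const whom_var, of "\<lambda>_. 1" i 1 "c i"] by simp
qed

lemma bih_linear_st: "bih 1 0 (mp_const t0 * mp_var vS - mp_const s0 * mp_var vT :: 'a::comm_ring_1 bipoly)"
  by (intro bih_diff bih_cmult bih_var)

text \<open>In any factorization one factor has bidegree (0, 0) and is therefore constant; in a
  factorial ring irreducible elements are prime.\<close>

lemma linear_st_prime:
  assumes "(s0, t0) \<noteq> (0, 0)"
  shows "prime_elem (mp_const t0 * mp_var vS - mp_const s0 * mp_var vT :: 'a::alg_closed_field bipoly)"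
    (is "prime_elem ?u")
proof (rule bipoly_irreducible_prime, rule irreducibleI)
  show u0: "?u \<noteq> 0"
  proof
    assume "?u = 0"
    then have "ev ?u (bp s t 0) = 0" for s t by simp
    then have "t0 * s - s0 * t = 0" for s t by simp
    from this[of 1 0] this[of 0 1] show False using assms by simp
  qed
  show "\<not> ?u dvd 1"
  proof
    assume "?u dvd 1"
    from bih_unit[OF bih_linear_st this] show False by simp
  qed
  fix q r :: "'a bipoly" assume qr: "?u = q * r"
  have "bih 1 0 (q * r)" "q * r \<noteq> 0" using bih_linear_st[of t0 s0] u0 unfolding qr by this+
  then obtain i j k l where ij: "bih i j q" "bih k l r" "i + k = 1" "j + l = 0" by (rule bih_factor)
  have nz: "q \<noteq> 0" "r \<noteq> 0" using u0 qr by auto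
  have "i = 0 \<and> j = 0 \<or> k = 0 \<and> l = 0" using ij(3,4) by arith
  then show "q dvd 1 \<or> r dvd 1" using bih_00_unit[OF _ nz(1)] bih_00_unit[OF _ nz(2)] ij(1,2) by auto
qed

lemma linear_st_dvd:
  fixes G :: "'a::alg_closed_field bipoly"
  assumes st: "(s0, t0) \<noteq> (0, 0)" and G: "bih m 0 G" "ev G (bp s0 t0 0) = 0"
  shows "mp_const t0 * mp_var vS - mp_const s0 * mp_var vT dvd G"
proof (rule bipoly_nullstellensatz[OF linear_st_prime[OF st]])
  fix p assume "ev (mp_const t0 * mp_var vS - mp_const s0 * mp_var vT) p = 0"
  then have eq: "t0 * p vS = s0 * p vT" by simp
  define c where "c = (if s0 \<noteq> 0 then p vS / s0 else p vT / t0)"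
  have c: "p vS = c * s0" "p vT = c * t0" using eq st by (auto simp: c_def field_simps)
  have "ev G p = ev G (bp (c * s0) (c * t0) (\<chi> j. p (vX j)))" using bp_surj[of p] c by metis
  also have "\<dots> = ev G (bp (c * s0) (c * t0) (0 *s 0))" by (rule ev_bih_X0[OF G(1)])
  also have "\<dots> = 0" unfolding ev_bih_scale[OF G(1)] using G(2) by simp
  finally show "ev G p = 0" .
qed

section \<open>The parametrization of the scroll\<close>

locale scroll =
  fixes a b :: "3 \<Rightarrow> 'a::alg_closed_field ^ 6"
  assumes spans: "vec.span (range a \<union> range b) = UNIV"
begin

definition Av :: "'a ^ 3 \<Rightarrow> 'a ^ 6" where "Av x = (\<Sum>j\<in>UNIV. x $ j *s a j)"
definition Bv :: "'a ^ 3 \<Rightarrow> 'a ^ 6" where "Bv x = (\<Sum>j\<in>UNIV. x $ j *s b j)"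
definition P :: "'a \<Rightarrow> 'a \<Rightarrow> 'a ^ 3 \<Rightarrow> 'a ^ 6" where "P s t x = s *s Av x + t *s Bv x"

text \<open>The six spanning vectors \<open>a j\<close>, \<open>b j\<close> form a basis. The rows
  of the inverse matrix, sorted by a bijection of the six indices with
  \<open>bool \<times> 3\<close>, give the coordinates along the \<open>a j\<close> and along the
  \<open>b j\<close>.\<close>

lemma coords_ex: "\<exists>N :: ('a ^ 6 ^ 3) \<times> ('a ^ 6 ^ 3).
    (\<forall>x y. fst N *v (Av x + Bv y) = x \<and> snd N *v (Av x + Bv y) = y) \<and>
    (\<forall>v. Av (fst N *v v) + Bv (snd N *v v) = v)"
proof -
  have "card (UNIV :: 6 set) = card (UNIV :: (bool \<times> 3) set)"
    by (simp add: card_prod)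
  then obtain \<beta> where \<beta>: "bij_betw \<beta> (UNIV :: 6 set) (UNIV :: (bool \<times> 3) set)"
    using finite_same_card_bij[of "UNIV :: 6 set" "UNIV :: (bool \<times> 3) set"] by auto
  define \<gamma> where "\<gamma> = inv_into UNIV \<beta>"
  have \<beta>\<gamma>: "\<beta> (\<gamma> p) = p" and \<gamma>\<beta>: "\<gamma> (\<beta> k) = k" for p k
    using \<beta> by (auto simp: \<gamma>_def bij_betw_def f_inv_into_f)
  define col where "col k = (if fst (\<beta> k) then a (snd (\<beta> k)) else b (snd (\<beta> k)))" for k
  define M :: "'a ^ 6 ^ 6" where "M = (\<chi> i k. col k $ i)"
  have colM: "column k M = col k" for k
    by (simp add: column_def M_def Finite_Cartesian_Product.vec_eq_iff)
  have "range a \<union> range b \<subseteq> columns M"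
  proof
    fix v assume "v \<in> range a \<union> range b"
    then obtain c j where "v = (if c then a j else b j)" by (metis Un_iff imageE)
    then have "v = column (\<gamma> (c, j)) M" by (simp add: colM col_def \<beta>\<gamma>)
    then show "v \<in> columns M" by (auto simp: columns_def)
  qed
  then have "vec.span (columns M) = UNIV" using spans vec.span_mono by blast
  then obtain N :: "'a ^ 6 ^ 6" where MN: "M ** N = Finite_Cartesian_Product.mat 1"
    using matrix_right_invertible_span_columns[of M] by blast
  then have NM: "N ** M = Finite_Cartesian_Product.mat 1" using matrix_left_right_inverse by blast
  define z where "z x y = (\<chi> k. if fst (\<beta> k) then x $ snd (\<beta> k) else y $ snd (\<beta> k))" for x y :: "'a ^ 3"
  have Mz: "M *v z x y = Av x + Bv y" for x y
  proof -
    let ?g = "\<lambda>c j. (if c then x $ j else y $ j) *s (if c then a j else b j)"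
    have "M *v z x y = (\<Sum>k\<in>UNIV. z x y $ k *s col k)"
      by (simp add: matrix_mult_sum colM)
    also have "\<dots> = (\<Sum>k\<in>UNIV. ?g (fst (\<beta> k)) (snd (\<beta> k)))"
      by (rule sum.cong) (auto simp: z_def col_def)
    also have "\<dots> = (\<Sum>p\<in>UNIV. ?g (fst p) (snd p))"
      by (rule sum.reindex_bij_betw[OF \<beta>])
    also have "\<dots> = (\<Sum>(c, j)\<in>UNIV \<times> UNIV. ?g c j)"
      by (simp only: UNIV_Times_UNIV case_prod_unfold)
    also have "\<dots> = (\<Sum>c\<in>UNIV. \<Sum>j\<in>UNIV. ?g c j)"
      by (rule sum.cartesian_product[symmetric])
    also have "\<dots> = Av x + Bv y"
      by (simp add: UNIV_bool Av_def Bv_def add.commute)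
    finally show ?thesis .
  qed
  define Nx :: "'a ^ 6 ^ 3" where "Nx = (\<chi> j. N $ \<gamma> (True, j))"
  define Ny :: "'a ^ 6 ^ 3" where "Ny = (\<chi> j. N $ \<gamma> (False, j))"
  have Nxy: "(Nx *v v) $ j = (N *v v) $ \<gamma> (True, j)" "(Ny *v v) $ j = (N *v v) $ \<gamma> (False, j)" for v j
    by (simp_all add: matrix_vector_mult_def Nx_def Ny_def)
  have Nz: "N *v (Av x + Bv y) = z x y" for x y
    unfolding Mz[symmetric] by (simp add: matrix_vector_mul_assoc NM)
  have 1: "Nx *v (Av x + Bv y) = x \<and> Ny *v (Av x + Bv y) = y" for x y
    by (simp add: Finite_Cartesian_Product.vec_eq_iff Nxy Nz) (simp add: z_def \<beta>\<gamma>)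
  have 2: "Av (Nx *v v) + Bv (Ny *v v) = v" for v
  proof -
    have "z (Nx *v v) (Ny *v v) = N *v v"
    proof (rule Finite_Cartesian_Product.vec_eq_iff[THEN iffD2], rule allI)
      fix k
      obtain c j where "\<beta> k = (c, j)" by force
      moreover have "\<gamma> (c, j) = k" using \<gamma>\<beta>[of k] calculation by simp
      ultimately show "z (Nx *v v) (Ny *v v) $ k = (N *v v) $ k"
        by (cases c) (simp_all add: z_def Nxy)
    qed
    then have "Av (Nx *v v) + Bv (Ny *v v) = M *v (N *v v)" by (simp flip: Mz)
    then show ?thesis by (simp add: matrix_vector_mul_assoc MN)
  qed
  show ?thesis by (rule exI[of _ "(Nx, Ny)"]) (use 1 2 in simp)
qed

definition NN :: "('a ^ 6 ^ 3) \<times> ('a ^ 6 ^ 3)" where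
  "NN = (SOME N. (\<forall>x y. fst N *v (Av x + Bv y) = x \<and> snd N *v (Av x + Bv y) = y) \<and>
    (\<forall>v. Av (fst N *v v) + Bv (snd N *v v) = v))"

definition NX :: "'a ^ 6 ^ 3" where "NX = fst NN"
definition NY :: "'a ^ 6 ^ 3" where "NY = snd NN"

lemma NX_AB: "NX *v (Av x + Bv y) = x" and NY_AB: "NY *v (Av x + Bv y) = y"
  and AB_N: "Av (NX *v v) + Bv (NY *v v) = v"
  using someI_ex[OF coords_ex] unfolding NX_def NY_def NN_def by auto

lemma Av_add: "Av (x + y) = Av x + Av y" and Av_scale: "Av (c *s x) = c *s Av x"
  and Bv_add: "Bv (x + y) = Bv x + Bv y" and Bv_scale: "Bv (c *s x) = c *s Bv x"
  and Av_0: "Av 0 = 0" and Bv_0: "Bv 0 = 0"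
  by (simp_all add: Av_def Bv_def vec.scale_left_distrib sum.distrib vec.scale_sum_right)

lemma P_AB: "P s t x = Av (s *s x) + Bv (t *s x)"
  by (simp add: P_def Av_scale Bv_scale)

lemma NX_P: "NX *v P s t x = s *s x" and NY_P: "NY *v P s t x = t *s x"
  by (simp_all add: P_AB NX_AB NY_AB)

lemma P_add: "P s t (x + y) = P s t x + P s t y"
  by (simp add: P_def Av_add Bv_add vec.scale_right_distrib)

lemma P_scale: "P s t (c *s x) = c *s P s t x"
  by (simp add: P_def Av_scale Bv_scale vec.scale_right_distrib mult.commute)

lemma P_scale_st: "P (c * s) (c * t) x = c *s P s t x"
  by (simp add: P_def vec.scale_right_distrib)

lemma P_0 [simp]: "P s t 0 = 0" "P 0 0 x = 0"
  by (simp_all add: P_def Av_0 Bv_0)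

lemma P_eq_0_iff: "P s t x = 0 \<longleftrightarrow> (s = 0 \<and> t = 0) \<or> x = 0"
proof
  assume "P s t x = 0"
  then have "s *s x = 0" "t *s x = 0" using NX_P[of s t x] NY_P[of s t x] by simp_all
  then show "(s = 0 \<and> t = 0) \<or> x = 0" by auto
qed auto

text \<open>Injectivity of the Segre embedding: the coordinates of the point are the products of s,
  t with the entries of x, so they determine (s, t) and x up to separate scalars. The scalar
  \<open>c\<close> is read off at an entry where x does not vanish.\<close>

lemma P_span_eqE:
  assumes "vec.span {P s t x} = vec.span {P s' t' x'}" "P s t x \<noteq> 0"
  obtains c e where "c \<noteq> 0" "e \<noteq> 0" "s' = c * s" "t' = c * t" "x' = e *s x"
proof -
  obtain k where k: "k \<noteq> 0" "P s t x = k *s P s' t' x'" using assms by (rule span_eqE)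
  then have P': "P s' t' x' \<noteq> 0" using assms by auto
  have "NX *v P s t x = k *s (NX *v P s' t' x')" "NY *v P s t x = k *s (NY *v P s' t' x')"
    unfolding k(2) by (simp_all only: vector_scalar_commute)
  then have eq: "s *s x = (k * s') *s x'" "t *s x = (k * t') *s x'" by (simp_all add: NX_P NY_P)
  have nz: "x \<noteq> 0" "x' \<noteq> 0" "s \<noteq> 0 \<or> t \<noteq> 0" "s' \<noteq> 0 \<or> t' \<noteq> 0"
    using assms P' by (auto simp: P_eq_0_iff)
  obtain j where j: "x $ j \<noteq> 0" using nz by (auto simp: Finite_Cartesian_Product.vec_eq_iff)
  have eqj: "s * x $ j = k * s' * x' $ j" "t * x $ j = k * t' * x' $ j"
    using eq by (auto simp: Finite_Cartesian_Product.vec_eq_iff)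
  have j': "x' $ j \<noteq> 0" using eqj j nz by auto
  define c where "c = x $ j / (k * x' $ j)"
  have c: "c \<noteq> 0" "s' = c * s" "t' = c * t"
    using eqj j j' k by (auto simp: c_def field_simps)
  define e where "e = 1 / (k * c)"
  have "x' = e *s x"
  proof (rule Finite_Cartesian_Product.vec_eq_iff[THEN iffD2], rule allI)
    fix i
    have "s * x $ i = k * s' * x' $ i" "t * x $ i = k * t' * x' $ i"
      using eq by (auto simp: Finite_Cartesian_Product.vec_eq_iff)
    then have "s * x $ i = s * (k * c * x' $ i)" "t * x $ i = t * (k * c * x' $ i)"
      by (simp_all add: c(2,3) algebra_simps)
    then have "x $ i = k * c * x' $ i" using nz by auto
    then show "x' $ i = (e *s x) $ i" using c k by (simp add: e_def field_simps)
  qed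
  moreover have "e \<noteq> 0" using c k by (simp add: e_def)
  ultimately show thesis using c that by blast
qed

text \<open>Nonvanishing of \<open>P s t x\<close> excludes (s, t) = (0, 0) and x = 0, where the
  parametrization defines no point. The scroll itself is \<open>V 0\<close>.\<close>

definition V :: "'a bipoly \<Rightarrow> ('a ^ 6) set set" where
  "V G = {vec.span {P s t x} | s t x. P s t x \<noteq> 0 \<and> ev G (bp s t x) = 0}"

lemma V_I: "P s t x \<noteq> 0 \<Longrightarrow> ev G (bp s t x) = 0 \<Longrightarrow> vec.span {P s t x} \<in> V G"
  by (auto simp: V_def)

lemma V_iff:
  assumes "bih m n G" "P s t x \<noteq> 0"
  shows "vec.span {P s t x} \<in> V G \<longleftrightarrow> ev G (bp s t x) = 0"
proof
  assume "vec.span {P s t x} \<in> V G"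
  then obtain s' t' x' where *: "vec.span {P s t x} = vec.span {P s' t' x'}" "ev G (bp s' t' x') = 0"
    by (auto simp: V_def)
  obtain c e where "c \<noteq> 0" "e \<noteq> 0" "s' = c * s" "t' = c * t" "x' = e *s x"
    using *(1) assms(2) by (rule P_span_eqE)
  with * show "ev G (bp s t x) = 0" by (simp add: ev_bih_scale[OF assms(1)])
qed (rule V_I[OF assms(2)])

lemma ruling_plane_eq:
  assumes "(s, t) \<noteq> (0, 0)"
  shows "ruling_plane a b s t = {vec.span {P s t x} | x. x \<noteq> 0}"
proof -
  let ?S = "range (\<lambda>i. s *s a i + t *s b i)"
  have P_sum: "P s t x = (\<Sum>j\<in>UNIV. x $ j *s (s *s a j + t *s b j))" for x
    by (simp add: P_def Av_def Bv_def vec.scale_sum_right vec.scale_right_distrib sum.distrib mult.commute)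
  have "vec.span ?S = range (P s t)"
  proof (rule antisym)
    show "vec.span ?S \<subseteq> range (P s t)"
    proof (rule vec.span_minimal)
      show "vec.subspace (range (P s t))"
        unfolding vec.subspace_def
        by (auto simp: P_add[symmetric] P_scale[symmetric] intro: range_eqI[of _ _ 0])
      show "?S \<subseteq> range (P s t)"
      proof
        fix v assume "v \<in> ?S"
        then obtain i where v: "v = s *s a i + t *s b i" by auto
        have "P s t (axis i 1) = (\<Sum>j\<in>UNIV. if j = i then s *s a i + t *s b i else 0)"
          unfolding P_sum by (rule sum.cong) (auto simp: axis_def)
        then have "P s t (axis i 1) = v" by (simp add: v)
        then show "v \<in> range (P s t)" by (metis rangeI)
      qed
    qed
    show "range (P s t) \<subseteq> vec.span ?S"
    proof
      fix v assume "v \<in> range (P s t)"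
      then obtain x where "v = P s t x" by blast
      then show "v \<in> vec.span ?S"
        by (simp only: P_sum) (rule vec.span_sum, rule vec.span_scale, rule vec.span_base, rule rangeI)
    qed
  qed
  then have "ruling_plane a b s t = points (range (P s t))" by (simp add: ruling_plane_def)
  also have "\<dots> = {vec.span {P s t x} | x. x \<noteq> 0}"
  proof (intro equalityI subsetI)
    fix p assume "p \<in> points (range (P s t))"
    then have p: "p \<in> proj_space" "p \<subseteq> range (P s t)" by (auto simp: points_def)
    obtain v where v: "v \<noteq> 0" "p = vec.span {v}" using p(1) by (rule proj_spaceE)
    then have "v \<in> range (P s t)" using p(2) vec.span_base by blast
    then obtain x where "v = P s t x" by auto
    with v show "p \<in> {vec.span {P s t x} | x. x \<noteq> 0}" using P_0(1)[of s t] by blast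
  next
    fix p assume "p \<in> {vec.span {P s t x} | x. x \<noteq> 0}"
    then obtain x where x: "p = vec.span {P s t x}" "x \<noteq> 0" by auto
    then have "P s t x \<noteq> 0" using assms by (simp add: P_eq_0_iff)
    moreover have "vec.span {P s t x} \<subseteq> range (P s t)"
      by (auto simp: vec.span_singleton P_scale[symmetric])
    ultimately show "p \<in> points (range (P s t))" by (simp add: points_def x span_singleton_proj)
  qed
  finally show ?thesis .
qed

lemma scroll_eq_V: "(\<Union>(s, t)\<in>{(s, t). (s, t) \<noteq> (0, 0)}. ruling_plane a b s t) = V 0"
proof -
  have "(\<Union>(s, t)\<in>{(s, t). (s, t) \<noteq> (0, 0)}. ruling_plane a b s t) =
     (\<Union>(s, t)\<in>{(s, t). (s, t) \<noteq> (0, 0)}. {vec.span {P s t x} | x. x \<noteq> 0})"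
    by (intro SUP_cong refl) (auto simp: ruling_plane_eq)
  also have "\<dots> = V 0"
    by (fastforce simp: V_def P_eq_0_iff)
  finally show ?thesis .
qed

section \<open>Pulling forms back to P^1 x P^2\<close>

definition Yv :: "6 \<Rightarrow> 'a bipoly" where
  "Yv i = (\<Sum>j\<in>UNIV. (mp_const (a j $ i) * mp_var vS + mp_const (b j $ i) * mp_var vT) * mp_var (vX j))"

definition Phi :: "(6, 'a) mpoly \<Rightarrow> 'a bipoly" where
  "Phi = mp_eval mp_const Yv"

lemma Phi_hom: "comm_ring_hom Phi"
  unfolding Phi_def by (rule mp_eval_hom[OF mp_const_hom])

lemma Phi_simps [simp]: "Phi (F + G) = Phi F + Phi G" "Phi (F * G) = Phi F * Phi G" "Phi (F - G) = Phi F - Phi G"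
  "Phi 0 = 0" "Phi 1 = 1" "Phi (F ^ n) = Phi F ^ n" "Phi (sum f I) = (\<Sum>k\<in>I. Phi (f k))" "Phi (mp_const c) = mp_const c"
proof -
  interpret comm_ring_hom Phi by (rule Phi_hom)
  show "Phi (F + G) = Phi F + Phi G" "Phi (F * G) = Phi F * Phi G" "Phi (F - G) = Phi F - Phi G"
    "Phi 0 = 0" "Phi 1 = 1" "Phi (F ^ n) = Phi F ^ n" "Phi (sum f I) = (\<Sum>k\<in>I. Phi (f k))"
    by (simp_all add: hom_add hom_mult hom_minus hom_power hom_sum hom_one)
  show "Phi (mp_const c) = mp_const c" unfolding Phi_def by (rule mp_eval_const[OF mp_const_hom])
qed

lemma ev_Yv: "ev (Yv i) (bp s t x) = P s t x $ i"
  by (simp add: Yv_def P_def Av_def Bv_def sum_distrib_left distrib_right distrib_left sum.distrib algebra_simps)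

lemma ev_Phi: "ev (Phi F) (bp s t x) = mp_value F (P s t x)"
  unfolding Phi_def ev_subst ev_Yv mp_value_ev ..

lemma bih_Phi: "F \<in> forms n \<Longrightarrow> bih n n (Phi F)"
proof -
  assume F: "F \<in> forms n"
  have Y: "bih 1 1 (Yv i)" for i
    unfolding Yv_def
  proof (rule bih_sum)
    fix j :: 3
    have "bih 1 0 (mp_const (a j $ i) * mp_var vS + mp_const (b j $ i) * mp_var vT)"
      by (intro bih_add bih_cmult bih_var)
    from bih_mult[OF this bih_var(3)[of j]]
    show "bih 1 1 ((mp_const (a j $ i) * mp_var vS + mp_const (b j $ i) * mp_var vT) * mp_var (vX j))" by simp
  qed
  show ?thesis
    using whom_mp_eval[OF F, of wS 1 Yv] whom_mp_eval[OF F, of wX 1 Yv] Y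
    by (simp add: bih_def Phi_def)
qed

definition zS :: "3 \<Rightarrow> (6, 'a) mpoly" where "zS j = (\<Sum>i\<in>UNIV. mp_const (NX $ j $ i) * mp_var i)"
definition zT :: "3 \<Rightarrow> (6, 'a) mpoly" where "zT j = (\<Sum>i\<in>UNIV. mp_const (NY $ j $ i) * mp_var i)"

lemma z_forms: "zS j \<in> forms 1" "zT j \<in> forms 1"
  unfolding zS_def zT_def by (rule linear_form)+

lemma mp_value_z: "mp_value (zS j) v = (NX *v v) $ j" "mp_value (zT j) v = (NY *v v) $ j"
  by (simp_all add: zS_def zT_def matrix_vector_mult_def)

lemma Phi_z: "Phi (zS j) = mp_var vS * mp_var (vX j)" "Phi (zT j) = mp_var vT * mp_var (vX j)"
  by (rule bipoly_eqI, simp add: ev_Phi mp_value_z NX_P NY_P)+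

text \<open>A monomial of bidegree (n + 1, n + 1) contains one of s, t and some x_j, and their
  product is the pullback of the linear form \<open>zS j\<close> or \<open>zT j\<close>; the rest is
  covered by induction.\<close>

lemma Phi_surj_monomial:
  "wdeg wS m = n \<Longrightarrow> wdeg wX m = n \<Longrightarrow> \<exists>F\<in>forms n. Phi F = Poly_Mapping.single m 1"
proof (induction n arbitrary: m)
  case 0
  have "bih 0 0 (Poly_Mapping.single m (1 :: 'a))" using 0 by (simp add: bih_def whom_single)
  then obtain c where c: "Poly_Mapping.single m (1 :: 'a) = mp_const c" by (rule bih_00_const)
  have "mp_const c \<in> forms 0" by (simp add: forms_whom whom_const)
  with c show ?case by (intro bexI[of _ "mp_const c"]) auto
next
  case (Suc n)
  have wdeg_add: "wdeg w (m1 + m2) = wdeg w m1 + wdeg w m2" for w and m1 m2 :: "bvar \<Rightarrow>\<^sub>0 nat"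
    by (simp add: wdeg_def lookup_add distrib_left sum.distrib)
  have wdeg_single: "wdeg w (Poly_Mapping.single v 1) = w v" for w and v :: bvar
  proof -
    have "wdeg w (Poly_Mapping.single v 1) = (\<Sum>i\<in>UNIV. if i = v then w v else 0)"
      unfolding wdeg_def by (rule sum.cong) (auto simp: lookup_single when_def)
    then show ?thesis by simp
  qed
  have "Poly_Mapping.lookup m vS + Poly_Mapping.lookup m vT = Suc n"
    using Suc.prems(1) unfolding wdeg_def sum_bvar w_simps by simp
  then obtain v where v: "v = vS \<or> v = vT" "Poly_Mapping.lookup m v > 0" by (metis add_is_0 gr0I nat.distinct(1))
  have "(\<Sum>j\<in>UNIV. Poly_Mapping.lookup m (vX j)) = Suc n"
    using Suc.prems(2) unfolding wdeg_def sum_bvar w_simps by simp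
  then obtain j where j: "Poly_Mapping.lookup m (vX j) > 0" by (metis gr0I nat.distinct(1) sum.neutral)
  define m0 where "m0 = Poly_Mapping.single v 1 + Poly_Mapping.single (vX j) (1 :: nat)"
  define m' where "m' = m - m0"
  have le: "Poly_Mapping.lookup m0 i \<le> Poly_Mapping.lookup m i" for i
    using v j by (auto simp: m0_def lookup_add lookup_single when_def)
  have m: "m = m' + m0"
    by (rule poly_mapping_eqI) (use le in \<open>simp add: m'_def lookup_add lookup_minus\<close>)
  have d0: "wdeg wS m0 = 1" "wdeg wX m0 = 1"
    unfolding m0_def wdeg_add wdeg_single using v by auto
  have "wdeg wS m' = n" "wdeg wX m' = n"
    using Suc.prems d0 unfolding m wdeg_add by auto
  then obtain F where F: "F \<in> forms n" "Phi F = Poly_Mapping.single m' 1" using Suc.IH by blast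
  define z where "z = (if v = vS then zS j else zT j)"
  have z: "z \<in> forms 1" "Phi z = Poly_Mapping.single m0 1"
    using v by (auto simp: z_def z_forms z_forms[simplified] Phi_z m0_def mp_var_def mult_single)
  have "F * z \<in> forms (n + 1)" using F z by (intro forms_mult)
  moreover have "Phi (F * z) = Poly_Mapping.single m 1" using F z by (simp add: m mult_single)
  ultimately show ?case by (intro bexI[of _ "F * z"]) simp_all
qed

lemma Phi_surj:
  assumes "bih n n G"
  obtains F where "F \<in> forms n" "Phi F = G"
proof -
  have "\<forall>m\<in>Poly_Mapping.keys G. \<exists>F. F \<in> forms n \<and> Phi F = Poly_Mapping.single m 1"
    using assms Phi_surj_monomial unfolding bih_def whom_def by blast
  then obtain g where g: "\<And>m. m \<in> Poly_Mapping.keys G \<Longrightarrow> g m \<in> forms n"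
    "\<And>m. m \<in> Poly_Mapping.keys G \<Longrightarrow> Phi (g m) = Poly_Mapping.single m 1"
    by metis
  define F where "F = (\<Sum>m\<in>Poly_Mapping.keys G. mp_const (Poly_Mapping.lookup G m) * g m)"
  have "F \<in> forms n"
    unfolding F_def forms_whom mem_Collect_eq
  proof (rule whom_sum)
    fix m assume "m \<in> Poly_Mapping.keys G"
    then have "whom (\<lambda>_. 1) n (g m)" using g(1) by (simp add: forms_whom)
    from whom_mult[OF whom_const this] show "whom (\<lambda>_. 1) n (mp_const (Poly_Mapping.lookup G m) * g m)" by simp
  qed
  moreover have "Phi F = (\<Sum>m\<in>Poly_Mapping.keys G. Poly_Mapping.single m (Poly_Mapping.lookup G m))"
    unfolding F_def Phi_simps by (rule sum.cong) (simp_all add: g mp_const_def mult_single)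
  ultimately show thesis using that mpoly_sum_monomials[of G] by metis
qed

lemma vanishes_V:
  assumes "homogeneous F"
  shows "vanishes F (V G) \<longleftrightarrow> (\<forall>s t x. P s t x \<noteq> 0 \<longrightarrow> ev G (bp s t x) = 0 \<longrightarrow> ev (Phi F) (bp s t x) = 0)"
  unfolding vanishes_def V_def ev_Phi
  using homogeneous_vanishes_point[OF assms] by fastforce

lemma in_scroll: "v = P s t x \<longleftrightarrow> NX *v v = s *s x \<and> NY *v v = t *s x"
  by (metis NX_P NY_P AB_N P_AB)

text \<open>The hypothesis says that the 2 x 3 matrix with rows \<open>NX *v v\<close> and
  \<open>NY *v v\<close> has rank at most 1. Its minors are the quadrics that cut out the
  scroll.\<close>

lemma scroll_point:
  assumes "\<And>j k. (NX *v v) $ j * (NY *v v) $ k = (NX *v v) $ k * (NY *v v) $ j"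
  obtains s t x where "v = P s t x"
proof (cases "NX *v v = 0")
  case True
  then have "v = P 0 1 (NY *v v)" by (simp add: in_scroll)
  then show thesis by (rule that)
next
  case False
  then obtain j where j: "(NX *v v) $ j \<noteq> 0" by (auto simp: Finite_Cartesian_Product.vec_eq_iff)
  have "NY *v v = ((NY *v v) $ j / (NX *v v) $ j) *s (NX *v v)"
    using assms[of j] j by (simp add: Finite_Cartesian_Product.vec_eq_iff field_simps)
  then have "v = P 1 ((NY *v v) $ j / (NX *v v) $ j) (NX *v v)" by (simp add: in_scroll)
  then show thesis by (rule that)
qed

text \<open>The equations are the forms whose pullback is divisible by \<open>G\<close>. Those with
  pullback 0 already force a point onto the scroll; there the vanishing of \<open>G\<close> has to
  be recovered although \<open>G\<close> may have unequal degrees.\<close>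

lemma V_closed:
  assumes G: "bih m n G"
  shows "closedin zariski (V G)"
proof -
  define S where "S = {F. homogeneous F \<and> G dvd Phi F}"
  have "closedin zariski {p \<in> proj_space. \<forall>F\<in>S. \<forall>v\<in>p. mp_value F v = 0}"
    by (rule closedin_zariski_zeros) (auto simp: S_def)
  moreover have "{p \<in> proj_space. \<forall>F\<in>S. \<forall>v\<in>p. mp_value F v = 0} = V G"
  proof (intro equalityI subsetI)
    fix p assume "p \<in> V G"
    then obtain s t x where p: "p = vec.span {P s t x}" "P s t x \<noteq> 0" "ev G (bp s t x) = 0"
      by (auto simp: V_def)
    have "\<forall>v\<in>p. mp_value F v = 0" if "F \<in> S" for F
    proof -
      have F: "homogeneous F" "G dvd Phi F" using that by (auto simp: S_def)
      obtain H where "Phi F = G * H" using F(2) by (rule dvdE)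
      then have "ev (Phi F) (bp s t x) = 0" by (simp add: p)
      then show ?thesis unfolding p using homogeneous_vanishes_point[OF F(1)] by (simp add: ev_Phi)
    qed
    then show "p \<in> {p \<in> proj_space. \<forall>F\<in>S. \<forall>v\<in>p. mp_value F v = 0}"
      using p by (simp add: span_singleton_proj)
  next
    fix p assume p: "p \<in> {p \<in> proj_space. \<forall>F\<in>S. \<forall>v\<in>p. mp_value F v = 0}"
    then have "p \<in> proj_space" by simp
    then obtain v where v: "v \<noteq> 0" "p = vec.span {v}" by (rule proj_spaceE)
    have S: "mp_value F v = 0" if "F \<in> forms k" "G dvd Phi F" for F k
      using p that v vec.span_base[of v "{v}"] by (auto simp: S_def homogeneous_def)
    have "(NX *v v) $ j * (NY *v v) $ k = (NX *v v) $ k * (NY *v v) $ j" for j k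
    proof -
      have "whom (\<lambda>_. 1) (1 + 1) (zS j * zT k - zS k * zT j)"
        using z_forms unfolding forms_whom by (intro whom_diff whom_mult) auto
      then have "zS j * zT k - zS k * zT j \<in> forms 2" by (simp add: forms_whom numeral_2_eq_2)
      moreover have "Phi (zS j * zT k - zS k * zT j) = 0" by (simp add: Phi_z)
      ultimately have "mp_value (zS j * zT k - zS k * zT j) v = 0" by (intro S) auto
      then show ?thesis by (simp add: mp_value_z)
    qed
    then obtain s t x where P: "v = P s t x" by (rule scroll_point)
    have nz: "x \<noteq> 0" "s \<noteq> 0 \<or> t \<noteq> 0" using v P by (auto simp: P_eq_0_iff)
    obtain j where j: "x $ j \<noteq> 0" using nz by (auto simp: Finite_Cartesian_Product.vec_eq_iff)
    \<comment> \<open>With truncated subtraction one exponent is 0 and the other is the gap between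
      the two degrees, so \<open>G * h\<close> lifts to P^5. The variables are chosen nonzero at the
      point, so vanishing of \<open>G * h\<close> there means vanishing of \<open>G\<close>.\<close>
    define h :: "'a bipoly" where "h = mp_var (vX j) ^ (m - n) * (if s \<noteq> 0 then mp_var vS else mp_var vT) ^ (n - m)"
    have "bih (0 * (m - n) + 1 * (n - m)) (1 * (m - n) + 0 * (n - m)) h"
      unfolding h_def by (intro bih_mult bih_power) (auto simp: bih_var bih_var[unfolded One_nat_def])
    then have "bih (max m n) (max m n) (G * h)"
      using bih_mult[OF G, of "n - m" "m - n" h] by (cases "m \<le> n") (simp_all add: max_def)
    then obtain F where F: "F \<in> forms (max m n)" "Phi F = G * h" by (rule Phi_surj)
    have "mp_value F v = 0" by (rule S[OF F(1)]) (simp add: F)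
    then have "ev G (bp s t x) * ev h (bp s t x) = 0"
      using ev_Phi[of s t x F] F(2) P by simp
    moreover have "ev h (bp s t x) \<noteq> 0" using j nz by (auto simp: h_def)
    ultimately have "ev G (bp s t x) = 0" by simp
    then show "p \<in> V G" using v P by (auto intro: V_I)
  qed
  ultimately show ?thesis by simp
qed

text \<open>The case \<open>p = 0\<close> describes the scroll, the case of a prime \<open>p\<close>
  its divisors, so one statement yields both vanishing ideals.\<close>

lemma V_dvd:
  assumes p: "prime_elem p \<or> p = 0" and ne: "V p \<noteq> {}" and F: "F \<in> forms k" "vanishes F (V p)"
  shows "p dvd Phi F"
proof -
  have hF: "homogeneous F" using F by (auto simp: homogeneous_def)
  \<comment> \<open>The Nullstellensatz speaks about all of affine space, including parameters with
    \<open>P s t x = 0\<close>. There the claim is that \<open>F\<close> vanishes at 0, which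
    follows from homogeneity and a single genuine zero of \<open>F\<close>.\<close>
  have van: "ev (Phi F) (bp s t x) = 0" if "ev p (bp s t x) = 0" for s t x
  proof (cases "P s t x = 0")
    case True
    obtain s' t' x' where "P s' t' x' \<noteq> 0" "ev p (bp s' t' x') = 0" using ne by (auto simp: V_def)
    then have "mp_value F (P s' t' x') = 0" using F(2) vanishes_V[OF hF] by (simp add: ev_Phi)
    then show ?thesis using forms_vanish_0[OF F(1)] by (simp add: ev_Phi True)
  qed (use that F(2) vanishes_V[OF hF] in auto)
  show ?thesis
  proof (cases "p = 0")
    case True
    then have "Phi F = 0" by (intro bipoly_eqI) (simp add: van)
    then show ?thesis by simp
  next
    case False
    then have "prime_elem p" using p by simp
    then show ?thesis
      by (rule bipoly_nullstellensatz) (metis bp_surj van)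
  qed
qed

lemma dvd_V: "homogeneous F \<Longrightarrow> p dvd Phi F \<Longrightarrow> vanishes F (V p)"
  unfolding vanishes_V by (auto elim!: dvdE)

lemma V_irreducible:
  assumes p: "prime_elem p \<or> p = 0" and ne: "V p \<noteq> {}" and "bih m n p"
  shows "irreducible_closed zariski (V p)"
proof (rule irreducible_closedI[OF V_closed[OF assms(3)] ne])
  fix F G :: "(6, 'a) mpoly" assume FG: "homogeneous F" "homogeneous G" "vanishes (F * G) (V p)"
  obtain k where "F * G \<in> forms k" using homogeneous_mult[OF FG(1,2)] by (auto simp: homogeneous_def)
  then have "p dvd Phi F * Phi G" using V_dvd[OF p ne _ FG(3)] by simp
  then have "p dvd Phi F \<or> p dvd Phi G" using p prime_elem_dvd_multD by fastforce
  then show "vanishes F (V p) \<or> vanishes G (V p)" using dvd_V FG by blast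
qed

lemma V_nonempty:
  assumes "bih m n p" "\<not> p dvd 1"
  shows "V p \<noteq> {}"
proof -
  consider "n \<ge> 1" | "n = 0" "m \<ge> 1" | "n = 0" "m = 0" by linarith
  then show ?thesis
  proof cases
    case 1
    obtain x where "x \<noteq> 0" "ev p (bp 1 0 x) = 0"
      by (rule bih_zero_X[OF assms(1) 1, of 1 2 1 0]) auto
    then have "vec.span {P 1 0 x} \<in> V p" by (intro V_I) (auto simp: P_eq_0_iff)
    then show ?thesis by blast
  next
    case 2
    obtain s t where "(s, t) \<noteq> (0, 0)" "ev p (bp s t (axis 1 1)) = 0"
      by (rule bih_zero_S[OF assms(1) 2(2), of "axis 1 1"])
    then have "vec.span {P s t (axis 1 1)} \<in> V p" by (intro V_I) (auto simp: P_eq_0_iff)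
    then show ?thesis by blast
  next
    case 3
    then have "p = 0" using assms bih_00_unit by auto
    moreover have "P 1 0 (axis 1 1) \<noteq> 0" by (auto simp: P_eq_0_iff)
    ultimately have "vec.span {P 1 0 (axis 1 1)} \<in> V p" by (intro V_I) auto
    then show ?thesis by blast
  qed
qed

lemma V_eq_scroll:
  assumes "bih m n G" "V G = V 0"
  shows "G = 0"
proof -
  \<comment> \<open>The extra factor vanishes wherever the parameters define no point, where the
    hypothesis gives no information on \<open>G\<close>.\<close>
  have "mp_var vS * mp_var (vX 1) * G = 0"
  proof (rule bipoly_eqI)
    fix s t :: 'a and x :: "'a ^ 3"
    show "ev (mp_var vS * mp_var (vX 1) * G) (bp s t x) = ev 0 (bp s t x)"
    proof (cases "s = 0 \<or> x $ 1 = 0")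
      case False
      then have nz: "P s t x \<noteq> 0" by (auto simp: P_eq_0_iff)
      then have "vec.span {P s t x} \<in> V G" unfolding assms(2) by (intro V_I) auto
      then show ?thesis using V_iff[OF assms(1) nz] by simp
    qed auto
  qed
  then show ?thesis by (simp add: mp_var_nonzero)
qed

lemma V_sub_scroll: "V G \<subseteq> V 0"
  by (auto simp: V_def)

lemma V_mult: "V (F * G) \<subseteq> V F \<union> V G"
proof
  fix p assume "p \<in> V (F * G)"
  then obtain s t x where p: "p = vec.span {P s t x}" "P s t x \<noteq> 0" "ev F (bp s t x) = 0 \<or> ev G (bp s t x) = 0"
    unfolding V_def by auto
  from p(3) show "p \<in> V F \<union> V G" unfolding p(1) using V_I[OF p(2)] by blast
qed

section \<open>Curves in ruling planes, and dimensions of divisors on the scroll\<close>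

definition fibre_curve :: "'a \<Rightarrow> 'a \<Rightarrow> 'a bipoly \<Rightarrow> ('a ^ 6) set set" where
  "fibre_curve s0 t0 q = {vec.span {P s0 t0 x} | x. x \<noteq> 0 \<and> ev q (bp s0 t0 x) = 0}"

lemma fibre_curve_V:
  assumes st: "(s0, t0) \<noteq> (0, 0)" and q: "bih 0 k q"
  shows "fibre_curve s0 t0 q = V q \<inter> V (mp_const t0 * mp_var vS - mp_const s0 * mp_var vT)"
proof (intro equalityI subsetI)
  fix p assume "p \<in> fibre_curve s0 t0 q"
  then obtain x where x: "p = vec.span {P s0 t0 x}" "x \<noteq> 0" "ev q (bp s0 t0 x) = 0"
    by (auto simp: fibre_curve_def)
  then have "P s0 t0 x \<noteq> 0" using st by (auto simp: P_eq_0_iff)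
  with x show "p \<in> V q \<inter> V (mp_const t0 * mp_var vS - mp_const s0 * mp_var vT)"
    by (auto intro!: V_I)
next
  fix p assume p: "p \<in> V q \<inter> V (mp_const t0 * mp_var vS - mp_const s0 * mp_var vT)"
  then obtain s t x where P: "p = vec.span {P s t x}" "P s t x \<noteq> 0" "ev q (bp s t x) = 0"
    by (auto simp: V_def)
  have "ev (mp_const t0 * mp_var vS - mp_const s0 * mp_var vT) (bp s t x) = 0"
    using p V_iff[OF bih_linear_st P(2)] P(1) by auto
  then have eq: "t0 * s = s0 * t" by simp
  define c where "c = (if s0 \<noteq> 0 then s / s0 else t / t0)"
  have c: "s = c * s0" "t = c * t0" using eq st by (auto simp: c_def field_simps)
  then have "c \<noteq> 0" using P by (auto simp: P_eq_0_iff)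
  then have "p = vec.span {P s0 t0 x}" using P by (simp add: c P_scale_st span_scale)
  moreover have "x \<noteq> 0" using P by auto
  moreover have "ev q (bp s0 t0 x) = 0" using P(3) ev_bih_S0[OF q] by metis
  ultimately show "p \<in> fibre_curve s0 t0 q" by (auto simp: fibre_curve_def)
qed

definition sub_st :: "'a \<Rightarrow> 'a \<Rightarrow> 'a bipoly \<Rightarrow> 'a bipoly" where
  "sub_st s0 t0 = mp_eval mp_const (\<lambda>v. case v of None \<Rightarrow> mp_const s0 | Some None \<Rightarrow> mp_const t0 | Some (Some j) \<Rightarrow> mp_var (vX j))"

lemma ev_sub_st: "ev (sub_st s0 t0 G) (bp s t x) = ev G (bp s0 t0 x)"
  unfolding sub_st_def ev_subst
  by (rule arg_cong2[where f = "\<lambda>p q. mp_eval (\<lambda>c. c) p q"]) (auto simp: fun_eq_iff bp_def split: option.split)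

lemma sub_st_mult: "sub_st s0 t0 (F * G) = sub_st s0 t0 F * sub_st s0 t0 G"
  unfolding sub_st_def by (rule mp_eval_mult[OF mp_const_hom])

lemma bih_sub_st:
  assumes "bih m n G"
  shows "bih 0 n (sub_st s0 t0 G)"
proof -
  have "whom (\<lambda>_. 0) 0 G" by (simp add: whom_def wdeg_def)
  then have "whom wS 0 (sub_st s0 t0 G)"
    unfolding sub_st_def by (rule whom_subst) (auto simp: whom_const whom_var split: option.split)
  moreover have "whom wX n G" using assms by (simp add: bih_def)
  then have "whom wX n (sub_st s0 t0 G)"
    unfolding sub_st_def by (rule whom_subst) (auto simp: wX_def whom_const whom_var split: option.split)
  ultimately show ?thesis by (simp add: bih_def)
qed

lemma fibre_curve_irreducible:
  assumes st: "(s0, t0) \<noteq> (0, 0)" and q: "bih 0 k q" "k \<ge> 1" "prime_elem q"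
  shows "irreducible_closed zariski (fibre_curve s0 t0 q)"
proof (rule irreducible_closedI)
  show "closedin zariski (fibre_curve s0 t0 q)"
    unfolding fibre_curve_V[OF st q(1)] using V_closed[OF q(1)] V_closed[OF bih_linear_st] by (rule closedin_Int)
  obtain x0 where x0: "x0 \<noteq> 0" "ev q (bp s0 t0 x0) = 0"
    by (rule bih_zero_X[OF q(1,2), of 1 2 s0 t0]) auto
  then show "fibre_curve s0 t0 q \<noteq> {}" by (auto simp: fibre_curve_def)
  have iff: "vanishes F (fibre_curve s0 t0 q) \<longleftrightarrow> q dvd sub_st s0 t0 (Phi F)" if F: "homogeneous F" for F
  proof -
    obtain l where l: "F \<in> forms l" using F by (auto simp: homogeneous_def)
    have van: "vanishes F (fibre_curve s0 t0 q) \<longleftrightarrow> (\<forall>x. x \<noteq> 0 \<longrightarrow> ev q (bp s0 t0 x) = 0 \<longrightarrow> mp_value F (P s0 t0 x) = 0)"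
      unfolding vanishes_def fibre_curve_def using homogeneous_vanishes_point[OF F] by fastforce
    show ?thesis
    proof
      assume "vanishes F (fibre_curve s0 t0 q)"
      then have v: "mp_value F (P s0 t0 x) = 0" if "x \<noteq> 0" "ev q (bp s0 t0 x) = 0" for x
        using that van by blast
      have v0: "mp_value F (P s0 t0 x) = 0" if "ev q (bp s0 t0 x) = 0" for x
        using v[of x] that forms_vanish_0[OF l v[OF x0]] by (cases "x = 0") auto
      show "q dvd sub_st s0 t0 (Phi F)"
      proof (rule bipoly_nullstellensatz[OF q(3)])
        fix p assume "ev q p = 0"
        then have "ev q (bp s0 t0 (\<chi> j. p (vX j))) = 0"
          using bp_surj[of p] ev_bih_S0[OF q(1)] by metis
        then have "ev (sub_st s0 t0 (Phi F)) (bp (p vS) (p vT) (\<chi> j. p (vX j))) = 0"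
          by (simp add: ev_sub_st ev_Phi v0)
        then show "ev (sub_st s0 t0 (Phi F)) p = 0" by (simp flip: bp_surj)
      qed
    next
      assume "q dvd sub_st s0 t0 (Phi F)"
      then obtain H where H: "sub_st s0 t0 (Phi F) = q * H" by (rule dvdE)
      have "mp_value F (P s0 t0 x) = 0" if "ev q (bp s0 t0 x) = 0" for x
        using arg_cong[OF H, of "\<lambda>F. ev F (bp s0 t0 x)"] that by (simp add: ev_sub_st ev_Phi)
      then show "vanishes F (fibre_curve s0 t0 q)" using van by blast
    qed
  qed
  fix F G :: "(6, 'a) mpoly" assume FG: "homogeneous F" "homogeneous G" "vanishes (F * G) (fibre_curve s0 t0 q)"
  then have "q dvd sub_st s0 t0 (Phi F) * sub_st s0 t0 (Phi G)"
    using iff[OF homogeneous_mult] by (simp add: sub_st_mult)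
  then show "vanishes F (fibre_curve s0 t0 q) \<or> vanishes G (fibre_curve s0 t0 q)"
    using prime_elem_dvd_multD[OF q(3)] iff FG by blast
qed

text \<open>A point of the curve is properly contained in it because a second point exists: the
  curve has a zero on the coordinate line x_3 = 0, and another coordinate line is chosen, depending
  on that zero, on which it cannot recur.\<close>

lemma fibre_curve_dim:
  assumes st: "(s0, t0) \<noteq> (0, 0)" and q: "bih 0 k q" "k \<ge> 1" "prime_elem q"
  shows "enat 1 \<le> krull_dim zariski (fibre_curve s0 t0 q)"
proof -
  obtain x where x: "x \<noteq> 0" "\<And>k. k \<noteq> 1 \<Longrightarrow> k \<noteq> 2 \<Longrightarrow> x $ k = 0" "ev q (bp s0 t0 x) = 0"
    by (rule bih_zero_X[OF q(1,2), of 1 2 s0 t0]) auto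
  obtain y where y: "y \<noteq> 0" "ev q (bp s0 t0 y) = 0" "\<And>c. y \<noteq> c *s x"
  proof (cases "x $ 1 = 0")
    case False
    obtain y where y: "y \<noteq> 0" "\<And>k. k \<noteq> 2 \<Longrightarrow> k \<noteq> 3 \<Longrightarrow> y $ k = 0" "ev q (bp s0 t0 y) = 0"
      by (rule bih_zero_X[OF q(1,2), of 2 3 s0 t0]) auto
    have "y $ 1 = 0" by (rule y(2)) auto
    then have "y \<noteq> c *s x" for c using False y(1) by auto
    with y that show thesis by blast
  next
    case True
    obtain y where y: "y \<noteq> 0" "\<And>k. k \<noteq> 1 \<Longrightarrow> k \<noteq> 3 \<Longrightarrow> y $ k = 0" "ev q (bp s0 t0 y) = 0"
      by (rule bih_zero_X[OF q(1,2), of 1 3 s0 t0]) auto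
    have "x $ 3 = 0" by (rule x(2)) auto
    then have "x $ 2 \<noteq> 0" using x(1) True vec3_eqI[of x 0] by auto
    moreover have "y $ 2 = 0" by (rule y(2)) auto
    ultimately have "y \<noteq> c *s x" for c using y(1) by auto
    with y that show thesis by blast
  qed
  have nz: "P s0 t0 x \<noteq> 0" "P s0 t0 y \<noteq> 0" using st x y by (auto simp: P_eq_0_iff)
  have ne: "vec.span {P s0 t0 x} \<noteq> vec.span {P s0 t0 y}"
  proof
    assume "vec.span {P s0 t0 x} = vec.span {P s0 t0 y}"
    then obtain c e where "y = e *s x" using nz(1) by (rule P_span_eqE)
    with y show False by blast
  qed
  have irr: "irreducible_closed zariski (fibre_curve s0 t0 q)" by (rule fibre_curve_irreducible[OF assms])
  have mem: "vec.span {P s0 t0 x} \<in> fibre_curve s0 t0 q" "vec.span {P s0 t0 y} \<in> fibre_curve s0 t0 q"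
    using x y by (auto simp: fibre_curve_def)
  show ?thesis
  proof (rule krull_dim_geI[of _ _ "\<lambda>i. if i = 0 then {vec.span {P s0 t0 x}} else fibre_curve s0 t0 q"])
    show "irreducible_closed zariski (if i = 0 then {vec.span {P s0 t0 x}} else fibre_curve s0 t0 q) \<and>
      (if i = 0 then {vec.span {P s0 t0 x}} else fibre_curve s0 t0 q) \<subseteq> fibre_curve s0 t0 q" for i :: nat
      using irr mem irreducible_point[OF nz(1)] by auto
    show "(if i = 0 then {vec.span {P s0 t0 x}} else fibre_curve s0 t0 q) \<subset>
      (if Suc i = 0 then {vec.span {P s0 t0 x}} else fibre_curve s0 t0 q)" if "i < 1" for i :: nat
      using mem ne that by auto
  qed
qed

text \<open>The chain consists of a point, a curve in a ruling plane, and \<open>V p\<close>. If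
  \<open>p\<close> does not involve x, then \<open>V p\<close> contains a whole ruling plane, and a
  prime factor of x_1 cuts out a curve in it. Otherwise the curve is a component of
  \<open>V p\<close> in a ruling plane on which \<open>p\<close> is not identically zero, and a
  second plane supplies a point off this curve.\<close>

lemma V_dim_ge_2:
  assumes p: "prime_elem p" "bih m n p"
  shows "enat 2 \<le> krull_dim zariski (V p)"
proof -
  have "p \<noteq> 0" "\<not> p dvd 1" using p by (auto simp: prime_elem_def)
  have irr: "irreducible_closed zariski (V p)"
    by (rule V_irreducible[OF disjI1[OF p(1)] V_nonempty[OF p(2) \<open>\<not> p dvd 1\<close>] p(2)])
  have factor: "\<exists>q k. prime_elem q \<and> q dvd G \<and> bih 0 k q \<and> k \<ge> 1" if G: "bih 0 n G" "n \<ge> 1" "G \<noteq> 0" for G :: "'a bipoly" and n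
  proof -
    have "\<not> G dvd 1" using bih_unit[OF G(1)] G(2) by auto
    then obtain q where q: "prime_elem q" "q dvd G" by (rule bipoly_prime_factor[OF G(3)])
    obtain i j where ij: "bih i j q" "i \<le> 0" "j \<le> n" by (rule bih_dvd[OF G(1,3) q(2)])
    have "j \<noteq> 0"
    proof
      assume "j = 0"
      then have "bih 0 0 q" using ij by simp
      then show False using q bih_00_unit by (auto simp: prime_elem_def)
    qed
    with ij q show ?thesis by (intro exI[of _ q] exI[of _ j]) auto
  qed
  obtain s0 t0 q k where st: "(s0, t0) \<noteq> (0, 0)" and q: "prime_elem q" "bih 0 k q" "k \<ge> 1"
    and sub: "fibre_curve s0 t0 q \<subset> V p"
  proof (cases "n = 0")
    case True
    have "m \<ge> 1"
    proof (rule ccontr)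
      assume "\<not> m \<ge> 1"
      then have "m = 0" by simp
      then have "bih 0 0 p" using p(2) True by simp
      then show False using bih_00_unit \<open>p \<noteq> 0\<close> \<open>\<not> p dvd 1\<close> by blast
    qed
    then obtain s0 t0 where st: "(s0, t0) \<noteq> (0, 0)" "ev p (bp s0 t0 0) = 0"
      using bih_zero_S[OF p(2), of 0] by blast
    have ev0: "ev p (bp s0 t0 x) = 0" for x using st(2) ev_bih_X0[of m p] p(2) True by metis
    obtain q :: "'a bipoly" and k where "prime_elem q \<and> q dvd mp_var (vX 1) \<and> bih 0 k q \<and> k \<ge> 1"
      using factor[OF bih_var(3)[of 1] order_refl mp_var_nonzero] by (elim exE)
    then have q: "prime_elem q" "bih 0 k q" "k \<ge> 1" by simp_all
    have "q \<noteq> 0" using q by (auto simp: prime_elem_def)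
    then obtain s t x where x: "ev q (bp s t x) \<noteq> 0" using bipoly_eqI[of q 0] by force
    have "ev q (bp s t (0 *s y)) = 0" for y
      using ev_bih_scale[OF q(2), of 1 s t 0 y] q(3) by simp
    then have "x \<noteq> 0" using x by auto
    have qx: "ev q (bp s0 t0 x) \<noteq> 0" using x ev_bih_S0[OF q(2)] by metis
    have nz: "P s0 t0 x \<noteq> 0" using st \<open>x \<noteq> 0\<close> by (auto simp: P_eq_0_iff)
    have "fibre_curve s0 t0 q \<subseteq> V p"
      using st by (auto simp: fibre_curve_def P_eq_0_iff ev0 intro!: V_I)
    moreover have "vec.span {P s0 t0 x} \<in> V p" using nz by (intro V_I) (auto simp: ev0)
    moreover have "vec.span {P s0 t0 x} \<notin> fibre_curve s0 t0 q"
      unfolding fibre_curve_V[OF st(1) q(2)] using V_iff[OF q(2) nz] qx by simp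
    ultimately have "fibre_curve s0 t0 q \<subset> V p" by blast
    with st(1) q show thesis by (intro that)
  next
    case False
    then have n: "n \<ge> 1" by simp
    \<comment> \<open>The factor s ensures that \<open>s0\<close> is nonzero, so the plane differs
      from the one over (0, 1), which supplies the point off the curve.\<close>
    have "mp_var vS * p \<noteq> 0" using \<open>p \<noteq> 0\<close> by (simp add: mp_var_nonzero)
    then obtain s0 t0 x0 where "ev (mp_var vS * p) (bp s0 t0 x0) \<noteq> ev 0 (bp s0 t0 x0)"
      using bipoly_eqI[of "mp_var vS * p" 0] by metis
    then have st: "s0 \<noteq> 0" "(s0, t0) \<noteq> (0, 0)" "ev p (bp s0 t0 x0) \<noteq> 0" by auto
    let ?q0 = "sub_st s0 t0 p"
    have q0: "?q0 \<noteq> 0" using ev_sub_st[of s0 t0 x0 s0 t0 p] st by auto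
    obtain q k where "prime_elem q \<and> q dvd ?q0 \<and> bih 0 k q \<and> k \<ge> 1"
      using factor[OF bih_sub_st[OF p(2)] n q0] by (elim exE)
    then have q: "prime_elem q" "q dvd ?q0" "bih 0 k q" "k \<ge> 1" by simp_all
    have evq: "ev p (bp s0 t0 x) = 0" if "ev q (bp s0 t0 x) = 0" for x
    proof -
      obtain H where "?q0 = q * H" using q(2) by (rule dvdE)
      then show ?thesis using ev_sub_st[of s0 t0 x s0 t0 p] that by simp
    qed
    have "fibre_curve s0 t0 q \<subseteq> V p"
      using st by (auto simp: fibre_curve_def P_eq_0_iff intro!: V_I evq)
    moreover obtain y where y: "y \<noteq> 0" "ev p (bp 0 1 y) = 0"
      by (rule bih_zero_X[OF p(2) n, of 1 2 0 1]) auto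
    have nz: "P 0 1 y \<noteq> 0" using y by (auto simp: P_eq_0_iff)
    then have "vec.span {P 0 1 y} \<in> V p" using y by (intro V_I)
    moreover have "vec.span {P 0 1 y} \<notin> fibre_curve s0 t0 q"
      unfolding fibre_curve_V[OF st(2) q(3)] using V_iff[OF bih_linear_st nz] st(1) by auto
    ultimately have "fibre_curve s0 t0 q \<subset> V p" by blast
    with st(2) q show thesis by (intro that)
  qed
  have "enat (Suc 1) \<le> krull_dim zariski (V p)"
    by (rule krull_dim_extend[OF irr sub fibre_curve_dim[OF st q(2,3,1)]]) simp
  then show ?thesis by (simp add: numeral_2_eq_2)
qed

lemma scroll_irreducible: "irreducible_closed zariski (V 0)"
  by (rule V_irreducible[of 0 0 0]) (use V_nonempty[of 0 0 0] in auto)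

text \<open>A chain in \<open>V p\<close> can be prolonged by the scroll, so the dimension of
  \<open>V p\<close> is less than 3; the lower bound 2 is \<open>V_dim_ge_2\<close>.\<close>

lemma V_prime_divisor:
  assumes dim: "krull_dim zariski (V 0) = 3" and p: "prime_elem p" "bih m n p"
  shows "prime_divisor (V 0) (V p)"
proof -
  have "\<not> p dvd 1" using p(1) by (simp add: prime_elem_def)
  then have irr: "irreducible_closed zariski (V p)"
    by (rule V_irreducible[OF disjI1[OF p(1)] V_nonempty[OF p(2)] p(2)])
  have "V p \<noteq> V 0" using V_eq_scroll[OF p(2)] p(1) by (auto simp: prime_elem_def)
  then have sub: "V p \<subset> V 0" using V_sub_scroll by blast
  have "\<not> enat 3 \<le> krull_dim zariski (V p)"
  proof
    assume "enat 3 \<le> krull_dim zariski (V p)"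
    then have "enat (Suc 3) \<le> krull_dim zariski (V 0)"
      by (intro krull_dim_extend[OF scroll_irreducible sub]) auto
    then show False unfolding dim by (simp add: numeral_eq_enat)
  qed
  then obtain d where d: "krull_dim zariski (V p) = enat d" "d < 3" by (cases "krull_dim zariski (V p)") auto
  with V_dim_ge_2[OF p] have "d = 2" by simp
  then have "krull_dim zariski (V p) + 1 = krull_dim zariski (V 0)"
    by (simp add: d dim one_enat_def numeral_eq_enat)
  with irr sub show ?thesis by (auto simp: prime_divisor_def)
qed

lemma irreducible_in_V_prime:
  assumes X: "irreducible_closed zariski X" and G: "bih m n G" "G \<noteq> 0" "X \<subseteq> V G"
  obtains q k l where "prime_elem q" "bih k l q" "X \<subseteq> V q"
proof -
  have "X \<noteq> {}" using X by (simp add: irreducible_closed_def)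
  have "\<exists>q k l. prime_elem q \<and> bih k l q \<and> X \<subseteq> V q"
    if "\<forall>q\<in>#Q. prime_elem q" "bih m n (prod_mset Q)" "X \<subseteq> V (prod_mset Q)" for Q m n
    using that
  proof (induction Q arbitrary: m n)
    case empty
    then show ?case using \<open>X \<noteq> {}\<close> by (auto simp: V_def)
  next
    case (add q Q)
    have "prod_mset (add_mset q Q) \<noteq> 0" using add.prems(1) by (metis not_prime_elem_zero prod_mset_zero_iff)
    then have "bih m n (q * prod_mset Q)" "q * prod_mset Q \<noteq> 0" using add.prems by simp_all
    then obtain i j k l where ij: "bih i j q" "bih k l (prod_mset Q)" by (rule bih_factor)
    have "X \<subseteq> V q \<union> V (prod_mset Q)" using add.prems(3) V_mult[of q "prod_mset Q"] by simp
    then have "X \<subseteq> V q \<or> X \<subseteq> V (prod_mset Q)"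
      using X V_closed[OF ij(1)] V_closed[OF ij(2)] by (simp add: irreducible_closed_def)
    then show ?case
    proof
      assume "X \<subseteq> V q"
      moreover have "prime_elem q" using add.prems(1) by simp
      ultimately show ?thesis using ij(1) by (intro exI conjI)
    next
      assume "X \<subseteq> V (prod_mset Q)"
      then show ?thesis using add.IH[OF _ ij(2)] add.prems(1) by simp
    qed
  qed
  note * = this
  have "\<not> G dvd 1"
  proof
    assume "G dvd 1"
    then obtain H where H: "1 = G * H" by (rule dvdE)
    have "ev G p \<noteq> 0" for p using arg_cong[OF H, of "\<lambda>F. ev F p"] by auto
    then show False using G(3) \<open>X \<noteq> {}\<close> by (auto simp: V_def)
  qed
  obtain Q where "(\<forall>q\<in>#Q. prime_elem q) \<and> G = prod_mset Q \<and> Q \<noteq> {#}"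
    using bipoly_prime_factors[OF G(2) \<open>\<not> G dvd 1\<close>] ..
  then have Q: "\<forall>q\<in>#Q. prime_elem q" "G = prod_mset Q" by auto
  have "bih m n (prod_mset Q)" "X \<subseteq> V (prod_mset Q)" using G(1,3) by (simp_all only: Q(2))
  from *[OF Q(1) this] show thesis by (elim exE conjE) (rule that)
qed

text \<open>A form that vanishes on \<open>X\<close> but not on the scroll has a nonzero pullback,
  and irreducibility puts \<open>X\<close> inside \<open>V f\<close> for a prime factor
  \<open>f\<close>. A strict inclusion would produce a chain of length 4 in the scroll.\<close>

lemma prime_divisor_V:
  assumes X: "prime_divisor (V 0) X" and dim: "krull_dim zariski X = 2"
  obtains f m n where "prime_elem f" "bih m n f" "X = V f" "krull_dim zariski (V 0) = 3"
proof -
  have irr: "irreducible_closed zariski X" and sub: "X \<subseteq> V 0" and "krull_dim zariski X + 1 = krull_dim zariski (V 0)"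
    using X by (auto simp: prime_divisor_def)
  then have dim0: "krull_dim zariski (V 0) = 3" using dim by simp
  then have "X \<noteq> V 0" using dim by auto
  then obtain p where p: "p \<in> V 0" "p \<notin> X" using sub by blast
  then have "p \<in> proj_space" using closedin_zariski_subset[OF V_closed[of 0 0 0]] by auto
  have cl: "closedin zariski X" using irr by (simp add: irreducible_closed_def)
  obtain F where F: "homogeneous F" "vanishes F X" "\<exists>v\<in>p. mp_value F v \<noteq> 0"
    by (rule closedin_zariski_separate[OF cl \<open>p \<in> proj_space\<close> p(2)])
  have "Phi F \<noteq> 0"
  proof
    assume "Phi F = 0"
    then have "vanishes F (V 0)" by (intro dvd_V F(1)) simp
    with F p show False by (auto simp: vanishes_def)
  qed
  obtain k where "F \<in> forms k" using F by (auto simp: homogeneous_def)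
  then have bF: "bih k k (Phi F)" by (rule bih_Phi)
  have "X \<subseteq> V (Phi F)"
  proof
    fix x assume "x \<in> X"
    then obtain s t y where y: "x = vec.span {P s t y}" "P s t y \<noteq> 0" using sub by (auto simp: V_def)
    have "mp_value F (P s t y) = 0" using F(2) \<open>x \<in> X\<close> y vec.span_base[of "P s t y" "{P s t y}"]
      unfolding vanishes_def by blast
    then show "x \<in> V (Phi F)" using y by (auto intro: V_I simp: ev_Phi)
  qed
  then obtain f m n where f: "prime_elem f" "bih m n f" "X \<subseteq> V f"
    by (rule irreducible_in_V_prime[OF irr bF \<open>Phi F \<noteq> 0\<close>])
  have "X = V f"
  proof (rule ccontr)
    assume "X \<noteq> V f"
    then have "X \<subset> V f" using f by blast
    moreover have "V f \<subset> V 0" using V_eq_scroll[OF f(2)] V_sub_scroll[of f] f(1) by (auto simp: prime_elem_def)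
    moreover have "\<not> f dvd 1" using f(1) by (simp add: prime_elem_def)
    then have irrf: "irreducible_closed zariski (V f)"
      by (rule V_irreducible[OF disjI1[OF f(1)] V_nonempty[OF f(2)] f(2)])
    moreover have "enat 2 \<le> krull_dim zariski X" unfolding dim by (simp add: numeral_eq_enat)
    ultimately have "enat (Suc 2) \<le> krull_dim zariski (V f)" by (intro krull_dim_extend[OF irrf]) auto
    from krull_dim_extend[OF scroll_irreducible \<open>V f \<subset> V 0\<close> this]
    have "enat (Suc (Suc 2)) \<le> krull_dim zariski (V 0)" by simp
    then show False unfolding dim0 by (simp add: numeral_eq_enat)
  qed
  from that[OF f(1,2) this dim0] show thesis .
qed

end

section \<open>Orders of vanishing along prime divisors of the scroll\<close>

definition pmult :: "'r::comm_ring_1 \<Rightarrow> 'r \<Rightarrow> nat" where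
  "pmult p G = (GREATEST n. p ^ n dvd G)"

text \<open>A prime bihomogeneous \<open>p\<close> has a positive partial degree, so m + n bounds
  the exponents and the greatest one in \<open>pmult\<close> exists.\<close>

lemma pmult_iff:
  fixes p G :: "'a::alg_closed_field bipoly"
  assumes p: "prime_elem p" "bih i j p" and G: "bih m n G" "G \<noteq> 0"
  shows "p ^ e dvd G \<longleftrightarrow> e \<le> pmult p G"
proof -
  have p0: "p \<noteq> 0" "\<not> p dvd 1" using p(1) by (simp_all add: prime_elem_def)
  have bound: "e \<le> m + n" if dvd: "p ^ e dvd G" for e
  proof -
    obtain i' j' where ij: "bih i' j' (p ^ e)" "i' \<le> m" "j' \<le> n" by (rule bih_dvd[OF G dvd])
    have "p ^ e \<noteq> 0" using p0 by simp
    then have eq: "i * e = i'" "j * e = j'" using bih_unique[OF bih_power[OF p(2)] ij(1)] by auto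
    have "\<not> (i = 0 \<and> j = 0)"
    proof
      assume "i = 0 \<and> j = 0"
      then have "bih 0 0 p" using p(2) by simp
      then show False using bih_00_unit[OF _ p0(1)] p0(2) by simp
    qed
    then have "e \<le> i * e + j * e" by (cases i; cases j) auto
    with eq ij show ?thesis by linarith
  qed
  have ex: "p ^ 0 dvd G" by simp
  have max: "p ^ pmult p G dvd G" unfolding pmult_def
    by (rule GreatestI_nat[of "\<lambda>n. p ^ n dvd G", OF ex]) (use bound in blast)
  show ?thesis
  proof
    assume "p ^ e dvd G"
    then show "e \<le> pmult p G" unfolding pmult_def
      by (rule Greatest_le_nat[of "\<lambda>n. p ^ n dvd G"]) (use bound in blast)
  next
    assume "e \<le> pmult p G"
    then have "p ^ e dvd p ^ pmult p G" by (rule le_imp_power_dvd)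
    then show "p ^ e dvd G" using max by (rule dvd_trans)
  qed
qed

lemma pmult_mult:
  fixes p G H :: "'a::alg_closed_field bipoly"
  assumes p: "prime_elem p" "bih i j p" and G: "bih m n G" "G \<noteq> 0" and H: "bih k l H" "H \<noteq> 0"
  shows "pmult p (G * H) = pmult p G + pmult p H"
proof (rule antisym)
  have p0: "p \<noteq> 0" using p(1) by (simp add: prime_elem_def)
  note GH = bih_mult[OF G(1) H(1)]
  have GH0: "G * H \<noteq> 0" using G H by simp
  have "p ^ pmult p G dvd G" using pmult_iff[OF p G] by simp
  then obtain G' where G': "G = p ^ pmult p G * G'" by (rule dvdE)
  have "p ^ pmult p H dvd H" using pmult_iff[OF p H] by simp
  then obtain H' where H': "H = p ^ pmult p H * H'" by (rule dvdE)
  have "p ^ (pmult p G + pmult p H) dvd G * H"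
    unfolding power_add by (rule mult_dvd_mono) fact+
  then show "pmult p G + pmult p H \<le> pmult p (G * H)" using pmult_iff[OF p GH GH0] by simp
  show "pmult p (G * H) \<le> pmult p G + pmult p H"
  proof (rule ccontr)
    assume "\<not> ?thesis"
    then have "Suc (pmult p G + pmult p H) \<le> pmult p (G * H)" by simp
    then have "p ^ Suc (pmult p G + pmult p H) dvd G * H" using pmult_iff[OF p GH GH0] by blast
    also have "G * H = p ^ (pmult p G + pmult p H) * (G' * H')"
      by (subst G', subst H') (simp only: power_add mult_ac)
    finally have "p ^ (pmult p G + pmult p H) * p dvd p ^ (pmult p G + pmult p H) * (G' * H')"
      by (simp only: power_Suc2)
    then have "p dvd G' * H'" using p0 by (simp only: dvd_mult_cancel_left) simp
    then have "p dvd G' \<or> p dvd H'" using prime_elem_dvd_multD[OF p(1)] by blast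
    then show False
    proof
      assume "p dvd G'"
      then have "p ^ pmult p G * p dvd G" by (subst G') (rule mult_dvd_mono[OF dvd_refl])
      then have "p ^ Suc (pmult p G) dvd G" by (simp only: power_Suc2)
      then have "Suc (pmult p G) \<le> pmult p G" using pmult_iff[OF p G] by blast
      then show False by simp
    next
      assume "p dvd H'"
      then have "p ^ pmult p H * p dvd H" by (subst H') (rule mult_dvd_mono[OF dvd_refl])
      then have "p ^ Suc (pmult p H) dvd H" by (simp only: power_Suc2)
      then have "Suc (pmult p H) \<le> pmult p H" using pmult_iff[OF p H] by blast
      then show False by simp
    qed
  qed
qed

lemma pmult_power:
  fixes p G :: "'a::alg_closed_field bipoly"
  assumes p: "prime_elem p" "bih i j p" and G: "bih m n G" "G \<noteq> 0"
  shows "pmult p (G ^ e) = e * pmult p G"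
proof (induction e)
  case 0
  have "\<not> p ^ 1 dvd 1" using p(1) by (simp add: prime_elem_def)
  then have "\<not> 1 \<le> pmult p (1 :: 'a bipoly)" using pmult_iff[OF p bih_1, of 1] by simp
  then show ?case by simp
next
  case (Suc e)
  have "G ^ e \<noteq> 0" using G by simp
  then show ?case using pmult_mult[OF p G bih_power[OF G(1), of e]] Suc by simp
qed

lemma bih_assoc_degrees:
  fixes G H :: "'a::field bipoly"
  assumes "bih m n G" "bih k l H" "G \<noteq> 0" "H \<noteq> 0" "G dvd H" "H dvd G"
  shows "m = k \<and> n = l"
proof -
  obtain i j where "bih i j G" "i \<le> k" "j \<le> l" by (rule bih_dvd[OF assms(2,4,5)])
  moreover obtain i' j' where "bih i' j' H" "i' \<le> m" "j' \<le> n" by (rule bih_dvd[OF assms(1,3,6)])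
  ultimately show ?thesis using bih_unique[OF assms(1)] bih_unique[OF assms(2)] assms(3,4) by fastforce
qed

text \<open>Testing bihomogeneous primes suffices, since every divisor of a nonzero bihomogeneous
  form is bihomogeneous. In this way divisors on the scroll control divisibility.\<close>

lemma bih_dvd_of_mult:
  fixes G H :: "'a::alg_closed_field bipoly"
  assumes G: "bih m n G" "G \<noteq> 0" and H: "bih k l H" "H \<noteq> 0"
    and le: "\<And>p i j. prime_elem p \<Longrightarrow> bih i j p \<Longrightarrow> pmult p G \<le> pmult p H"
  shows "G dvd H"
proof (rule bipoly_dvd_of_prime_powers[OF G(2)])
  fix p e assume p: "prime_elem p" "p ^ e dvd G"
  show "p ^ e dvd H"
  proof (cases e)
    case (Suc e')
    then have "p dvd p ^ e" by simp
    then have "p dvd G" using p(2) by (rule dvd_trans)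
    then obtain i j where ij: "bih i j p" by (rule bih_dvd[OF G])
    have "e \<le> pmult p G" using pmult_iff[OF p(1) ij G] p(2) by blast
    also have "\<dots> \<le> pmult p H" by (rule le[OF p(1) ij])
    finally show ?thesis using pmult_iff[OF p(1) ij H] by blast
  qed simp
qed

section \<open>Ideals and valuations on the scroll\<close>

context scroll
begin

lemma vanishing_ideal_dvd:
  assumes p: "prime_elem p \<or> p = 0" "V p \<noteq> {}" and F: "F \<in> vanishing_ideal (V p)"
  shows "p dvd Phi F"
  using F unfolding vanishing_ideal_def
proof (induction rule: ideal.span_induct_alt)
  case base
  show ?case by simp
next
  case (step c x y)
  then have x: "homogeneous x" "vanishes x (V p)" by (auto simp: vanishes_def)
  then obtain k where "x \<in> forms k" by (auto simp: homogeneous_def)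
  then have "p dvd Phi x" by (rule V_dvd[OF p _ x(2)])
  with step show ?case by simp
qed

lemma homogeneous_in_vanishing_ideal:
  assumes "prime_elem p \<or> p = 0" "V p \<noteq> {}" "homogeneous F"
  shows "F \<in> vanishing_ideal (V p) \<longleftrightarrow> p dvd Phi F"
  using vanishing_ideal_dvd[OF assms(1,2)] dvd_V[OF assms(3)] vanishing_idealI[OF assms(3)] by blast

lemma V_0_nonempty: "V 0 \<noteq> {}"
  using V_nonempty[of 0 0 0] by simp

lemma in_scroll_ideal: "F \<in> vanishing_ideal (V 0) \<Longrightarrow> Phi F = 0"
  using vanishing_ideal_dvd[OF _ V_0_nonempty] by simp

lemma homogeneous_in_scroll_ideal: "homogeneous F \<Longrightarrow> F \<in> vanishing_ideal (V 0) \<longleftrightarrow> Phi F = 0"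
  using homogeneous_in_vanishing_ideal[OF _ V_0_nonempty] by simp

lemma ideal_power_dvd:
  assumes p: "prime_elem p" "V p \<noteq> {}" and F: "F \<in> ideal_power (vanishing_ideal (V p)) n"
  shows "p ^ n dvd Phi F"
  using F
proof (induction n arbitrary: F)
  case (Suc n)
  from Suc.prems show ?case
    unfolding ideal_power.simps
  proof (induction rule: ideal.span_induct_alt)
    case (step c x y)
    then obtain f g where fg: "x = f * g" "f \<in> vanishing_ideal (V p)" "g \<in> ideal_power (vanishing_ideal (V p)) n"
      by auto
    have "p * p ^ n dvd Phi f * Phi g"
      by (rule mult_dvd_mono[OF vanishing_ideal_dvd[OF disjI1[OF p(1)] p(2) fg(2)] Suc.IH[OF fg(3)]])
    then have "p ^ Suc n dvd Phi x" by (simp add: fg)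
    with step show ?case by simp
  qed simp
qed simp

lemma power_in_ideal_power: "F \<in> I \<Longrightarrow> F ^ n \<in> ideal_power I n"
proof (induction n)
  case (Suc n)
  then have "F * F ^ n \<in> {f * g | f g. f \<in> I \<and> g \<in> ideal_power I n}" by blast
  then show ?case by (simp add: ideal.span_base)
qed simp

text \<open>From left to right, pull back: the ideal of the scroll goes to 0, the e-th power becomes
  divisible by \<open>p ^ e\<close>, and \<open>p\<close> does not divide the pullback of
  \<open>s\<close>. From right to left, \<open>p\<close> and the cofactor \<open>R\<close> of
  \<open>p ^ e\<close> need not be pullbacks; after multiplication by suitable monomials they are,
  and the denominator \<open>s\<close> absorbs these monomials.\<close>

lemma ord_witness_iff:
  assumes p: "prime_elem p" "bih m n p" and g: "g \<in> forms k" "Phi g \<noteq> 0"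
  shows "(\<exists>s. homogeneous s \<and> s \<notin> vanishing_ideal (V p) \<and>
      s * g \<in> ideal.span (ideal_power (vanishing_ideal (V p)) e \<union> vanishing_ideal (V 0))) \<longleftrightarrow> p ^ e dvd Phi g"
    (is "?L \<longleftrightarrow> ?R")
proof -
  have p0: "p \<noteq> 0" "\<not> p dvd 1" using p(1) by (simp_all add: prime_elem_def)
  have ne: "V p \<noteq> {}" by (rule V_nonempty[OF p(2) p0(2)])
  note mem = homogeneous_in_vanishing_ideal[OF disjI1[OF p(1)] ne]
  show ?thesis
  proof
    assume ?L
    then obtain s where s: "homogeneous s" "s \<notin> vanishing_ideal (V p)"
      "s * g \<in> ideal.span (ideal_power (vanishing_ideal (V p)) e \<union> vanishing_ideal (V 0))" by blast
    have "p ^ e dvd Phi (s * g)"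
      using s(3)
    proof (induction rule: ideal.span_induct_alt)
      case (step c x y)
      then have "p ^ e dvd Phi x"
        using ideal_power_dvd[OF p(1) ne] in_scroll_ideal by (metis Un_iff dvd_0_right)
      with step show ?case by simp
    qed simp
    then have "p ^ e dvd Phi s * Phi g" by simp
    moreover have "\<not> p dvd Phi s" using s mem by blast
    ultimately show ?R using prime_power_dvd_cancel[OF p(1)] by blast
  next
    assume ?R
    then obtain R where R: "Phi g = p ^ e * R" by (rule dvdE)
    have bg: "bih k k (p ^ e * R)" "p ^ e * R \<noteq> 0" using bih_Phi[OF g(1)] g(2) by (simp_all add: R)
    obtain i j i' j' where ij: "bih i j (p ^ e)" "bih i' j' R" "i + i' = k" "j + j' = k" by (rule bih_factor[OF bg])
    have "i = m * e" "j = n * e" using bih_unique[OF ij(1) bih_power[OF p(2)]] p0 by auto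
    note ij = ij[unfolded this]
    obtain s0 t0 x0 where pt: "P s0 t0 x0 \<noteq> 0" "ev p (bp s0 t0 x0) = 0" using ne by (auto simp: V_def)
    then have nz: "x0 \<noteq> 0" "s0 \<noteq> 0 \<or> t0 \<noteq> 0" by (auto simp: P_eq_0_iff)
    obtain l where l: "x0 $ l \<noteq> 0" using nz by (auto simp: Finite_Cartesian_Product.vec_eq_iff)
    define v where "v = (if s0 \<noteq> 0 then vS else vT)"
    define sg :: "'a bipoly" where "sg = mp_var v"
    define X :: "'a bipoly" where "X = mp_var (vX l)"
    have ev_nz: "ev sg (bp s0 t0 x0) \<noteq> 0" "ev X (bp s0 t0 x0) \<noteq> 0" using nz l by (auto simp: sg_def X_def v_def)
    have bsg: "bih 1 0 sg" and bX: "bih 0 1 X" by (simp_all only: sg_def X_def v_def bih_var if_split) (simp add: bih_var[unfolded One_nat_def])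
    \<comment> \<open>\<open>h\<close> balances the bidegree (m, n) of \<open>p\<close>, and
      \<open>r\<close> complements \<open>h ^ e\<close> so that \<open>h ^ e * r\<close> has both
      degrees equal to e |m - n| and is the pullback of the denominator. Neither vanishes at the
      chosen point of \<open>V p\<close>, so \<open>p\<close> does not divide their product.\<close>
    define h where "h = sg ^ (n - m) * X ^ (m - n)"
    define r where "r = sg ^ (e * (m - n)) * X ^ (e * (n - m))"
    have bh: "bih (n - m) (m - n) h"
      using bih_mult[OF bih_power[OF bsg, of "n - m"] bih_power[OF bX, of "m - n"]] by (simp add: h_def)
    have br: "bih (e * (m - n)) (e * (n - m)) r"
      using bih_mult[OF bih_power[OF bsg, of "e * (m - n)"] bih_power[OF bX, of "e * (n - m)"]] by (simp add: r_def)
    have evh: "ev h (bp s0 t0 x0) \<noteq> 0" "ev r (bp s0 t0 x0) \<noteq> 0" using ev_nz by (simp_all add: h_def r_def)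
    let ?N = "e * (m - n) + e * (n - m)"
    have "bih ?N ?N (h ^ e * r)"
      using bih_mult[OF bih_power[OF bh, of e] br] by (simp add: mult.commute add.commute)
    then obtain s where s: "s \<in> forms ?N" "Phi s = h ^ e * r" by (rule Phi_surj)
    have "bih (max m n) (max m n) (p * h)"
      using bih_mult[OF p(2) bh] by (cases "m \<le> n") (simp_all add: max_def)
    then obtain P0 where P0: "P0 \<in> forms (max m n)" "Phi P0 = p * h" by (rule Phi_surj)
    have le: "m * e \<le> k" "n * e \<le> k" using ij by auto
    \<comment> \<open>\<open>R\<close> has bidegree (k - m e, k - n e); multiplication by
      \<open>r\<close> raises the smaller degree to the larger one, which is
      \<open>D\<close>.\<close>
    define D where "D = k - e * min m n"
    have brR: "bih D D (r * R)"
    proof -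
      have "e * (m - n) + i' = D"
        using ij(3) by (cases "m \<le> n") (auto simp: D_def min_def algebra_simps diff_mult_distrib2)
      moreover have "e * (n - m) + j' = D"
        using ij(4) by (cases "m \<le> n") (auto simp: D_def min_def algebra_simps diff_mult_distrib2)
      ultimately show ?thesis using bih_mult[OF br ij(2)] by simp
    qed
    then obtain R0 where R0: "R0 \<in> forms D" "Phi R0 = r * R" by (rule Phi_surj)
    have hs: "homogeneous s" using s by (auto simp: homogeneous_def)
    have "\<not> p dvd Phi s"
    proof
      assume "p dvd Phi s"
      then obtain H where "h ^ e * r = p * H" unfolding s(2) by (rule dvdE)
      then have "ev (h ^ e * r) (bp s0 t0 x0) = 0" using pt(2) by simp
      then show False using evh by simp
    qed
    then have s_notin: "s \<notin> vanishing_ideal (V p)" using mem[OF hs] by blast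
    have P0_in: "P0 \<in> vanishing_ideal (V p)"
      using mem[of P0] P0 by (auto simp: homogeneous_def)
    have Phi0: "Phi (s * g - P0 ^ e * R0) = 0"
      by (simp add: s P0 R0 R power_mult_distrib mult_ac)
    have deg: "max m n * e + D = ?N + k"
      using le by (cases "m \<le> n") (auto simp: D_def min_def max_def algebra_simps diff_mult_distrib2)
    have "P0 ^ e * R0 \<in> forms (max m n * e + D)"
      using P0(1) R0(1) unfolding forms_whom mem_Collect_eq by (intro whom_mult whom_power)
    moreover have "s * g \<in> forms (?N + k)" by (rule forms_mult[OF s(1) g(1)])
    ultimately have "s * g - P0 ^ e * R0 \<in> forms (?N + k)"
      unfolding deg forms_whom mem_Collect_eq by (intro whom_diff)
    then have rest: "s * g - P0 ^ e * R0 \<in> vanishing_ideal (V 0)"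
      by (intro homogeneous_in_scroll_ideal[THEN iffD2, OF _ Phi0]) (auto simp: homogeneous_def)
    let ?U = "ideal_power (vanishing_ideal (V p)) e \<union> vanishing_ideal (V 0)"
    have "R0 * P0 ^ e \<in> ideal.span ?U"
      by (rule ideal.span_scale, rule ideal.span_base) (simp add: power_in_ideal_power[OF P0_in])
    moreover have "s * g - P0 ^ e * R0 \<in> ideal.span ?U" by (rule ideal.span_base) (simp add: rest)
    ultimately have "R0 * P0 ^ e + (s * g - P0 ^ e * R0) \<in> ideal.span ?U" by (rule ideal.span_add)
    then have "s * g \<in> ideal.span ?U" by (simp add: mult.commute)
    with hs s_notin show ?L by blast
  qed
qed

lemma form_divisor_V:
  assumes dim: "krull_dim zariski (V 0) = 3" and p: "prime_elem p" "bih m n p" and g: "g \<in> forms k" "Phi g \<noteq> 0"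
  shows "form_divisor (V 0) g (V p) = int (pmult p (Phi g))"
  using V_prime_divisor[OF dim p] unfolding form_divisor_def ord_along_def ord_witness_iff[OF p g] pmult_def by simp

text \<open>\<open>f\<close> times a monomial that is nonzero at a chosen point of
  \<open>V p\<close> lifts to a form vanishing on \<open>V f\<close>, which equals
  \<open>V p\<close>. The prime \<open>p\<close> divides the product but not the monomial.\<close>

lemma V_eq_imp_dvd:
  assumes p: "prime_elem p" "bih i j p" and f: "bih m n f" and "V p = V f"
  shows "p dvd f"
proof -
  have p0: "p \<noteq> 0" "\<not> p dvd 1" using p(1) by (simp_all add: prime_elem_def)
  have ne: "V p \<noteq> {}" by (rule V_nonempty[OF p(2) p0(2)])
  obtain s0 t0 x0 where pt: "P s0 t0 x0 \<noteq> 0" "ev p (bp s0 t0 x0) = 0" using ne by (auto simp: V_def)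
  then have nz: "x0 \<noteq> 0" "s0 \<noteq> 0 \<or> t0 \<noteq> 0" by (auto simp: P_eq_0_iff)
  obtain l where l: "x0 $ l \<noteq> 0" using nz by (auto simp: Finite_Cartesian_Product.vec_eq_iff)
  define h :: "'a bipoly" where "h = (if s0 \<noteq> 0 then mp_var vS else mp_var vT) ^ (n - m) * mp_var (vX l) ^ (m - n)"
  have evh: "ev h (bp s0 t0 x0) \<noteq> 0" using nz l by (auto simp: h_def)
  have v: "bih 1 0 (if s0 \<noteq> 0 then mp_var vS else mp_var vT :: 'a bipoly)" by (cases "s0 = 0") (simp_all only: bih_var if_True if_False not_True_eq_False not_False_eq_True simp_thms)
  have "bih (n - m) (m - n) h"
    using bih_mult[OF bih_power[OF v, of "n - m"] bih_power[OF bih_var(3)[of l], of "m - n"]] by (simp add: h_def)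
  then have "bih (max m n) (max m n) (f * h)"
    using bih_mult[OF f, of "n - m" "m - n" h] by (cases "m \<le> n") (simp_all add: max_def)
  then obtain F where F: "F \<in> forms (max m n)" "Phi F = f * h" by (rule Phi_surj)
  have hF: "homogeneous F" using F by (auto simp: homogeneous_def)
  have "vanishes F (V f)" by (rule dvd_V[OF hF]) (simp add: F)
  then have "p dvd f * h" using V_dvd[OF disjI1[OF p(1)] ne F(1)] assms(4) F(2) by simp
  moreover have "\<not> p dvd h"
  proof
    assume "p dvd h"
    then obtain H where "h = p * H" by (rule dvdE)
    then show False using evh pt by simp
  qed
  ultimately show ?thesis using prime_elem_dvd_multD[OF p(1)] by blast
qed

lemma prime_dvd_prime:
  fixes p f :: "'a bipoly"
  assumes "prime_elem p" "prime_elem f" "p dvd f"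
  obtains u v where "f = p * u" "u * v = 1"
proof -
  obtain u where u: "f = p * u" using assms(3) by (rule dvdE)
  have "irreducible f" using assms(2) by (rule prime_elem_imp_irreducible)
  then have "u dvd 1" using irreducibleD[OF _ u] assms(1) by (auto simp: prime_elem_def)
  then obtain v where "1 = u * v" by (rule dvdE)
  with u that show thesis by metis
qed

lemma pmult_prime:
  assumes p: "prime_elem p" "bih i j p" and f: "prime_elem f" "bih m n f"
  shows "pmult p f = (if V p = V f then 1 else 0)"
proof -
  have f0: "f \<noteq> 0" using f by (simp add: prime_elem_def)
  have p0: "p \<noteq> 0" "\<not> p dvd 1" using p(1) by (simp_all add: prime_elem_def)
  show ?thesis
  proof (cases "V p = V f")
    case True
    then have "p dvd f" by (rule V_eq_imp_dvd[OF p f(2)])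
    then obtain u v where u: "f = p * u" "u * v = 1" by (rule prime_dvd_prime[OF p(1) f(1)])
    have "p ^ 1 dvd f" using u by simp
    then have "1 \<le> pmult p f" using pmult_iff[OF p f(2) f0] by blast
    moreover have "\<not> 2 \<le> pmult p f"
    proof
      assume "2 \<le> pmult p f"
      then have "p ^ 2 dvd p * u" using pmult_iff[OF p f(2) f0] u(1) by blast
      then have "p * p dvd p * u" by (simp only: power2_eq_square)
      then have "p dvd u" using p0 by (simp only: dvd_mult_cancel_left) simp
      then have "p dvd u * v" by (rule dvd_mult2)
      then show False using u p0 by simp
    qed
    ultimately show ?thesis using True by simp
  next
    case False
    have "\<not> p ^ 1 dvd f"
    proof
      assume "p ^ 1 dvd f"
      then have "p dvd f" by simp
      then obtain u v where u: "f = p * u" "u * v = 1" by (rule prime_dvd_prime[OF p(1) f(1)])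
      have "ev u q \<noteq> 0" for q using arg_cong[OF u(2), of "\<lambda>F. ev F q"] by auto
      then have "V p = V f" unfolding V_def u(1) by simp
      with False show False ..
    qed
    then have "\<not> 1 \<le> pmult p f" using pmult_iff[OF p f(2) f0] by blast
    then show ?thesis using False by simp
  qed
qed

lemma ruling_plane_V:
  assumes "(s0, t0) \<noteq> (0, 0)"
  obtains u where "prime_elem u" "bih 1 0 u" "V u = ruling_plane a b s0 t0"
proof -
  let ?u = "mp_const t0 * mp_var vS - mp_const s0 * mp_var vT :: 'a bipoly"
  have "ruling_plane a b s0 t0 = fibre_curve s0 t0 0"
    unfolding ruling_plane_eq[OF assms] fibre_curve_def by simp
  also have "\<dots> = V 0 \<inter> V ?u" by (rule fibre_curve_V[OF assms, of 0]) simp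
  also have "\<dots> = V ?u" using V_sub_scroll by blast
  finally have Vu: "V ?u = ruling_plane a b s0 t0" ..
  with linear_st_prime[OF assms] bih_linear_st show thesis by (rule that)
qed

text \<open>After clearing denominators the linear equivalence says that \<open>f * Phi h\<close>
  and \<open>Phi l * u ^ (d - 3) * Phi g\<close>, with \<open>u\<close> the equation of the ruling
  plane, have the same multiplicity at every bihomogeneous prime. So they divide each other, and
  cancelling (k, k) from their bidegrees leaves (d - 2, 1).\<close>

theorem type_I_equation:
  assumes X: "prime_divisor (V 0) X" "krull_dim zariski X = 2" and d: "d \<ge> 3" and st: "(s0, t0) \<noteq> (0, 0)"
    and l: "l \<in> forms 1 - vanishing_ideal (V 0)"
    and lin: "linearly_equivalent (V 0) (single_divisor X)
       (\<lambda>Y. form_divisor (V 0) l Y + (int d - 3) * single_divisor (ruling_plane a b s0 t0) Y)"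
  obtains f where "prime_elem f" "bih (d - 2) 1 f" "X = V f"
proof -
  obtain f m n where f: "prime_elem f" "bih m n f" "X = V f" and dim: "krull_dim zariski (V 0) = 3"
    by (rule prime_divisor_V[OF X])
  obtain u where u: "prime_elem u" "bih 1 0 u" "V u = ruling_plane a b s0 t0" by (rule ruling_plane_V[OF st])
  obtain k g h where gh: "g \<in> forms k - vanishing_ideal (V 0)" "h \<in> forms k - vanishing_ideal (V 0)"
    and eq: "\<And>Y. single_divisor X Y - (form_divisor (V 0) l Y + (int d - 3) * single_divisor (ruling_plane a b s0 t0) Y)
        = form_divisor (V 0) g Y - form_divisor (V 0) h Y"
    using lin unfolding linearly_equivalent_def by blast
  have nz: "Phi F \<noteq> 0" "F \<in> forms j" if "F \<in> forms j - vanishing_ideal (V 0)" for F j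
    using that homogeneous_in_scroll_ideal[of F] by (auto simp: homogeneous_def)
  note G = nz[OF gh(1)] note H = nz[OF gh(2)] note L = nz[OF l]
  have f0: "f \<noteq> 0" "u \<noteq> 0" using f(1) u(1) by (auto simp: prime_elem_def)
  define G1 where "G1 = f * Phi h"
  define G2 where "G2 = Phi l * u ^ (d - 3) * Phi g"
  note bL = bih_Phi[OF L(2)] note bG = bih_Phi[OF G(2)] note bH = bih_Phi[OF H(2)]
  have bu: "bih (d - 3) 0 (u ^ (d - 3))" using bih_power[OF u(2), of "d - 3"] by simp
  have u0: "u ^ (d - 3) \<noteq> 0" using f0 by simp
  have bLu: "bih (1 + (d - 3)) 1 (Phi l * u ^ (d - 3))" using bih_mult[OF bL bu] by simp
  have Lu0: "Phi l * u ^ (d - 3) \<noteq> 0" using L u0 by simp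
  have b1: "bih (m + k) (n + k) G1" unfolding G1_def by (rule bih_mult[OF f(2) bH])
  have b2: "bih (1 + (d - 3) + k) (1 + k) G2" unfolding G2_def by (rule bih_mult[OF bLu bG])
  have n1: "G1 \<noteq> 0" "G2 \<noteq> 0" using f0 H Lu0 G by (simp_all add: G1_def G2_def)
  have eqm: "pmult p G1 = pmult p G2" if p: "prime_elem p" "bih i j p" for p i j
  proof -
    have 1: "pmult p G1 = pmult p f + pmult p (Phi h)"
      unfolding G1_def by (rule pmult_mult[OF p f(2) f0(1) bH H(1)])
    have 2: "pmult p G2 = pmult p (Phi l) + (d - 3) * pmult p u + pmult p (Phi g)"
      unfolding G2_def by (simp only: pmult_mult[OF p bLu Lu0 bG G(1)] pmult_mult[OF p bL L(1) bu u0] pmult_power[OF p u(2) f0(2)])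
    have sd: "single_divisor X (V p) = int (pmult p f)" "single_divisor (ruling_plane a b s0 t0) (V p) = int (pmult p u)"
      unfolding pmult_prime[OF p f(1,2)] pmult_prime[OF p u(1,2)] single_divisor_def f(3) u(3)[symmetric] by simp_all
    have d3: "int d - 3 = int (d - 3)" using d by simp
    have "int (pmult p f) - (int (pmult p (Phi l)) + int (d - 3) * int (pmult p u)) = int (pmult p (Phi g)) - int (pmult p (Phi h))"
      using eq[of "V p"]
      unfolding form_divisor_V[OF dim p G(2,1)] form_divisor_V[OF dim p H(2,1)] form_divisor_V[OF dim p L(2,1)] sd d3 .
    then have "int (pmult p f + pmult p (Phi h)) = int (pmult p (Phi l) + (d - 3) * pmult p u + pmult p (Phi g))"
      unfolding of_nat_add of_nat_mult by linarith
    then show ?thesis unfolding 1 2 by (simp only: of_nat_eq_iff)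
  qed
  have "G1 dvd G2" by (rule bih_dvd_of_mult[OF b1 n1(1) b2 n1(2)]) (simp add: eqm)
  moreover have "G2 dvd G1" by (rule bih_dvd_of_mult[OF b2 n1(2) b1 n1(1)]) (simp add: eqm)
  ultimately have "m + k = 1 + (d - 3) + k \<and> n + k = 1 + k"
    by (rule bih_assoc_degrees[OF b1 b2 n1])
  then have "m = d - 2" "n = 1" using d by auto
  then have "bih (d - 2) 1 f" using f(2) by simp
  from that[OF f(1) this f(3)] show thesis .
qed

end

section \<open>Lines and Hilbert functions\<close>

definition line :: "'a::field ^ 'n \<Rightarrow> 'a ^ 'n \<Rightarrow> ('a ^ 'n) set" where
  "line v w = {\<alpha> *s v + \<beta> *s w | \<alpha> \<beta>. True}"

lemma line_subspace: "vec.subspace (line v w)"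
  unfolding vec.subspace_def
proof (intro conjI ballI allI)
  show "0 \<in> line v w" unfolding line_def by (intro CollectI exI[of _ 0]) simp
next
  fix x y assume "x \<in> line v w" "y \<in> line v w"
  then obtain p q r s where "x = p *s v + q *s w" "y = r *s v + s *s w" by (auto simp: line_def)
  then have "x + y = (p + r) *s v + (q + s) *s w" by (simp add: vec.scale_left_distrib)
  then show "x + y \<in> line v w" unfolding line_def by blast
next
  fix c x assume "x \<in> line v w"
  then obtain p q where "x = p *s v + q *s w" by (auto simp: line_def)
  then have "c *s x = (c * p) *s v + (c * q) *s w" by (simp add: vec.scale_right_distrib)
  then show "c *s x \<in> line v w" unfolding line_def by blast
qed

lemma in_line: "\<alpha> *s v + \<beta> *s w \<in> line v w" "v \<in> line v w" "w \<in> line v w"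
proof -
  show *: "\<alpha> *s v + \<beta> *s w \<in> line v w" for \<alpha> \<beta> by (auto simp: line_def)
  show "v \<in> line v w" "w \<in> line v w" using *[of 1 0] *[of 0 1] by simp_all
qed

lemma line_span: "line v w = vec.span {v, w}"
proof (rule antisym)
  show "line v w \<subseteq> vec.span {v, w}"
  proof
    fix x assume "x \<in> line v w"
    then obtain p q where x: "x = p *s v + q *s w" by (auto simp: line_def)
    show "x \<in> vec.span {v, w}"
      unfolding x by (rule vec.span_add; rule vec.span_scale; rule vec.span_base) simp_all
  qed
  show "vec.span {v, w} \<subseteq> line v w"
    by (rule vec.span_minimal[OF _ line_subspace]) (auto intro: in_line)
qed

lemma proportional:
  fixes v w :: "'a::field ^ 'n"
  assumes "\<And>i j. v $ i * w $ j = v $ j * w $ i" "v \<noteq> 0"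
  obtains c where "w = c *s v"
proof -
  obtain i where i: "v $ i \<noteq> 0" using assms(2) by (auto simp: Finite_Cartesian_Product.vec_eq_iff)
  have "w = (w $ i / v $ i) *s v"
  proof (rule Finite_Cartesian_Product.vec_eq_iff[THEN iffD2], rule allI)
    fix j
    show "w $ j = ((w $ i / v $ i) *s v) $ j" using assms(1)[of i j] i by (simp add: field_simps)
  qed
  then show thesis by (rule that)
qed

lemma line_Gr1:
  fixes v w :: "'a::field ^ 'n"
  assumes "v $ i * w $ j \<noteq> v $ j * w $ i"
  shows "line v w \<in> Gr 1"
proof -
  have "v \<noteq> 0" using assms by auto
  have "w \<noteq> c *s v" for c using assms by auto
  then have "w \<notin> vec.span {v}" by (auto simp: vec.span_singleton)
  then have "vec.independent {w, v}" using \<open>v \<noteq> 0\<close> by (auto simp: vec.independent_insert)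
  moreover have "w \<noteq> v" using assms by auto
  ultimately have "vec.dim (vec.span {w, v}) = 2" by (simp add: vec.dim_eq_card_independent)
  then show ?thesis by (simp add: Gr_def line_span insert_commute)
qed

lemma Gr1E:
  fixes L :: "('a::field ^ 'n) set"
  assumes L: "L \<in> Gr 1" "u \<in> L" "u \<noteq> 0"
  obtains v i j where "L = line v u" "v $ i * u $ j \<noteq> v $ j * u $ i"
proof -
  have sub: "vec.subspace L" and dim: "vec.dim L = 2" using L by (auto simp: Gr_def)
  have "\<not> L \<subseteq> vec.span {u}"
  proof
    assume "L \<subseteq> vec.span {u}"
    then have "vec.dim L \<le> vec.dim (vec.span {u})" by (rule vec.dim_subset)
    then show False using dim L(3) by simp
  qed
  then obtain v where v: "v \<in> L" "v \<notin> vec.span {u}" by blast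
  have "\<exists>i j. v $ i * u $ j \<noteq> v $ j * u $ i"
  proof (rule ccontr)
    assume "\<not> ?thesis"
    then have "u $ i * v $ j = u $ j * v $ i" for i j by (metis mult.commute)
    then obtain c where "v = c *s u" using L(3) by (rule proportional)
    with v show False by (auto simp: vec.span_singleton)
  qed
  then obtain i j where ij: "v $ i * u $ j \<noteq> v $ j * u $ i" by blast
  have "line v u \<subseteq> L" unfolding line_span using v L sub by (intro vec.span_minimal) auto
  moreover have "vec.dim (line v u) = 2" using line_Gr1[OF ij] by (simp add: Gr_def)
  ultimately have "line v u = L" using vec.subspace_dim_equal[OF line_subspace sub] dim by simp
  with ij that show thesis by blast
qed

text \<open>Cramer's rule in the coordinates i and j, whose minor is nonzero. The functional serves
  as a coordinate on the line through \<open>v\<close> and \<open>w\<close>.\<close>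

lemma dual_pair:
  fixes v w :: "'a::field ^ 'n"
  assumes "v $ i * w $ j \<noteq> v $ j * w $ i"
  obtains c where "(\<Sum>k\<in>UNIV. c k * v $ k) = 1" "(\<Sum>k\<in>UNIV. c k * w $ k) = 0"
proof -
  define D where "D = v $ i * w $ j - v $ j * w $ i"
  have D: "D \<noteq> 0" using assms by (simp add: D_def)
  define c where "c k = (if k = i then w $ j / D else 0) - (if k = j then w $ i / D else 0)" for k
  have sum: "(\<Sum>k\<in>UNIV. c k * z $ k) = (w $ j * z $ i - w $ i * z $ j) / D" for z
  proof -
    have "(\<Sum>k\<in>UNIV. c k * z $ k) = (\<Sum>k\<in>UNIV. if k = i then w $ j / D * z $ i else 0) - (\<Sum>k\<in>UNIV. if k = j then w $ i / D * z $ j else 0)"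
      unfolding sum_subtractf[symmetric] by (rule sum.cong) (auto simp: c_def left_diff_distrib)
    then show ?thesis by (simp add: diff_divide_distrib)
  qed
  show thesis
    by (rule that[of c]) (use D in \<open>simp_all add: sum D_def mult.commute\<close>)
qed

abbreviation restr_line :: "'a ^ 'n \<Rightarrow> 'a ^ 'n \<Rightarrow> ('n::finite, 'a::comm_ring_1) mpoly \<Rightarrow> 'a poly" where
  "restr_line v w \<equiv> restr (($) v) (($) w)"

lemma poly_restr_line: "poly (restr_line v w F) \<tau> = mp_value F (v + \<tau> *s w)"
  by (simp add: poly_restr mp_value_ev)

lemma restr_simps [simp]: "restr p q (F + G) = restr p q F + restr p q G" "restr p q (F * G) = restr p q F * restr p q G"
  "restr p q (F - G) = restr p q F - restr p q G" "restr p q 0 = 0" "restr p q (F ^ n) = restr p q F ^ n"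
  "restr p q (sum f A) = (\<Sum>k\<in>A. restr p q (f k))" "restr p q 1 = 1"
proof -
  interpret comm_ring_hom "restr p q" by (rule restr_hom)
  show "restr p q (F + G) = restr p q F + restr p q G" "restr p q (F * G) = restr p q F * restr p q G"
  "restr p q (F - G) = restr p q F - restr p q G" "restr p q 0 = 0" "restr p q (F ^ n) = restr p q F ^ n"
  "restr p q (sum f A) = (\<Sum>k\<in>A. restr p q (f k))" "restr p q 1 = 1"
    by (simp_all add: hom_add hom_mult hom_minus hom_power hom_sum hom_one)
qed

lemma restr_const: "restr p q (mp_const c) = [:c:]"
  unfolding restr_def by (rule mp_eval_const[OF pCons_hom])

lemma restr_var: "restr p q (mp_var i) = [:p i, q i:]"
  unfolding restr_def by (rule mp_eval_var[OF pCons_hom])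

lemma top_coeff_mult:
  fixes F G :: "'a::comm_ring_1 poly"
  assumes "degree F \<le> m" "degree G \<le> n"
  shows "degree (F * G) \<le> m + n" "coeff (F * G) (m + n) = coeff F m * coeff G n"
proof -
  show "degree (F * G) \<le> m + n" using degree_mult_le[of F G] assms by simp
  have "coeff (F * G) (m + n) = (\<Sum>i\<le>m+n. if i = m then coeff F m * coeff G n else 0)"
    unfolding coeff_mult
  proof (rule sum.cong)
    fix i assume "i \<in> {..m+n}"
    then show "coeff F i * coeff G (m + n - i) = (if i = m then coeff F m * coeff G n else 0)"
      using assms coeff_eq_0[of F i] coeff_eq_0[of G "m + n - i"] by (cases i m rule: linorder_cases) auto
  qed simp
  then show "coeff (F * G) (m + n) = coeff F m * coeff G n" by simp
qed

lemma top_coeff_power: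
  fixes F :: "'a::comm_ring_1 poly"
  assumes "degree F \<le> m"
  shows "degree (F ^ k) \<le> m * k \<and> coeff (F ^ k) (m * k) = coeff F m ^ k"
proof (induction k)
  case (Suc k)
  then show ?case using top_coeff_mult[OF assms, of "F ^ k" "m * k"] by simp
qed simp

lemma top_coeff_prod:
  fixes F :: "'i \<Rightarrow> 'a::comm_ring_1 poly"
  assumes "finite A" "\<And>i. i \<in> A \<Longrightarrow> degree (F i) \<le> m i"
  shows "degree (\<Prod>i\<in>A. F i) \<le> (\<Sum>i\<in>A. m i) \<and> coeff (\<Prod>i\<in>A. F i) (\<Sum>i\<in>A. m i) = (\<Prod>i\<in>A. coeff (F i) (m i))"
  using assms
proof (induction A)
  case (insert a A)
  then show ?case using top_coeff_mult[of "F a" "m a" "\<Prod>i\<in>A. F i" "\<Sum>i\<in>A. m i"] by simp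
qed simp

text \<open>The coefficient of degree n is the value at the point at infinity of the line p + tau q.
  The weights tell which coordinates move: all of them on a line in projective space, only s, t or
  only x in P^1 x P^2.\<close>

lemma restr_top:
  fixes F :: "('n::finite, 'a::comm_ring_1) mpoly"
  assumes F: "whom w n F" and w: "\<And>i. w i = 0 \<and> q i = 0 \<or> w i = 1"
  shows "degree (restr p q F) \<le> n" "coeff (restr p q F) n = ev F (\<lambda>i. if w i = 0 then p i else q i)"
proof -
  let ?t = "\<lambda>i. if w i = 0 then p i else q i"
  have base: "degree [:p i, q i:] \<le> w i \<and> coeff [:p i, q i:] (w i) = ?t i" for i
    using w[of i] by auto
  have mono: "degree (\<Prod>i\<in>UNIV. [:p i, q i:] ^ Poly_Mapping.lookup m i) \<le> n \<and>
      coeff (\<Prod>i\<in>UNIV. [:p i, q i:] ^ Poly_Mapping.lookup m i) n = (\<Prod>i\<in>UNIV. ?t i ^ Poly_Mapping.lookup m i)"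
    if "m \<in> Poly_Mapping.keys F" for m
  proof -
    have n: "(\<Sum>i\<in>UNIV. w i * Poly_Mapping.lookup m i) = n" using that F by (auto simp: whom_def wdeg_def)
    have pw: "degree ([:p i, q i:] ^ Poly_Mapping.lookup m i) \<le> w i * Poly_Mapping.lookup m i"
      "coeff ([:p i, q i:] ^ Poly_Mapping.lookup m i) (w i * Poly_Mapping.lookup m i) = ?t i ^ Poly_Mapping.lookup m i" for i
      using top_coeff_power[of "[:p i, q i:]" "w i" "Poly_Mapping.lookup m i"] base[of i] by auto
    show ?thesis
      using top_coeff_prod[of UNIV "\<lambda>i. [:p i, q i:] ^ Poly_Mapping.lookup m i" "\<lambda>i. w i * Poly_Mapping.lookup m i"] pw
      unfolding n by simp
  qed
  show "degree (restr p q F) \<le> n"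
    unfolding restr_def mp_eval_def
    by (rule degree_sum_le) (use mono degree_smult_le order_trans in \<open>fastforce+\<close>)
  show "coeff (restr p q F) n = ev F ?t"
    unfolding restr_def mp_eval_def coeff_sum
    by (rule sum.cong) (use mono in auto)
qed

lemma restr_line_forms:
  assumes "F \<in> forms n"
  shows "degree (restr_line v w F) \<le> n" "coeff (restr_line v w F) n = mp_value F w"
  using restr_top[of "\<lambda>_. 1" n F "($) w" "($) v"] assms by (auto simp: forms_whom mp_value_ev)

lemma poly_eqI_infinite:
  fixes p q :: "'a::alg_closed_field poly"
  assumes "\<And>\<tau>. poly p \<tau> = poly q \<tau>"
  shows "p = q"
proof -
  have "p - q = 0" by (rule poly_eq_0_of_infinite[OF infinite_alg_closed]) (simp add: assms)
  then show ?thesis by simp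
qed

lemma restr_line_surj:
  fixes v w :: "'a::alg_closed_field ^ 'n"
  assumes ij: "v $ i * w $ j \<noteq> v $ j * w $ i" and Q: "degree Q \<le> n"
  obtains F where "F \<in> forms n" "restr_line v w F = Q"
proof -
  obtain c where c: "(\<Sum>k\<in>UNIV. c k * v $ k) = 1" "(\<Sum>k\<in>UNIV. c k * w $ k) = 0" by (rule dual_pair[OF ij])
  have "w $ i * v $ j \<noteq> w $ j * v $ i" using ij by (metis mult.commute)
  then obtain e where e: "(\<Sum>k\<in>UNIV. e k * w $ k) = 1" "(\<Sum>k\<in>UNIV. e k * v $ k) = 0" by (rule dual_pair)
  define lv :: "('n, 'a) mpoly" where "lv = (\<Sum>i\<in>UNIV. mp_const (c i) * mp_var i)"
  define lw :: "('n, 'a) mpoly" where "lw = (\<Sum>i\<in>UNIV. mp_const (e i) * mp_var i)"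
  have l: "lv \<in> forms 1" "lw \<in> forms 1" unfolding lv_def lw_def by (rule linear_form)+
  have val: "mp_value lv (v + \<tau> *s w) = 1" "mp_value lw (v + \<tau> *s w) = \<tau>" for \<tau>
  proof -
    have "(\<Sum>k\<in>UNIV. c k * (v + \<tau> *s w) $ k) = (\<Sum>k\<in>UNIV. c k * v $ k) + \<tau> * (\<Sum>k\<in>UNIV. c k * w $ k)"
      "(\<Sum>k\<in>UNIV. e k * (v + \<tau> *s w) $ k) = (\<Sum>k\<in>UNIV. e k * v $ k) + \<tau> * (\<Sum>k\<in>UNIV. e k * w $ k)"
      by (simp_all add: distrib_left sum.distrib sum_distrib_left mult.left_commute)
    then show "mp_value lv (v + \<tau> *s w) = 1" "mp_value lw (v + \<tau> *s w) = \<tau>"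
      by (simp_all add: lv_def lw_def c e)
  qed
  define F where "F = (\<Sum>k\<le>n. mp_const (coeff Q k) * (lw ^ k * lv ^ (n - k)))"
  have "F \<in> forms n"
    unfolding F_def forms_whom mem_Collect_eq
  proof (rule whom_sum)
    fix k assume "k \<in> {..n}"
    have "whom (\<lambda>_. 1) (0 + (1 * k + 1 * (n - k))) (mp_const (coeff Q k) * (lw ^ k * lv ^ (n - k)))"
      using l unfolding forms_whom mem_Collect_eq by (intro whom_mult whom_const whom_power)
    with \<open>k \<in> {..n}\<close> show "whom (\<lambda>_. 1) n (mp_const (coeff Q k) * (lw ^ k * lv ^ (n - k)))" by simp
  qed
  moreover have "restr_line v w F = Q"
  proof (rule poly_eqI_infinite)
    fix \<tau>
    have "poly (restr_line v w F) \<tau> = (\<Sum>k\<le>n. coeff Q k * \<tau> ^ k)"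
      unfolding poly_restr_line F_def mp_value_simps val by simp
    also have "\<dots> = poly Q \<tau>"
      unfolding poly_altdef by (rule sum.mono_neutral_right) (use Q in \<open>auto simp: coeff_eq_0\<close>)
    finally show "poly (restr_line v w F) \<tau> = poly Q \<tau>" .
  qed
  ultimately show thesis by (rule that)
qed

lemma points_line:
  fixes v w :: "'a::field ^ 'n"
  assumes "F \<in> forms n" "restr_line v w F = 0"
  shows "F \<in> vanishing_ideal (points (line v w))"
proof (rule vanishing_idealI)
  show "homogeneous F" using assms by (auto simp: homogeneous_def)
  have "mp_value F u = 0" if "u \<in> line v w" for u
  proof -
    obtain \<alpha> \<beta> where u: "u = \<alpha> *s v + \<beta> *s w" using \<open>u \<in> line v w\<close> by (auto simp: line_def)
    show ?thesis
    proof (cases "\<alpha> = 0")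
      case True
      have "mp_value F w = 0" using restr_line_forms(2)[OF assms(1), of v w] assms(2) by simp
      then show ?thesis using True forms_scale[OF assms(1), of \<beta> w] by (simp add: u)
    next
      case False
      have eq: "u = \<alpha> *s (v + (\<beta> / \<alpha>) *s w)" using False by (simp add: u vec.scale_right_distrib)
      have "mp_value F (v + (\<beta> / \<alpha>) *s w) = 0" using poly_restr_line[of v w F "\<beta> / \<alpha>"] assms(2) by simp
      moreover have "mp_value F u = \<alpha> ^ n * mp_value F (v + (\<beta> / \<alpha>) *s w)"
        by (subst eq) (rule forms_scale[OF assms(1)])
      ultimately show ?thesis by simp
    qed
  qed
  then show "vanishes F (points (line v w))" by (auto simp: vanishes_def points_def)
qed

lemma vanishing_ideal_line:
  fixes v w :: "'a::alg_closed_field ^ 'n"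
  assumes "vanishes F (points (line v w))" and ij: "v $ i * w $ j \<noteq> v $ j * w $ i"
  shows "restr_line v w F = 0"
proof (rule poly_eq_0_of_infinite[OF infinite_alg_closed])
  fix \<tau>
  let ?u = "v + \<tau> *s w"
  have "?u \<noteq> 0"
  proof
    assume "?u = 0"
    then have "?u $ k = 0" for k by simp
    then have "v $ k = - \<tau> * w $ k" for k by (simp add: eq_neg_iff_add_eq_0)
    with ij show False by simp
  qed
  moreover have "vec.span {?u} \<subseteq> line v w"
    by (rule vec.span_minimal[OF _ line_subspace]) (use in_line(1)[of 1 v \<tau> w] in simp)
  ultimately have "vec.span {?u} \<in> points (line v w)" by (simp add: points_def span_singleton_proj)
  then have "mp_value F ?u = 0" using assms(1) vec.span_base[of ?u "{?u}"] unfolding vanishes_def by blast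
  then show "poly (restr_line v w F) \<tau> = 0" by (simp add: poly_restr_line)
qed

section \<open>Hilbert functions by linear algebra\<close>

lemma forms_subspace: "mpoly.subspace (forms n :: ('n::finite, 'a::field) mpoly set)"
proof (rule mpoly.subspaceI)
  fix c :: 'a and x y :: "('n, 'a) mpoly" assume x: "x \<in> forms n"
  then show "mp_const c * x \<in> forms n" using whom_mult[OF whom_const, of "\<lambda>_. 1" n x c] by (simp add: forms_whom)
  show "x + y \<in> forms n" if "y \<in> forms n" using x that by (simp add: forms_whom whom_add)
qed (simp add: forms_whom)

lemma ideal_subspace: "ideal.subspace J \<Longrightarrow> mpoly.subspace J"
  for J :: "('n::finite, 'a::field) mpoly set"
  by (auto simp: mpoly.subspace_def ideal.subspace_def)

lemma forms_finite_span:
  obtains T where "finite T" "(forms n :: ('n::finite, 'a::field) mpoly set) \<subseteq> mpoly.span T"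
proof -
  define M where "M = {m :: 'n \<Rightarrow>\<^sub>0 nat. (\<Sum>i\<in>UNIV. Poly_Mapping.lookup m i) = n}"
  have "M \<subseteq> Poly_Mapping.lookup -` {g. \<forall>i. (i \<in> UNIV \<longrightarrow> g i \<in> {..n}) \<and> (i \<notin> UNIV \<longrightarrow> g i = 0)}"
  proof
    fix m assume m: "m \<in> M"
    from m have e: "(\<Sum>i\<in>UNIV. Poly_Mapping.lookup m i) = n" by (simp only: M_def mem_Collect_eq)
    have "Poly_Mapping.lookup m i \<le> (\<Sum>i\<in>UNIV. Poly_Mapping.lookup m i)" for i
      by (rule member_le_sum) auto
    then have "Poly_Mapping.lookup m i \<le> n" for i unfolding e .
    then show "m \<in> Poly_Mapping.lookup -` {g. \<forall>i. (i \<in> UNIV \<longrightarrow> g i \<in> {..n}) \<and> (i \<notin> UNIV \<longrightarrow> g i = 0)}"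
      by simp
  qed
  moreover have "finite (Poly_Mapping.lookup -` {g :: 'n \<Rightarrow> nat. \<forall>i. (i \<in> UNIV \<longrightarrow> g i \<in> {..n}) \<and> (i \<notin> UNIV \<longrightarrow> g i = 0)})"
    by (intro finite_vimageI finite_set_of_finite_funs injI) (simp_all add: poly_mapping.lookup_inject)
  ultimately have fin: "finite M" by (rule finite_subset)
  show thesis
  proof (rule that[of "(\<lambda>m. Poly_Mapping.single m (1 :: 'a)) ` M"])
    show "finite ((\<lambda>m. Poly_Mapping.single m (1 :: 'a)) ` M)" using fin by simp
    show "forms n \<subseteq> mpoly.span ((\<lambda>m. Poly_Mapping.single m (1 :: 'a)) ` M)"
    proof
      fix F :: "('n, 'a) mpoly" assume F: "F \<in> forms n"
      have "F = (\<Sum>m\<in>Poly_Mapping.keys F. mp_const (Poly_Mapping.lookup F m) * Poly_Mapping.single m 1)"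
        using mpoly_sum_monomials[of F] by (simp add: mp_const_def mult_single)
      moreover have "(\<Sum>m\<in>Poly_Mapping.keys F. mp_const (Poly_Mapping.lookup F m) * Poly_Mapping.single m 1) \<in>
          mpoly.span ((\<lambda>m. Poly_Mapping.single m (1 :: 'a)) ` M)"
        by (intro mpoly.span_sum mpoly.span_scale mpoly.span_base) (use F in \<open>auto simp: forms_def M_def\<close>)
      ultimately show "F \<in> mpoly.span ((\<lambda>m. Poly_Mapping.single m (1 :: 'a)) ` M)" by simp
    qed
  qed
qed

lemma dim_le_codim:
  fixes V U :: "('n::finite, 'a::field) mpoly set"
  assumes V: "V \<subseteq> mpoly.span T" "finite T" and U: "U \<subseteq> V"
    and gen: "V \<subseteq> mpoly.span (U \<union> w ` {..<e::nat})"
  shows "mpoly.dim V \<le> mpoly.dim U + e"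
proof -
  obtain B where B: "B \<subseteq> U" "mpoly.independent B" "U \<subseteq> mpoly.span B" "card B = mpoly.dim U"
    by (rule mpoly.basis_exists)
  obtain C where C: "C \<subseteq> V" "mpoly.independent C" "V \<subseteq> mpoly.span C" "card C = mpoly.dim V"
    by (rule mpoly.basis_exists)
  have finB: "finite B" using mpoly.independent_span_bound[OF V(2) B(2)] B(1) U V(1) by blast
  let ?W = "B \<union> w ` {..<e}"
  have "U \<union> w ` {..<e} \<subseteq> mpoly.span ?W"
    using B(3) mpoly.span_mono[of B ?W] mpoly.span_superset[of ?W] by blast
  then have "mpoly.span (U \<union> w ` {..<e}) \<subseteq> mpoly.span ?W" by (intro mpoly.span_minimal mpoly.subspace_span)
  then have "C \<subseteq> mpoly.span ?W" using C(1) gen by blast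
  then have "card C \<le> card ?W" using mpoly.independent_span_bound[OF _ C(2)] finB by simp
  also have "\<dots> \<le> card B + card (w ` {..<e})" by (rule card_Un_le)
  also have "\<dots> \<le> card B + e" using card_image_le[of "{..<e}" w] by simp
  finally show ?thesis using B C by simp
qed

text \<open>A basis of \<open>U\<close> stays independent while the \<open>w k\<close> are adjoined
  one by one: the auxiliary set \<open>S\<close> contains the span reached so far, and membership of
  \<open>w k\<close> in it would be a relation modulo \<open>U\<close> with coefficient 1 at
  k.\<close>

lemma dim_ge_codim:
  fixes V U :: "('n::finite, 'a::field) mpoly set"
  assumes V: "V \<subseteq> mpoly.span T" "finite T" and U: "U \<subseteq> V" "mpoly.subspace U"
    and w: "\<And>i. i < e \<Longrightarrow> w i \<in> V"
    and ind: "\<And>c. (\<Sum>i<e. mp_const (c i) * w i) \<in> U \<Longrightarrow> \<forall>i<e. c i = 0"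
  shows "mpoly.dim U + e \<le> mpoly.dim V"
proof -
  obtain B where B: "B \<subseteq> U" "mpoly.independent B" "U \<subseteq> mpoly.span B" "card B = mpoly.dim U"
    by (rule mpoly.basis_exists)
  obtain C where C: "C \<subseteq> V" "mpoly.independent C" "V \<subseteq> mpoly.span C" "card C = mpoly.dim V"
    by (rule mpoly.basis_exists)
  have finB: "finite B" and finC: "finite C"
    using mpoly.independent_span_bound[OF V(2) B(2)] mpoly.independent_span_bound[OF V(2) C(2)] B(1) C(1) U(1) V(1) by blast+
  have "mpoly.independent (B \<union> w ` {..<k}) \<and> card (B \<union> w ` {..<k}) = card B + k" if "k \<le> e" for k
    using that
  proof (induction k)
    case (Suc k)
    define S where "S = {u + (\<Sum>i<k. mp_const (c i) * w i) | u c. u \<in> U}"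
    have subS: "mpoly.subspace S"
      unfolding mpoly.subspace_def
    proof (intro conjI ballI allI)
      have "0 + (\<Sum>i<k. mp_const 0 * w i) \<in> S" unfolding S_def using mpoly.subspace_0[OF U(2)]
        by (intro CollectI exI[of _ 0] exI[of _ "\<lambda>_. 0"]) simp
      then show "0 \<in> S" by (simp add: mp_const_def)
    next
      fix x y assume "x \<in> S" "y \<in> S"
      then obtain u c u' c' where *: "x = u + (\<Sum>i<k. mp_const (c i) * w i)" "u \<in> U"
        "y = u' + (\<Sum>i<k. mp_const (c' i) * w i)" "u' \<in> U" unfolding S_def by blast
      have "x + y = (u + u') + (\<Sum>i<k. mp_const (c i + c' i) * w i)"
        by (simp add: * mp_const_def single_add distrib_right sum.distrib)
      moreover have "u + u' \<in> U" using * U(2) by (intro mpoly.subspace_add)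
      ultimately show "x + y \<in> S" unfolding S_def
        by (intro CollectI exI[of _ "u + u'"] exI[of _ "\<lambda>i. c i + c' i"] conjI)
    next
      fix a x assume "x \<in> S"
      then obtain u c where *: "x = u + (\<Sum>i<k. mp_const (c i) * w i)" "u \<in> U" unfolding S_def by blast
      have "mp_const a * x = mp_const a * u + (\<Sum>i<k. mp_const (a * c i) * w i)"
        by (simp add: * distrib_left sum_distrib_left mp_const_def mult_single flip: mult.assoc)
      moreover have "mp_const a * u \<in> U" using * U(2) by (intro mpoly.subspace_scale)
      ultimately show "mp_const a * x \<in> S" unfolding S_def
        by (intro CollectI exI[of _ "mp_const a * u"] exI[of _ "\<lambda>i. a * c i"] conjI)
    qed
    have "B \<union> w ` {..<k} \<subseteq> S"
    proof
      fix x assume "x \<in> B \<union> w ` {..<k}"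
      then consider "x \<in> U" | j where "j < k" "x = w j" using B(1) by auto
      then show "x \<in> S"
      proof cases
        case 1
        have "x = x + (\<Sum>i<k. mp_const 0 * w i)" by (simp add: mp_const_def)
        with 1 show ?thesis unfolding S_def
          by (intro CollectI exI[of _ x] exI[of _ "\<lambda>i. 0"] conjI)
      next
        case 2
        have "(\<Sum>i<k. mp_const (if i = j then 1 else 0) * w i) = (\<Sum>i<k. if i = j then w j else 0)"
          by (rule sum.cong) (auto simp: mp_const_def)
        then have "x = 0 + (\<Sum>i<k. mp_const (if i = j then 1 else 0) * w i)" using 2 by simp
        with mpoly.subspace_0[OF U(2)] show ?thesis unfolding S_def
          by (intro CollectI exI[of _ 0] exI[of _ "\<lambda>i. if i = j then 1 else 0"] conjI)
      qed
    qed
    then have spS: "mpoly.span (B \<union> w ` {..<k}) \<subseteq> S" by (rule mpoly.span_minimal[OF _ subS])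
    have notin: "w k \<notin> mpoly.span (B \<union> w ` {..<k})"
    proof
      assume "w k \<in> mpoly.span (B \<union> w ` {..<k})"
      then obtain u c where uc: "w k = u + (\<Sum>i<k. mp_const (c i) * w i)" "u \<in> U" using spS unfolding S_def by blast
      define c' where "c' i = (if i < k then - c i else if i = k then 1 else 0)" for i
      have "(\<Sum>i<e. mp_const (c' i) * w i) = (\<Sum>i<Suc k. mp_const (c' i) * w i)"
        by (rule sum.mono_neutral_right) (use Suc.prems in \<open>auto simp: c'_def mp_const_def\<close>)
      also have "\<dots> = w k + (\<Sum>i<k. - (mp_const (c i) * w i))"
        by (simp add: c'_def mp_const_def single_uminus add.commute)
      also have "\<dots> = u" by (subst uc(1)) (simp add: sum_negf)
      finally have "\<forall>i<e. c' i = 0" using uc(2) ind by metis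
      then have "c' k = 0" using Suc.prems by simp
      then show False by (simp add: c'_def)
    qed
    then have "w k \<notin> B \<union> w ` {..<k}" using mpoly.span_base[of "w k" "B \<union> w ` {..<k}"] by blast
    moreover have eq: "B \<union> w ` {..<Suc k} = insert (w k) (B \<union> w ` {..<k})" unfolding lessThan_Suc by simp
    ultimately show ?case
      using Suc notin finB by (simp add: eq mpoly.independent_insert)
  qed (use B in simp)
  then have ind': "mpoly.independent (B \<union> w ` {..<e})" "card (B \<union> w ` {..<e}) = card B + e" by auto
  have "B \<union> w ` {..<e} \<subseteq> mpoly.span C" using B(1) U(1) w C(3) by blast
  then have "card (B \<union> w ` {..<e}) \<le> card C" using mpoly.independent_span_bound[OF finC ind'(1)] by blast
  with ind'(2) B C show ?thesis by simp
qed

text \<open>Euclidean division by \<open>\<phi>\<close> on the line: modulo \<open>J\<close> every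
  form of degree n is a combination of the forms \<open>g k\<close> that restrict to the powers of
  the parameter below the degree of \<open>\<phi>\<close>.\<close>

lemma hilbert_function_le:
  fixes v w :: "'a::alg_closed_field ^ 'n"
  assumes ij: "v $ i * w $ j \<noteq> v $ j * w $ i" and \<phi>: "\<phi> \<noteq> 0" "degree \<phi> \<le> n"
    and J: "\<And>F. F \<in> forms n \<Longrightarrow> \<phi> dvd restr_line v w F \<Longrightarrow> F \<in> J"
  shows "hilbert_function J n \<le> degree \<phi>"
proof -
  obtain T where T: "finite T" "(forms n :: ('n, 'a) mpoly set) \<subseteq> mpoly.span T" by (rule forms_finite_span)
  have "\<exists>F. F \<in> forms n \<and> restr_line v w F = monom 1 k" if "k \<le> n" for k
  proof -
    have "degree (monom (1 :: 'a) k) \<le> n" using that by (simp add: degree_monom_eq)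
    then obtain F where "F \<in> forms n" "restr_line v w F = monom 1 k" by (rule restr_line_surj[OF ij])
    then show ?thesis by blast
  qed
  then obtain g where g: "\<And>k. k \<le> n \<Longrightarrow> g k \<in> forms n" "\<And>k. k \<le> n \<Longrightarrow> restr_line v w (g k) = monom 1 k" by metis
  have "forms n \<subseteq> mpoly.span (forms n \<inter> J \<union> g ` {..<degree \<phi>})"
  proof
    fix F :: "('n, 'a) mpoly" assume F: "F \<in> forms n"
    define r where "r = restr_line v w F mod \<phi>"
    have dr: "r = 0 \<or> degree r < degree \<phi>" using degree_mod_less[OF \<phi>(1)] by (simp add: r_def)
    define H where "H = (\<Sum>k<degree \<phi>. mp_const (coeff r k) * g k)"
    have Hs: "H \<in> mpoly.span (forms n \<inter> J \<union> g ` {..<degree \<phi>})"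
      unfolding H_def by (intro mpoly.span_sum mpoly.span_scale mpoly.span_base) auto
    have Hf: "H \<in> forms n"
      unfolding H_def
      by (intro mpoly.subspace_sum[OF forms_subspace] mpoly.subspace_scale[OF forms_subspace] g) (use \<phi>(2) in auto)
    have "restr_line v w H = (\<Sum>k<degree \<phi>. monom (coeff r k) k)"
      unfolding H_def restr_simps
      by (rule sum.cong) (use \<phi>(2) in \<open>auto simp: restr_const g(2) smult_monom\<close>)
    also have "\<dots> = r"
    proof (rule poly_eqI)
      fix k
      have "coeff (\<Sum>k<degree \<phi>. monom (coeff r k) k) k = (\<Sum>i<degree \<phi>. if i = k then coeff r k else 0)"
        unfolding coeff_sum by (rule sum.cong) auto
      also have "\<dots> = coeff r k" using dr coeff_eq_0[of r k] by auto
      finally show "coeff (\<Sum>k<degree \<phi>. monom (coeff r k) k) k = coeff r k" .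
    qed
    finally have "restr_line v w (F - H) = restr_line v w F - restr_line v w F mod \<phi>" by (simp add: r_def)
    then have "\<phi> dvd restr_line v w (F - H)" by (simp add: minus_mod_eq_mult_div)
    moreover have "F - H \<in> forms n" using F Hf by (rule mpoly.subspace_diff[OF forms_subspace])
    ultimately have "F - H \<in> forms n \<inter> J" using J by blast
    then have "F - H \<in> mpoly.span (forms n \<inter> J \<union> g ` {..<degree \<phi>})" by (intro mpoly.span_base) simp
    from mpoly.span_add[OF this Hs] show "F \<in> mpoly.span (forms n \<inter> J \<union> g ` {..<degree \<phi>})" by simp
  qed
  from dim_le_codim[OF T(2,1) _ this] show ?thesis by (simp add: hilbert_function_def)
qed

text \<open>Forms \<open>g k\<close> restricting to the first \<open>e\<close> powers of the
  parameter are independent modulo \<open>J\<close>, as a combination of them restricts to a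
  polynomial of degree below \<open>e\<close>. They exist in degree n as long as \<open>e\<close> is
  at most n + 1.\<close>

lemma hilbert_function_ge:
  fixes v w :: "'a::alg_closed_field ^ 'n"
  assumes ij: "v $ i * w $ j \<noteq> v $ j * w $ i" and e: "e \<le> n + 1" and sub: "ideal.subspace J"
    and J: "\<And>F. F \<in> forms n \<Longrightarrow> F \<in> J \<Longrightarrow> degree (restr_line v w F) < e \<Longrightarrow> restr_line v w F = 0"
  shows "e \<le> hilbert_function J n"
proof -
  obtain T where T: "finite T" "(forms n :: ('n, 'a) mpoly set) \<subseteq> mpoly.span T" by (rule forms_finite_span)
  have "\<exists>F. F \<in> forms n \<and> restr_line v w F = monom 1 k" if "k \<le> n" for k
  proof -
    have "degree (monom (1 :: 'a) k) \<le> n" using that by (simp add: degree_monom_eq)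
    then obtain F where "F \<in> forms n" "restr_line v w F = monom 1 k" by (rule restr_line_surj[OF ij])
    then show ?thesis by blast
  qed
  then obtain g where g: "\<And>k. k \<le> n \<Longrightarrow> g k \<in> forms n" "\<And>k. k \<le> n \<Longrightarrow> restr_line v w (g k) = monom 1 k" by metis
  have "mpoly.subspace (forms n \<inter> J)"
    using forms_subspace ideal_subspace[OF sub] by (rule mpoly.subspace_inter)
  moreover have "\<forall>k<e. c k = 0" if c: "(\<Sum>k<e. mp_const (c k) * g k) \<in> forms n \<inter> J" for c
  proof (cases "e = 0")
    case False
    define r where "r = (\<Sum>k<e. monom (c k) k)"
    have r: "restr_line v w (\<Sum>k<e. mp_const (c k) * g k) = r"
      unfolding r_def restr_simps
      by (rule sum.cong) (use e in \<open>auto simp: restr_const g(2) smult_monom\<close>)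
    have cr: "coeff r k = (if k < e then c k else 0)" for k
    proof -
      have "coeff r k = (\<Sum>i<e. if i = k then c k else 0)" unfolding r_def coeff_sum by (rule sum.cong) auto
      then show ?thesis by simp
    qed
    then have "degree r \<le> e - 1" by (intro degree_le) auto
    then have "degree r < e" using False by simp
    have "restr_line v w (\<Sum>k<e. mp_const (c k) * g k) = 0"
      by (rule J) (use c \<open>degree r < e\<close> in \<open>simp_all only: r Int_iff\<close>)
    then have "r = 0" by (simp only: r)
    then show ?thesis using cr by (metis coeff_0)
  qed simp
  ultimately have "mpoly.dim (forms n \<inter> J) + e \<le> mpoly.dim (forms n :: ('n, 'a) mpoly set)"
    by (intro dim_ge_codim[OF T(2,1), where w = g]) (use g e in auto)
  then show ?thesis by (simp add: hilbert_function_def)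
qed

section \<open>Saturation and intersections of subschemes\<close>

lemma saturation_ideal:
  fixes I :: "('n::finite, 'a::comm_ring_1) mpoly set"
  assumes I: "ideal.subspace I"
  shows "ideal.subspace (saturation I)" "I \<subseteq> saturation I"
proof -
  have up: "mp_var i ^ N * f \<in> I" if "mp_var i ^ M * f \<in> I" "M \<le> N" for i M N f
  proof -
    have "mp_var i ^ (N - M) * (mp_var i ^ M * f) \<in> I" by (rule ideal.subspace_scale[OF I that(1)])
    then show ?thesis using that(2) by (simp flip: mult.assoc power_add)
  qed
  show "ideal.subspace (saturation I)"
    unfolding ideal.subspace_def
  proof (intro conjI ballI allI)
    show "0 \<in> saturation I" using ideal.subspace_0[OF I] by (auto simp: saturation_def)
  next
    fix f g assume "f \<in> saturation I" "g \<in> saturation I"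
    then obtain M N where MN: "\<And>i. mp_var i ^ M * f \<in> I" "\<And>i. mp_var i ^ N * g \<in> I" by (auto simp: saturation_def)
    have "mp_var i ^ max M N * f \<in> I" "mp_var i ^ max M N * g \<in> I" for i
      by (rule up[OF MN(1) max.cobounded1], rule up[OF MN(2) max.cobounded2])
    then have "mp_var i ^ max M N * f + mp_var i ^ max M N * g \<in> I" for i by (intro ideal.subspace_add[OF I])
    then show "f + g \<in> saturation I" unfolding saturation_def by (auto simp: distrib_left)
  next
    fix c f assume "f \<in> saturation I"
    then obtain M where M: "\<And>i. mp_var i ^ M * f \<in> I" by (auto simp: saturation_def)
    have "c * (mp_var i ^ M * f) \<in> I" for i by (rule ideal.subspace_scale[OF I M])
    then show "c * f \<in> saturation I" unfolding saturation_def by (auto simp: mult.left_commute)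
  qed
  show "I \<subseteq> saturation I"
    unfolding saturation_def by (auto intro!: exI[of _ 0])
qed

lemma saturation_mono: "I \<subseteq> J \<Longrightarrow> saturation I \<subseteq> saturation J"
  by (auto simp: saturation_def)

lemma saturation_idem:
  fixes I :: "('n::finite, 'a::comm_ring_1) mpoly set"
  assumes I: "ideal.subspace I"
  shows "saturation (saturation I) = saturation I"
proof (rule antisym)
  show "saturation I \<subseteq> saturation (saturation I)" by (rule saturation_ideal(2)[OF saturation_ideal(1)[OF I]])
  show "saturation (saturation I) \<subseteq> saturation I"
  proof
    fix f assume "f \<in> saturation (saturation I)"
    then obtain N where "\<And>i. mp_var i ^ N * f \<in> saturation I" by (auto simp: saturation_def)
    then have "\<exists>M. mp_var i ^ M * (mp_var i ^ N * f) \<in> I" for i by (auto simp: saturation_def)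
    then obtain M where M: "\<And>i. mp_var i ^ M i * (mp_var i ^ N * f) \<in> I" by metis
    define K where "K = (\<Sum>i\<in>UNIV. M i)"
    have "mp_var i ^ (K + N) * f \<in> I" for i
    proof -
      have "M i \<le> K" unfolding K_def by (rule member_le_sum) auto
      have "mp_var i ^ (K - M i) * (mp_var i ^ M i * (mp_var i ^ N * f)) \<in> I" by (rule ideal.subspace_scale[OF I M])
      moreover have "mp_var i ^ (K - M i) * (mp_var i ^ M i * (mp_var i ^ N * f)) = mp_var i ^ (K - M i + M i + N) * f"
        by (simp only: power_add mult.assoc)
      ultimately show ?thesis using \<open>M i \<le> K\<close> by simp
    qed
    then show "f \<in> saturation I" by (auto simp: saturation_def)
  qed
qed

lemma scheme_inter_ideal: "ideal.subspace (scheme_inter I J)" "I \<subseteq> scheme_inter I J" "J \<subseteq> scheme_inter I J"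
proof -
  note s = saturation_ideal[OF ideal.subspace_span[of "I \<union> J"]]
  show "ideal.subspace (scheme_inter I J)" unfolding scheme_inter_def by (rule s)
  show "I \<subseteq> scheme_inter I J" "J \<subseteq> scheme_inter I J"
    using s(2) ideal.span_superset[of "I \<union> J"] unfolding scheme_inter_def by blast+
qed

text \<open>If the subscheme of \<open>J\<close> lies in that of \<open>K\<close>, intersecting with
  \<open>K\<close> beforehand changes nothing. It is applied to a line inside a hyperplane.\<close>

lemma scheme_inter_absorb:
  assumes "K \<subseteq> J"
  shows "scheme_inter (scheme_inter I K) J = scheme_inter I J"
proof (rule antisym)
  have "scheme_inter I K \<subseteq> scheme_inter I J"
    unfolding scheme_inter_def using assms by (intro saturation_mono ideal.span_mono) blast
  then have "ideal.span (scheme_inter I K \<union> J) \<subseteq> scheme_inter I J"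
    using scheme_inter_ideal(3)[of J I] scheme_inter_ideal(1)[of I J] by (intro ideal.span_minimal) auto
  then have "scheme_inter (scheme_inter I K) J \<subseteq> saturation (scheme_inter I J)"
    unfolding scheme_inter_def[of "scheme_inter I K"] by (rule saturation_mono)
  also have "\<dots> = scheme_inter I J"
    unfolding scheme_inter_def by (rule saturation_idem[OF ideal.subspace_span])
  finally show "scheme_inter (scheme_inter I K) J \<subseteq> scheme_inter I J" .
  show "scheme_inter I J \<subseteq> scheme_inter (scheme_inter I K) J"
    unfolding scheme_inter_def[of _ J] using scheme_inter_ideal(2)[of I K] by (intro saturation_mono ideal.span_mono) blast
qed

lemma has_length_le: "has_length J l \<Longrightarrow> (\<And>n. n \<ge> N \<Longrightarrow> hilbert_function J n \<le> e) \<Longrightarrow> l \<le> e"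
  unfolding has_length_def eventually_sequentially by (metis nat_le_linear)

lemma has_lengthI: "(\<And>n. n \<ge> N \<Longrightarrow> hilbert_function J n = e) \<Longrightarrow> has_length J e"
  unfolding has_length_def eventually_sequentially by blast

lemma has_length_unbounded: "(\<And>n. n + 1 \<le> hilbert_function J n) \<Longrightarrow> \<not> has_length J l"
  unfolding has_length_def eventually_sequentially
  by (metis Suc_eq_plus1 Suc_n_not_le_n nat_le_linear order_trans le_add2 add.commute)

text \<open>Induction on the degree of \<open>\<phi>\<close>: at a root of \<open>\<phi>\<close>
  some \<open>p i\<close> is nonzero, so the corresponding linear factor must divide what is left of
  \<open>G\<close>.\<close>

lemma dvd_of_no_common_root:
  fixes \<phi> G :: "'a::alg_closed_field poly"
  assumes "\<phi> \<noteq> 0" "\<And>i. \<phi> dvd p i ^ N * G" "\<And>\<tau>. \<exists>i. poly (p i) \<tau> \<noteq> 0"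
  shows "\<phi> dvd G"
  using assms(1,2)
proof (induction "degree \<phi>" arbitrary: \<phi> G)
  case 0
  then obtain c where "\<phi> = [:c:]" by (metis degree_eq_zeroE)
  then have "\<phi> dvd 1" using 0 by (simp add: is_unit_const_poly_iff dvd_field_iff)
  then show ?case by (rule dvd_trans) simp
next
  case (Suc n)
  then obtain \<tau> where \<tau>: "poly \<phi> \<tau> = 0" using alg_closed_imp_poly_has_root[of \<phi>] by auto
  then obtain \<psi> where \<psi>: "\<phi> = [:- \<tau>, 1:] * \<psi>" by (auto simp: poly_eq_0_iff_dvd elim: dvdE)
  have \<psi>0: "\<psi> \<noteq> 0" using \<psi> Suc.prems by auto
  have "degree \<phi> = 1 + degree \<psi>" unfolding \<psi> by (subst degree_mult_eq) (use \<psi>0 in auto)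
  then have d: "n = degree \<psi>" using Suc.hyps by simp
  have "\<psi> dvd p i ^ N * G" for i using Suc.prems(2)[of i] unfolding \<psi> by (metis dvd_mult_right)
  from Suc.hyps(1)[OF d \<psi>0 this] obtain H where H: "G = \<psi> * H" by (rule dvdE)
  obtain i where i: "poly (p i) \<tau> \<noteq> 0" using assms(3) by blast
  have eq: "p i ^ N * G = \<psi> * (p i ^ N * H)" by (simp only: H mult.left_commute)
  have eq': "\<phi> = \<psi> * [:- \<tau>, 1:]" by (simp only: \<psi> mult.commute)
  have "\<psi> * [:- \<tau>, 1:] dvd \<psi> * (p i ^ N * H)"
    using Suc.prems(2)[of i] unfolding eq unfolding eq' .
  then have "[:- \<tau>, 1:] dvd p i ^ N * H" using \<psi>0 by (simp only: dvd_mult_cancel_left) simp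
  then have "poly (p i ^ N * H) \<tau> = 0" by (simp only: poly_eq_0_iff_dvd)
  then have "poly H \<tau> = 0" using i by simp
  then have "[:- \<tau>, 1:] dvd H" by (simp add: poly_eq_0_iff_dvd)
  then show ?case unfolding \<psi> H by (metis mult.commute mult_dvd_mono dvd_refl)
qed

text \<open>The variables restrict to the polynomials v_k + tau w_k, which have no common zero, so
  the powers introduced by saturation can be cancelled. The case \<open>\<phi> = 0\<close> is
  included because it treats lines contained in the surface.\<close>

lemma saturated_restr_line:
  fixes v w :: "'a::alg_closed_field ^ 'n"
  assumes ij: "v $ i * w $ j \<noteq> v $ j * w $ i"
    and I: "\<And>F. F \<in> I \<Longrightarrow> \<phi> dvd restr_line v w F" and F: "F \<in> scheme_inter I (vanishing_ideal (points (line v w)))"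
  shows "\<phi> dvd restr_line v w F"
proof -
  have sp: "\<phi> dvd restr_line v w G" if "G \<in> ideal.span (I \<union> vanishing_ideal (points (line v w)))" for G
    using that
  proof (induction rule: ideal.span_induct_alt)
    case (step c x y)
    have "\<phi> dvd restr_line v w x"
      using step.hyps I vanishing_ideal_line[OF vanishing_ideal_vanishes ij] by (metis Un_iff dvd_0_right)
    with step show ?case by simp
  qed simp
  obtain N where N: "\<And>k. mp_var k ^ N * F \<in> ideal.span (I \<union> vanishing_ideal (points (line v w)))"
    using F unfolding scheme_inter_def saturation_def by blast
  then have dvd: "\<phi> dvd [:v $ k, w $ k:] ^ N * restr_line v w F" for k
    using sp[OF N[of k]] by (simp only: restr_simps restr_var)
  have root: "\<exists>k. poly [:v $ k, w $ k:] \<tau> \<noteq> 0" for \<tau>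
  proof (rule ccontr)
    assume "\<not> ?thesis"
    then have "v $ k = - \<tau> * w $ k" for k by (simp add: eq_neg_iff_add_eq_0)
    with ij show False by simp
  qed
  show ?thesis
  proof (cases "\<phi> = 0")
    case True
    obtain k where "poly [:v $ k, w $ k:] 0 \<noteq> 0" using root by blast
    then have "[:v $ k, w $ k:] ^ N \<noteq> 0" by (intro power_not_zero) auto
    moreover have "[:v $ k, w $ k:] ^ N * restr_line v w F = 0" using dvd[of k] True by (simp only: dvd_0_left_iff)
    ultimately have "restr_line v w F = 0" by (simp only: mult_eq_0_iff simp_thms)
    then show ?thesis by simp
  next
    case False
    show ?thesis by (rule dvd_of_no_common_root[OF False dvd root])
  qed
qed

section \<open>Secant lines of the surface\<close>

lemma ev_wX1_linear:
  assumes "whom wX 1 (G :: 'a::comm_ring_1 bipoly)"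
  shows "ev G (bp s t (x + c *s y)) = ev G (bp s t x) + c * ev G (bp s t y)"
proof -
  let ?Q = "restr (bp s t x) (bp 0 0 y) G"
  have w: "wX i = 0 \<and> bp 0 0 y i = 0 \<or> wX i = 1" for i
    by (auto simp: wX_def bp_def split: option.split)
  have pt: "(\<lambda>i. bp s t x i + \<tau> * bp 0 0 y i) = bp s t (x + \<tau> *s y)" for \<tau>
    by (rule ext) (auto simp: bp_def split: option.split)
  have top: "(\<lambda>i. if wX i = 0 then bp s t x i else bp 0 0 y i) = bp s t y"
    by (rule ext) (auto simp: bp_def wX_def split: option.split)
  have Q: "poly ?Q \<tau> = ev G (bp s t (x + \<tau> *s y))" for \<tau> unfolding poly_restr pt ..
  have deg: "degree ?Q \<le> 1" and c1: "coeff ?Q 1 = ev G (bp s t y)"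
    using restr_top[OF assms w, of "bp s t x"] unfolding top by auto
  have "poly ?Q \<tau> = coeff ?Q 0 + coeff ?Q 1 * \<tau>" for \<tau>
  proof -
    have "poly ?Q \<tau> = (\<Sum>i\<le>1. coeff ?Q i * \<tau> ^ i)"
      unfolding poly_altdef by (rule sum.mono_neutral_left) (use deg in \<open>auto simp: coeff_eq_0\<close>)
    then show ?thesis by simp
  qed
  from this[of c] this[of 0] show ?thesis
    using Q[of c] Q[of 0] c1 by (simp add: mult.commute)
qed

lemma independent_minor:
  fixes v w :: "'a::field ^ 'n"
  assumes "v \<noteq> 0" "\<And>c. w \<noteq> c *s v"
  obtains i j where "v $ i * w $ j \<noteq> v $ j * w $ i"
  using proportional[OF _ assms(1), of w] assms(2) by metis

context scroll
begin

definition Lx :: "'a ^ 3 \<Rightarrow> ('a ^ 6) set" where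
  "Lx x = {P s t x | s t. True}"

lemma P_comb: "\<alpha> *s P s t x + \<beta> *s P s' t' x = P (\<alpha> * s + \<beta> * s') (\<alpha> * t + \<beta> * t') x"
  by (simp add: P_def vec.scale_right_distrib vec.scale_left_distrib)

lemma Lx_line:
  assumes "s' * t \<noteq> s * t'"
  shows "line (P s' t' x) (P s t x) = Lx x"
proof (rule antisym)
  show "line (P s' t' x) (P s t x) \<subseteq> Lx x" unfolding line_def Lx_def P_comb by blast
  show "Lx x \<subseteq> line (P s' t' x) (P s t x)"
  proof
    fix u assume "u \<in> Lx x"
    then obtain \<sigma> \<tau> where u: "u = P \<sigma> \<tau> x" by (auto simp: Lx_def)
    define D where "D = s' * t - s * t'"
    have D: "D \<noteq> 0" using assms by (simp add: D_def)
    define \<alpha> \<beta> where "\<alpha> = (\<sigma> * t - \<tau> * s) / D" and "\<beta> = (\<tau> * s' - \<sigma> * t') / D"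
    have "\<alpha> * s' + \<beta> * s = \<sigma> * D / D" "\<alpha> * t' + \<beta> * t = \<tau> * D / D"
      unfolding \<alpha>_def \<beta>_def times_divide_eq_left add_divide_distrib[symmetric]
      by (rule arg_cong[where f = "\<lambda>z. z / D"], simp add: D_def algebra_simps)+
    then have "u = \<alpha> *s P s' t' x + \<beta> *s P s t x" using D by (simp add: u P_comb)
    then show "u \<in> line (P s' t' x) (P s t x)" by (auto simp: line_def)
  qed
qed

lemma Lx_minor:
  assumes "s' * t \<noteq> s * t'" "x \<noteq> 0"
  obtains i j where "P s' t' x $ i * P s t x $ j \<noteq> P s' t' x $ j * P s t x $ i"
proof (rule independent_minor)
  show "P s' t' x \<noteq> 0" using assms by (auto simp: P_eq_0_iff)
  show "P s t x \<noteq> c *s P s' t' x" for c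
  proof
    assume "P s t x = c *s P s' t' x"
    then have "P s t x = P (c * s') (c * t') x" by (simp add: P_scale_st)
    then have "s *s x = (c * s') *s x" "t *s x = (c * t') *s x" by (metis NX_P, metis NY_P)
    then have "s = c * s'" "t = c * t'" using assms(2) by auto
    with assms(1) show False by (simp add: mult.left_commute)
  qed
qed (rule that)

lemma Lx_Gr1: "x \<noteq> 0 \<Longrightarrow> Lx x \<in> Gr 1"
proof -
  assume x: "x \<noteq> 0"
  obtain i j where ij: "P 1 0 x $ i * P 0 1 x $ j \<noteq> P 1 0 x $ j * P 0 1 x $ i"
    by (rule Lx_minor[of 1 1 0 0 x]) (use x in auto)
  have "line (P 1 0 x) (P 0 1 x) = Lx x" by (rule Lx_line) simp
  with line_Gr1[OF ij] show ?thesis by simp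
qed

definition quadric :: "3 \<Rightarrow> 3 \<Rightarrow> (6, 'a) mpoly" where
  "quadric j k = zS j * zT k - zS k * zT j"

lemma quadric: "quadric j k \<in> forms 2" "Phi (quadric j k) = 0"
  "mp_value (quadric j k) v = (NX *v v) $ j * (NY *v v) $ k - (NX *v v) $ k * (NY *v v) $ j"
proof -
  have "whom (\<lambda>_. 1) (1 + 1) (zS j * zT k - zS k * zT j)"
    using z_forms unfolding forms_whom by (intro whom_diff whom_mult) auto
  then show "quadric j k \<in> forms 2" by (simp add: quadric_def forms_whom numeral_2_eq_2)
qed (simp_all add: quadric_def Phi_z mp_value_z)

end

section \<open>Secant lines of the divisor \<open>V f\<close>\<close>

locale type_I_surface = scroll a b for a b :: "3 \<Rightarrow> 'a::alg_closed_field ^ 6" +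
  fixes f :: "'a bipoly" and d :: nat
  assumes f_prime: "prime_elem f" and f_bih: "bih (d - 2) 1 f" and d5: "d > 5"
begin

abbreviation IX :: "(6, 'a) mpoly set" where "IX \<equiv> vanishing_ideal (V f)"

lemma f_not_unit: "\<not> f dvd 1" and f_nonzero: "f \<noteq> 0"
  using f_prime by (auto simp: prime_elem_def)

lemma X_nonempty: "V f \<noteq> {}"
  by (rule V_nonempty[OF f_bih f_not_unit])

lemma IX_dvd: "F \<in> IX \<Longrightarrow> f dvd Phi F"
  by (rule vanishing_ideal_dvd[OF disjI1[OF f_prime] X_nonempty])

lemma IX_I: "homogeneous F \<Longrightarrow> f dvd Phi F \<Longrightarrow> F \<in> IX"
  using homogeneous_in_vanishing_ideal[OF disjI1[OF f_prime] X_nonempty] by blast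

lemma f_linear: "ev f (bp s t (x + c *s y)) = ev f (bp s t x) + c * ev f (bp s t y)"
  by (rule ev_wX1_linear) (use f_bih in \<open>simp add: bih_def\<close>)

abbreviation SL :: "('a ^ 6) set \<Rightarrow> (6, 'a) mpoly set" where
  "SL L \<equiv> scheme_inter IX (vanishing_ideal (points L))"

text \<open>\<open>F\<close> and \<open>G * H\<close> agree on the line, so they differ by an
  element of its ideal, while \<open>G * H\<close> is a multiple of \<open>G\<close>.\<close>

lemma SL_memI:
  assumes "F \<in> forms n" "G \<in> SL L" "L = line v w" "H \<in> forms k" "G \<in> forms m" "m + k = n"
    "restr_line v w F = restr_line v w G * restr_line v w H"
  shows "F \<in> SL L"
proof -
  note sub = scheme_inter_ideal(1)[of IX "vanishing_ideal (points L)"]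
  have "G * H \<in> forms n" using forms_mult[OF assms(5,4)] assms(6) by simp
  then have "F - G * H \<in> forms n" by (rule mpoly.subspace_diff[OF forms_subspace assms(1)])
  moreover have "restr_line v w (F - G * H) = 0" using assms(7) by simp
  ultimately have "F - G * H \<in> vanishing_ideal (points L)" unfolding assms(3) by (rule points_line)
  then have 1: "F - G * H \<in> SL L" using scheme_inter_ideal(3) by blast
  have "H * G \<in> SL L" by (rule ideal.subspace_scale[OF sub assms(2)])
  from ideal.subspace_add[OF sub this 1] show ?thesis by (simp add: mult.commute)
qed

lemma degree_quotient:
  fixes \<phi> g :: "'a poly"
  assumes "\<phi> \<noteq> 0" "degree (\<phi> * g) \<le> n" "degree \<phi> \<le> n"
  shows "degree g \<le> n - degree \<phi>"
proof (cases "g = 0")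
  case False
  then have "degree (\<phi> * g) = degree \<phi> + degree g" using assms(1) by (rule degree_mult_eq[rotated])
  with assms show ?thesis by simp
qed simp

text \<open>On \<open>Lx x\<close> the surface is cut out by the binary form f(s, t, x) of degree d
  - 2. Taking the parameter at which it is nonzero as the point at infinity makes its
  dehomogenization \<open>\<phi>\<close> a polynomial of degree exactly d - 2.\<close>

lemma Lx_length:
  assumes x: "x \<noteq> 0" and nz: "ev f (bp s t x) \<noteq> 0"
  shows "has_length (SL (Lx x)) (d - 2)"
proof -
  have st: "(s, t) \<noteq> (0, 0)"
  proof
    assume "(s, t) = (0, 0)"
    then have "ev f (bp s t x) = 0 ^ (d - 2) * ev f (bp 0 0 x)" using ev_bih_scale[OF f_bih, of 0 0 0 1 x] by simp
    then show False using nz d5 by simp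
  qed
  \<comment> \<open>Any parameter independent of (s, t) will do; the two points then span the
    line.\<close>
  define s' t' :: 'a where "s' = (if s \<noteq> 0 then 0 else 1)" and "t' = (if s \<noteq> 0 then 1 else 0)"
  have D: "s' * t \<noteq> s * t'" using st by (auto simp: s'_def t'_def)
  let ?v = "P s' t' x" and ?w = "P s t x"
  have L: "Lx x = line ?v ?w" by (rule Lx_line[OF D, symmetric])
  obtain i j where ij: "?v $ i * ?w $ j \<noteq> ?v $ j * ?w $ i" by (rule Lx_minor[OF D x])
  let ?\<rho> = "restr (bp s' t' x) (bp s t 0)"
  define \<phi> where "\<phi> = ?\<rho> f"
  have w: "wS i = 0 \<and> bp s t 0 i = 0 \<or> wS i = 1" for i
    by (auto simp: wS_def bp_def split: option.split)
  have top: "(\<lambda>i. if wS i = 0 then bp s' t' x i else bp s t 0 i) = bp s t x"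
    by (rule ext) (auto simp: bp_def wS_def split: option.split)
  have pt: "(\<lambda>i. bp s' t' x i + \<tau> * bp s t 0 i) = bp (s' + \<tau> * s) (t' + \<tau> * t) x" for \<tau>
    by (rule ext) (auto simp: bp_def split: option.split)
  have "whom wS (d - 2) f" using f_bih by (simp add: bih_def)
  from restr_top[OF this w, of "bp s' t' x"] have "degree \<phi> \<le> d - 2" "coeff \<phi> (d - 2) \<noteq> 0"
    using nz unfolding top \<phi>_def by auto
  then have deg: "degree \<phi> = d - 2" and \<phi>0: "\<phi> \<noteq> 0" using le_degree[of \<phi> "d - 2"] by auto
  have restr: "restr_line ?v ?w F = ?\<rho> (Phi F)" for F
  proof (rule poly_eqI_infinite)
    fix \<tau>
    have "?v + \<tau> *s ?w = P (s' + \<tau> * s) (t' + \<tau> * t) x" using P_comb[of 1 s' t' x \<tau> s t] by simp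
    then have "poly (restr_line ?v ?w F) \<tau> = mp_value F (P (s' + \<tau> * s) (t' + \<tau> * t) x)"
      using poly_restr_line[of ?v ?w F \<tau>] by simp
    moreover have "poly (?\<rho> (Phi F)) \<tau> = mp_value F (P (s' + \<tau> * s) (t' + \<tau> * t) x)"
      unfolding poly_restr pt ev_Phi ..
    ultimately show "poly (restr_line ?v ?w F) \<tau> = poly (?\<rho> (Phi F)) \<tau>" by simp
  qed
  obtain l where l: "x $ l \<noteq> 0" using x by (auto simp: Finite_Cartesian_Product.vec_eq_iff)
  \<comment> \<open>A linear form in x with value 1 along the line: multiplying \<open>f\<close> by
    \<open>lam ^ (d - 3)\<close> balances the bidegree without changing the restriction.\<close>
  define lam :: "'a bipoly" where "lam = mp_const (1 / x $ l) * mp_var (vX l)"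
  have blam: "bih 0 1 lam" unfolding lam_def by (intro bih_cmult bih_var)
  have "1 + (d - 3) = d - 2" using d5 by arith
  then have "bih (d - 2) (d - 2) (f * lam ^ (d - 3))"
    using bih_mult[OF f_bih bih_power[OF blam, of "d - 3"]] by simp
  then obtain G where G: "G \<in> forms (d - 2)" "Phi G = f * lam ^ (d - 3)" by (rule Phi_surj)
  have "?\<rho> lam = 1"
    by (rule poly_eqI_infinite) (use l in \<open>simp add: poly_restr pt lam_def\<close>)
  then have rG: "restr_line ?v ?w G = \<phi>" unfolding restr G(2) by (simp add: \<phi>_def)
  have "homogeneous G" using G by (auto simp: homogeneous_def)
  then have "G \<in> IX" by (rule IX_I) (simp add: G)
  then have GS: "G \<in> SL (Lx x)" using scheme_inter_ideal(2) by blast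
  show ?thesis
  proof (rule has_lengthI)
    fix n assume n: "n \<ge> d - 2"
    have "hilbert_function (SL (Lx x)) n \<le> degree \<phi>"
    proof (rule hilbert_function_le[OF ij \<phi>0])
      show "degree \<phi> \<le> n" using n deg by simp
      fix F assume F: "F \<in> forms n" "\<phi> dvd restr_line ?v ?w F"
      then obtain g where g: "restr_line ?v ?w F = \<phi> * g" by blast
      have "degree (\<phi> * g) \<le> n" using restr_line_forms(1)[OF F(1), of ?v ?w] by (simp only: g)
      then have "degree g \<le> n - (d - 2)" using degree_quotient[OF \<phi>0] n deg by simp
      then obtain H where H: "H \<in> forms (n - (d - 2))" "restr_line ?v ?w H = g" by (rule restr_line_surj[OF ij])
      show "F \<in> SL (Lx x)"
        by (rule SL_memI[OF F(1) GS L H(1) G(1)]) (use n g rG H in auto)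
    qed
    moreover have "d - 2 \<le> hilbert_function (SL (Lx x)) n"
    proof (rule hilbert_function_ge[OF ij _ scheme_inter_ideal(1)])
      show "d - 2 \<le> n + 1" using n by simp
      fix F assume F: "F \<in> forms n" "F \<in> SL (Lx x)" "degree (restr_line ?v ?w F) < d - 2"
      have "\<phi> dvd restr_line ?v ?w F"
      proof (rule saturated_restr_line[OF ij _ F(2)[unfolded L]])
        fix F assume "F \<in> IX"
        then obtain H where "Phi F = f * H" using IX_dvd by blast
        then show "\<phi> dvd restr_line ?v ?w F" unfolding restr by (simp add: \<phi>_def)
      qed
      then show "restr_line ?v ?w F = 0" using F(3) deg dvd_imp_degree_le[of \<phi> "restr_line ?v ?w F"] by fastforce
    qed
    ultimately show "hilbert_function (SL (Lx x)) n = d - 2" using deg by simp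
  qed
qed

lemma no_length_in_X:
  assumes L: "L \<in> Gr 1" "points L \<subseteq> V f"
  shows "\<not> has_length (SL L) l"
proof -
  have "\<not> L \<subseteq> {0}" using L(1) by (auto simp: Gr_def simp flip: vec.dim_eq_0)
  then obtain u where u: "u \<in> L" "u \<noteq> 0" by blast
  obtain v i j where v: "L = line v u" "v $ i * u $ j \<noteq> v $ j * u $ i" by (rule Gr1E[OF L(1) u])
  show ?thesis
  proof (rule has_length_unbounded)
    fix n
    show "n + 1 \<le> hilbert_function (SL L) n"
    proof (rule hilbert_function_ge[OF v(2) le_refl scheme_inter_ideal(1)])
      fix F assume F: "F \<in> SL L"
      \<comment> \<open>Divisibility by 0 encodes that the restriction is zero. Hence all n + 1
        powers of the parameter stay independent in degree n, and the Hilbert function is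
        unbounded.\<close>
      have "0 dvd restr_line v u F"
      proof (rule saturated_restr_line[OF v(2) _ F[unfolded v(1)]])
        fix F assume "F \<in> IX"
        then have "vanishes F (points L)" using vanishes_subset[OF vanishing_ideal_vanishes L(2)] by blast
        then have "restr_line v u F = 0" unfolding v(1) by (rule vanishing_ideal_line[OF _ v(2)])
        then show "0 dvd restr_line v u F" by simp
      qed
      then show "restr_line v u F = 0" by simp
    qed
  qed
qed

text \<open>If \<open>q\<close> were nonzero at \<open>u\<close>, its restriction to the line, with
  \<open>u\<close> as point at infinity, would have degree exactly 2, and the section would have
  length at most 2.\<close>

lemma quadric_vanishes_on_long_line:
  assumes L: "L \<in> Gr 1" "has_length (SL L) l" "l \<ge> 3" and q: "q \<in> forms 2" "Phi q = 0" and u: "u \<in> L"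
  shows "mp_value q u = 0"
proof (rule ccontr)
  assume nz: "mp_value q u \<noteq> 0"
  have "u \<noteq> 0"
  proof
    assume "u = 0"
    then have "mp_value q u = 0" using forms_scale[OF q(1), of 0 0] by simp
    with nz show False ..
  qed
  obtain v i j where v: "L = line v u" "v $ i * u $ j \<noteq> v $ j * u $ i" by (rule Gr1E[OF L(1) u \<open>u \<noteq> 0\<close>])
  define \<phi> where "\<phi> = restr_line v u q"
  have "degree \<phi> \<le> 2" "coeff \<phi> 2 \<noteq> 0" using restr_line_forms[OF q(1), of v u] nz by (auto simp: \<phi>_def)
  then have deg: "degree \<phi> = 2" and \<phi>0: "\<phi> \<noteq> 0" using le_degree[of \<phi> 2] by auto
  have "homogeneous q" using q by (auto simp: homogeneous_def)
  then have "q \<in> IX" by (rule IX_I) (simp add: q)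
  then have qS: "q \<in> SL L" using scheme_inter_ideal(2) by blast
  have "l \<le> 2"
  proof (rule has_length_le[OF L(2)])
    fix n :: nat assume n: "n \<ge> 2"
    have "hilbert_function (SL L) n \<le> degree \<phi>"
    proof (rule hilbert_function_le[OF v(2) \<phi>0])
      show "degree \<phi> \<le> n" using n deg by simp
      fix F assume F: "F \<in> forms n" "\<phi> dvd restr_line v u F"
      then obtain g where g: "restr_line v u F = \<phi> * g" by blast
      have "degree (\<phi> * g) \<le> n" using restr_line_forms(1)[OF F(1), of v u] by (simp only: g)
      then have "degree g \<le> n - 2" using degree_quotient[OF \<phi>0] n deg by simp
      then obtain H where H: "H \<in> forms (n - 2)" "restr_line v u H = g" by (rule restr_line_surj[OF v(2)])
      show "F \<in> SL L"
        by (rule SL_memI[OF F(1) qS v(1) H(1) q(1)]) (use n g H in \<open>auto simp: \<phi>_def\<close>)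
    qed
    then show "hilbert_function (SL L) n \<le> 2" using deg by simp
  qed
  with L(3) show False by simp
qed

text \<open>In a ruling plane \<open>f\<close> is linear in x, so it restricts to a linear
  polynomial \<open>\<phi>\<close> on L. The lift of f lam^(d-3) also vanishes at the zero of lam on
  L; two choices of lam, restricting to 1 and to the parameter, have no common zero on L and leave
  only the root of \<open>\<phi>\<close>.\<close>

lemma fibre_line_short:
  assumes L: "L \<in> Gr 1" "has_length (SL L) l" and st: "(s, t) \<noteq> (0, 0)" "L \<subseteq> range (P s t)"
  shows "l \<le> 1"
proof -
  have "\<not> points L \<subseteq> V f" using no_length_in_X L by blast
  then obtain p where p: "p \<in> points L" "p \<notin> V f" by blast
  then obtain z where z: "z \<noteq> 0" "p = vec.span {z}" by (auto simp: points_def elim: proj_spaceE)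
  have zL: "z \<in> L" using p(1) z vec.span_base[of z "{z}"] by (auto simp: points_def)
  then obtain y where y: "z = P s t y" using st(2) by auto
  have fy: "ev f (bp s t y) \<noteq> 0" using p(2) V_I[of s t y f] z y by auto
  obtain v i j where v: "L = line v z" "v $ i * z $ j \<noteq> v $ j * z $ i" by (rule Gr1E[OF L(1) zL z(1)])
  have "v \<in> L" unfolding v(1) by (rule in_line)
  then obtain x where x: "v = P s t x" using st(2) by auto
  obtain k m where km: "x $ k * y $ m \<noteq> x $ m * y $ k"
  proof (rule independent_minor[of x y])
    show "x \<noteq> 0" using v(2) x by auto
    show "y \<noteq> c *s x" for c using v(2) x y by (auto simp: P_scale)
  qed blast
  then have "y $ k * x $ m \<noteq> y $ m * x $ k" by (metis mult.commute)
  then obtain e where e: "(\<Sum>k\<in>UNIV. e k * y $ k) = 1" "(\<Sum>k\<in>UNIV. e k * x $ k) = 0" by (rule dual_pair)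
  obtain c where c: "(\<Sum>k\<in>UNIV. c k * x $ k) = 1" "(\<Sum>k\<in>UNIV. c k * y $ k) = 0" by (rule dual_pair[OF km])
  define lam :: "(3 \<Rightarrow> 'a) \<Rightarrow> 'a bipoly" where "lam c = (\<Sum>k\<in>UNIV. mp_const (c k) * mp_var (vX k))" for c
  have blam: "bih 0 1 (lam c)" for c unfolding lam_def by (intro bih_sum bih_cmult bih_var)
  have elam: "ev (lam c) (bp s t (x + \<tau> *s y)) = (\<Sum>k\<in>UNIV. c k * x $ k) + \<tau> * (\<Sum>k\<in>UNIV. c k * y $ k)" for c \<tau>
    by (simp add: lam_def distrib_left sum.distrib sum_distrib_left mult.left_commute)
  define \<phi> where "\<phi> = [:ev f (bp s t x), ev f (bp s t y):]"
  have deg: "degree \<phi> = 1" and \<phi>0: "\<phi> \<noteq> 0" using fy by (auto simp: \<phi>_def)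
  have "\<exists>G. G \<in> forms (d - 2) \<and> Phi G = f * lam c ^ (d - 3)" for c
  proof -
    have "bih (d - 2) (d - 2) (f * lam c ^ (d - 3))"
    proof -
      have "d - 2 + 0 * (d - 3) = d - 2" "1 + 1 * (d - 3) = d - 2" using d5 by simp_all
      then show ?thesis using bih_mult[OF f_bih bih_power[OF blam, of "d - 3" c]] by metis
    qed
    then show ?thesis by (metis Phi_surj)
  qed
  then obtain G where G: "\<And>c. G c \<in> forms (d - 2)" "\<And>c. Phi (G c) = f * lam c ^ (d - 3)" by metis
  have GS: "G c \<in> SL L" for c
  proof -
    have "homogeneous (G c)" using G by (auto simp: homogeneous_def)
    then have "G c \<in> IX" by (rule IX_I) (simp add: G)
    then show ?thesis using scheme_inter_ideal(2) by blast
  qed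
  have rG: "poly (restr_line v z (G c)) \<tau> = poly \<phi> \<tau> * ((\<Sum>k\<in>UNIV. c k * x $ k) + \<tau> * (\<Sum>k\<in>UNIV. c k * y $ k)) ^ (d - 3)" for c \<tau>
  proof -
    have "v + \<tau> *s z = P s t (x + \<tau> *s y)" by (simp add: x y P_add P_scale)
    then have "poly (restr_line v z (G c)) \<tau> = ev (Phi (G c)) (bp s t (x + \<tau> *s y))"
      unfolding poly_restr_line ev_Phi by simp
    then show ?thesis by (simp add: G f_linear elam \<phi>_def)
  qed
  have r1: "restr_line v z (G c) = \<phi>" by (rule poly_eqI_infinite) (simp add: rG c)
  have r2: "restr_line v z (G e) = \<phi> * monom 1 (d - 3)" by (rule poly_eqI_infinite) (simp add: rG e poly_monom)
  note sub = scheme_inter_ideal(1)[of IX "vanishing_ideal (points L)"]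
  show ?thesis
  proof (rule has_length_le[OF L(2)])
    fix n assume n: "n \<ge> 2 * d"
    have "hilbert_function (SL L) n \<le> degree \<phi>"
    proof (rule hilbert_function_le[OF v(2) \<phi>0])
      show "degree \<phi> \<le> n" using n deg d5 by simp
      fix F assume F: "F \<in> forms n" "\<phi> dvd restr_line v z F"
      then obtain g where g: "restr_line v z F = \<phi> * g" by blast
      have "degree (\<phi> * g) \<le> n" using restr_line_forms(1)[OF F(1), of v z] by (simp only: g)
      then have dg: "degree g \<le> n - 1" using degree_quotient[OF \<phi>0] n deg d5 by simp
      \<comment> \<open>The cofactor g, of degree at most n - 1, is split at degree d - 3 between
        the two forms; n is large enough for both parts to have degree at most n - (d - 2).\<close>
      define g1 g2 where "g1 = poly_cutoff (d - 3) g" and "g2 = poly_shift (d - 3) g"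
      have g12: "g = g1 + monom 1 (d - 3) * g2"
        by (rule poly_eqI) (simp add: g1_def g2_def coeff_poly_cutoff coeff_poly_shift coeff_monom_mult)
      have d1: "degree g1 \<le> n - (d - 2)"
        by (rule degree_le) (use n d5 in \<open>auto simp: g1_def coeff_poly_cutoff\<close>)
      have d2: "degree g2 \<le> n - (d - 2)"
      proof (rule degree_le, intro allI impI)
        fix i assume "i > n - (d - 2)"
        then have "i + (d - 3) > degree g" using dg n d5 by simp
        then show "coeff g2 i = 0" by (simp add: g2_def coeff_poly_shift coeff_eq_0)
      qed
      obtain H1 where H1: "H1 \<in> forms (n - (d - 2))" "restr_line v z H1 = g1" by (rule restr_line_surj[OF v(2) d1])
      obtain H2 where H2: "H2 \<in> forms (n - (d - 2))" "restr_line v z H2 = g2" by (rule restr_line_surj[OF v(2) d2])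
      have le: "d - 2 + (n - (d - 2)) = n" using n by simp
      have G1H1: "G c * H1 \<in> forms n" using forms_mult[OF G(1) H1(1)] le by simp
      have "F - G c * H1 \<in> forms n" by (rule mpoly.subspace_diff[OF forms_subspace F(1) G1H1])
      then have "F - G c * H1 \<in> SL L"
        by (rule SL_memI[OF _ GS[of e] v(1) H2(1) G(1) le]) (simp add: g g12 r1 r2 H1 H2 distrib_left mult.assoc)
      moreover have "H1 * G c \<in> SL L" by (rule ideal.subspace_scale[OF sub GS])
      ultimately have "F - G c * H1 + H1 * G c \<in> SL L" by (rule ideal.subspace_add[OF sub])
      then show "F \<in> SL L" by (simp add: mult.commute)
    qed
    then show "hilbert_function (SL L) n \<le> 1" using deg by simp
  qed
qed

text \<open>By the quadrics all points of \<open>L\<close> lie on the scroll. Either x is constant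
  along \<open>L\<close>, or \<open>L\<close> lies in one ruling plane, where the length would be at
  most 1.\<close>

lemma long_line:
  assumes L: "L \<in> Gr 1" "has_length (SL L) l" "l \<ge> 3"
  obtains x s t where "x \<noteq> 0" "L = Lx x" "ev f (bp s t x) \<noteq> 0"
proof -
  have quad: "(NX *v u) $ j * (NY *v u) $ k = (NX *v u) $ k * (NY *v u) $ j" if u: "u \<in> L" for u j k
    using quadric_vanishes_on_long_line[OF L quadric(1,2) u, of j k] by (simp add: quadric(3))
  have inW: "\<exists>s t x. u = P s t x" if u: "u \<in> L" for u
  proof -
    obtain s t x where "u = P s t x" by (rule scroll_point[OF quad[OF u]])
    then show ?thesis by blast
  qed
  have "\<not> L \<subseteq> {0}" using L(1) by (auto simp: Gr_def simp flip: vec.dim_eq_0)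
  then obtain u where u: "u \<in> L" "u \<noteq> 0" by blast
  obtain v i j where v: "L = line v u" "v $ i * u $ j \<noteq> v $ j * u $ i" by (rule Gr1E[OF L(1) u])
  obtain s t x where x: "v = P s t x" using inW[of v] in_line(2)[of v u] v(1) by blast
  obtain s' t' x' where x': "u = P s' t' x'" using inW[OF u(1)] by blast
  have "v \<noteq> 0" using v(2) by auto
  then have nz: "x \<noteq> 0" "(s, t) \<noteq> (0, 0)" "x' \<noteq> 0" "(s', t') \<noteq> (0, 0)" using x x' u(2) by (auto simp: P_eq_0_iff)
  have "v + u \<in> L" using in_line(1)[of 1 v 1 u] v(1) by simp
  \<comment> \<open>The sum of the two points satisfies the quadrics as well, and their value there
    factors into the minor of the parameters and a minor of x and x'.\<close>
  have prod: "(s * t' - s' * t) * (x $ j * x' $ k - x $ k * x' $ j) = 0" for j k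
  proof -
    have N: "NX *v (v + u) = s *s x + s' *s x'" "NY *v (v + u) = t *s x + t' *s x'"
      by (simp_all add: x x' matrix_vector_right_distrib NX_P NY_P)
    show ?thesis using quad[OF \<open>v + u \<in> L\<close>, of j k] unfolding N by (simp add: algebra_simps)
  qed
  have notX: "\<not> points L \<subseteq> V f" using no_length_in_X L by blast
  show thesis
  proof (cases "s * t' = s' * t")
    case False
    then have "x $ j * x' $ k = x $ k * x' $ j" for j k using prod[of j k] by simp
    then obtain c where c: "x' = c *s x" using nz(1) by (rule proportional)
    then have "c \<noteq> 0" using nz by auto
    have "u = P (c * s') (c * t') x" by (simp add: x' c P_scale P_scale_st)
    moreover have "s * (c * t') \<noteq> c * s' * t" using False \<open>c \<noteq> 0\<close> by (simp add: mult_ac)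
    ultimately have LL: "L = Lx x" using Lx_line[of s "c * t'" "c * s'" t x] v(1) x by simp
    have "\<exists>s t. ev f (bp s t x) \<noteq> 0"
    proof (rule ccontr)
      assume none: "\<not> ?thesis"
      have "points L \<subseteq> V f"
      proof
        fix p assume p: "p \<in> points L"
        then obtain z where z: "z \<noteq> 0" "p = vec.span {z}" by (auto simp: points_def elim: proj_spaceE)
        then have "z \<in> Lx x" using p vec.span_base[of z "{z}"] LL by (auto simp: points_def)
        then obtain \<sigma> \<tau> where "z = P \<sigma> \<tau> x" by (auto simp: Lx_def)
        then show "p \<in> V f" using z none V_I by blast
      qed
      with notX show False ..
    qed
    with LL nz(1) that show thesis by blast
  next
    case True
    obtain c where c: "s' = c * s" "t' = c * t"
    proof (cases "s = 0")
      case True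
      then have "t \<noteq> 0" "s' = 0" using \<open>s * t' = s' * t\<close> nz(2) by auto
      then show thesis using that[of "t' / t"] True by simp
    next
      case False
      then show thesis using that[of "s' / s"] \<open>s * t' = s' * t\<close> by (simp add: field_simps)
    qed
    have "L \<subseteq> range (P s t)"
    proof
      fix z assume "z \<in> L"
      then obtain \<alpha> \<beta> where "z = \<alpha> *s v + \<beta> *s u" unfolding v(1) line_def by blast
      then have "z = P s t (\<alpha> *s x + (\<beta> * c) *s x')" by (simp add: x x' c P_add P_scale P_scale_st)
      then show "z \<in> range (P s t)" by blast
    qed
    then have "l \<le> 1" by (rule fibre_line_short[OF L(1,2) nz(2)])
    with L(3) show thesis by simp
  qed
qed

text \<open>For nonzero x this means that the line \<open>Lx x\<close> is not contained in the
  surface.\<close>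

definition good_x :: "'a ^ 3 \<Rightarrow> bool" where
  "good_x x \<longleftrightarrow> (\<exists>s t. ev f (bp s t x) \<noteq> 0)"

lemma good_x_nonzero: "good_x x \<Longrightarrow> x \<noteq> 0"
proof -
  assume "good_x x"
  then obtain s t where "ev f (bp s t x) \<noteq> 0" by (auto simp: good_x_def)
  moreover have "ev f (bp s t 0) = 0" using ev_bih_scale[OF f_bih, of 1 s t 0 0] by simp
  ultimately show ?thesis by auto
qed

lemma secant_lines:
  "{L \<in> Gr 1. \<exists>l\<ge>d - 2. has_length (SL L) l} = {Lx x | x. good_x x}"
proof (intro equalityI subsetI)
  fix L assume "L \<in> {L \<in> Gr 1. \<exists>l\<ge>d - 2. has_length (SL L) l}"
  then obtain l where l: "L \<in> Gr 1" "has_length (SL L) l" "l \<ge> 3" using d5 by force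
  obtain x s t where "x \<noteq> 0" "L = Lx x" "ev f (bp s t x) \<noteq> 0" by (rule long_line[OF l])
  then show "L \<in> {Lx x | x. good_x x}" by (auto simp: good_x_def)
next
  fix L assume "L \<in> {Lx x | x. good_x x}"
  then obtain x where "L = Lx x" "good_x x" by blast
  moreover from this obtain s t where "ev f (bp s t x) \<noteq> 0" by (auto simp: good_x_def)
  ultimately have x: "L = Lx x" "x \<noteq> 0" "ev f (bp s t x) \<noteq> 0" using good_x_nonzero by auto
  then show "L \<in> {L \<in> Gr 1. \<exists>l\<ge>d - 2. has_length (SL L) l}" using Lx_length Lx_Gr1 by blast
qed

end

section \<open>Polynomial functions and density\<close>

definition polyfun :: "('a::comm_ring_1 ^ 'n::finite \<Rightarrow> 'a) \<Rightarrow> bool" where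
  "polyfun g \<longleftrightarrow> (\<exists>G. \<forall>x. g x = mp_value G x)"

lemma polyfun_mp_value: "polyfun (mp_value G)"
  by (auto simp: polyfun_def)

lemma polyfun_const: "polyfun (\<lambda>x. c)"
  unfolding polyfun_def by (rule exI[of _ "mp_const c"]) simp

lemma polyfun_coord: "polyfun (\<lambda>x. x $ i)"
  unfolding polyfun_def by (rule exI[of _ "mp_var i"]) simp

lemma polyfun_add: "polyfun g \<Longrightarrow> polyfun h \<Longrightarrow> polyfun (\<lambda>x. g x + h x)"
  unfolding polyfun_def by (metis mp_value_simps(1))

lemma polyfun_mult: "polyfun g \<Longrightarrow> polyfun h \<Longrightarrow> polyfun (\<lambda>x. g x * h x)"
  unfolding polyfun_def by (metis mp_value_simps(2))

lemma polyfun_diff: "polyfun g \<Longrightarrow> polyfun h \<Longrightarrow> polyfun (\<lambda>x. g x - h x)"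
  unfolding polyfun_def by (metis mp_value_simps(3))

lemma polyfun_sum: "(\<And>k. k \<in> A \<Longrightarrow> polyfun (g k)) \<Longrightarrow> polyfun (\<lambda>x. \<Sum>k\<in>A. g k x)"
  by (induction A rule: infinite_finite_induct) (auto intro: polyfun_const polyfun_add)

lemma polyfun_prod: "(\<And>k. k \<in> A \<Longrightarrow> polyfun (g k)) \<Longrightarrow> polyfun (\<lambda>x. \<Prod>k\<in>A. g k x)"
  by (induction A rule: infinite_finite_induct) (auto intro: polyfun_const polyfun_mult)

lemma polyfun_compose:
  assumes "polyfun g" "\<And>i. polyfun (\<lambda>x. h x $ i)"
  shows "polyfun (\<lambda>x. g (h x))"
proof -
  obtain G where G: "\<And>y. g y = mp_value G y" using assms(1) by (auto simp: polyfun_def)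
  have "\<forall>i. \<exists>H. \<forall>x. h x $ i = mp_value H x" using assms(2) by (auto simp: polyfun_def)
  then obtain H where H: "\<And>i x. h x $ i = mp_value (H i) x" by metis
  have "g (h x) = mp_value (mp_eval mp_const H G) x" for x
    unfolding G mp_value_ev ev_subst H by simp
  then show ?thesis by (auto simp: polyfun_def)
qed

text \<open>Restricted to the line through \<open>v\<close> and \<open>w\<close> both functions are
  nonzero polynomials in one variable, at 0 and at 1 respectively, and their product has finitely
  many zeros in an infinite field.\<close>

lemma polyfun_nonzero_mult:
  fixes g h :: "'a::alg_closed_field ^ 'n \<Rightarrow> 'a"
  assumes "polyfun g" "polyfun h" "g v \<noteq> 0" "h w \<noteq> 0"
  obtains u where "g u \<noteq> 0" "h u \<noteq> 0"
proof -
  obtain G H where GH: "\<And>x. g x = mp_value G x" "\<And>x. h x = mp_value H x" using assms by (auto simp: polyfun_def)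
  let ?r = "restr_line v (w - v)"
  have "poly (?r G) 0 \<noteq> 0" "poly (?r H) 1 \<noteq> 0" using assms by (simp_all add: poly_restr_line GH)
  then have "?r G * ?r H \<noteq> 0" by auto
  then obtain \<tau> where "poly (?r G * ?r H) \<tau> \<noteq> 0" using poly_eq_0_of_infinite[OF infinite_alg_closed] by blast
  then have "g (v + \<tau> *s (w - v)) \<noteq> 0" "h (v + \<tau> *s (w - v)) \<noteq> 0" by (auto simp: poly_restr_line GH)
  then show thesis by (rule that)
qed

lemma polyfun_nonzero_prod:
  fixes g :: "'i \<Rightarrow> 'a::alg_closed_field ^ 'n \<Rightarrow> 'a"
  assumes "finite I" "\<And>i. i \<in> I \<Longrightarrow> polyfun (g i)" "\<And>i. i \<in> I \<Longrightarrow> \<exists>v. g i v \<noteq> 0"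
  obtains u where "\<And>i. i \<in> I \<Longrightarrow> g i u \<noteq> 0"
proof -
  have "\<exists>u. (\<Prod>i\<in>I. g i u) \<noteq> 0"
    using assms
  proof (induction I)
    case (insert i I)
    then obtain u where u: "(\<Prod>i\<in>I. g i u) \<noteq> 0" by auto
    obtain v where v: "g i v \<noteq> 0" using insert.prems by blast
    have "polyfun (\<lambda>u. \<Prod>i\<in>I. g i u)" using insert.prems by (intro polyfun_prod) auto
    then obtain z where "g i z \<noteq> 0" "(\<Prod>i\<in>I. g i z) \<noteq> 0"
      using polyfun_nonzero_mult[of "g i" "\<lambda>u. \<Prod>i\<in>I. g i u" v u] insert.prems u v by auto
    then show ?case using insert.hyps by (intro exI[of _ z]) simp
  qed simp
  then obtain u where "(\<Prod>i\<in>I. g i u) \<noteq> 0" ..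
  then have "g i u \<noteq> 0" if "i \<in> I" for i using assms(1) that by auto
  then show thesis by (rule that)
qed

definition zdense :: "('a::comm_ring_1 ^ 'n::finite) set \<Rightarrow> bool" where
  "zdense S \<longleftrightarrow> (\<forall>g. polyfun g \<longrightarrow> (\<exists>x. g x \<noteq> 0) \<longrightarrow> (\<exists>x\<in>S. g x \<noteq> 0))"

section \<open>The Pluecker image\<close>

lemma exhaust_6: "x = 1 \<or> x = 2 \<or> x = 3 \<or> x = 4 \<or> x = 5 \<or> x = 6" for x :: 6
proof (induct x)
  case (of_int z)
  then have "0 \<le> z" and "z < 6" by simp_all
  then have "z = 0 \<or> z = 1 \<or> z = 2 \<or> z = 3 \<or> z = 4 \<or> z = 5" by arith
  then show ?case by auto
qed

lemma forall_6: "(\<forall>i::6. Q i) \<longleftrightarrow> Q 1 \<and> Q 2 \<and> Q 3 \<and> Q 4 \<and> Q 5 \<and> Q 6"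
  by (metis exhaust_6)

lemma UNIV_6: "UNIV = {1 :: 6, 2, 3, 4, 5, 6}"
  using exhaust_6 by auto

lemma sum_6: "(\<Sum>i\<in>(UNIV :: 6 set). g i) = g 1 + g 2 + g 3 + g 4 + g 5 + g 6"
  unfolding UNIV_6 by (simp add: add.assoc)

lemma vector_6 [simp]:
  "(vector [u1, u2, u3, u4, u5, u6] :: 'b::zero ^ 6) $ 1 = u1" "(vector [u1, u2, u3, u4, u5, u6] :: 'b ^ 6) $ 2 = u2"
  "(vector [u1, u2, u3, u4, u5, u6] :: 'b ^ 6) $ 3 = u3" "(vector [u1, u2, u3, u4, u5, u6] :: 'b ^ 6) $ 4 = u4"
  "(vector [u1, u2, u3, u4, u5, u6] :: 'b ^ 6) $ 5 = u5" "(vector [u1, u2, u3, u4, u5, u6] :: 'b ^ 6) $ 6 = u6"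
  by (simp_all add: vector_def)

lemma plucker_coords_nth: "plucker_coords u v $ k = u $ fst (Rep_plucker_index k) * v $ snd (Rep_plucker_index k)
    - u $ snd (Rep_plucker_index k) * v $ fst (Rep_plucker_index k)"
  by (simp add: plucker_coords_def split: prod.split)

lemma sum_plucker_index: "(\<Sum>k\<in>UNIV. g (Rep_plucker_index k)) = (\<Sum>p\<in>{(i, j). i < j}. g p)"
proof -
  have "range Rep_plucker_index = {(i, j). i < j}"
    using type_definition.Rep_range[OF type_definition_plucker_index] by simp
  moreover have "inj Rep_plucker_index" by (meson Rep_plucker_index_inject injI)
  ultimately show ?thesis using sum.reindex[of Rep_plucker_index UNIV g] by simp
qed

lemma sum_pairs: "(\<Sum>i\<in>UNIV. \<Sum>j\<in>UNIV. T i j) = (\<Sum>(i, j)\<in>{(i, j). i < j}. T i j + T j i) + (\<Sum>i\<in>UNIV. T i i)"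
  for T :: "6 \<Rightarrow> 6 \<Rightarrow> 'b::comm_monoid_add"
proof -
  let ?A = "{(i :: 6, j). i < j}" and ?B = "{(i :: 6, j). j < i}" and ?D = "(\<lambda>i :: 6. (i, i)) ` UNIV"
  have U: "UNIV \<times> UNIV = (?A \<union> ?B) \<union> ?D" by auto
  have "(\<Sum>i\<in>UNIV. \<Sum>j\<in>UNIV. T i j) = (\<Sum>(i, j)\<in>UNIV \<times> UNIV. T i j)" by (rule sum.cartesian_product)
  also have "\<dots> = (\<Sum>(i, j)\<in>?A \<union> ?B. T i j) + (\<Sum>(i, j)\<in>?D. T i j)"
    unfolding U by (rule sum.union_disjoint) auto
  also have "(\<Sum>(i, j)\<in>?A \<union> ?B. T i j) = (\<Sum>(i, j)\<in>?A. T i j) + (\<Sum>(i, j)\<in>?B. T i j)"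
    by (rule sum.union_disjoint) auto
  also have "?B = prod.swap ` ?A" by auto
  then have "(\<Sum>(i, j)\<in>?B. T i j) = (\<Sum>(i, j)\<in>?A. T j i)"
    by (simp only:) (subst sum.reindex, auto simp: case_prod_unfold)
  also have "(\<Sum>(i, j)\<in>?A. T i j) + (\<Sum>(i, j)\<in>?A. T j i) = (\<Sum>(i, j)\<in>?A. T i j + T j i)"
    by (simp add: sum.distrib case_prod_unfold)
  also have "(\<Sum>(i, j)\<in>?D. T i j) = (\<Sum>i\<in>UNIV. T i i)"
    by (subst sum.reindex) (auto simp: inj_on_def)
  finally show ?thesis .
qed

definition vdot :: "'a::comm_ring_1 ^ 'n \<Rightarrow> 'a ^ 'n \<Rightarrow> 'a" where
  "vdot u v = (\<Sum>i\<in>UNIV. u $ i * v $ i)"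

text \<open>The double sum over all pairs is grouped by i < j. The identity evaluates decomposable
  functionals on Pluecker vectors by pairings in the original space.\<close>

lemma cauchy_binet:
  "vdot (plucker_coords p q) (plucker_coords v w) = vdot p v * vdot q w - vdot p w * vdot q v"
proof -
  define T where "T i j = p $ i * q $ j * (v $ i * w $ j - w $ i * v $ j)" for i j
  have "vdot p v * vdot q w - vdot p w * vdot q v = (\<Sum>i\<in>UNIV. \<Sum>j\<in>UNIV. T i j)"
    unfolding vdot_def sum_product sum_subtractf[symmetric] T_def
    by (intro sum.cong refl) (simp add: algebra_simps)
  also have "\<dots> = (\<Sum>(i, j)\<in>{(i, j). i < j}. T i j + T j i) + (\<Sum>i\<in>UNIV. T i i)" by (rule sum_pairs)
  also have "(\<Sum>i\<in>UNIV. T i i) = 0" by (rule sum.neutral) (simp add: T_def)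
  also have "(\<Sum>(i, j)\<in>{(i, j). i < j}. T i j + T j i) =
      (\<Sum>r\<in>{(i, j). i < j}. (p $ fst r * q $ snd r - p $ snd r * q $ fst r) * (v $ fst r * w $ snd r - v $ snd r * w $ fst r))"
    by (rule sum.cong) (auto simp: T_def algebra_simps)
  also have "\<dots> = vdot (plucker_coords p q) (plucker_coords v w)"
    unfolding vdot_def plucker_coords_nth sum_plucker_index[symmetric] ..
  finally show ?thesis by simp
qed

lemma vdot_linear: "vdot p (v + w) = vdot p v + vdot p w" "vdot p (c *s v) = c * vdot p v" "vdot p 0 = 0"
  by (simp_all add: vdot_def distrib_left sum.distrib sum_distrib_left mult.left_commute)

lemma vdot_left: "vdot (p + q) v = vdot p v + vdot q v" "vdot (e *s p) v = e * vdot p v"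
  "vdot (p - q) v = vdot p v - vdot q v"
  by (simp_all add: vdot_def distrib_right left_diff_distrib sum.distrib sum_subtractf sum_distrib_left mult.assoc)

lemma plucker_coords_comb:
  "plucker_coords (\<alpha> *s v + \<beta> *s w) (\<gamma> *s v + \<delta> *s w) = (\<alpha> * \<delta> - \<beta> * \<gamma>) *s plucker_coords v w"
  by (simp add: Finite_Cartesian_Product.vec_eq_iff plucker_coords_nth algebra_simps)

lemma plucker_line: "plucker (line v w) = vec.span {plucker_coords v w}"
proof -
  have "{plucker_coords x y | x y. x \<in> line v w \<and> y \<in> line v w} \<subseteq> vec.span {plucker_coords v w}"
  proof
    fix z assume "z \<in> {plucker_coords x y | x y. x \<in> line v w \<and> y \<in> line v w}"
    then obtain \<alpha> \<beta> \<gamma> \<delta> where "z = plucker_coords (\<alpha> *s v + \<beta> *s w) (\<gamma> *s v + \<delta> *s w)"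
      unfolding line_def by blast
    then show "z \<in> vec.span {plucker_coords v w}"
      unfolding plucker_coords_comb using vec.span_scale[OF vec.span_base[of "plucker_coords v w" "{plucker_coords v w}"]] by blast
  qed
  moreover have "plucker_coords v w \<in> {plucker_coords x y | x y. x \<in> line v w \<and> y \<in> line v w}"
    using in_line(2)[of v w] in_line(3)[of w v] by blast
  ultimately show ?thesis
    unfolding plucker_def
    by (intro antisym[OF vec.span_minimal[OF _ vec.subspace_span] vec.span_minimal[OF _ vec.subspace_span]])
      (auto intro: vec.span_base)
qed

section \<open>The family of lines of the scroll in Pluecker space\<close>

context scroll
begin

lemma vdot_N: "vdot (NX $ i) v = (NX *v v) $ i" "vdot (NY $ i) v = (NY *v v) $ i"
  by (simp_all add: vdot_def matrix_vector_mult_def)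

lemma Lx_eq_line: "Lx x = line (Av x) (Bv x)"
  using Lx_line[of 1 1 0 0 x] by (simp add: P_def)

definition wd :: "'a ^ 3 \<Rightarrow> 'a ^ plucker_index" where
  "wd x = plucker_coords (Av x) (Bv x)"

lemma plucker_Lx: "plucker (Lx x) = vec.span {wd x}"
  by (simp add: Lx_eq_line plucker_line wd_def)

lemma NX_NY_ab: "NX *v Av x = x" "NY *v Av x = 0" "NX *v Bv x = 0" "NY *v Bv x = x"
  using NX_AB[of x 0] NY_AB[of x 0] NX_AB[of 0 x] NY_AB[of 0 x] by (simp_all add: Av_0 Bv_0)

lemma vdot_wd: "vdot (plucker_coords (NX $ i) (NY $ j)) (plucker_coords (Av x) (Bv y)) = x $ i * y $ j"
  unfolding cauchy_binet vdot_N NX_NY_ab by simp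

lemma wd_nonzero: "x \<noteq> 0 \<Longrightarrow> wd x \<noteq> 0"
proof
  assume x: "x \<noteq> 0" and "wd x = 0"
  then obtain i where "x $ i \<noteq> 0" by (auto simp: Finite_Cartesian_Product.vec_eq_iff)
  moreover have "x $ i * x $ i = 0" using vdot_wd[of i i x x] \<open>wd x = 0\<close> by (simp add: wd_def vdot_linear)
  ultimately show False by simp
qed

text \<open>Coefficient vectors of x_1^2, x_1 x_2, x_1 x_3, x_2^2, x_2 x_3, x_3^2 in
  \<open>wd x\<close>, in the order used by \<open>veronese\<close>. A mixed monomial receives
  contributions from a_i, b_j and from a_j, b_i.\<close>

definition ver_cols :: "('a ^ plucker_index) ^ 6" where
  "ver_cols = vector [plucker_coords (a 1) (b 1), plucker_coords (a 1) (b 2) + plucker_coords (a 2) (b 1),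
     plucker_coords (a 1) (b 3) + plucker_coords (a 3) (b 1), plucker_coords (a 2) (b 2),
     plucker_coords (a 2) (b 3) + plucker_coords (a 3) (b 2), plucker_coords (a 3) (b 3)]"

definition ver_mat :: "'a ^ 6 ^ plucker_index" where
  "ver_mat = (\<chi> k i. ver_cols $ i $ k)"

lemma ver_mat_mult: "ver_mat *v y = y $ 1 *s ver_cols $ 1 + y $ 2 *s ver_cols $ 2 + y $ 3 *s ver_cols $ 3 +
    y $ 4 *s ver_cols $ 4 + y $ 5 *s ver_cols $ 5 + y $ 6 *s ver_cols $ 6"
  by (simp add: Finite_Cartesian_Product.vec_eq_iff matrix_vector_mult_def ver_mat_def sum_6 mult.commute)

lemma ver_mat_veronese: "ver_mat *v veronese x = wd x"
proof -
  have A: "Av x = x $ 1 *s a 1 + x $ 2 *s a 2 + x $ 3 *s a 3" "Bv x = x $ 1 *s b 1 + x $ 2 *s b 2 + x $ 3 *s b 3"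
    by (simp_all add: Av_def Bv_def sum_3)
  show ?thesis
    unfolding ver_mat_mult veronese_def wd_def A ver_cols_def
    by (simp add: Finite_Cartesian_Product.vec_eq_iff plucker_coords_nth algebra_simps)
qed

lemma a_Av: "a j = Av (axis j 1)" "b j = Bv (axis j 1)"
proof -
  have "Av (axis j 1) = (\<Sum>i\<in>UNIV. if i = j then a j else 0)" "Bv (axis j 1) = (\<Sum>i\<in>UNIV. if i = j then b j else 0)"
    unfolding Av_def Bv_def by (rule sum.cong; auto simp: axis_def)+
  then show "a j = Av (axis j 1)" "b j = Bv (axis j 1)" by simp_all
qed

lemma vdot_ab: "vdot (plucker_coords (NX $ i) (NY $ j)) (plucker_coords (a k) (b l)) = (if i = k \<and> j = l then 1 else 0)"
  unfolding a_Av vdot_wd by (auto simp: axis_def)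

text \<open>The functionals \<open>plucker_coords (NX $ i) (NY $ j)\<close> with i <= j are dual to
  the six columns, in every characteristic, and so read off all coordinates.\<close>

lemma ver_mat_inj: "inj ((*v) ver_mat)"
proof (rule injI)
  fix y z assume eq: "ver_mat *v y = ver_mat *v z"
  have E: "vdot (plucker_coords (NX $ 1) (NY $ 1)) (ver_mat *v y) = y $ 1"
    "vdot (plucker_coords (NX $ 1) (NY $ 2)) (ver_mat *v y) = y $ 2"
    "vdot (plucker_coords (NX $ 1) (NY $ 3)) (ver_mat *v y) = y $ 3"
    "vdot (plucker_coords (NX $ 2) (NY $ 2)) (ver_mat *v y) = y $ 4"
    "vdot (plucker_coords (NX $ 2) (NY $ 3)) (ver_mat *v y) = y $ 5"
    "vdot (plucker_coords (NX $ 3) (NY $ 3)) (ver_mat *v y) = y $ 6" for y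
    unfolding ver_mat_mult ver_cols_def vector_6 vdot_linear vdot_ab by simp_all
  have "y $ 1 = z $ 1" "y $ 2 = z $ 2" "y $ 3 = z $ 3" "y $ 4 = z $ 4" "y $ 5 = z $ 5" "y $ 6 = z $ 6"
    using E[of y] E[of z] unfolding eq by (metis, metis, metis, metis, metis, metis)
  then show "y = z" by (simp add: Finite_Cartesian_Product.vec_eq_iff forall_6)
qed

lemma ver_mat_Gr: "range ((*v) ver_mat) \<in> Gr 5"
proof -
  have lin: "Vector_Spaces.linear (*s) (*s) ((*v) ver_mat)" by (rule matrix_vector_mul_linear_gen)
  have "vec.dim (range ((*v) ver_mat)) = vec.dim (UNIV :: ('a ^ 6) set)"
    using vec.dim_image_eq[OF lin, of UNIV] ver_mat_inj by simp
  then have "vec.dim (range ((*v) ver_mat)) = 6" by (simp add: vec.dim_UNIV card_cart_basis)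
  moreover have "vec.subspace (range ((*v) ver_mat))"
    unfolding vec.subspace_def
  proof (intro conjI ballI allI)
    show "0 \<in> range ((*v) ver_mat)" by (rule range_eqI[of _ _ 0]) simp
    show "x + y \<in> range ((*v) ver_mat)" if "x \<in> range ((*v) ver_mat)" "y \<in> range ((*v) ver_mat)" for x y
      using that by (auto simp flip: matrix_vector_right_distrib)
    show "c *s x \<in> range ((*v) ver_mat)" if "x \<in> range ((*v) ver_mat)" for c x
      using that by (auto simp flip: vector_scalar_commute)
  qed
  ultimately show ?thesis by (simp add: Gr_def)
qed

lemma veronese_Lx: "is_veronese_surface (range ((*v) ver_mat)) (plucker ` {Lx x | x. x \<noteq> 0})"
  unfolding is_veronese_surface_def
proof (intro exI conjI)
  show "inj ((*v) ver_mat)" by (rule ver_mat_inj)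
  show "plucker ` {Lx x | x. x \<noteq> 0} = {vec.span {ver_mat *v veronese x} | x. x \<noteq> 0}"
    unfolding ver_mat_veronese plucker_Lx[symmetric] by auto
qed simp

text \<open>Linear equations for the span of the vectors \<open>wd x\<close>: up to sign the three
  families contain 3 + 3 + 3 independent functionals, which leaves a space of dimension 15 - 9 =
  6.\<close>

definition plucker_functionals :: "('a ^ plucker_index) set" where
  "plucker_functionals = {plucker_coords (NX $ i) (NX $ j) | i j. True} \<union> {plucker_coords (NY $ i) (NY $ j) | i j. True} \<union>
     {plucker_coords (NX $ i) (NY $ j) - plucker_coords (NX $ j) (NY $ i) | i j. True}"

lemma functional_wd: "c \<in> plucker_functionals \<Longrightarrow> vdot c (wd x) = 0"
  by (auto simp: plucker_functionals_def wd_def vdot_left(3) cauchy_binet vdot_N NX_NY_ab)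

text \<open>The first two families make the \<open>NX\<close> parts of all vectors of
  \<open>L\<close> proportional, and likewise the \<open>NY\<close> parts. So \<open>L\<close>
  contains a nonzero \<open>u\<close> with vanishing \<open>NX\<close> part, that is
  \<open>u = Bv y\<close>, and the third family forces the \<open>NX\<close> part of any other
  vector of \<open>L\<close> to be proportional to y.\<close>

lemma line_is_Lx:
  assumes L: "L \<in> Gr 1" and zero: "\<And>c v w. c \<in> plucker_functionals \<Longrightarrow> v \<in> L \<Longrightarrow> w \<in> L \<Longrightarrow> vdot c (plucker_coords v w) = 0"
  obtains x where "x \<noteq> 0" "L = Lx x"
proof -
  have XX: "(NX *v v) $ i * (NX *v w) $ j = (NX *v v) $ j * (NX *v w) $ i"
    and YY: "(NY *v v) $ i * (NY *v w) $ j = (NY *v v) $ j * (NY *v w) $ i"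
    and XY: "(NX *v v) $ i * (NY *v w) $ j - (NX *v w) $ i * (NY *v v) $ j = (NX *v v) $ j * (NY *v w) $ i - (NX *v w) $ j * (NY *v v) $ i"
    if "v \<in> L" "w \<in> L" for v w i j
  proof -
    have "vdot (plucker_coords (NX $ i) (NX $ j)) (plucker_coords v w) = 0"
      "vdot (plucker_coords (NY $ i) (NY $ j)) (plucker_coords v w) = 0"
      "vdot (plucker_coords (NX $ i) (NY $ j) - plucker_coords (NX $ j) (NY $ i)) (plucker_coords v w) = 0"
      by (intro zero that; auto simp: plucker_functionals_def)+
    then show "(NX *v v) $ i * (NX *v w) $ j = (NX *v v) $ j * (NX *v w) $ i"
     "(NY *v v) $ i * (NY *v w) $ j = (NY *v v) $ j * (NY *v w) $ i"
     "(NX *v v) $ i * (NY *v w) $ j - (NX *v w) $ i * (NY *v v) $ j = (NX *v v) $ j * (NY *v w) $ i - (NX *v w) $ j * (NY *v v) $ i"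
      unfolding vdot_left(3) cauchy_binet vdot_N by (simp_all add: algebra_simps)
  qed
  have sub: "vec.subspace L" using L by (auto simp: Gr_def)
  have "\<exists>u\<in>L. u \<noteq> 0 \<and> NX *v u = 0"
  proof -
    have "\<not> L \<subseteq> {0}" using L by (auto simp: Gr_def simp flip: vec.dim_eq_0)
    then obtain w where w: "w \<in> L" "w \<noteq> 0" by blast
    obtain v i j where v: "L = line v w" "v $ i * w $ j \<noteq> v $ j * w $ i" by (rule Gr1E[OF L w])
    have vL: "v \<in> L" unfolding v(1) by (rule in_line)
    show ?thesis
    proof (cases "NX *v w = 0")
      case True then show ?thesis using w by blast
    next
      case False
      obtain c where c: "NX *v v = c *s (NX *v w)" by (rule proportional[OF _ False]) (rule XX[OF w(1) vL])
      let ?u = "v - c *s w"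
      have "?u \<in> L" using sub vL w by (intro vec.subspace_diff vec.subspace_scale)
      moreover have "?u \<noteq> 0" using v(2) by auto
      moreover have "NX *v ?u = 0" by (simp add: matrix_vector_mult_diff_distrib vector_scalar_commute c)
      ultimately show ?thesis by blast
    qed
  qed
  then obtain u where u: "u \<in> L" "u \<noteq> 0" "NX *v u = 0" by blast
  define y where "y = NY *v u"
  have uB: "u = Bv y" using AB_N[of u] u(3) by (simp add: y_def Av_0)
  have y0: "y \<noteq> 0" using u(2) uB by (auto simp: Bv_0)
  obtain v i j where v: "L = line v u" "v $ i * u $ j \<noteq> v $ j * u $ i" by (rule Gr1E[OF L u(1,2)])
  have vL: "v \<in> L" unfolding v(1) by (rule in_line)
  obtain c where c: "NY *v v = c *s y" by (rule proportional[OF _ y0]) (use YY[OF u(1) vL] in \<open>simp add: y_def\<close>)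
  define x where "x = NX *v v"
  have vP: "v = Av x + Bv (c *s y)" using AB_N[of v] by (simp add: x_def c)
  have x0: "x \<noteq> 0"
  proof
    assume "x = 0"
    then have "v = c *s u" using vP uB by (simp add: Av_0 Bv_scale)
    then show False using v(2) by simp
  qed
  have "x $ i * y $ j = x $ j * y $ i" for i j
    using XY[OF vL u(1), of i j] by (simp add: x_def y_def u(3))
  then obtain e where e: "y = e *s x" using x0 by (rule proportional)
  have "e \<noteq> 0" using y0 e by auto
  have "v = P 1 (c * e) x" "u = P 0 e x" using vP uB by (simp_all add: P_def Bv_scale e)
  then have "L = Lx x" using Lx_line[of 1 e 0 "c * e" x] \<open>e \<noteq> 0\<close> v(1) by simp
  with x0 that show thesis by blast
qed

text \<open>By \<open>line_is_Lx\<close> the family is the preimage of a linear section of Pluecker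
  space. This bounds the closures of secant loci from above.\<close>

lemma lines_closed: "closedin line_topology {Lx x | x. x \<noteq> 0}"
proof -
  define lin :: "'a ^ plucker_index \<Rightarrow> (plucker_index, 'a) mpoly" where "lin c = (\<Sum>k\<in>UNIV. mp_const (c $ k) * mp_var k)" for c
  have lin: "lin c \<in> forms 1" "mp_value (lin c) v = vdot c v" for c v
    unfolding lin_def by (rule linear_form) (simp add: vdot_def)
  define C where "C = {p \<in> proj_space. \<forall>F\<in>lin ` plucker_functionals. \<forall>v\<in>p. mp_value F v = 0}"
  have C: "closedin zariski C"
    unfolding C_def by (rule closedin_zariski_zeros) (use lin(1) in \<open>auto simp: homogeneous_def\<close>)
  have eq: "{Lx x | x. x \<noteq> 0} = plucker -` C \<inter> Gr 1"
  proof (intro equalityI subsetI)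
    fix L assume "L \<in> {Lx x | x. x \<noteq> 0}"
    then obtain x where x: "L = Lx x" "x \<noteq> 0" by blast
    have "vec.span {wd x} \<in> C"
      unfolding C_def using span_singleton_proj[OF wd_nonzero[OF x(2)]]
      by (auto simp: lin(2) functional_wd vdot_linear(2) dest!: vec.span_singleton[THEN equalityD1, THEN subsetD])
    then show "L \<in> plucker -` C \<inter> Gr 1" using x Lx_Gr1 by (simp add: plucker_Lx)
  next
    fix L assume L: "L \<in> plucker -` C \<inter> Gr 1"
    have "vdot c (plucker_coords v w) = 0" if "c \<in> plucker_functionals" "v \<in> L" "w \<in> L" for c v w
    proof -
      have "plucker_coords v w \<in> plucker L" unfolding plucker_def by (rule vec.span_base) (use that in blast)
      then have "mp_value (lin c) (plucker_coords v w) = 0" using L that(1) unfolding C_def by blast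
      then show ?thesis by (simp add: lin(2))
    qed
    then obtain x where "x \<noteq> 0" "L = Lx x" using line_is_Lx[of L] L by blast
    then show "L \<in> {Lx x | x. x \<noteq> 0}" by blast
  qed
  have "openin zariski (topspace zariski - C)" using C by (simp add: closedin_def)
  then have "openin line_topology (plucker -` (topspace zariski - C) \<inter> Gr 1)"
    unfolding line_topology_def openin_pullback_topology by blast
  moreover have "topspace line_topology - (plucker -` C \<inter> Gr 1) = plucker -` (topspace zariski - C) \<inter> Gr 1"
    unfolding line_topology_def topspace_pullback_topology by blast
  moreover have "plucker -` C \<inter> Gr 1 \<subseteq> topspace line_topology"
    unfolding line_topology_def topspace_pullback_topology using closedin_subset[OF C] by blast
  ultimately show ?thesis unfolding eq closedin_def by simp
qed

lemma polyfun_P: "polyfun (\<lambda>x. P s t x $ i)"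
proof -
  have "P s t x $ i = (\<Sum>j\<in>UNIV. x $ j * (s * a j $ i + t * b j $ i))" for x
    by (simp add: P_def Av_def Bv_def sum_distrib_left sum.distrib algebra_simps)
  then show ?thesis by (simp only:) (intro polyfun_sum polyfun_mult polyfun_coord polyfun_const)
qed

lemma polyfun_wd: "polyfun (\<lambda>x. wd x $ k)"
proof -
  have "Av x = P 1 0 x" "Bv x = P 0 1 x" for x by (simp_all add: P_def)
  then show ?thesis
    unfolding wd_def plucker_coords_nth by (simp only:) (intro polyfun_diff polyfun_mult polyfun_P)
qed

text \<open>A basic neighbourhood of \<open>Lx x\<close> is given by the nonvanishing of a form at
  \<open>wd x\<close>. This is a polynomial function of x that is nonzero somewhere, hence somewhere
  on \<open>S\<close>.\<close>

lemma closure_of_lines: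
  assumes S: "zdense S" "\<And>x. x \<in> S \<Longrightarrow> x \<noteq> 0"
  shows "line_topology closure_of (Lx ` S) = {Lx x | x. x \<noteq> 0}"
proof (rule antisym)
  show "line_topology closure_of (Lx ` S) \<subseteq> {Lx x | x. x \<noteq> 0}"
    by (rule closure_of_minimal[OF _ lines_closed]) (use S(2) in auto)
  show "{Lx x | x. x \<noteq> 0} \<subseteq> line_topology closure_of (Lx ` S)"
  proof
    fix L assume L: "L \<in> {Lx x | x. x \<noteq> 0}"
    then obtain x where x: "L = Lx x" "x \<noteq> 0" by blast
    show "L \<in> line_topology closure_of (Lx ` S)"
      unfolding in_closure_of
    proof (intro conjI allI impI)
      show "L \<in> topspace line_topology" using L closedin_subset[OF lines_closed] by blast
      fix U assume U: "L \<in> U \<and> openin line_topology U"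
      then obtain O' where O': "openin zariski O'" "U = plucker -` O' \<inter> Gr 1"
        unfolding line_topology_def openin_pullback_topology by blast
      have "plucker L \<in> O'" using U O'(2) by blast
      then obtain F where F: "homogeneous F" "plucker L \<in> nonvanishing F" "nonvanishing F \<subseteq> O'"
        using openin_zariski_basis[OF O'(1)] by blast
      have "mp_value F (wd x) \<noteq> 0"
        using F(2) homogeneous_vanishes_point[OF F(1), of "wd x"] by (auto simp: nonvanishing_def x(1) plucker_Lx)
      moreover have "polyfun (\<lambda>x. mp_value F (wd x))" by (rule polyfun_compose[OF polyfun_mp_value polyfun_wd])
      ultimately obtain y where y: "y \<in> S" "mp_value F (wd y) \<noteq> 0" using S(1) unfolding zdense_def by blast
      have "vec.span {wd y} \<in> nonvanishing F"
        unfolding nonvanishing_def using span_singleton_proj[OF wd_nonzero[OF S(2)[OF y(1)]]] y(2) vec.span_base[of "wd y" "{wd y}"] by blast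
      then have "Lx y \<in> U" using O'(2) F(3) Lx_Gr1[OF S(2)[OF y(1)]] by (auto simp: plucker_Lx)
      then show "\<exists>y. y \<in> Lx ` S \<and> y \<in> U" using y(1) by blast
    qed
  qed
qed

lemma points_Lx: "points (Lx x) \<subseteq> V 0"
proof
  fix p assume p: "p \<in> points (Lx x)"
  then obtain z where z: "z \<noteq> 0" "p = vec.span {z}" by (auto simp: points_def elim: proj_spaceE)
  then have "z \<in> Lx x" using p vec.span_base[of z "{z}"] by (auto simp: points_def)
  then obtain s t where "z = P s t x" by (auto simp: Lx_def)
  then show "p \<in> V 0" using z by (auto intro: V_I)
qed

lemma point_in_Lx: "P s t x \<noteq> 0 \<Longrightarrow> vec.span {P s t x} \<in> points (Lx x)"
proof -
  assume nz: "P s t x \<noteq> 0"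
  have "vec.span {P s t x} \<subseteq> Lx x"
    unfolding Lx_eq_line by (rule vec.span_minimal[OF _ line_subspace]) (auto simp: line_def P_def)
  with nz show ?thesis by (simp add: points_def span_singleton_proj)
qed

text \<open>For a point of the scroll with parameters (s, t, x), keeping (s, t) fixed and varying x
  in the dense set already approximates it.\<close>

lemma closure_of_union:
  assumes S: "zdense S" "\<And>x. x \<in> S \<Longrightarrow> x \<noteq> 0"
  shows "zariski closure_of (\<Union>x\<in>S. points (Lx x)) = V 0"
proof (rule antisym)
  have cl: "closedin zariski (V 0)" by (rule V_closed[of 0 0]) simp
  show "zariski closure_of (\<Union>x\<in>S. points (Lx x)) \<subseteq> V 0"
    by (rule closure_of_minimal[OF _ cl]) (use points_Lx in blast)
  show "V 0 \<subseteq> zariski closure_of (\<Union>x\<in>S. points (Lx x))"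
  proof
    fix p assume p: "p \<in> V 0"
    then obtain s t x where x: "p = vec.span {P s t x}" "P s t x \<noteq> 0" by (auto simp: V_def)
    show "p \<in> zariski closure_of (\<Union>x\<in>S. points (Lx x))"
      unfolding in_closure_of
    proof (intro conjI allI impI)
      show "p \<in> topspace zariski" using p closedin_subset[OF cl] by blast
      fix U assume U: "p \<in> U \<and> openin zariski U"
      then obtain F where F: "homogeneous F" "p \<in> nonvanishing F" "nonvanishing F \<subseteq> U"
        using openin_zariski_basis by blast
      have "mp_value F (P s t x) \<noteq> 0"
        using F(2) homogeneous_vanishes_point[OF F(1), of "P s t x"] by (auto simp: nonvanishing_def x(1))
      moreover have "polyfun (\<lambda>x. mp_value F (P s t x))" by (rule polyfun_compose[OF polyfun_mp_value polyfun_P])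
      ultimately obtain y where y: "y \<in> S" "mp_value F (P s t y) \<noteq> 0" using S(1) unfolding zdense_def by blast
      have nz: "P s t y \<noteq> 0" using x(2) S(2)[OF y(1)] by (auto simp: P_eq_0_iff)
      have "vec.span {P s t y} \<in> nonvanishing F"
        unfolding nonvanishing_def using span_singleton_proj[OF nz] y(2) vec.span_base[of "P s t y" "{P s t y}"] by blast
      then show "\<exists>q. q \<in> (\<Union>x\<in>S. points (Lx x)) \<and> q \<in> U" using point_in_Lx[OF nz] y(1) F(3) by blast
    qed
  qed
qed

end

context type_I_surface
begin

lemma polyfun_f: "polyfun (\<lambda>x. ev f (bp s t x))"
proof -
  have "ev f (bp s t x) = x $ 1 * ev f (bp s t (axis 1 1)) + x $ 2 * ev f (bp s t (axis 2 1)) + x $ 3 * ev f (bp s t (axis 3 1))" for x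
  proof -
    have x: "x = (x $ 1 *s axis 1 1 + x $ 2 *s axis 2 1) + x $ 3 *s axis 3 1"
      by (rule vec3_eqI) (auto simp: axis_def)
    have "ev f (bp s t (c *s y)) = c * ev f (bp s t y)" for c y
      using ev_bih_scale[OF f_bih, of 1 s t c y] by simp
    then show ?thesis by (subst x) (simp only: f_linear)
  qed
  note eq = this
  have "polyfun (\<lambda>x :: 'a ^ 3. x $ 1 * ev f (bp s t (axis 1 1)) + x $ 2 * ev f (bp s t (axis 2 1)) + x $ 3 * ev f (bp s t (axis 3 1)))"
    by (intro polyfun_add polyfun_mult polyfun_coord polyfun_const)
  then show ?thesis unfolding eq[symmetric] .
qed

lemma good_x_exists: "\<exists>x. good_x x"
proof (rule ccontr)
  assume none: "\<not> ?thesis"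
  have "f = 0" by (rule bipoly_eqI) (use none in \<open>auto simp: good_x_def\<close>)
  with f_nonzero show False ..
qed

lemma good_x_dense: "zdense {x. good_x x}"
  unfolding zdense_def
proof (intro allI impI)
  fix g :: "'a ^ 3 \<Rightarrow> 'a" assume g: "polyfun g" "\<exists>x. g x \<noteq> 0"
  obtain s t y where y: "ev f (bp s t y) \<noteq> 0" using good_x_exists by (auto simp: good_x_def)
  obtain x where x: "g x \<noteq> 0" using g(2) by blast
  obtain u where "g u \<noteq> 0" "ev f (bp s t u) \<noteq> 0" by (rule polyfun_nonzero_mult[OF g(1) polyfun_f x y])
  then show "\<exists>x\<in>{x. good_x x}. g x \<noteq> 0" by (auto simp: good_x_def)
qed

lemma extremal_secant_locus_eq: "extremal_secant_locus (V f) d = {Lx x | x. x \<noteq> 0}"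
proof -
  have "{Lx x | x. good_x x} = Lx ` {x. good_x x}" by auto
  moreover have "line_topology closure_of (Lx ` {x. good_x x}) = {Lx x | x. x \<noteq> 0}"
    by (rule closure_of_lines[OF good_x_dense], rule good_x_nonzero, erule CollectD)
  ultimately show ?thesis unfolding extremal_secant_locus_def secant_lines by (simp only:)
qed

lemma zdense_nonzero: "zdense {x :: 'a ^ 3. x \<noteq> 0}"
  using good_x_dense good_x_nonzero unfolding zdense_def by blast

lemma extended_extremal_variety_eq: "extended_extremal_variety (V f) d = V 0"
proof -
  have "(\<Union>L\<in>{Lx x | x. x \<noteq> 0}. points L) = (\<Union>x\<in>{x. x \<noteq> 0}. points (Lx x))" by auto
  then show ?thesis
    unfolding extended_extremal_variety_def extremal_secant_locus_eq
    by (rule trans[OF arg_cong[where f = "(closure_of) zariski"] closure_of_union[OF zdense_nonzero]]) auto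
qed

end

section \<open>Cross products\<close>

definition cr :: "'a::comm_ring_1 ^ 3 \<Rightarrow> 'a ^ 3 \<Rightarrow> 'a ^ 3" where
  "cr p q = vector [p $ 2 * q $ 3 - p $ 3 * q $ 2, p $ 3 * q $ 1 - p $ 1 * q $ 3, p $ 1 * q $ 2 - p $ 2 * q $ 1]"

lemma cr_nth: "cr p q $ 1 = p $ 2 * q $ 3 - p $ 3 * q $ 2" "cr p q $ 2 = p $ 3 * q $ 1 - p $ 1 * q $ 3"
  "cr p q $ 3 = p $ 1 * q $ 2 - p $ 2 * q $ 1"
  by (simp_all add: cr_def)

lemma vdot_3: "vdot p x = p $ 1 * x $ 1 + p $ 2 * x $ 2 + p $ 3 * x $ 3" for p :: "'a::comm_ring_1 ^ 3"
  by (simp add: vdot_def sum_3)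

lemma cr_cr: "cr (cr p q) x = vdot p x *s q - vdot q x *s p"
  by (rule vec3_eqI) (simp_all add: cr_nth vdot_3 algebra_simps)

lemma vdot_cr: "vdot p (cr p q) = 0" "vdot q (cr p q) = 0"
  by (simp_all add: cr_nth vdot_3 algebra_simps)

text \<open>The minors of \<open>cr p q\<close> and x are, up to sign, the entries of
  \<open>cr (cr p q) x\<close>, which \<open>cr_cr\<close> expands. The ring is arbitrary because
  the vectors will have polynomial entries.\<close>

lemma cr_comb: "\<exists>u w. cr p q $ i * x $ j - cr p q $ j * x $ i = vdot p x * u + vdot q x * w"
proof -
  have k: "cr (cr p q) x $ k = vdot p x * q $ k + vdot q x * (- p $ k)"
    "- cr (cr p q) x $ k = vdot p x * (- q $ k) + vdot q x * p $ k" for k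
    unfolding cr_cr by simp_all
  have "i = j \<or> (\<exists>k. cr p q $ i * x $ j - cr p q $ j * x $ i \<in> {cr (cr p q) x $ k, - cr (cr p q) x $ k})"
    using exhaust_3[of i] exhaust_3[of j] cr_nth[of "cr p q" x, symmetric]
    by (elim disjE) (simp_all, (metis minus_diff_eq)+)
  then show ?thesis
  proof
    assume "i = j"
    then show ?thesis by (intro exI[of _ 0]) simp
  next
    assume "\<exists>k. cr p q $ i * x $ j - cr p q $ j * x $ i \<in> {cr (cr p q) x $ k, - cr (cr p q) x $ k}"
    then obtain k where "cr p q $ i * x $ j - cr p q $ j * x $ i = cr (cr p q) x $ k \<or>
      cr p q $ i * x $ j - cr p q $ j * x $ i = - cr (cr p q) x $ k" by blast
    then show ?thesis using k by metis
  qed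
qed

lemma cr_proportional:
  fixes p q :: "'a::field ^ 3"
  assumes "cr p q = 0" "p \<noteq> 0"
  obtains e where "q = e *s p"
proof (rule proportional[OF _ assms(2)])
  have z: "p $ 2 * q $ 3 = p $ 3 * q $ 2" "p $ 3 * q $ 1 = p $ 1 * q $ 3" "p $ 1 * q $ 2 = p $ 2 * q $ 1"
    using cr_nth[of p q] assms(1) by simp_all
  show "p $ i * q $ j = p $ j * q $ i" for i j
    using exhaust_3[of i] exhaust_3[of j] z by auto
qed (rule that)

lemma cr_kernel:
  fixes p q :: "'a::field ^ 3"
  assumes "cr p q \<noteq> 0" "vdot p x = 0" "vdot q x = 0"
  obtains e where "x = e *s cr p q"
  by (rule cr_proportional[OF _ assms(1), of x]) (use assms(2,3) in \<open>auto simp: cr_cr intro: that\<close>)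

text \<open>For a basis vector y = e_i the double product is \<gamma>_i r - (\<gamma> . r) e_i. If
  it vanished for all i, the matrix of rank 1 with entries r_k \<gamma>_i would be a scalar matrix,
  which is impossible in size 3.\<close>

lemma cr_nonzero:
  fixes r \<gamma> :: "'a::field ^ 3"
  assumes "r \<noteq> 0" "\<gamma> \<noteq> 0"
  obtains y where "cr \<gamma> (cr r y) \<noteq> 0"
proof (rule ccontr)
  assume neg: "\<not> thesis"
  then have z: "cr \<gamma> (cr r y) = 0" for y using that by blast
  have "r $ k * \<gamma> $ i = (if k = i then vdot \<gamma> r else 0)" for k i
  proof -
    have "cr \<gamma> (cr r (axis i 1)) $ k = 0" by (simp add: z)
    then show ?thesis
      using exhaust_3[of i] exhaust_3[of k] by (auto simp: cr_nth axis_def vdot_3 algebra_simps neg_eq_iff_add_eq_0)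
  qed
  note E = this
  obtain k where k: "r $ k \<noteq> 0" using assms(1) by (auto simp: Finite_Cartesian_Product.vec_eq_iff)
  obtain i where i: "\<gamma> $ i \<noteq> 0" using assms(2) by (auto simp: Finite_Cartesian_Product.vec_eq_iff)
  have "k = i" using E[of k i] k i by (auto split: if_splits)
  moreover obtain j :: 3 where "j \<noteq> i" by (metis exhaust_3 one_neq_zero num1_eq_iff zero_neq_one numeral_eq_one_iff)
  ultimately show False using E[of j j] E[of k i] E[of j i] k i by auto
qed

text \<open>Dependent \<open>p\<close> and \<open>q\<close> are multiples of one nonzero vector r,
  so every \<open>cr r y\<close> lies in their common kernel, and \<open>cr_nonzero\<close> finds
  one that is not proportional to \<gamma>.\<close>

lemma cr_zero_kernel:
  fixes p q \<gamma> :: "'a::field ^ 3"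
  assumes "cr p q = 0" "\<gamma> \<noteq> 0"
  obtains w where "vdot p w = 0" "vdot q w = 0" "cr \<gamma> w \<noteq> 0"
proof -
  obtain r where r: "r \<noteq> 0" "\<And>y. vdot p (cr r y) = 0" "\<And>y. vdot q (cr r y) = 0"
  proof (cases "p = 0")
    case True
    show thesis
    proof (cases "q = 0")
      case q: True
      show thesis by (rule that[of "axis 1 1"]) (use True q in \<open>auto simp: vdot_3 axis_eq_0_iff\<close>)
    next
      case False
      then show thesis by (rule that) (use True in \<open>auto simp: vdot_cr vdot_def[of 0]\<close>)
    qed
  next
    case False
    then obtain e where e: "q = e *s p" using cr_proportional[OF assms(1)] by blast
    have "vdot q (cr p y) = e * vdot p (cr p y)" for y by (simp add: e vdot_3 algebra_simps)
    then show thesis using that[OF False] by (simp add: vdot_cr)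
  qed
  obtain y where "cr \<gamma> (cr r y) \<noteq> 0" by (rule cr_nonzero[OF r(1) assms(2)])
  with r(2,3) show thesis by (rule that)
qed

lemma common_zero:
  fixes p q :: "'a::field ^ 3"
  obtains x where "x \<noteq> 0" "vdot p x = 0" "vdot q x = 0"
proof (cases "cr p q = 0")
  case True
  obtain w where w: "vdot p w = 0" "vdot q w = 0" "cr (axis 1 1) w \<noteq> 0"
    by (rule cr_zero_kernel[OF True, of "axis 1 1"]) (simp add: axis_eq_0_iff)
  then have "w \<noteq> 0" by (auto simp: cr_def vec_eq_iff forall_3 Finite_Cartesian_Product.vec_eq_iff)
  with w(1,2) that show thesis by blast
next
  case False
  then show thesis using that vdot_cr by blast
qed

section \<open>Hyperplanes\<close>

definition hyp :: "'a::field ^ 'n \<Rightarrow> ('a ^ 'n) set" where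
  "hyp c = {v. vdot c v = 0}"

lemma vdot_axis: "vdot v (axis i 1) = v $ i"
proof -
  have "vdot v (axis i 1) = (\<Sum>j\<in>UNIV. if j = i then v $ j else 0)"
    unfolding vdot_def by (rule sum.cong) (auto simp: axis_def)
  then show ?thesis by simp
qed

lemma vdot_right_diff: "vdot p (v - w) = vdot p v - vdot p w"
  by (simp add: vdot_def right_diff_distrib sum_subtractf)

lemma hyp_subspace: "vec.subspace (hyp c)"
  by (auto simp: vec.subspace_def hyp_def vdot_linear)

lemma hyp_dim_le: "c \<noteq> 0 \<Longrightarrow> vec.dim (hyp (c :: 'a::field ^ 'n)) < CARD('n)"
proof -
  assume "c \<noteq> 0"
  then obtain i where "c $ i \<noteq> 0" by (auto simp: Finite_Cartesian_Product.vec_eq_iff)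
  then have "axis i 1 \<notin> hyp c" by (simp add: hyp_def vdot_axis)
  then have "vec.span (hyp c) \<noteq> UNIV" by (metis UNIV_I hyp_subspace vec.span_eq_iff)
  then have "vec.dim (hyp c) \<noteq> CARD('n)" using vec.dim_eq_full[of "hyp c"] by (simp add: vec.dimension_def card_cart_basis)
  moreover have "vec.dim (hyp c) \<le> CARD('n)" using vec.dim_subset_UNIV[of "hyp c"] by (simp add: vec_dim_card vec.dimension_def card_cart_basis)
  ultimately show ?thesis by simp
qed

lemma hyp_Gr: "c \<noteq> 0 \<Longrightarrow> hyp (c :: 'a::field ^ 6) \<in> Gr 4"
proof -
  assume c: "c \<noteq> 0"
  then obtain i where i: "c $ i \<noteq> 0" by (auto simp: Finite_Cartesian_Product.vec_eq_iff)
  have "v \<in> vec.span (insert (axis i 1) (hyp c))" for v :: "'a ^ 6"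
  proof -
    let ?k = "vdot c v / c $ i"
    have "v - ?k *s axis i 1 \<in> hyp c" using i by (simp add: hyp_def vdot_right_diff vdot_linear vdot_axis)
    then have "(v - ?k *s axis i 1) + ?k *s axis i 1 \<in> vec.span (insert (axis i 1) (hyp c))"
      by (intro vec.span_add vec.span_scale vec.span_base) auto
    then show ?thesis by simp
  qed
  then have "vec.span (insert (axis i 1) (hyp c)) = UNIV" by blast
  then have "vec.dim (insert (axis i 1) (hyp c)) = 6"
    using vec.dim_eq_full[of "insert (axis i 1) (hyp c)"] by (simp add: vec.dimension_def card_cart_basis)
  moreover have "vec.dim (insert (axis i 1) (hyp c)) \<le> vec.dim (hyp c) + 1" by (simp add: vec.dim_insert)
  ultimately have "vec.dim (hyp c) = 5" using hyp_dim_le[OF c] by simp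
  then show ?thesis using hyp_subspace by (simp add: Gr_def)
qed

lemma Gr4E:
  assumes "\<Lambda> \<in> Gr 4"
  obtains c :: "'a::field ^ 6" where "c \<noteq> 0" "\<Lambda> = hyp c"
proof -
  have L: "vec.subspace \<Lambda>" "vec.dim \<Lambda> = 5" using assms by (auto simp: Gr_def)
  obtain B where B: "B \<subseteq> \<Lambda>" "vec.independent B" "\<Lambda> \<subseteq> vec.span B" "card B = vec.dim \<Lambda>"
    by (rule vec.basis_exists)
  have sB: "vec.span B = \<Lambda>" using B L(1) by (metis subset_antisym vec.span_minimal)
  have "\<Lambda> \<noteq> UNIV" using L(2) vec_dim_card[where 'a='a and 'n=6] by auto
  then obtain z where z: "z \<notin> \<Lambda>" by blast
  then have ind: "vec.independent (insert z B)" using B(2) sB by (metis vec.independent_insertI)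
  obtain g :: "'a ^ 6 \<Rightarrow> 'a ^ 6" where g: "Vector_Spaces.linear (*s) (*s) g"
    "\<And>x. x \<in> insert z B \<Longrightarrow> g x = (if x = z then axis 1 1 else 0)"
    using vec.linear_independent_extend[OF ind, of "\<lambda>x. if x = z then axis 1 1 else 0"] by blast
  interpret g: Vector_Spaces.linear "(*s)" "(*s)" g by (rule g(1))
  define c where "c = (\<chi> i. g (axis i 1) $ 1)"
  have gc: "g v $ 1 = vdot c v" for v
  proof -
    have "v = (\<Sum>i\<in>UNIV. v $ i *s axis i 1)"
      by (rule basis_expansion[symmetric])
    from arg_cong[OF this, of g] have "g v = (\<Sum>i\<in>UNIV. v $ i *s g (axis i 1))" by (simp only: g.sum g.scale)
    then show ?thesis by (simp add: vdot_def c_def mult.commute)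
  qed
  have "B \<subseteq> hyp c"
  proof
    fix x assume x: "x \<in> B"
    then have "x \<noteq> z" using z B(1) by blast
    then have "g x = 0" using g(2) x by simp
    then show "x \<in> hyp c" using gc[of x] by (simp add: hyp_def)
  qed
  then have sub: "\<Lambda> \<subseteq> hyp c" using sB hyp_subspace by (metis vec.span_minimal)
  have "vdot c z = 1" using gc[of z] g(2)[of z] by simp
  then have c: "c \<noteq> 0" by (auto simp: vdot_def)
  have "\<Lambda> = hyp c"
    by (rule vec.subspace_dim_equal[OF L(1) hyp_subspace sub]) (use hyp_dim_le[OF c] L(2) in simp)
  with c that show thesis by blast
qed

lemma annihilator_hyp:
  fixes c :: "'a::field ^ 'n"
  assumes "c \<noteq> 0"
  shows "annihilator (hyp c) = vec.span {c}"
proof (rule antisym)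
  obtain i where i: "c $ i \<noteq> 0" using assms by (auto simp: Finite_Cartesian_Product.vec_eq_iff)
  show "annihilator (hyp c) \<subseteq> vec.span {c}"
  proof
    fix e assume e: "e \<in> annihilator (hyp c)"
    have "e $ j = (e $ i / c $ i) * c $ j" for j
    proof -
      have "axis j 1 - (c $ j / c $ i) *s axis i 1 \<in> hyp c"
        using i by (simp add: hyp_def vdot_right_diff vdot_linear vdot_axis)
      then have "vdot e (axis j 1 - (c $ j / c $ i) *s axis i 1) = 0" using e by (auto simp: annihilator_def vdot_def)
      then show ?thesis by (simp add: vdot_right_diff vdot_linear vdot_axis)
    qed
    then have "e = (e $ i / c $ i) *s c" unfolding Finite_Cartesian_Product.vec_eq_iff vector_smult_component by blast
    then show "e \<in> vec.span {c}" by (metis vec.span_scale vec.span_base singletonI)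
  qed
  show "vec.span {c} \<subseteq> annihilator (hyp c)"
    by (auto simp: vec.span_singleton annihilator_def hyp_def vdot_left(2) simp flip: vdot_def)
qed

section \<open>Bihomogeneous components\<close>

text \<open>The bihomogeneous component of bidegree (m, n). It replaces the cofactors in an ideal
  membership by bihomogeneous ones.\<close>

definition bihc :: "nat \<Rightarrow> nat \<Rightarrow> 'a::comm_ring_1 bipoly \<Rightarrow> 'a bipoly" where
  "bihc m n G = coeff (grade wX (coeff (grade wS G) m)) n"

lemma lookup_bihc: "Poly_Mapping.lookup (bihc m n G) \<mu> =
    (if wdeg wX \<mu> = n \<and> wdeg wS \<mu> = m then Poly_Mapping.lookup G \<mu> else 0)"
  by (simp add: bihc_def lookup_grade)

lemma bih_bihc: "bih m n (bihc m n G)"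
  by (auto simp: bih_def whom_def in_keys_iff lookup_bihc split: if_splits)

lemma bihc_add: "bihc m n (F + G) = bihc m n F + bihc m n G"
  by (rule poly_mapping_eqI) (simp add: lookup_bihc lookup_add)

lemma bihc_bih: "bih m n G \<Longrightarrow> bihc m n G = G"
  by (rule poly_mapping_eqI) (auto simp: lookup_bihc bih_def whom_def in_keys_iff)

lemma bihc_mult:
  fixes p G :: "'a::comm_ring_1 bipoly"
  assumes "bih i j p"
  shows "bihc m n (p * G) = (if i \<le> m \<and> j \<le> n then p * bihc (m - i) (n - j) G else 0)"
proof -
  have gr: "coeff (grade w (p * H)) m = (if k \<le> m then p * coeff (grade w H) (m - k) else 0)"
    if w: "whom w k p" for w k m and H :: "'a bipoly"
  proof -
    interpret comm_ring_hom "grade w :: 'a bipoly \<Rightarrow> _" by (rule grade_hom)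
    have "grade w (p * H) = monom p k * grade w H" using w by (simp add: hom_mult whom_iff_grade)
    then show ?thesis by (simp add: coeff_monom_mult)
  qed
  have g0: "grade w (0 :: 'a bipoly) = 0" for w by (simp add: grade_def mp_eval_zero)
  have "whom wS i p" "whom wX j p" using assms by (simp_all add: bih_def)
  from gr[OF this(1)] gr[OF this(2)] show ?thesis by (simp add: bihc_def g0)
qed


section \<open>Hyperplane sections of the surface\<close>

lemma saturation_vanishes:
  fixes v :: "'a::field ^ 'n"
  assumes "F \<in> saturation I" "v \<noteq> 0" "\<And>G. G \<in> I \<Longrightarrow> mp_value G v = 0"
  shows "mp_value F v = 0"
proof -
  obtain N where N: "\<And>i. mp_var i ^ N * F \<in> I" using assms(1) by (auto simp: saturation_def)
  obtain i where "v $ i \<noteq> 0" using assms(2) by (auto simp: Finite_Cartesian_Product.vec_eq_iff)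
  moreover have "mp_value (mp_var i ^ N * F) v = 0" by (rule assms(3)[OF N])
  ultimately show ?thesis by simp
qed

lemma span_vanishes:
  fixes v :: "'a::field ^ 'n"
  assumes "F \<in> ideal.span B" "\<And>G. G \<in> B \<Longrightarrow> mp_value G v = 0"
  shows "mp_value F v = 0"
proof -
  have "ideal.subspace {F. mp_value F v = 0}" by (simp add: ideal.subspace_def)
  then have "ideal.span B \<subseteq> {F. mp_value F v = 0}" using assms(2) by (intro ideal.span_minimal) auto
  then show ?thesis using assms(1) by blast
qed

context scroll
begin

definition al :: "'a ^ 6 \<Rightarrow> 'a ^ 3" where "al c = (\<chi> j. vdot c (a j))"
definition be :: "'a ^ 6 \<Rightarrow> 'a ^ 3" where "be c = (\<chi> j. vdot c (b j))"
text \<open>On P^1 x P^2 the hyperplane with equation \<open>c\<close> becomes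
  \<open>vdot (hl c s t) x = 0\<close>; below, \<open>Hb c\<close> is the same vector with
  polynomial entries.\<close>

definition hl :: "'a ^ 6 \<Rightarrow> 'a \<Rightarrow> 'a \<Rightarrow> 'a ^ 3" where "hl c s t = s *s al c + t *s be c"

lemma vdot_P: "vdot c (P s t x) = vdot (hl c s t) x"
proof -
  have sum: "vdot c (\<Sum>j\<in>UNIV. g j) = (\<Sum>j\<in>UNIV. vdot c (g j))" for g :: "3 \<Rightarrow> 'a ^ 6"
    by (simp add: sum_3 vdot_linear)
  show ?thesis
    by (simp add: P_def Av_def Bv_def vdot_linear sum hl_def vdot_left al_def be_def)
      (simp add: vdot_3 sum_3 algebra_simps)
qed

definition lf :: "'a ^ 6 \<Rightarrow> (6, 'a) mpoly" where "lf c = (\<Sum>i\<in>UNIV. mp_const (c $ i) * mp_var i)"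

lemma lf: "lf c \<in> forms 1" "mp_value (lf c) v = vdot c v"
  unfolding lf_def by (rule linear_form) (simp add: vdot_def)

definition Hb :: "'a ^ 6 \<Rightarrow> 'a bipoly ^ 3" where
  "Hb c = (\<chi> j. mp_const (al c $ j) * mp_var vS + mp_const (be c $ j) * mp_var vT)"

definition Xb :: "'a bipoly ^ 3" where "Xb = (\<chi> j. mp_var (vX j))"

lemma bih_Hb: "bih 1 0 (Hb c $ j)"
  unfolding Hb_def by (simp only: vec_lambda_beta) (intro bih_add bih_cmult bih_var)

lemma ev_Hb: "ev (Hb c $ j) (bp s t x) = hl c s t $ j"
  by (simp add: Hb_def hl_def mult.commute)

lemma ev_vdot: "ev (vdot p q) u = vdot (\<chi> j. ev (p $ j) u) (\<chi> j. ev (q $ j) u)" for p q :: "'a bipoly ^ 3"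
  by (simp add: vdot_def)

lemma Phi_lf: "Phi (lf c) = vdot (Hb c) Xb"
proof (rule bipoly_eqI)
  fix s t x
  show "ev (Phi (lf c)) (bp s t x) = ev (vdot (Hb c) Xb) (bp s t x)"
    unfolding ev_Phi lf vdot_P ev_vdot ev_Hb by (simp add: Xb_def)
qed

lemma lf_in_ideal: "lf c \<in> vanishing_ideal (points (hyp c))"
proof (rule vanishing_idealI)
  show "homogeneous (lf c)" using lf(1) by (auto simp: homogeneous_def)
  show "vanishes (lf c) (points (hyp c))" by (auto simp: vanishes_def points_def lf hyp_def)
qed

lemma hl_eq_0: "(s, t) \<noteq> (0, 0) \<Longrightarrow> hl c s t = 0 \<Longrightarrow> cr (al c) (be c) = 0"
proof -
  assume st: "(s, t) \<noteq> (0, 0)" and "hl c s t = 0"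
  then have e: "s * al c $ j + t * be c $ j = 0" for j
    by (metis hl_def vector_add_component vector_smult_component zero_index)
  have "s * (al c $ i * be c $ j - al c $ j * be c $ i) = (s * al c $ i + t * be c $ i) * be c $ j - (s * al c $ j + t * be c $ j) * be c $ i"
    "t * (al c $ i * be c $ j - al c $ j * be c $ i) = (s * al c $ j + t * be c $ j) * al c $ i - (s * al c $ i + t * be c $ i) * al c $ j" for i j
    by (simp_all add: algebra_simps)
  then have "al c $ i * be c $ j - al c $ j * be c $ i = 0" for i j
    using st e by simp (metis mult_eq_0_iff)
  then show ?thesis by (intro vec3_eqI) (simp_all add: cr_nth)
qed

lemma hyp_nonzero: "c \<noteq> 0 \<Longrightarrow> al c \<noteq> 0 \<or> be c \<noteq> 0"
proof (rule ccontr)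
  assume c: "c \<noteq> 0" and n: "\<not> (al c \<noteq> 0 \<or> be c \<noteq> 0)"
  then have z: "vdot c (P s t x) = 0" for s t x unfolding vdot_P by (simp add: hl_def vdot_def)
  have "vdot c v = 0" for v
  proof -
    have "vdot c (P 1 0 (NX *v v) + P 0 1 (NY *v v)) = 0" by (simp only: vdot_linear z) simp
    then show ?thesis using AB_N[of v] by (simp add: P_def)
  qed
  from this[of "axis i 1" for i] have "c = 0" by (simp add: vdot_axis Finite_Cartesian_Product.vec_eq_iff)
  with c show False ..
qed

end

context type_I_surface
begin

text \<open>As \<open>f\<close> is linear in x, substituting the basis vector e_j extracts the
  coefficient of x_j, a binary form of degree d - 2 whose value at (s, t) is
  \<open>fv s t $ j\<close>.\<close>

definition Fb :: "'a bipoly ^ 3" where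
  "Fb = (\<chi> j. mp_eval mp_const (\<lambda>v. case v of None \<Rightarrow> mp_var vS | Some None \<Rightarrow> mp_var vT
     | Some (Some k) \<Rightarrow> mp_const (axis j 1 $ k)) f)"

definition fv :: "'a \<Rightarrow> 'a \<Rightarrow> 'a ^ 3" where "fv s t = (\<chi> j. ev f (bp s t (axis j 1)))"

lemma ev_Fb: "ev (Fb $ j) (bp s t x) = fv s t $ j"
proof -
  have "(\<lambda>v. ev (case v of None \<Rightarrow> mp_var vS | Some None \<Rightarrow> mp_var vT | Some (Some k) \<Rightarrow> mp_const (axis j 1 $ k)) (bp s t x))
      = bp s t (axis j 1)"
    by (rule ext) (auto simp: bp_def split: option.split)
  then show ?thesis by (simp add: Fb_def fv_def ev_subst)
qed

lemma bih_Fb: "bih (d - 2) 0 (Fb $ j)"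
  unfolding bih_def
proof
  have w: "whom wS (wS v) ((case v of None \<Rightarrow> mp_var vS | Some None \<Rightarrow> mp_var vT | Some (Some k) \<Rightarrow> mp_const (axis j 1 $ k)) :: 'a bipoly)"
    "whom wX 0 ((case v of None \<Rightarrow> mp_var vS | Some None \<Rightarrow> mp_var vT | Some (Some k) \<Rightarrow> mp_const (axis j 1 $ k)) :: 'a bipoly)" for v
    by (auto split: option.split intro!: whom_var whom_const)
  have "whom wS (d - 2) f" using f_bih by (simp add: bih_def)
  then show "whom wS (d - 2) (Fb $ j)" unfolding Fb_def vec_lambda_beta by (rule whom_subst) (rule w)
  have "whom (\<lambda>_. 0) 0 f" by (simp add: whom_def wdeg_def)
  then show "whom wX 0 (Fb $ j)" unfolding Fb_def vec_lambda_beta by (rule whom_subst) (rule w)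
qed

lemma f_vdot: "ev f (bp s t x) = vdot (fv s t) x"
proof -
  have x: "x = (x $ 1 *s axis 1 1 + x $ 2 *s axis 2 1) + x $ 3 *s axis 3 1"
    by (rule vec3_eqI) (auto simp: axis_def)
  have "ev f (bp s t (c *s y)) = c * ev f (bp s t y)" for c y
    using ev_bih_scale[OF f_bih, of 1 s t c y] by simp
  then have "ev f (bp s t x) = x $ 1 * fv s t $ 1 + x $ 2 * fv s t $ 2 + x $ 3 * fv s t $ 3"
    by (subst x) (simp only: f_linear fv_def vec_lambda_beta)
  then show ?thesis by (simp add: vdot_3 mult.commute)
qed

lemma f_eq: "f = vdot Fb Xb"
  by (rule bipoly_eqI) (simp add: ev_vdot ev_Fb f_vdot Xb_def)

abbreviation HS :: "'a ^ 6 \<Rightarrow> (6, 'a) mpoly set" where "HS c \<equiv> hyperplane_section (V f) (hyp c)"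

lemma HS_ideal: "ideal.subspace (HS c)" "IX \<subseteq> HS c" "vanishing_ideal (points (hyp c)) \<subseteq> HS c"
  unfolding hyperplane_section_def by (rule scheme_inter_ideal)+

lemma HS_vanishes:
  assumes F: "F \<in> HS c" and x: "P s t x \<noteq> 0" "vdot (fv s t) x = 0" "vdot (hl c s t) x = 0"
  shows "mp_value F (P s t x) = 0"
proof (rule saturation_vanishes[OF F[unfolded hyperplane_section_def scheme_inter_def] x(1)])
  fix G assume "G \<in> ideal.span (IX \<union> vanishing_ideal (points (hyp c)))"
  then show "mp_value G (P s t x) = 0"
  proof (rule span_vanishes)
    fix H assume H: "H \<in> IX \<union> vanishing_ideal (points (hyp c))"
    have self: "P s t x \<in> vec.span {P s t x}" by (simp add: vec.span_base)
    have "vec.span {P s t x} \<in> V f" using x by (intro V_I) (simp_all add: f_vdot)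
    moreover have "vec.span {P s t x} \<in> points (hyp c)"
      using span_singleton_proj[OF x(1)] x(3)
      by (auto simp: points_def hyp_def vec.span_singleton vdot_linear vdot_P)
    ultimately show "mp_value H (P s t x) = 0"
      using H vanishing_ideal_vanishes[of H] self by (auto simp: vanishes_def)
  qed
qed

text \<open>Membership in the ideal generated by \<open>f\<close> and the equation of the hyperplane
  in the ring of P^1 x P^2, before any saturation or grading.\<close>

definition inc :: "'a ^ 6 \<Rightarrow> 'a bipoly \<Rightarrow> bool" where
  "inc c G \<longleftrightarrow> (\<exists>u w. G = f * u + Phi (lf c) * w)"

text \<open>Components of bidegree (n, n) make both terms pullbacks. For the first, divisibility by
  \<open>f\<close> alone gives membership in the ideal of the surface; for the second, the cofactor
  of the hyperplane has bidegree (n - 1, n - 1) and lifts to P^5.\<close>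

lemma inc_HS:
  assumes F: "F \<in> forms n" and inc: "inc c (Phi F)"
  shows "F \<in> HS c"
proof -
  obtain u w where uw: "Phi F = f * u + Phi (lf c) * w" using inc by (auto simp: inc_def)
  have bl: "bih 1 1 (Phi (lf c))" by (rule bih_Phi[OF lf(1)])
  have "Phi F = bihc n n (f * u) + bihc n n (Phi (lf c) * w)"
    using bihc_bih[OF bih_Phi[OF F]] bihc_add unfolding uw by metis
  moreover obtain u' where u': "bihc n n (f * u) = f * u'"
    unfolding bihc_mult[OF f_bih] by (metis mult_zero_right)
  \<comment> \<open>In degree 0 the component of the second term is 0, as \<open>lf c\<close> has
    bidegree (1, 1); otherwise the degrees of its cofactor are n - 1.\<close>
  moreover have "\<exists>w'. bihc n n (Phi (lf c) * w) = Phi (lf c) * w' \<and> (w' = 0 \<or> n \<ge> 1 \<and> bih (n - 1) (n - 1) w')"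
  proof (cases "1 \<le> n")
    case True
    show ?thesis
      by (rule exI[of _ "bihc (n - 1) (n - 1) w"]) (unfold bihc_mult[OF bl], use True in \<open>simp add: bih_bihc\<close>)
  qed (unfold bihc_mult[OF bl], simp)
  ultimately obtain w' where w': "Phi F = f * u' + Phi (lf c) * w'" "w' = 0 \<or> n \<ge> 1 \<and> bih (n - 1) (n - 1) w'"
    by metis
  obtain F1 where F1: "F1 \<in> forms n" "Phi F1 = f * u'"
    by (rule Phi_surj[of n "f * u'"]) (unfold u'[symmetric], rule bih_bihc)
  have F1': "homogeneous F1" using F1(1) by (auto simp: homogeneous_def)
  have "F1 \<in> IX" by (rule IX_I[OF F1']) (simp add: F1(2))
  then have F1S: "F1 \<in> HS c" using HS_ideal(2) by blast
  obtain F2 where F2: "lf c * F2 \<in> forms n" "Phi F2 = w'"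
  proof (cases "w' = 0")
    case True
    show thesis by (rule that[of 0]) (use True mpoly.subspace_0[OF forms_subspace] in auto)
  next
    case False
    then have n: "n \<ge> 1" and "bih (n - 1) (n - 1) w'" using w'(2) by auto
    from this(2) obtain F2 where "F2 \<in> forms (n - 1)" "Phi F2 = w'" by (rule Phi_surj)
    with forms_mult[OF lf(1)[of c] this(1)] n show thesis by (intro that) auto
  qed
  have F3: "F - F1 - lf c * F2 \<in> forms n" by (intro mpoly.subspace_diff[OF forms_subspace] F F1(1) F2(1))
  then have "homogeneous (F - F1 - lf c * F2)" by (auto simp: homogeneous_def)
  then have "F - F1 - lf c * F2 \<in> IX" by (rule IX_I) (simp add: F1 F2 w')
  then have F3S: "F - F1 - lf c * F2 \<in> HS c" using HS_ideal(2) by blast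
  have "lf c \<in> HS c" using lf_in_ideal HS_ideal(3) by blast
  then have "F2 * lf c \<in> HS c" by (rule ideal.subspace_scale[OF HS_ideal(1)])
  from ideal.subspace_add[OF HS_ideal(1) ideal.subspace_add[OF HS_ideal(1) F3S F1S] this]
  show ?thesis by (simp add: mult.commute)
qed

definition Cb :: "'a ^ 6 \<Rightarrow> 'a bipoly ^ 3" where "Cb c = cr Fb (Hb c)"
definition cv :: "'a ^ 6 \<Rightarrow> 'a \<Rightarrow> 'a \<Rightarrow> 'a ^ 3" where "cv c s t = cr (fv s t) (hl c s t)"

lemma ev_Cb: "ev (Cb c $ j) (bp s t x) = cv c s t $ j"
  using exhaust_3[of j] by (elim disjE) (simp_all add: Cb_def cv_def cr_nth ev_Fb ev_Hb)

lemma bih_Cb: "bih (d - 1) 0 (Cb c $ j)"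
proof -
  have d: "d - 1 = (d - 2) + 1" using d5 by simp
  have "bih (d - 1) (0 + 0) (Fb $ i * Hb c $ k)" for i k unfolding d by (intro bih_mult bih_Fb bih_Hb)
  then show ?thesis
    using exhaust_3[of j] by (elim disjE) (simp_all add: Cb_def cr_nth bih_diff)
qed

lemma inc_Cb: "inc c (Cb c $ i * Xb $ j - Cb c $ j * Xb $ i)"
  unfolding inc_def Cb_def Phi_lf using cr_comb[of Fb "Hb c" i Xb j] f_eq by (simp only:)

definition good :: "'a ^ 6 \<Rightarrow> bool" where
  "good c \<longleftrightarrow> (\<forall>s t. (s, t) \<noteq> (0, 0) \<longrightarrow> cv c s t \<noteq> 0)"

text \<open>If the cross product vanished, \<open>cr_cr\<close> would give
  \<open>Phi (lf c) * Fb $ k = f * Hb c $ k\<close> with some nonzero \<open>Fb $ k\<close>. The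
  prime \<open>f\<close> would divide a nonzero form of bidegree (1, 1) or (d - 2, 0), each too
  small in one degree.\<close>

lemma Cb_nonzero:
  assumes c: "c \<noteq> 0"
  shows "Cb c \<noteq> 0"
proof
  assume z: "Cb c = 0"
  have nd: "\<not> f dvd G" if G: "bih m n G" "G \<noteq> 0" "m < d - 2 \<or> n < 1" for m n and G :: "'a bipoly"
  proof
    assume "f dvd G"
    from bih_dvd[OF G(1,2) this] obtain i j where "bih i j f" "i \<le> m" "j \<le> n" .
    with bih_unique[OF f_bih _ f_nonzero] G(3) show False by fastforce
  qed
  obtain k where k: "Fb $ k \<noteq> 0"
  proof (rule ccontr)
    assume "\<not> thesis"
    then have "Fb $ k = 0" for k using that by blast
    then have "f = 0" by (subst f_eq) (simp add: vdot_def)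
    with f_nonzero show False ..
  qed
  have "Hb c $ k * vdot Fb Xb - vdot (Hb c) Xb * Fb $ k = cr (Cb c) Xb $ k"
    by (simp add: Cb_def cr_cr algebra_simps)
  also have "cr (Cb c) Xb = 0" unfolding z by (rule vec3_eqI) (simp_all add: cr_nth)
  finally have "Phi (lf c) * Fb $ k = f * Hb c $ k" by (simp add: Phi_lf flip: f_eq) (simp add: mult.commute)
  then have "f dvd Phi (lf c) * Fb $ k" by simp
  then have "f dvd Phi (lf c) \<or> f dvd Fb $ k" using f_prime by (rule prime_elem_dvd_multD[rotated])
  moreover have "\<not> f dvd Fb $ k" by (rule nd[OF bih_Fb k]) simp
  moreover have "Phi (lf c) \<noteq> 0"
  proof
    assume "Phi (lf c) = 0"
    then have "vdot c (P s t x) = 0" for s t x using ev_Phi[where F = "lf c" and s = s and t = t and x = x] by (simp add: lf)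
    then have "vdot (hl c s t) (axis j 1) = 0" for s t j by (simp add: vdot_P)
    then have "hl c s t = 0" for s t by (simp add: vdot_axis Finite_Cartesian_Product.vec_eq_iff)
    from this[of 1 0] this[of 0 1] show False using hyp_nonzero[OF c] by (simp add: hl_def)
  qed
  then have "\<not> f dvd Phi (lf c)" by (rule nd[OF bih_Phi[OF lf(1)]]) (use d5 in simp)
  ultimately show False by blast
qed

end

lemma prime_ideal_power: "prime_ideal I \<Longrightarrow> U ^ e \<in> I \<Longrightarrow> U \<in> I"
proof (induction e)
  case 0
  then have "r * 1 \<in> I" for r using ideal.subspace_scale[of I 1 r] by (simp add: prime_ideal_def)
  with 0 show ?case by (auto simp: prime_ideal_def)
next
  case (Suc e)
  then have "U * U ^ e \<in> I" by simp
  with Suc show ?case by (auto simp: prime_ideal_def)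
qed

lemma polyfun_vdot: "polyfun (\<lambda>l. vdot l x)"
  unfolding vdot_def by (intro polyfun_sum polyfun_mult polyfun_coord polyfun_const)

lemma vdot_nonzero: "x \<noteq> 0 \<Longrightarrow> \<exists>l. vdot l x \<noteq> (0 :: 'a::comm_ring_1)"
proof -
  assume "x \<noteq> 0"
  then obtain i where "x $ i \<noteq> 0" by (auto simp: Finite_Cartesian_Product.vec_eq_iff)
  moreover have "vdot (axis i 1) x = x $ i"
    using vdot_axis[of x i] by (simp add: vdot_def mult.commute)
  ultimately show ?thesis by metis
qed

context type_I_surface
begin

lemma HS_saturated: "saturation (HS c) = HS c"
  unfolding hyperplane_section_def scheme_inter_def by (rule saturation_idem) (rule ideal.subspace_span)

text \<open>\<open>e\<close> is the largest exponent for which the power of the linear form divides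
  all entries; by maximality the quotients do not all vanish at (s0, t0).\<close>

lemma Cb_reduced:
  assumes c: "c \<noteq> 0" and st: "(s0, t0) \<noteq> (0, 0)"
  obtains e m C where "\<And>i. Cb c $ i = (mp_const t0 * mp_var vS - mp_const s0 * mp_var vT) ^ e * C i"
    "\<And>i. bih m 0 (C i)" "\<exists>i. ev (C i) (bp s0 t0 0) \<noteq> 0"
proof -
  define u :: "'a bipoly" where "u = mp_const t0 * mp_var vS - mp_const s0 * mp_var vT"
  have u: "prime_elem u" "bih 1 0 u" unfolding u_def by (rule linear_st_prime[OF st], rule bih_linear_st)
  obtain k where k: "Cb c $ k \<noteq> 0" using Cb_nonzero[OF c] by (auto simp: Finite_Cartesian_Product.vec_eq_iff)
  define n0 where "n0 = (LEAST n. \<not> (\<forall>i. u ^ n dvd Cb c $ i))"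
  have "\<not> u ^ Suc (pmult u (Cb c $ k)) dvd Cb c $ k" by (simp only: pmult_iff[OF u bih_Cb k])
  then have ex: "\<exists>n. \<not> (\<forall>i. u ^ n dvd Cb c $ i)" by blast
  then have n0: "\<not> (\<forall>i. u ^ n0 dvd Cb c $ i)" unfolding n0_def by (rule LeastI_ex)
  then have "n0 \<noteq> 0" by (cases n0) auto
  then obtain e where e: "n0 = Suc e" by (cases n0) auto
  have "\<not> \<not> (\<forall>i. u ^ e dvd Cb c $ i)" by (rule not_less_Least) (use e in \<open>simp add: n0_def\<close>)
  then have dv: "u ^ e dvd Cb c $ i" for i by blast
  define C where "C i = (SOME r. Cb c $ i = u ^ e * r)" for i
  have C: "Cb c $ i = u ^ e * C i" for i
    unfolding C_def by (rule someI_ex) (use dv[of i] in \<open>simp add: dvd_def\<close>)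
  have u0: "u ^ e \<noteq> 0" using u(1) by (simp add: prime_elem_def)
  have bu: "bih e 0 (u ^ e)" using bih_power[OF u(2), of e] by simp
  have bC: "bih (d - 1 - e) 0 (C i)" for i
  proof (cases "C i = 0")
    case False
    have "bih (d - 1) 0 (u ^ e * C i)" "u ^ e * C i \<noteq> 0" using bih_Cb[of c i] u0 False unfolding C by simp_all
    then obtain i' j k l where ij: "bih i' j (u ^ e)" "bih k l (C i)" "i' + k = d - 1" "j + l = 0" by (rule bih_factor)
    have "i' = e" using bih_unique[OF ij(1) bu u0] by simp
    then have "d - 1 - e = k" using ij(3) by linarith
    moreover have "l = 0" using ij(4) by simp
    ultimately show ?thesis using ij(2) by simp
  qed simp
  have "\<exists>i. ev (C i) (bp s0 t0 0) \<noteq> 0"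
  proof (rule ccontr)
    assume "\<not> ?thesis"
    then have "u dvd C i" for i unfolding u_def by (intro linear_st_dvd[OF st bC]) blast
    then have "u ^ e * u dvd Cb c $ i" for i unfolding C by (intro mult_dvd_mono dvd_refl)
    then show False using n0 by (simp add: e mult.commute)
  qed
  with C bC show thesis unfolding u_def by (rule that)
qed

text \<open>At a zero (s0, t0) of the cross product the section contains a line of the ruling plane
  over (s0, t0), besides the curve given by the reduced cross product \<open>C\<close>. A power of a
  linear form \<open>U\<close> vanishing on that plane, times lifted minors of \<open>C\<close> and
  x, lies in the ideal of the section, but \<open>U\<close> does not, and neither do all the lifted
  minors.\<close>

lemma prime_imp_good:
  assumes c: "c \<noteq> 0" and pr: "prime_ideal (HS c)"
  shows "good c"
  unfolding good_def
proof (intro allI impI notI)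
  fix s0 t0 assume st: "(s0, t0) \<noteq> (0, 0)" and "cv c s0 t0 = 0"
  then have cr0: "cr (fv s0 t0) (hl c s0 t0) = 0" by (simp add: cv_def)
  define u :: "'a bipoly" where "u = mp_const t0 * mp_var vS - mp_const s0 * mp_var vT"
  obtain e C m where C: "\<And>i. Cb c $ i = u ^ e * C i" "\<And>i. bih m 0 (C i)" "\<exists>i. ev (C i) (bp s0 t0 0) \<noteq> 0"
  proof (rule Cb_reduced[OF c st, folded u_def])
    fix e m C
    assume "\<And>i. Cb c $ i = u ^ e * C i" "\<And>i. bih m 0 (C i)" "\<exists>i. ev (C i) (bp s0 t0 0) \<noteq> 0"
    then show thesis by (rule that)
  qed
  define \<gamma> where "\<gamma> = (\<chi> i. ev (C i) (bp s0 t0 0))"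
  have "\<gamma> \<noteq> 0" using C(3) by (auto simp: \<gamma>_def Finite_Cartesian_Product.vec_eq_iff)
  \<comment> \<open>The common kernel at (s0, t0) has dimension at least 2, so it contains a vector
    that is not on the reduced curve.\<close>
  then obtain w where w: "vdot (fv s0 t0) w = 0" "vdot (hl c s0 t0) w = 0" "cr \<gamma> w \<noteq> 0"
    by (rule cr_zero_kernel[OF cr0])
  have w0: "w \<noteq> 0"
  proof
    assume "w = 0"
    then have "cr \<gamma> w = 0" by (intro vec3_eqI) (simp_all add: cr_nth)
    with w(3) show False ..
  qed
  \<comment> \<open>A second ruling plane; it contains a point x1 of the section at which
    \<open>U\<close> will be nonzero.\<close>
  obtain s1 t1 :: 'a where st1: "t0 * s1 \<noteq> s0 * t1"
  proof (cases "s0 = 0")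
    case True then show thesis using st by (intro that[of 1 0]) simp
  next
    case False then show thesis by (intro that[of 0 1]) simp
  qed
  obtain x1 where x1: "x1 \<noteq> 0" "vdot (fv s1 t1) x1 = 0" "vdot (hl c s1 t1) x1 = 0" by (rule common_zero)
  obtain l1 l2 where "vdot l1 x1 \<noteq> 0" "vdot l2 w \<noteq> 0" using vdot_nonzero x1(1) w0 by metis
  then obtain l where l: "vdot l x1 \<noteq> 0" "vdot l w \<noteq> 0"
    by (rule polyfun_nonzero_mult[OF polyfun_vdot polyfun_vdot])
  define L :: "'a bipoly" where "L = (\<Sum>k\<in>UNIV. mp_const (l $ k) * mp_var (vX k))"
  have L: "bih 0 1 L" unfolding L_def by (intro bih_sum bih_cmult bih_var)
  have evL: "ev L (bp s t x) = vdot l x" for s t x by (simp add: L_def vdot_def)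
  define Z :: "'a bipoly" where "Z = (if s0 \<noteq> 0 then mp_var vS else mp_var vT)"
  have Z: "bih 1 0 Z" unfolding Z_def by (simp only: bih_var split: if_splits) simp
  have evZ: "ev Z (bp s0 t0 x) \<noteq> 0" for x using st by (auto simp: Z_def)
  have "bih (1 + 0) (0 + 1) (u * L)" unfolding u_def by (intro bih_mult bih_linear_st L)
  then obtain U where U: "U \<in> forms 1" "Phi U = u * L" using Phi_surj[of 1 "u * L"] by auto
  have "U \<notin> HS c"
  proof
    assume "U \<in> HS c"
    then have "mp_value U (P s1 t1 x1) = 0"
      by (rule HS_vanishes) (use x1 st1 in \<open>auto simp: P_eq_0_iff\<close>)
    then have "ev (Phi U) (bp s1 t1 x1) = 0" by (simp only: ev_Phi)
    then show False using st1 l(1) by (simp add: U(2) u_def evL)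
  qed
  have "\<gamma> $ i * w $ j = \<gamma> $ j * w $ i" for i j
  proof -
    \<comment> \<open>\<open>L ^ m\<close> and \<open>Z\<close> raise the bidegree (m, 1) of the
      minor to (m + 1, m + 1), and both factors are nonzero at (s0, t0, w).\<close>
    define H where "H = (C i * mp_var (vX j) - C j * mp_var (vX i)) * L ^ m * Z"
    have "bih ((m + 0) + 0 * m + 1) ((0 + 1) + 1 * m + 0) H"
      unfolding H_def by (intro bih_mult bih_diff bih_power C(2) bih_var L Z)
    then have "bih (m + 1) (m + 1) H" by (simp add: add.commute)
    then obtain G where G: "G \<in> forms (m + 1)" "Phi G = H" by (rule Phi_surj)
    have "U ^ e * G \<in> forms (e + (m + 1))"
    proof (rule forms_mult[OF _ G(1)])
      show "U ^ e \<in> forms e" using U(1) whom_power[of "\<lambda>_. 1" 1 U e] by (simp add: forms_whom)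
    qed
    moreover have "inc c (Phi (U ^ e * G))"
    proof -
      have "Phi (U ^ e * G) = (Cb c $ i * Xb $ j - Cb c $ j * Xb $ i) * (L ^ e * L ^ m * Z)"
        unfolding C(1) by (simp add: U G H_def Xb_def power_mult_distrib algebra_simps)
      moreover obtain u' w' where "Cb c $ i * Xb $ j - Cb c $ j * Xb $ i = f * u' + Phi (lf c) * w'"
        using inc_Cb[where c = c and i = i and j = j] unfolding inc_def by blast
      ultimately have "Phi (U ^ e * G) = f * (u' * (L ^ e * L ^ m * Z)) + Phi (lf c) * (w' * (L ^ e * L ^ m * Z))"
        by (simp only: distrib_right mult.assoc)
      then show ?thesis unfolding inc_def by blast
    qed
    ultimately have "U ^ e * G \<in> HS c" by (rule inc_HS)
    then have "U ^ e \<in> HS c \<or> G \<in> HS c" using pr unfolding prime_ideal_def by blast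
    then have "G \<in> HS c" using prime_ideal_power[OF pr] \<open>U \<notin> HS c\<close> by blast
    then have "mp_value G (P s0 t0 w) = 0"
      by (rule HS_vanishes) (use w w0 st in \<open>auto simp: P_eq_0_iff\<close>)
    then have "ev H (bp s0 t0 w) = 0" unfolding G(2)[symmetric] by (simp only: ev_Phi)
    then have "(ev (C i) (bp s0 t0 w) * w $ j - ev (C j) (bp s0 t0 w) * w $ i) * vdot l w ^ m * ev Z (bp s0 t0 w) = 0"
      by (simp add: H_def evL)
    then have "ev (C i) (bp s0 t0 w) * w $ j = ev (C j) (bp s0 t0 w) * w $ i"
      using l(2) evZ by simp
    moreover have "ev (C k) (bp s0 t0 w) = \<gamma> $ k" for k
      unfolding \<gamma>_def vec_lambda_beta by (rule ev_bih_X0[OF C(2)])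
    ultimately show ?thesis by simp
  qed
  then have "cr \<gamma> w = 0" by (intro vec3_eqI) (simp_all add: cr_nth)
  with w(3) show False ..
qed

end

section \<open>Binary forms\<close>

text \<open>A nonzero element of minimal degree divides all others. It has no root, since a root
  would be common to the whole ideal, so it is constant.\<close>

lemma poly_ideal_1:
  fixes I :: "'a::alg_closed_field poly set"
  assumes I: "ideal.subspace I" and nz: "\<And>\<tau>. \<exists>p\<in>I. poly p \<tau> \<noteq> 0"
  shows "1 \<in> I"
proof -
  define Q where "Q n \<longleftrightarrow> (\<exists>p\<in>I. p \<noteq> 0 \<and> degree p = n)" for n
  obtain p0 where "p0 \<in> I" "poly p0 0 \<noteq> 0" using nz by blast
  then have "Q (degree p0)" unfolding Q_def by (intro bexI[of _ p0]) auto
  then have "Q (LEAST n. Q n)" by (rule LeastI)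
  then obtain g where g: "g \<in> I" "g \<noteq> 0" "degree g = (LEAST n. Q n)" unfolding Q_def by blast
  have dvd: "g dvd p" if p: "p \<in> I" for p
  proof (rule ccontr)
    assume "\<not> g dvd p"
    then have r: "p mod g \<noteq> 0" by (simp add: mod_eq_0_iff_dvd)
    have "p - (p div g) * g \<in> I" by (intro ideal.subspace_diff[OF I] ideal.subspace_scale[OF I] p g)
    then have "p mod g \<in> I" by (simp add: minus_div_mult_eq_mod)
    then have "Q (degree (p mod g))" unfolding Q_def using r by blast
    then have "degree g \<le> degree (p mod g)" unfolding g(3) by (rule Least_le)
    moreover have "degree (p mod g) < degree g" using degree_mod_less[OF g(2), of p] r by auto
    ultimately show False by simp
  qed
  have "degree g = 0"
  proof (rule ccontr)
    assume "degree g \<noteq> 0"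
    then obtain z where z: "poly g z = 0" using alg_closed_imp_poly_has_root[of g] by blast
    obtain p where "p \<in> I" "poly p z \<noteq> 0" using nz by blast
    moreover from dvd[OF this(1)] obtain h where "p = g * h" by (rule dvdE)
    ultimately show False using z by simp
  qed
  then obtain e where e: "g = [:e:]" by (rule degree_eq_zeroE)
  then have e0: "e \<noteq> 0" using g(2) by simp
  have "[:1 / e:] * g \<in> I" by (rule ideal.subspace_scale[OF I g(1)])
  moreover have "1 / e * e = 1" using e0 by simp
  then have "[:1 / e:] * g = 1" unfolding e one_pCons by simp
  ultimately show ?thesis by simp
qed

text \<open>Homogenization of \<open>p\<close> in degree m with y as homogenizing variable. The pair
  x, y is left open because both charts of P^1 are needed, with s and t exchanged.\<close>

definition hz :: "'a bipoly \<Rightarrow> 'a bipoly \<Rightarrow> nat \<Rightarrow> 'a poly \<Rightarrow> 'a::comm_ring_1 bipoly" where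
  "hz x y m p = (\<Sum>i\<le>m. mp_const (coeff p i) * x ^ i * y ^ (m - i))"

lemma mp_const_simps:
  fixes c e :: "'a::comm_ring_1"
  shows "mp_const (c + e) = (mp_const c + mp_const e :: ('n::finite, 'a) mpoly)" "mp_const (c * e) = (mp_const c * mp_const e :: ('n, 'a) mpoly)"
  "mp_const 0 = (0 :: ('n, 'a) mpoly)" "mp_const 1 = (1 :: ('n, 'a) mpoly)"
proof -
  interpret comm_ring_hom "mp_const :: 'a \<Rightarrow> ('n, 'a) mpoly" by (rule mp_const_hom)
  show "mp_const (c + e) = (mp_const c + mp_const e :: ('n, 'a) mpoly)" "mp_const (c * e) = (mp_const c * mp_const e :: ('n, 'a) mpoly)"
    "mp_const 0 = (0 :: ('n, 'a) mpoly)" "mp_const 1 = (1 :: ('n, 'a) mpoly)"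
    by (simp_all add: hom_add hom_mult)
qed

lemma hz_add: "hz x y m (p + q) = hz x y m p + hz x y m q"
  by (simp add: hz_def mp_const_simps distrib_right sum.distrib)

lemma hz_smult: "hz x y m (smult c p) = mp_const c * hz x y m p"
  by (simp add: hz_def mp_const_simps sum_distrib_left mult.assoc)

lemma hz_pCons: "hz x y (Suc m) (pCons 0 p) = x * hz x y m p"
  unfolding hz_def sum.atMost_Suc_shift by (simp add: mp_const_simps sum_distrib_left mult_ac)

lemma hz_raise: "degree p \<le> m \<Longrightarrow> hz x y (m + k) p = y ^ k * hz x y m p"
proof -
  assume "degree p \<le> m"
  then have "hz x y (m + k) p = (\<Sum>i\<le>m. mp_const (coeff p i) * x ^ i * y ^ (m + k - i))"
    unfolding hz_def by (intro sum.mono_neutral_right) (auto simp: coeff_eq_0 mp_const_simps)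
  also have "\<dots> = (\<Sum>i\<le>m. y ^ k * (mp_const (coeff p i) * x ^ i * y ^ (m - i)))"
  proof (rule sum.cong)
    fix i assume "i \<in> {..m}"
    then have "m + k - i = k + (m - i)" by simp
    then have "y ^ (m + k - i) = y ^ k * y ^ (m - i)" by (simp only: power_add)
    then show "mp_const (coeff p i) * x ^ i * y ^ (m + k - i) = y ^ k * (mp_const (coeff p i) * x ^ i * y ^ (m - i))"
      by (simp only: mult_ac)
  qed simp
  finally show ?thesis by (simp add: hz_def sum_distrib_left)
qed

text \<open>The polynomials with some homogenization in \<open>Q\<close> form an ideal of the
  univariate ring. Without common zeros it contains 1, and the homogenizations of 1 are the powers
  of y.\<close>

lemma power_in_ideal:
  fixes p :: "'i \<Rightarrow> 'a::alg_closed_field poly" and Q :: "'a bipoly set"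
  assumes Q: "ideal.subspace Q" and p: "\<And>j. degree (p j) \<le> m" "\<And>j. hz x y m (p j) \<in> Q" "\<And>\<tau>. \<exists>j. poly (p j) \<tau> \<noteq> 0"
  obtains M where "y ^ M \<in> Q"
proof -
  define I where "I = {p. \<exists>m. degree p \<le> m \<and> hz x y m p \<in> Q}"
  have add: "p + q \<in> I" if pq: "p \<in> I" "q \<in> I" for p q
  proof -
    obtain m n where mn: "degree p \<le> m" "hz x y m p \<in> Q" "degree q \<le> n" "hz x y n q \<in> Q" using pq by (auto simp: I_def)
    have "hz x y (m + n) p \<in> Q" unfolding hz_raise[OF mn(1)] by (rule ideal.subspace_scale[OF Q mn(2)])
    moreover have "hz x y (n + m) q \<in> Q" unfolding hz_raise[OF mn(3)] by (rule ideal.subspace_scale[OF Q mn(4)])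
    ultimately have "hz x y (m + n) (p + q) \<in> Q" unfolding hz_add using ideal.subspace_add[OF Q] by (simp add: add.commute)
    moreover have "degree (p + q) \<le> m + n" by (rule degree_add_le) (use mn in auto)
    ultimately show ?thesis by (auto simp: I_def)
  qed
  have smult: "smult c p \<in> I" if p: "p \<in> I" for c p
  proof -
    obtain m where m: "degree p \<le> m" "hz x y m p \<in> Q" using p by (auto simp: I_def)
    then have "degree (smult c p) \<le> m" using degree_smult_le[of c p] by linarith
    moreover have "hz x y m (smult c p) \<in> Q" unfolding hz_smult by (rule ideal.subspace_scale[OF Q m(2)])
    ultimately show ?thesis by (auto simp: I_def)
  qed
  have shift: "pCons 0 p \<in> I" if p: "p \<in> I" for p
  proof -
    obtain m where m: "degree p \<le> m" "hz x y m p \<in> Q" using p by (auto simp: I_def)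
    have "hz x y (Suc m) (pCons 0 p) \<in> Q" unfolding hz_pCons by (rule ideal.subspace_scale[OF Q m(2)])
    moreover have "degree (pCons 0 p) \<le> Suc m" using m(1) by (cases "p = 0") auto
    ultimately show ?thesis unfolding I_def by blast
  qed
  have zero: "0 \<in> I" unfolding I_def using ideal.subspace_0[OF Q] by (auto simp: hz_def mp_const_simps intro!: exI[of _ 0])
  have scale: "r * p \<in> I" if "p \<in> I" for r p
  proof (induction r)
    case 0 then show ?case using zero by simp
  next
    case (pCons e r)
    have "smult e p + pCons 0 (r * p) \<in> I" by (intro add smult shift pCons.IH that)
    then show ?case by simp
  qed
  have sub: "ideal.subspace I" unfolding ideal.subspace_def using zero add scale by blast
  have "p j \<in> I" for j using p(1,2) by (auto simp: I_def)
  then have "1 \<in> I" using p(3) by (intro poly_ideal_1[OF sub]) blast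
  then obtain M where M: "hz x y M 1 \<in> Q" by (auto simp: I_def)
  have "hz x y M 1 = (\<Sum>i\<le>M. if i = 0 then y ^ M else 0)"
    unfolding hz_def by (rule sum.cong) (auto simp: mp_const_simps coeff_1)
  then have "hz x y M 1 = y ^ M" by simp
  with M that show thesis by simp
qed

lemma poly_bform: "degree p \<le> m \<Longrightarrow> poly p \<tau> = bform m p \<tau> 1"
  unfolding poly_altdef bform_def by (simp, intro sum.mono_neutral_left) (auto simp: coeff_eq_0)

lemma binary_form_hz:
  fixes G :: "'a::alg_closed_field bipoly"
  assumes G: "bih m 0 G"
  obtains p q where "degree p \<le> m" "hz (mp_var vS) (mp_var vT) m p = G" "\<And>\<tau>. poly p \<tau> = ev G (bp \<tau> 1 0)"
    "degree q \<le> m" "hz (mp_var vT) (mp_var vS) m q = G" "\<And>\<tau>. poly q \<tau> = ev G (bp 1 \<tau> 0)"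
proof
  have w: "whom wS m G" using G by (simp add: bih_def)
  define p where "p = dehom 0 G"
  note p = dehom_bform[OF w, where x = 0, folded p_def]
  \<comment> \<open>The reversed coefficients belong to the chart s = 1.\<close>
  define q where "q = (\<Sum>i\<le>m. monom (coeff p (m - i)) i)"
  have rev: "(\<Sum>i\<le>m. h i) = (\<Sum>i\<le>m. h (m - i))" for h :: "nat \<Rightarrow> 'b::comm_monoid_add"
    by (rule sum.reindex_bij_witness[of _ "\<lambda>i. m - i" "\<lambda>i. m - i"]) auto
  show "degree p \<le> m" by (rule p(1))
  show "hz (mp_var vS) (mp_var vT) m p = G"
  proof (rule bipoly_eqI)
    fix s t x
    show "ev (hz (mp_var vS) (mp_var vT) m p) (bp s t x) = ev G (bp s t x)"
      using p(2)[where s = s and t = t] ev_bih_X0[OF G, where s = s and t = t and x = x and y = 0] by (simp add: hz_def bform_def)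
  qed
  show "poly p \<tau> = ev G (bp \<tau> 1 0)" for \<tau> using poly_bform[OF p(1)] p(2) by metis
  have "degree (monom (coeff p (m - i)) i) \<le> m" if "i \<in> {..m}" for i
    using degree_monom_le[of "coeff p (m - i)" i] that by simp
  then show "degree q \<le> m" unfolding q_def by (intro degree_sum_le) auto
  have cq: "coeff q i = coeff p (m - i)" if "i \<le> m" for i
    using that by (simp add: q_def coeff_sum)
  show "hz (mp_var vT) (mp_var vS) m q = G"
  proof (rule bipoly_eqI)
    fix s t x
    have "(\<Sum>i\<le>m. coeff q i * t ^ i * s ^ (m - i)) = (\<Sum>i\<le>m. coeff p (m - i) * t ^ i * s ^ (m - i))"
      by (rule sum.cong) (auto simp: cq)
    also have "\<dots> = (\<Sum>i\<le>m. coeff p i * s ^ i * t ^ (m - i))"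
      by (subst rev) (rule sum.cong, auto simp: ac_simps)
    finally show "ev (hz (mp_var vT) (mp_var vS) m q) (bp s t x) = ev G (bp s t x)"
      using p(2)[where s = s and t = t] ev_bih_X0[OF G, where s = s and t = t and x = x and y = 0] by (simp add: hz_def bform_def)
  qed
  show "poly q \<tau> = ev G (bp 1 \<tau> 0)" for \<tau>
  proof -
    have "poly q \<tau> = (\<Sum>i\<le>m. coeff p (m - i) * \<tau> ^ i)" by (simp add: q_def poly_sum poly_monom)
    also have "\<dots> = bform m p 1 \<tau>" unfolding bform_def by (subst rev) (rule sum.cong, auto)
    finally show ?thesis using p(2) by simp
  qed
qed

text \<open>The projective Nullstellensatz on P^1: each of the two charts yields a power of its
  homogenizing variable.\<close>

lemma common_powers_in_ideal:
  fixes G :: "'i \<Rightarrow> 'a::alg_closed_field bipoly"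
  assumes Q: "ideal.subspace Q" and G: "\<And>j. bih m 0 (G j)" "\<And>j. G j \<in> Q"
    and nz: "\<And>s t. (s, t) \<noteq> (0, 0) \<Longrightarrow> \<exists>j. ev (G j) (bp s t 0) \<noteq> 0"
  obtains M N where "mp_var vT ^ M \<in> Q" "mp_var vS ^ N \<in> Q"
proof -
  have "\<exists>p q. degree p \<le> m \<and> hz (mp_var vS) (mp_var vT) m p = G j \<and> (\<forall>\<tau>. poly p \<tau> = ev (G j) (bp \<tau> 1 0)) \<and>
      degree q \<le> m \<and> hz (mp_var vT) (mp_var vS) m q = G j \<and> (\<forall>\<tau>. poly q \<tau> = ev (G j) (bp 1 \<tau> 0))" for j
    by (rule binary_form_hz[OF G(1)[of j]]) blast
  then obtain p q where p: "\<And>j. degree (p j) \<le> m" "\<And>j. hz (mp_var vS) (mp_var vT) m (p j) = G j"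
      "\<And>j \<tau>. poly (p j) \<tau> = ev (G j) (bp \<tau> 1 0)"
    and q: "\<And>j. degree (q j) \<le> m" "\<And>j. hz (mp_var vT) (mp_var vS) m (q j) = G j"
      "\<And>j \<tau>. poly (q j) \<tau> = ev (G j) (bp 1 \<tau> 0)"
    by metis
  obtain M where M: "mp_var vT ^ M \<in> Q"
  proof (rule power_in_ideal[OF Q, of p _ "mp_var vS" "mp_var vT"])
    show "\<exists>j. poly (p j) \<tau> \<noteq> 0" for \<tau> using nz[of \<tau> 1] by (simp add: p(3))
  qed (use p(1,2) G(2) that in auto)
  obtain N where N: "mp_var vS ^ N \<in> Q"
  proof (rule power_in_ideal[OF Q, of q _ "mp_var vT" "mp_var vS"])
    show "\<exists>j. poly (q j) \<tau> \<noteq> 0" for \<tau> using nz[of 1 \<tau>] by (simp add: q(3))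
  qed (use q(1,2) G(2) that in auto)
  from M N show thesis by (rule that)
qed

lemma binary_roots:
  fixes G :: "'a::alg_closed_field bipoly"
  assumes G: "bih m n G" and nz: "ev G (bp s1 t1 x) \<noteq> 0"
  obtains R where "finite R" "\<And>s t. (s, t) \<in> R \<Longrightarrow> (s, t) \<noteq> (0, 0) \<and> ev G (bp s t x) = 0"
    "\<And>s t. (s, t) \<noteq> (0, 0) \<Longrightarrow> ev G (bp s t x) = 0 \<Longrightarrow> \<exists>(s', t')\<in>R. \<exists>k. k \<noteq> 0 \<and> s = k * s' \<and> t = k * t'"
proof -
  have w: "whom wS m G" using G by (simp add: bih_def)
  define p where "p = dehom x G"
  note p = dehom_bform[OF w, where x = x, folded p_def]
  have "p \<noteq> 0"
  proof
    assume "p = 0"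
    then show False using nz p(2)[where s = s1 and t = t1] by (simp add: bform_def)
  qed
  then have fin: "finite {\<tau>. poly p \<tau> = 0}" by (rule poly_roots_finite)
  define R where "R = {(s, t) \<in> (\<lambda>\<tau>. (\<tau>, 1)) ` {\<tau>. poly p \<tau> = 0} \<union> {(1, 0)}. ev G (bp s t x) = 0}"
  have "finite ((\<lambda>\<tau>. (\<tau>, 1 :: 'a)) ` {\<tau>. poly p \<tau> = 0} \<union> {(1, 0)})" using fin by simp
  then have "finite R" unfolding R_def by (rule rev_finite_subset) auto
  moreover have "(s, t) \<in> R \<Longrightarrow> (s, t) \<noteq> (0, 0) \<and> ev G (bp s t x) = 0" for s t by (auto simp: R_def)
  moreover have "\<exists>(s', t')\<in>R. \<exists>k. k \<noteq> 0 \<and> s = k * s' \<and> t = k * t'"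
    if st: "(s, t) \<noteq> (0, 0)" and z: "ev G (bp s t x) = 0" for s t
  proof (cases "t = 0")
    case True
    then have s: "s \<noteq> 0" using st by simp
    have "ev G (bp (s * 1) (s * 0) (1 *s x)) = 0" using z True by simp
    then have "ev G (bp 1 0 x) = 0" unfolding ev_bih_scale[OF G] using s by simp
    then have "(1, 0) \<in> R" by (simp add: R_def)
    then show ?thesis using s True by (intro bexI[of _ "(1, 0)"]) auto
  next
    case False
    have "ev G (bp (t * (s / t)) (t * 1) (1 *s x)) = 0" using z False by simp
    then have e: "ev G (bp (s / t) 1 x) = 0" unfolding ev_bih_scale[OF G] using False by simp
    then have "poly p (s / t) = 0" using poly_bform[OF p(1)] p(2) by metis
    then have "(s / t, 1) \<in> R" using e by (auto simp: R_def)
    then show ?thesis using False by (intro bexI[of _ "(s / t, 1)"]) auto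
  qed
  ultimately show thesis by (rule that)
qed

section \<open>Integrality of hyperplane sections\<close>

lemma ideal_congruence:
  fixes y y' :: "'n::finite \<Rightarrow> ('m::finite, 'a::comm_ring_1) mpoly"
  assumes I: "ideal.subspace I" and y: "\<And>v. y v - y' v \<in> I"
  shows "mp_eval mp_const y G - mp_eval mp_const y' G \<in> I"
proof -
  have mult: "A * B - A' * B' \<in> I" if AB: "A - A' \<in> I" "B - B' \<in> I" for A A' B B'
  proof -
    have "A * (B - B') + B' * (A - A') \<in> I"
      by (intro ideal.subspace_add[OF I] ideal.subspace_scale[OF I] AB)
    then show ?thesis by (simp add: algebra_simps)
  qed
  have pow: "A ^ k - A' ^ k \<in> I" if A: "A - A' \<in> I" for A A' k
    by (induction k) (use A mult ideal.subspace_0[OF I] in auto)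
  have prod: "(\<Prod>v\<in>A. g v) - (\<Prod>v\<in>A. g' v) \<in> I" if g: "\<And>v. g v - g' v \<in> I" for A and g g' :: "'n \<Rightarrow> _"
    by (induction A rule: infinite_finite_induct) (use g mult ideal.subspace_0[OF I] in auto)
  have "mp_const e * (\<Prod>v\<in>UNIV. y v ^ k v) - mp_const e * (\<Prod>v\<in>UNIV. y' v ^ k v) \<in> I" for e and k :: "'n \<Rightarrow> nat"
    by (intro mult prod pow y) (simp add: ideal.subspace_0[OF I])
  then show ?thesis
    unfolding mp_eval_def sum_subtractf[symmetric] by (intro ideal.subspace_sum[OF I])
qed

context type_I_surface
begin

lemma inc_ideal: "ideal.subspace {G. inc c G}"
proof -
  have "{G. inc c G} = ideal.span {f, Phi (lf c)}"
    unfolding ideal.span_insert ideal.span_empty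
  proof (intro equalityI subsetI)
    fix G assume "G \<in> {G. inc c G}"
    then obtain u w where "G = f * u + Phi (lf c) * w" by (auto simp: inc_def)
    then have "G - u * f - w * Phi (lf c) = 0" by (simp add: algebra_simps)
    then show "G \<in> {x. \<exists>k. x - k * f \<in> {x. \<exists>k. x - k * Phi (lf c) \<in> {0}}}" by blast
  next
    fix G assume "G \<in> {x. \<exists>k. x - k * f \<in> {x. \<exists>k. x - k * Phi (lf c) \<in> {0}}}"
    then obtain u w where "G - u * f - w * Phi (lf c) = 0" by blast
    then have "G = f * u + Phi (lf c) * w" by (simp add: algebra_simps)
    then show "G \<in> {G. inc c G}" by (auto simp: inc_def)
  qed
  then show ?thesis by (simp only: ideal.subspace_span)
qed

definition ksub :: "'a ^ 6 \<Rightarrow> bvar \<Rightarrow> 'a bipoly" where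
  "ksub c v = (case v of None \<Rightarrow> mp_var vS | Some None \<Rightarrow> mp_var vT | Some (Some k) \<Rightarrow> Cb c $ k)"

text \<open>Pullback along the parametrization of the section that sends (s, t) to
  \<open>P s t (cv c s t)\<close>. The ideal of the section will turn out to be its kernel.\<close>

definition kap :: "'a ^ 6 \<Rightarrow> (6, 'a) mpoly \<Rightarrow> 'a bipoly" where
  "kap c F = mp_eval mp_const (ksub c) (Phi F)"

lemma kap_hom: "comm_ring_hom (kap c)"
  unfolding kap_def by (rule hom_compose[OF mp_eval_hom[OF mp_const_hom] Phi_hom])

lemma ev_kap: "ev (kap c F) (bp s t x) = mp_value F (P s t (cv c s t))"
proof -
  have "(\<lambda>v. ev (ksub c v) (bp s t x)) = bp s t (cv c s t)"
    by (rule ext) (simp add: ksub_def ev_Cb bp_def[of s t "cv c s t"] split: option.split)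
  then show ?thesis by (simp add: kap_def ev_subst ev_Phi)
qed

lemma cv_kernel: "vdot (fv s t) (cv c s t) = 0" "vdot (hl c s t) (cv c s t) = 0"
  by (simp_all add: cv_def vdot_cr)

lemma good_P: "good c \<Longrightarrow> (s, t) \<noteq> (0, 0) \<Longrightarrow> P s t (cv c s t) \<noteq> 0"
  by (auto simp: good_def P_eq_0_iff)

lemma HS_kap:
  assumes g: "good c" and F: "F \<in> HS c"
  shows "kap c F = 0"
proof -
  \<comment> \<open>The parameter (0, 0) defines no point of the section; the factor s disposes of
    it.\<close>
  have "mp_var vS * kap c F = 0"
  proof (rule bipoly_eqI)
    fix s t x
    have "s \<noteq> 0 \<Longrightarrow> mp_value F (P s t (cv c s t)) = 0"
      by (rule HS_vanishes[OF F good_P[OF g] cv_kernel]) simp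
    then show "ev (mp_var vS * kap c F) (bp s t x) = ev 0 (bp s t x)" by (auto simp: ev_kap)
  qed
  then show ?thesis using mp_var_nonzero[of vS, where 'a = 'a] by simp
qed

text \<open>\<open>Phi F\<close> has degree n both in s, t and in x, and each x_k is replaced by a
  binary form of degree d - 1, which gives n + (d - 1) n = n d.\<close>

lemma whom_kap: "F \<in> forms n \<Longrightarrow> whom wS (n * d) (kap c F)"
proof -
  assume F: "F \<in> forms n"
  let ?w = "\<lambda>v. wS v + (d - 1) * wX v"
  have "wdeg ?w \<mu> = wdeg wS \<mu> + (d - 1) * wdeg wX \<mu>" for \<mu>
    by (simp add: wdeg_def distrib_right sum.distrib sum_distrib_left mult.assoc)
  then have "whom ?w (n + (d - 1) * n) (Phi F)"
    using bih_Phi[OF F] by (simp add: bih_def whom_def)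
  moreover have "whom wS (?w v) (ksub c v)" for v
    using bih_Cb[of c] by (auto simp: ksub_def wS_def wX_def bih_def intro!: whom_var split: option.split)
  ultimately have "whom wS (n + (d - 1) * n) (kap c F)" unfolding kap_def by (rule whom_subst)
  moreover have "n + (d - 1) * n = n * d" using d5 by (cases d) auto
  ultimately show ?thesis by simp
qed

text \<open>Components of different degrees j have images of different degrees j d, so they cannot
  cancel each other.\<close>

lemma kap_components:
  assumes F: "kap c F = 0"
  shows "kap c (coeff (grade (\<lambda>_. 1) F) k) = 0"
proof -
  interpret K: comm_ring_hom "kap c" by (rule kap_hom)
  interpret G: comm_ring_hom "grade wS :: 'a bipoly \<Rightarrow> _" by (rule grade_hom)
  let ?F = "\<lambda>j. coeff (grade (\<lambda>_. 1) F) j"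
  let ?N = "degree (grade (\<lambda>_. 1) F)"
  have gr: "grade wS (kap c (?F j)) = monom (kap c (?F j)) (j * d)" for j
    using whom_kap[of "?F j" j c] whom_comp[of "\<lambda>_. 1" j F] by (simp add: forms_whom whom_iff_grade)
  have d: "j * d = k * d \<longleftrightarrow> j = k" for j using d5 by simp
  have "0 = grade wS (kap c F)" using F by simp
  also have "kap c F = (\<Sum>j\<le>?N. kap c (?F j))"
    using arg_cong[OF sum_comp[of F "\<lambda>_. 1"], of "kap c"] by (simp only: K.hom_sum)
  also have "grade wS \<dots> = (\<Sum>j\<le>?N. monom (kap c (?F j)) (j * d))" by (simp only: G.hom_sum gr)
  finally have "0 = coeff (\<Sum>j\<le>?N. monom (kap c (?F j)) (j * d)) (k * d)" by simp
  also have "\<dots> = (\<Sum>j\<le>?N. if j = k then kap c (?F j) else 0)"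
    unfolding coeff_sum coeff_monom d ..
  also have "\<dots> = (if k \<in> {..?N} then kap c (?F k) else 0)" by (rule sum.delta) simp
  finally have fin: "0 = (if k \<in> {..?N} then kap c (?F k) else 0)" .
  show ?thesis
  proof (cases "k \<in> {..?N}")
    case True
    with fin show ?thesis by (simp only: if_True)
  next
    case False
    then have "?F k = 0" by (intro coeff_eq_0) simp
    then show ?thesis by (simp only: K.hom_zero)
  qed
qed

text \<open>Each term of the binomial expansion contains the M-th power of x or of y.\<close>

lemma inc_power:
  assumes "inc c (x ^ M * G)" "inc c (y ^ M * G)"
  shows "inc c ((x * A + y * B) ^ (2 * M) * G)"
proof -
  note sub = inc_ideal[of c]
  have sc: "inc c (r * H)" if "inc c H" for r H using ideal.subspace_scale[OF sub, of H r] that by simp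
  have "inc c (of_nat (2 * M choose k) * (x * A) ^ k * (y * B) ^ (2 * M - k) * G)" for k
  proof (cases "M \<le> k")
    case True
    then have "x ^ k = x ^ (k - M) * x ^ M" by (simp flip: power_add)
    then have eq: "of_nat (2 * M choose k) * (x * A) ^ k * (y * B) ^ (2 * M - k) * G =
      (of_nat (2 * M choose k) * x ^ (k - M) * A ^ k * (y * B) ^ (2 * M - k)) * (x ^ M * G)"
      by (simp only: power_mult_distrib mult_ac)
    show ?thesis unfolding eq by (rule sc[OF assms(1)])
  next
    case False
    then have "2 * M - k = (M - k) + M" by simp
    then have "y ^ (2 * M - k) = y ^ (M - k) * y ^ M" by (simp only: power_add)
    then have eq: "of_nat (2 * M choose k) * (x * A) ^ k * (y * B) ^ (2 * M - k) * G =
      (of_nat (2 * M choose k) * (x * A) ^ k * B ^ (2 * M - k) * y ^ (M - k)) * (y ^ M * G)"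
      by (simp only: power_mult_distrib mult_ac)
    show ?thesis unfolding eq by (rule sc[OF assms(2)])
  qed
  then have "(\<Sum>k\<le>2 * M. of_nat (2 * M choose k) * (x * A) ^ k * (y * B) ^ (2 * M - k) * G) \<in> {G. inc c G}"
    by (intro ideal.subspace_sum[OF sub]) simp
  then show ?thesis by (simp add: binomial_ring sum_distrib_right)
qed

text \<open>Modulo the ideal \<open>inc\<close> the vectors C_j x and x_j C agree, so C_j^n
  \<open>Phi F\<close> is congruent to x_j^n \<open>kap c F\<close>, which is 0. The C_j have no
  common zero, so \<open>Phi F\<close> times large powers of s and of t lies in the ideal. Every
  coordinate of P^5 pulls back to s A + t B; hence its powers carry \<open>F\<close> into the ideal
  of the section, which is saturated.\<close>

lemma kap_HS_form:
  assumes g: "good c" and F: "F \<in> forms n" and z: "kap c F = 0"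
  shows "F \<in> HS c"
proof -
  note sub = inc_ideal[of c]
  have sc: "inc c (r * H)" if "inc c H" for r H using ideal.subspace_scale[OF sub, of H r] that by simp
  let ?G = "Phi F"
  have w: "whom wX n ?G" using bih_Phi[OF F] by (simp add: bih_def)
  have C: "inc c (Cb c $ j ^ n * ?G)" for j
  proof -
    \<comment> \<open>\<open>y\<close> scales x by C_j and \<open>y'\<close> replaces x by x_j C;
      the exponent \<open>wX v\<close> leaves s and t alone. On a form of degree n in x both
      substitutions release an n-th power.\<close>
    define y y' where "y v = Cb c $ j ^ wX v * mp_var v" and "y' v = Xb $ j ^ wX v * ksub c v" for v
    have "y v - y' v \<in> {G. inc c G}" for v
    proof -
      have "inc c 0" using ideal.subspace_0[OF sub] by simp
      then show ?thesis
        using inc_Cb[where c = c and i = j] by (auto simp: y_def y'_def ksub_def wX_def Xb_def mult.commute split: option.split)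
    qed
    then have "mp_eval mp_const y ?G - mp_eval mp_const y' ?G \<in> {G. inc c G}" by (rule ideal_congruence[OF sub])
    moreover have "mp_eval mp_const y ?G = Cb c $ j ^ n * ?G"
      unfolding y_def whom_eval[OF w] mp_eval_id ..
    moreover have "mp_eval mp_const y' ?G = 0"
      unfolding y'_def whom_eval[OF w] using z by (simp add: kap_def)
    ultimately show ?thesis by simp
  qed
  define Q where "Q = {q. inc c (q * ?G)}"
  have Q: "ideal.subspace Q"
    using ideal.subspace_0[OF sub] ideal.subspace_add[OF sub] sc
    by (auto simp: Q_def ideal.subspace_def distrib_right mult.assoc)
  have CQ: "Cb c $ j ^ n \<in> Q" for j using C by (simp add: Q_def)
  have bC: "bih ((d - 1) * n) 0 (Cb c $ j ^ n)" for j using bih_power[OF bih_Cb, of n c j] by simp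
  have "\<exists>j. ev (Cb c $ j ^ n) (bp s t 0) \<noteq> 0" if "(s, t) \<noteq> (0, 0)" for s t
    using g that by (auto simp: good_def Finite_Cartesian_Product.vec_eq_iff ev_Cb)
  then obtain M1 M2 where M1: "mp_var vT ^ M1 \<in> Q" and M2: "mp_var vS ^ M2 \<in> Q"
    by (rule common_powers_in_ideal[OF Q bC CQ])
  define M where "M = M1 + M2"
  have MT: "inc c (mp_var vT ^ M * ?G)" and MS: "inc c (mp_var vS ^ M * ?G)"
    using sc[of "mp_var vT ^ M1 * ?G" "mp_var vT ^ M2"] sc[of "mp_var vS ^ M2 * ?G" "mp_var vS ^ M1"] M1 M2
    by (simp_all add: M_def Q_def power_add mult_ac)
  have "mp_var i ^ (2 * M) * F \<in> HS c" for i
  proof (rule inc_HS)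
    have "mp_var i \<in> (forms 1 :: (6, 'a) mpoly set)" by (simp add: forms_whom whom_var)
    then have "mp_var i ^ (2 * M) \<in> (forms (2 * M) :: (6, 'a) mpoly set)"
      using whom_power[of "\<lambda>_. 1" 1 "mp_var i" "2 * M"] by (simp add: forms_whom)
    then show "mp_var i ^ (2 * M) * F \<in> forms (2 * M + n)" by (rule forms_mult[OF _ F])
    have "Phi (mp_var i) = mp_var vS * (\<Sum>j\<in>UNIV. mp_const (a j $ i) * mp_var (vX j)) + mp_var vT * (\<Sum>j\<in>UNIV. mp_const (b j $ i) * mp_var (vX j))"
      by (simp add: Phi_def mp_eval_var[OF mp_const_hom] Yv_def sum_distrib_left sum.distrib[symmetric] algebra_simps)
    then show "inc c (Phi (mp_var i ^ (2 * M) * F))"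
      using inc_power[OF MS MT] by simp
  qed
  then have "F \<in> saturation (HS c)" unfolding saturation_def by blast
  then show ?thesis by (simp only: HS_saturated)
qed

lemma HS_iff_kap:
  assumes g: "good c"
  shows "F \<in> HS c \<longleftrightarrow> kap c F = 0"
proof
  assume z: "kap c F = 0"
  have "coeff (grade (\<lambda>_. 1) F) k \<in> forms k" for k
    unfolding forms_whom mem_Collect_eq by (rule whom_comp)
  then have "coeff (grade (\<lambda>_. 1) F) k \<in> HS c" for k
    by (rule kap_HS_form[OF g _ kap_components[OF z]])
  then have "(\<Sum>k\<le>degree (grade (\<lambda>_. 1) F). coeff (grade (\<lambda>_. 1) F) k) \<in> HS c"
    by (intro ideal.subspace_sum[OF HS_ideal(1)])
  then show "F \<in> HS c" by (simp only: sum_comp[symmetric])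
qed (rule HS_kap[OF g])

text \<open>By \<open>HS_iff_kap\<close> the ideal is the kernel of a homomorphism into a
  domain.\<close>

lemma good_prime:
  assumes g: "good c"
  shows "prime_ideal (saturation (HS c))"
proof -
  interpret K: comm_ring_hom "kap c" by (rule kap_hom)
  have "kap c 1 \<noteq> 0" by simp
  then have "HS c \<noteq> UNIV" using HS_iff_kap[OF g, of 1] by blast
  then show ?thesis
    unfolding HS_saturated prime_ideal_def using HS_ideal(1) by (simp add: HS_iff_kap[OF g] K.hom_mult)
qed

definition Zc :: "'a ^ 6 \<Rightarrow> ('a ^ 6) set set" where
  "Zc c = {vec.span {P s t (cv c s t)} | s t. (s, t) \<noteq> (0, 0)}"

lemma vanishes_Zc:
  assumes g: "good c" and F: "homogeneous F"
  shows "vanishes F (Zc c) \<longleftrightarrow> kap c F = 0"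
proof -
  have "vanishes F (Zc c) \<longleftrightarrow> (\<forall>s t. (s, t) \<noteq> (0, 0) \<longrightarrow> mp_value F (P s t (cv c s t)) = 0)"
    unfolding vanishes_def Zc_def using homogeneous_vanishes_point[OF F] by fastforce
  also have "\<dots> \<longleftrightarrow> kap c F = 0"
  proof
    assume z: "\<forall>s t. (s, t) \<noteq> (0, 0) \<longrightarrow> mp_value F (P s t (cv c s t)) = 0"
    have "mp_var vS * kap c F = 0"
    proof (rule bipoly_eqI)
      fix s t x
      show "ev (mp_var vS * kap c F) (bp s t x) = ev 0 (bp s t x)"
        using z by (cases "s = 0") (auto simp: ev_kap)
    qed
    then show "kap c F = 0" using mp_var_nonzero[of vS, where 'a = 'a] by simp
  next
    assume "kap c F = 0"
    then show "\<forall>s t. (s, t) \<noteq> (0, 0) \<longrightarrow> mp_value F (P s t (cv c s t)) = 0"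
      using ev_kap[where c = c and F = F] by (metis ev_simps(5))
  qed
  finally show ?thesis .
qed

lemma support_HS:
  assumes g: "good c"
  shows "support (HS c) = Zc c"
proof (intro equalityI subsetI)
  fix p assume "p \<in> Zc c"
  then obtain s t where st: "(s, t) \<noteq> (0, 0)" "p = vec.span {P s t (cv c s t)}" by (auto simp: Zc_def)
  have "vanishes F (Zc c)" if "F \<in> HS c" "homogeneous F" for F
    using that HS_kap[OF g] vanishes_Zc[OF g] by blast
  then show "p \<in> support (HS c)"
    unfolding support_def vanishes_def using span_singleton_proj[OF good_P[OF g st(1)]] \<open>p \<in> Zc c\<close> st(2) by blast
next
  fix p assume p: "p \<in> support (HS c)"
  then have pp: "p \<in> proj_space" by (simp add: support_def)
  have van: "mp_value F v = 0" if "F \<in> HS c" "homogeneous F" "v \<in> p" for F v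
    using p that by (auto simp: support_def)
  have "p \<in> V f"
  proof (rule ccontr)
    assume "p \<notin> V f"
    then obtain F where F: "homogeneous F" "vanishes F (V f)" "\<exists>v\<in>p. mp_value F v \<noteq> 0"
      by (rule closedin_zariski_separate[OF V_closed[OF f_bih] pp])
    have "F \<in> HS c" using vanishing_idealI[OF F(1,2)] HS_ideal(2) by blast
    then show False using van F(1,3) by blast
  qed
  then obtain s t x where x: "p = vec.span {P s t x}" "P s t x \<noteq> 0" "ev f (bp s t x) = 0" by (auto simp: V_def)
  have st: "(s, t) \<noteq> (0, 0)" "x \<noteq> 0" using x(2) by (auto simp: P_eq_0_iff)
  have "lf c \<in> HS c" using lf_in_ideal HS_ideal(3) by blast
  moreover have "homogeneous (lf c)" using lf(1) by (auto simp: homogeneous_def)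
  ultimately have "mp_value (lf c) (P s t x) = 0" by (rule van) (simp add: x(1) vec.span_base)
  then have h: "vdot (hl c s t) x = 0" by (simp add: lf vdot_P)
  have "cv c s t \<noteq> 0" using g st(1) by (simp add: good_def)
  then obtain e where e: "x = e *s cv c s t"
    using cr_kernel[of "fv s t" "hl c s t" x] x(3) h by (auto simp: f_vdot cv_def)
  then have "e \<noteq> 0" using st(2) by auto
  then have "p = vec.span {P s t (cv c s t)}" unfolding x(1) e P_scale by (rule span_scale)
  with st(1) show "p \<in> Zc c" by (auto simp: Zc_def)
qed

lemma Zc_irreducible:
  assumes g: "good c"
  shows "irreducible_closed zariski (Zc c)"
proof (rule irreducible_closedI)
  have "support (HS c) = {p \<in> proj_space. \<forall>F\<in>{F \<in> HS c. homogeneous F}. \<forall>v\<in>p. mp_value F v = 0}"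
    by (auto simp: support_def)
  moreover have "closedin zariski {p \<in> proj_space. \<forall>F\<in>{F \<in> HS c. homogeneous F}. \<forall>v\<in>p. mp_value F v = 0}"
    by (rule closedin_zariski_zeros) simp
  ultimately show "closedin zariski (Zc c)" using support_HS[OF g] by simp
  show "Zc c \<noteq> {}" unfolding Zc_def by (auto intro!: exI[of _ 1])
  interpret K: comm_ring_hom "kap c" by (rule kap_hom)
  fix F G :: "(6, 'a) mpoly" assume FG: "homogeneous F" "homogeneous G" "vanishes (F * G) (Zc c)"
  then have "kap c F * kap c G = 0" using vanishes_Zc[OF g homogeneous_mult[OF FG(1,2)]] by (simp add: K.hom_mult)
  then show "vanishes F (Zc c) \<or> vanishes G (Zc c)" using vanishes_Zc[OF g] FG(1,2) by auto
qed

lemma cv_scale: "cv c (k * s) (k * t) = k ^ (d - 1) *s cv c s t"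
proof -
  have "cv c (k * s) (k * t) $ j = k ^ (d - 1) * cv c s t $ j" for j
  proof -
    have "ev (Cb c $ j) (bp (k * s) (k * t) (1 *s 0)) = k ^ (d - 1) * 1 ^ 0 * ev (Cb c $ j) (bp s t 0)"
      by (rule ev_bih_scale[OF bih_Cb])
    then show ?thesis by (simp add: ev_Cb)
  qed
  then show ?thesis by (simp add: Finite_Cartesian_Product.vec_eq_iff)
qed

text \<open>A form that vanishes on \<open>A\<close> but not on the whole curve pulls back to a
  nonzero binary form, which has finitely many zeros up to scaling.\<close>

lemma Zc_proper_finite:
  assumes g: "good c" and A: "closedin zariski A" "A \<subset> Zc c"
  shows "finite A"
proof -
  obtain p where p: "p \<in> Zc c" "p \<notin> A" using A(2) by blast
  then obtain s1 t1 where st1: "(s1, t1) \<noteq> (0, 0)" "p = vec.span {P s1 t1 (cv c s1 t1)}" by (auto simp: Zc_def)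
  have "p \<in> proj_space" using span_singleton_proj[OF good_P[OF g st1(1)]] st1(2) by simp
  then obtain F where F: "homogeneous F" "vanishes F A" "\<exists>v\<in>p. mp_value F v \<noteq> 0"
    by (rule closedin_zariski_separate[OF A(1) _ p(2)])
  obtain n where n: "F \<in> forms n" using F(1) by (auto simp: homogeneous_def)
  have "bih n n (Phi F)" by (rule bih_Phi[OF n])
  have "whom wX 0 (kap c F)"
    unfolding kap_def
  proof (rule whom_subst[of "\<lambda>_. 0"])
    show "whom (\<lambda>_. 0) 0 (Phi F)" by (simp add: whom_def wdeg_def)
    show "whom wX 0 (ksub c v)" for v
      using bih_Cb[of c] by (auto simp: ksub_def bih_def intro!: whom_var split: option.split)
  qed
  then have bk: "bih (n * d) 0 (kap c F)" using whom_kap[OF n] by (simp add: bih_def)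
  have "ev (kap c F) (bp s1 t1 0) \<noteq> 0"
    unfolding ev_kap using F(3) st1(2) homogeneous_vanishes_point[OF F(1)] by blast
  then obtain R where R: "finite R" "\<And>s t. (s, t) \<in> R \<Longrightarrow> (s, t) \<noteq> (0, 0) \<and> ev (kap c F) (bp s t 0) = 0"
    "\<And>s t. (s, t) \<noteq> (0, 0) \<Longrightarrow> ev (kap c F) (bp s t 0) = 0 \<Longrightarrow> \<exists>(s', t')\<in>R. \<exists>k. k \<noteq> 0 \<and> s = k * s' \<and> t = k * t'"
  proof (rule binary_roots[OF bk])
    fix R assume "finite R" "\<And>s t. (s, t) \<in> R \<Longrightarrow> (s, t) \<noteq> (0, 0) \<and> ev (kap c F) (bp s t 0) = 0"
      "\<And>s t. (s, t) \<noteq> (0, 0) \<Longrightarrow> ev (kap c F) (bp s t 0) = 0 \<Longrightarrow> \<exists>(s', t')\<in>R. \<exists>k. k \<noteq> 0 \<and> s = k * s' \<and> t = k * t'"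
    then show thesis by (rule that)
  qed
  have "A \<subseteq> (\<lambda>(s, t). vec.span {P s t (cv c s t)}) ` R"
  proof
    fix q assume q: "q \<in> A"
    then have "q \<in> Zc c" using A(2) by blast
    then obtain s t where st: "(s, t) \<noteq> (0, 0)" "q = vec.span {P s t (cv c s t)}" unfolding Zc_def by blast
    have "mp_value F (P s t (cv c s t)) = 0"
      using F(2) q st(2) vec.span_base[of "P s t (cv c s t)" "{P s t (cv c s t)}"] by (auto simp: vanishes_def)
    then have "ev (kap c F) (bp s t 0) = 0" by (simp only: ev_kap)
    then obtain s' t' k where k: "(s', t') \<in> R" "k \<noteq> 0" "s = k * s'" "t = k * t'" using R(3)[OF st(1)] by blast
    have "P s t (cv c s t) = (k ^ (d - 1) * k) *s P s' t' (cv c s' t')"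
      unfolding k cv_scale P_scale P_scale_st by simp
    then have "q = vec.span {P s' t' (cv c s' t')}" unfolding st(2) using k(2) by (simp add: span_scale)
    then show "q \<in> (\<lambda>(s, t). vec.span {P s t (cv c s t)}) ` R" using k(1) by force
  qed
  then show ?thesis using R(1) by (meson finite_imageI finite_subset)
qed

end

lemma irreducible_finite:
  fixes A :: "('a::field ^ 'n) set set"
  assumes A: "irreducible_closed zariski A" and fin: "finite A"
  obtains p where "A = {p}"
proof -
  have cl: "closedin zariski A" and ne: "A \<noteq> {}" using A by (auto simp: irreducible_closed_def)
  have pt: "closedin zariski {p}" if p: "p \<in> A" for p
  proof -
    have "p \<in> proj_space" using closedin_zariski_subset[OF cl] p by blast
    then obtain v where "v \<noteq> 0" "p = vec.span {v}" by (rule proj_spaceE)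
    then show ?thesis using closedin_point by blast
  qed
  obtain p where p: "p \<in> A" using ne by blast
  have "closedin zariski (\<Union>((\<lambda>q. {q}) ` (A - {p})))"
    by (rule closedin_Union) (use fin pt in auto)
  moreover have "\<Union>((\<lambda>q. {q}) ` (A - {p})) = A - {p}" by blast
  ultimately have "closedin zariski (A - {p})" by simp
  moreover have "A \<subseteq> {p} \<union> (A - {p})" by blast
  ultimately have "A \<subseteq> {p} \<or> A \<subseteq> A - {p}" using A pt[OF p] unfolding irreducible_closed_def by blast
  then have "A = {p}" using p by blast
  then show thesis by (rule that)
qed

context type_I_surface
begin

text \<open>A proper irreducible closed subset is finite, hence a single point, and the
  parametrization takes two distinct values.\<close>

lemma Zc_dim:
  assumes g: "good c"
  shows "krull_dim zariski (Zc c) = 1"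
proof (rule antisym)
  have "\<not> enat 2 \<le> krull_dim zariski (Zc c)"
  proof
    assume "enat 2 \<le> krull_dim zariski (Zc c)"
    then obtain C where C: "\<And>i. i \<le> 2 \<Longrightarrow> irreducible_closed zariski (C i) \<and> C i \<subseteq> Zc c" "\<And>i :: nat. i < 2 \<Longrightarrow> C i \<subset> C (Suc i)"
      by (rule krull_dim_geE) auto
    have "C 1 \<subset> C 2" using C(2)[of 1] by (simp add: numeral_2_eq_2)
    then have "C 1 \<subset> Zc c" using C(1)[of 2] by blast
    moreover have irr: "irreducible_closed zariski (C 1)" "irreducible_closed zariski (C 0)" using C(1) by auto
    ultimately have "finite (C 1)" using Zc_proper_finite[OF g] by (auto simp: irreducible_closed_def)
    then obtain p where "C 1 = {p}" by (rule irreducible_finite[OF irr(1)])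
    moreover have "C 0 \<subset> C 1" using C(2)[of 0] by simp
    ultimately have "C 0 \<subset> {p}" by simp
    then have "C 0 = {}" by (metis psubset_eq subset_singletonD)
    then show False using irr(2) by (simp add: irreducible_closed_def)
  qed
  then show "krull_dim zariski (Zc c) \<le> 1"
    by (cases "krull_dim zariski (Zc c)") (auto simp: one_enat_def)
  define p q where "p = vec.span {P 1 0 (cv c 1 0)}" and "q = vec.span {P 0 1 (cv c 0 1)}"
  have Zc: "(s, t) \<noteq> (0, 0) \<Longrightarrow> vec.span {P s t (cv c s t)} \<in> Zc c" for s t unfolding Zc_def by blast
  have pq: "p \<in> Zc c" "q \<in> Zc c" unfolding p_def q_def by (rule Zc, simp)+
  have p0: "P 1 0 (cv c 1 0) \<noteq> 0" by (rule good_P[OF g]) simp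
  have "p \<noteq> q"
  proof
    assume "p = q"
    then have "vec.span {P 1 0 (cv c 1 0)} = vec.span {P 0 1 (cv c 0 1)}" by (simp add: p_def q_def)
    then obtain e e' :: 'a where "0 = e * 1" "e \<noteq> 0" by (rule P_span_eqE[OF _ p0]) blast
    then show False by simp
  qed
  have irr: "irreducible_closed zariski {p}" unfolding p_def by (rule irreducible_point[OF p0])
  have "enat 1 \<le> krull_dim zariski (Zc c)"
  proof (rule krull_dim_geI[of 1 zariski "\<lambda>i. if i = 0 then {p} else Zc c"])
    fix i :: nat
    show "irreducible_closed zariski (if i = 0 then {p} else Zc c) \<and> (if i = 0 then {p} else Zc c) \<subseteq> Zc c"
      using irr Zc_irreducible[OF g] pq by auto
    assume "i < 1"
    then show "(if i = 0 then {p} else Zc c) \<subset> (if Suc i = 0 then {p} else Zc c)" using pq \<open>p \<noteq> q\<close> by auto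
  qed
  then show "1 \<le> krull_dim zariski (Zc c)" by (simp add: one_enat_def)
qed

lemma integral_iff_good:
  assumes c: "c \<noteq> 0"
  shows "integral_curve (HS c) \<longleftrightarrow> good c"
proof
  assume "integral_curve (HS c)"
  then show "good c" using prime_imp_good[OF c] by (simp add: integral_curve_def HS_saturated)
next
  assume g: "good c"
  then show "integral_curve (HS c)"
    unfolding integral_curve_def using good_prime support_HS Zc_dim by simp
qed

end

section \<open>Extremal hyperplanes\<close>

lemma det_forms:
  fixes e :: "nat \<Rightarrow> nat \<Rightarrow> ('n::finite, 'a::comm_ring_1) mpoly"
  assumes e: "\<And>i j. e i j \<in> forms 1"
  shows "Determinant.det (Matrix.mat n n (\<lambda>(i, j). e i j)) \<in> forms n"
proof -
  have "whom (\<lambda>_. 1) (0 + (\<Sum>i=0..<n. 1)) (signof p * (\<Prod>i=0..<n. e i (p i)))" for p :: "nat \<Rightarrow> nat"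
  proof (rule whom_mult)
    show "whom (\<lambda>_. 1) 0 (signof p :: ('n, 'a) mpoly)" unfolding sign_def by (auto intro: whom_1 whom_uminus)
    show "whom (\<lambda>_. 1) (\<Sum>i=0..<n. 1) (\<Prod>i=0..<n. e i (p i))" using e by (intro whom_prod) (simp add: forms_whom)
  qed
  then have w: "whom (\<lambda>_. 1) n (signof p * (\<Prod>i=0..<n. e i (p i)))" for p :: "nat \<Rightarrow> nat" by simp
  have "Determinant.det (Matrix.mat n n (\<lambda>(i, j). e i j)) =
      (\<Sum>p\<in>{p. p permutes {0..<n}}. signof p * (\<Prod>i=0..<n. e i (p i)))"
    unfolding Determinant.det_def
    by (auto intro!: sum.cong arg_cong2[where f = "(*)"] prod.cong simp: permutes_in_image)
  also have "whom (\<lambda>_. 1) n \<dots>" by (intro whom_sum w)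
  finally show ?thesis by (simp add: forms_whom)
qed

lemma cr_surj:
  fixes x :: "'a::field ^ 3"
  assumes "x $ 3 \<noteq> 0"
  obtains p q where "cr p q = x"
proof
  \<comment> \<open>Two vectors orthogonal to x, scaled so that their product is x and not just a
    multiple of it.\<close>
  show "cr (vector [1, 0, - x $ 1 / x $ 3]) (vector [0, x $ 3, - x $ 2]) = x"
    by (rule vec3_eqI) (use assms in \<open>simp_all add: cr_nth\<close>)
qed

context scroll
begin

text \<open>A hyperplane with prescribed \<open>al\<close> and \<open>be\<close>, by means of the
  coordinate functionals of the scroll.\<close>

definition cov :: "'a ^ 3 \<Rightarrow> 'a ^ 3 \<Rightarrow> 'a ^ 6" where
  "cov \<alpha> \<beta> = (\<chi> i. \<Sum>j\<in>UNIV. \<alpha> $ j * NX $ j $ i + \<beta> $ j * NY $ j $ i)"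

lemma vdot_cov: "vdot (cov \<alpha> \<beta>) v = vdot \<alpha> (NX *v v) + vdot \<beta> (NY *v v)"
proof -
  have "vdot (cov \<alpha> \<beta>) v = (\<Sum>i\<in>UNIV. \<Sum>j\<in>UNIV. (\<alpha> $ j * NX $ j $ i + \<beta> $ j * NY $ j $ i) * v $ i)"
    by (simp add: vdot_def cov_def sum_distrib_right)
  also have "\<dots> = (\<Sum>j\<in>UNIV. \<Sum>i\<in>UNIV. (\<alpha> $ j * NX $ j $ i + \<beta> $ j * NY $ j $ i) * v $ i)" by (rule sum.swap)
  finally show ?thesis
    by (simp add: vdot_def matrix_vector_mult_def sum_distrib_left sum.distrib distrib_right mult.assoc)
qed

lemma al_cov: "al (cov \<alpha> \<beta>) = \<alpha>" and be_cov: "be (cov \<alpha> \<beta>) = \<beta>"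
proof -
  have z: "vdot p 0 = 0" for p :: "'a ^ 3" by (rule vdot_linear(3))
  show "al (cov \<alpha> \<beta>) = \<alpha>" "be (cov \<alpha> \<beta>) = \<beta>"
    by (simp_all add: Finite_Cartesian_Product.vec_eq_iff al_def be_def vdot_cov a_Av NX_NY_ab vdot_axis z)
qed

lemma polyfun_al: "polyfun (\<lambda>c. al c $ j)" and polyfun_be: "polyfun (\<lambda>c. be c $ j)"
  by (simp_all add: al_def be_def polyfun_vdot)

lemma polyfun_cr: "polyfun (\<lambda>c. cr (al c) (be c) $ j)"
  using exhaust_3[of j]
  by (elim disjE) (simp_all only: cr_nth, (intro polyfun_diff polyfun_mult polyfun_al polyfun_be)+)

lemma Lx_scale: "e \<noteq> 0 \<Longrightarrow> Lx (e *s x) = Lx x"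
proof -
  assume e: "e \<noteq> 0"
  have "P s t (e *s x) = P (e * s) (e * t) x" for s t by (simp only: P_scale P_scale_st)
  moreover have "P s t x = P (s / e) (t / e) (e *s x)" for s t
  proof -
    have "P (s / e) (t / e) (e *s x) = P (e * (s / e)) (e * (t / e)) x" by (simp only: P_scale P_scale_st)
    then show ?thesis using e by simp
  qed
  ultimately show ?thesis unfolding Lx_def by blast
qed

lemma Lx_in_hyp: "Lx x \<subseteq> hyp c \<longleftrightarrow> vdot (al c) x = 0 \<and> vdot (be c) x = 0"
proof
  assume "Lx x \<subseteq> hyp c"
  then have z: "vdot c (P s t x) = 0" for s t by (auto simp: Lx_def hyp_def)
  from z[of 1 0] z[of 0 1] show "vdot (al c) x = 0 \<and> vdot (be c) x = 0"
    unfolding vdot_P hl_def by simp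
next
  assume "vdot (al c) x = 0 \<and> vdot (be c) x = 0"
  then show "Lx x \<subseteq> hyp c" by (auto simp: Lx_def hyp_def vdot_P hl_def vdot_left)
qed

end

lemma openin_hyperplanes:
  assumes "homogeneous F"
  shows "openin hyperplane_topology (annihilator -` nonvanishing F \<inter> Gr 4)"
  unfolding hyperplane_topology_def openin_pullback_topology using openin_nonvanishing[OF assms] by blast

lemma hyp_nonvanishing:
  fixes c :: "'a::field ^ 6"
  assumes F: "homogeneous F" and c: "c \<noteq> 0"
  shows "hyp c \<in> annihilator -` nonvanishing F \<inter> Gr 4 \<longleftrightarrow> mp_value F c \<noteq> 0"
proof -
  have "hyp c \<in> annihilator -` nonvanishing F \<inter> Gr 4 \<longleftrightarrow> vec.span {c} \<in> nonvanishing F"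
    using hyp_Gr[OF c] by (simp add: annihilator_hyp[OF c])
  also have "\<dots> \<longleftrightarrow> mp_value F c \<noteq> 0"
    unfolding nonvanishing_def using homogeneous_vanishes_point[OF F, of c] span_singleton_proj[OF c] by blast
  finally show ?thesis .
qed

lemma openin_hyperplane_basis:
  fixes c :: "'a::field ^ 6"
  assumes U: "openin hyperplane_topology U" and c: "c \<noteq> 0" "hyp c \<in> U"
  obtains F where "homogeneous F" "mp_value F c \<noteq> 0" "annihilator -` nonvanishing F \<inter> Gr 4 \<subseteq> U"
proof -
  obtain O' where O': "openin zariski O'" "U = annihilator -` O' \<inter> Gr 4"
    using U unfolding hyperplane_topology_def openin_pullback_topology by blast
  have "annihilator (hyp c) \<in> O'" using c(2) O'(2) by blast
  then obtain F where F: "homogeneous F" "annihilator (hyp c) \<in> nonvanishing F" "nonvanishing F \<subseteq> O'"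
    by (rule openin_zariski_basis[OF O'(1)])
  have "hyp c \<in> annihilator -` nonvanishing F \<inter> Gr 4" using F(2) hyp_Gr[OF c(1)] by blast
  then have "mp_value F c \<noteq> 0" by (rule hyp_nonvanishing[OF F(1) c(1), THEN iffD1])
  moreover have "annihilator -` nonvanishing F \<inter> Gr 4 \<subseteq> U" using F(3) O'(2) by blast
  ultimately show thesis using F(1) by (intro that)
qed

section \<open>Hyperplanes with integral section and their extremal lines\<close>

context type_I_surface
begin

lemma good_nonzero: "good c \<Longrightarrow> c \<noteq> 0"
proof
  assume g: "good c" and "c = 0"
  then have "hl c 1 0 = 0" by (simp add: hl_def al_def vdot_def Finite_Cartesian_Product.vec_eq_iff)
  then have "cv c 1 0 = 0" by (intro vec3_eqI) (simp_all add: cv_def cr_nth)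
  then show False using g by (auto simp: good_def)
qed

lemma good_cr: "good c \<Longrightarrow> cr (al c) (be c) \<noteq> 0"
proof
  assume g: "good c" and z: "cr (al c) (be c) = 0"
  have "\<exists>s t. (s, t) \<noteq> (0, 0) \<and> hl c s t = 0"
  proof (cases "al c = 0")
    case True
    then show ?thesis by (intro exI[of _ 1] exI[of _ 0]) (simp add: hl_def)
  next
    case False
    then obtain e where "be c = e *s al c" using cr_proportional[OF z] by blast
    then show ?thesis by (intro exI[of _ "- e"] exI[of _ 1]) (simp add: hl_def Finite_Cartesian_Product.vec_eq_iff)
  qed
  then obtain s t where st: "(s, t) \<noteq> (0, 0)" "hl c s t = 0" by blast
  then have "cv c s t = 0" by (intro vec3_eqI) (simp_all add: cv_def cr_nth)
  then show False using g st(1) by (auto simp: good_def)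
qed

text \<open>If the line over x = \<open>cr (al c) (be c)\<close> lay in the surface, x would be
  orthogonal to both factors of \<open>cv c s t\<close> for all s, t, hence a multiple of this
  product. But an entry of the product at an index where x is nonzero has positive degree d - 1 and
  therefore a zero on P^1.\<close>

lemma good_good_x:
  assumes g: "good c"
  shows "good_x (cr (al c) (be c))"
proof (rule ccontr)
  let ?x = "cr (al c) (be c)"
  assume "\<not> good_x ?x"
  then have f: "vdot (fv s t) ?x = 0" for s t by (simp add: good_x_def f_vdot)
  have h: "vdot (hl c s t) ?x = 0" for s t by (simp add: hl_def vdot_left vdot_cr)
  obtain j where j: "?x $ j \<noteq> 0" using good_cr[OF g] by (auto simp: Finite_Cartesian_Product.vec_eq_iff)
  have "d - 1 \<ge> 1" using d5 by simp
  then obtain s t where st: "(s, t) \<noteq> (0, 0)" "ev (Cb c $ j) (bp s t 0) = 0" by (rule bih_zero_S[OF bih_Cb])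
  have nz: "cv c s t \<noteq> 0" using g st(1) by (simp add: good_def)
  have "cr (cv c s t) ?x = 0" unfolding cv_def cr_cr by (simp add: f h)
  then obtain e where "?x = e *s cv c s t" by (rule cr_proportional[OF _ nz])
  then have "?x $ j = e * cv c s t $ j" by simp
  then show False using j st(2) by (simp add: ev_Cb)
qed

text \<open>By \<open>long_line\<close> a competing line is some \<open>Lx x\<close>, and lying in
  the hyperplane puts x into the common kernel of \<open>al c\<close> and \<open>be c\<close>, which
  their cross product spans.\<close>

lemma extremal_line_eq:
  assumes g: "good c"
  shows "extremal_line (V f) d (hyp c) = Lx (cr (al c) (be c))"
proof -
  let ?x = "cr (al c) (be c)"
  have abs: "scheme_inter (HS c) (vanishing_ideal (points L)) = SL L" if L: "L \<subseteq> hyp c" for L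
  proof -
    have "points L \<subseteq> points (hyp c)" using L by (auto simp: points_def)
    then have "vanishing_ideal (points (hyp c)) \<subseteq> vanishing_ideal (points L)"
      unfolding vanishing_ideal_def by (intro ideal.span_mono) blast
    then show ?thesis unfolding hyperplane_section_def by (rule scheme_inter_absorb)
  qed
  obtain s t where st: "ev f (bp s t ?x) \<noteq> 0" using good_good_x[OF g] by (auto simp: good_x_def)
  have sub: "Lx ?x \<subseteq> hyp c" unfolding Lx_in_hyp by (simp add: vdot_cr)
  show ?thesis
    unfolding extremal_line_def
  proof (rule the_equality)
    show "Lx ?x \<in> Gr 1 \<and> Lx ?x \<subseteq> hyp c \<and> has_length (scheme_inter (HS c) (vanishing_ideal (points (Lx ?x)))) (d - 2)"
      using Lx_Gr1[OF good_cr[OF g]] sub abs[OF sub] Lx_length[OF good_cr[OF g] st] by simp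
    fix L assume "L \<in> Gr 1 \<and> L \<subseteq> hyp c \<and> has_length (scheme_inter (HS c) (vanishing_ideal (points L))) (d - 2)"
    then have L: "L \<in> Gr 1" "L \<subseteq> hyp c" "has_length (SL L) (d - 2)" using abs[of L] by auto
    have "d - 2 \<ge> 3" using d5 by simp
    then obtain x s t where x: "x \<noteq> 0" "L = Lx x" "ev f (bp s t x) \<noteq> 0" by (rule long_line[OF L(1,3)])
    have "vdot (al c) x = 0" "vdot (be c) x = 0" using L(2) Lx_in_hyp x(2) by auto
    then obtain e where e: "x = e *s ?x" by (rule cr_kernel[OF good_cr[OF g]])
    then have "e \<noteq> 0" using x(1) by auto
    then show "L = Lx ?x" unfolding x(2) by (subst e) (rule Lx_scale)
  qed
qed

text \<open>The surface contains no ruling plane: otherwise the linear form of (s0, t0) would divide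
  all coefficients of \<open>f\<close>, hence \<open>f\<close>. Two primes dividing one another are
  associated, but d - 2 exceeds 1.\<close>

lemma fv_nonzero:
  assumes st: "(s0, t0) \<noteq> (0, 0)"
  shows "fv s0 t0 \<noteq> 0"
proof
  assume z: "fv s0 t0 = 0"
  let ?u = "mp_const t0 * mp_var vS - mp_const s0 * mp_var vT :: 'a bipoly"
  note u = linear_st_prime[OF st]
  have "ev (Fb $ j) (bp s0 t0 0) = 0" for j by (simp add: ev_Fb z)
  then have dv: "?u dvd Fb $ j" for j by (rule linear_st_dvd[OF st bih_Fb])
  have "?u dvd vdot Fb Xb" unfolding vdot_def by (intro dvd_sum dvd_mult2 dv)
  then have "?u dvd f" unfolding f_eq[symmetric] .
  then obtain r v where r: "f = ?u * r" "r * v = 1" by (rule prime_dvd_prime[OF u f_prime])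
  have "?u = f * v" by (simp only: r(1) mult.assoc r(2) mult_1_right)
  then have fu: "f dvd ?u" by (rule dvdI)
  have u0: "?u \<noteq> 0" using u by (simp add: prime_elem_def)
  obtain i j where ij: "bih i j f" "i \<le> 1" by (rule bih_dvd[OF bih_linear_st u0 fu])
  have "d - 2 = i" using bih_unique[OF f_bih ij(1) f_nonzero] by simp
  then show False using ij(2) d5 by linarith
qed

text \<open>For a good \<open>x0\<close> take h(s, t) = x0 \<times> (s p + t q). A zero of the cross
  product makes f(s, t) proportional to h(s, t), hence orthogonal to \<open>x0\<close>, which
  happens only at the finitely many roots in \<open>R\<close>. There the cross product is (f . y) x0
  with y = s p + t q, so generic p, q avoid a zero.\<close>

lemma good_exists: "\<exists>c. good c"
proof -
  obtain x0 where x0: "good_x x0" using good_x_exists by blast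
  then obtain s1 t1 where "ev f (bp s1 t1 x0) \<noteq> 0" by (auto simp: good_x_def)
  then obtain R where R: "finite R" "\<And>s t. (s, t) \<in> R \<Longrightarrow> (s, t) \<noteq> (0, 0) \<and> ev f (bp s t x0) = 0"
    "\<And>s t. (s, t) \<noteq> (0, 0) \<Longrightarrow> ev f (bp s t x0) = 0 \<Longrightarrow> \<exists>(s', t')\<in>R. \<exists>k. k \<noteq> 0 \<and> s = k * s' \<and> t = k * t'"
  proof (rule binary_roots[OF f_bih])
    fix R assume "finite R" "\<And>s t. (s, t) \<in> R \<Longrightarrow> (s, t) \<noteq> (0, 0) \<and> ev f (bp s t x0) = 0"
      "\<And>s t. (s, t) \<noteq> (0, 0) \<Longrightarrow> ev f (bp s t x0) = 0 \<Longrightarrow> \<exists>(s', t')\<in>R. \<exists>k. k \<noteq> 0 \<and> s = k * s' \<and> t = k * t'"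
    then show thesis by (rule that)
  qed
  let ?p = "\<lambda>w. NX *v w" and ?q = "\<lambda>w. NY *v w"
  have pN: "polyfun (\<lambda>w. (NX *v w) $ j)" "polyfun (\<lambda>w. (NY *v w) $ j)" for j
    unfolding vdot_N[symmetric] vdot_def by (intro polyfun_sum polyfun_mult polyfun_coord polyfun_const)+
  have NAB: "NX *v (Av p + Bv q) = p" "NY *v (Av p + Bv q) = q" for p q by (rule NX_AB, rule NY_AB)
  \<comment> \<open>The pair (p, q) is encoded by one vector w through \<open>NX\<close> and
    \<open>NY\<close>. The value \<open>None\<close> stands for the condition that keeps h(s, t)
    nonzero, \<open>Some (s, t)\<close> for the condition at a root.\<close>
  define g where "g r w = (case r of None \<Rightarrow> vdot x0 (cr (?p w) (?q w))
    | Some (s, t) \<Rightarrow> vdot (fv s t) (s *s ?p w + t *s ?q w))" for r w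
  have "\<exists>w. \<forall>r\<in>insert None (Some ` R). g r w \<noteq> 0"
  proof (rule polyfun_nonzero_prod[of "insert None (Some ` R)" g])
    show "finite (insert None (Some ` R))" using R(1) by simp
    show "polyfun (g r)" for r
    proof (cases r)
      case None
      then have "g r = (\<lambda>w. vdot x0 (cr (?p w) (?q w)))" by (simp add: g_def fun_eq_iff)
      then show ?thesis
        by (simp only: vdot_3 cr_nth) (intro polyfun_add polyfun_diff polyfun_mult polyfun_const pN)
    next
      case (Some st)
      then have "g r = (\<lambda>w. vdot (fv (fst st) (snd st)) (fst st *s ?p w + snd st *s ?q w))"
        by (simp add: g_def fun_eq_iff split: prod.split)
      then show ?thesis
        by (simp only: vdot_3 vector_add_component vector_smult_component)
          (intro polyfun_add polyfun_mult polyfun_const pN)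
    qed
    fix r assume r: "r \<in> insert None (Some ` R)"
    show "\<exists>w. g r w \<noteq> 0"
    proof (cases r)
      case None
      obtain l where l: "vdot l x0 \<noteq> 0" using vdot_nonzero[OF good_x_nonzero[OF x0]] by blast
      obtain y where y: "y $ 3 \<noteq> 0" "vdot y x0 \<noteq> 0"
      proof (rule polyfun_nonzero_mult[OF polyfun_coord polyfun_vdot])
        show "(axis 3 1 :: 'a ^ 3) $ 3 \<noteq> 0" by (simp add: axis_def)
        show "vdot l x0 \<noteq> 0" by (rule l)
      qed (rule that)
      obtain p q where "cr p q = y" by (rule cr_surj[OF y(1)])
      then have "g r (Av p + Bv q) \<noteq> 0"
        using y(2) by (simp add: g_def None NAB vdot_def mult.commute)
      then show ?thesis by blast
    next
      case (Some st)
      then obtain s t where st: "r = Some (s, t)" "(s, t) \<in> R" using r by (cases st) auto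
      then have nz: "(s, t) \<noteq> (0, 0)" using R(2) by blast
      obtain j where j: "fv s t $ j \<noteq> 0" using fv_nonzero[OF nz] by (auto simp: Finite_Cartesian_Product.vec_eq_iff)
      have "g r (Av p + Bv q) = vdot (fv s t) (s *s p + t *s q)" for p q by (simp add: g_def st(1) NAB)
      then have G: "g r (Av (s' *s axis j 1) + Bv (t' *s axis j 1)) = (s * s' + t * t') * fv s t $ j" for s' t'
        by (simp add: vdot_linear vdot_axis distrib_right mult.assoc)
      show ?thesis
      proof (cases "s = 0")
        case True
        then show ?thesis using G[of 0 1] nz j by (intro exI[of _ "Av (0 *s axis j 1) + Bv (1 *s axis j 1)"]) simp
      next
        case False
        then show ?thesis using G[of 1 0] j by (intro exI[of _ "Av (1 *s axis j 1) + Bv (0 *s axis j 1)"]) simp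
      qed
    qed
  qed blast
  then obtain w where w: "\<And>r. r \<in> insert None (Some ` R) \<Longrightarrow> g r w \<noteq> 0" by blast
  define p q where "p = NX *v w" and "q = NY *v w"
  have w1: "vdot x0 (cr p q) \<noteq> 0" using w[of None] by (simp add: g_def p_def q_def)
  have w2: "vdot (fv s t) (s *s p + t *s q) \<noteq> 0" if st: "(s, t) \<in> R" for s t
    using w[of "Some (s, t)"] st by (simp add: g_def p_def q_def)
  \<comment> \<open>With this choice \<open>cr (al c) (be c)\<close> is a nonzero multiple of
    \<open>x0\<close>, and \<open>hl c s t\<close> is orthogonal to \<open>x0\<close> for all s,
    t.\<close>
  define c where "c = cov (cr x0 p) (cr x0 q)"
  have h: "hl c s t = cr x0 (s *s p + t *s q)" for s t
    unfolding hl_def c_def al_cov be_cov by (rule vec3_eqI) (simp_all add: cr_nth algebra_simps)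
  have "vdot p (cr x0 q) = - vdot x0 (cr p q)" by (simp add: vdot_3 cr_nth algebra_simps)
  then have "cr (al c) (be c) = vdot x0 (cr p q) *s x0"
    unfolding c_def al_cov be_cov cr_cr by (simp add: vdot_cr)
  then have crc: "cr (al c) (be c) \<noteq> 0" using w1 good_x_nonzero[OF x0] by simp
  have "cv c s t \<noteq> 0" if st: "(s, t) \<noteq> (0, 0)" for s t
  proof
    assume z: "cv c s t = 0"
    have hnz: "hl c s t \<noteq> 0" using hl_eq_0[OF st] crc by blast
    have "cr (hl c s t) (fv s t) = 0"
      by (rule vec3_eqI) (use z cr_nth[of "fv s t" "hl c s t"] in \<open>simp_all add: cv_def cr_nth algebra_simps\<close>)
    then obtain e where e: "fv s t = e *s hl c s t" by (rule cr_proportional[OF _ hnz])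
    have "vdot (hl c s t) x0 = 0" unfolding h by (simp add: vdot_3 cr_nth algebra_simps)
    then have "ev f (bp s t x0) = 0" unfolding f_vdot e vdot_left by simp
    then obtain s' t' k where k: "(s', t') \<in> R" "k \<noteq> 0" "s = k * s'" "t = k * t'" using R(3)[OF st] by blast
    have fx: "vdot (fv s' t') x0 = 0" using R(2)[OF k(1)] by (simp add: f_vdot)
    let ?y = "s' *s p + t' *s q"
    have "k ^ (d - 1) *s cv c s' t' = 0" using z unfolding k cv_scale .
    then have "cv c s' t' = 0" using k(2) by simp
    then have zz: "cr (fv s' t') (cr x0 ?y) = 0" by (simp add: cv_def h)
    have "cr (fv s' t') (cr x0 ?y) = vdot (fv s' t') ?y *s x0 - vdot (fv s' t') x0 *s ?y"
      by (rule vec3_eqI) (simp_all add: cr_nth vdot_3 algebra_simps)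
    then have "vdot (fv s' t') ?y *s x0 = 0" using zz by (simp add: fx)
    then show False using w2[OF k(1)] good_x_nonzero[OF x0] by simp
  qed
  then show ?thesis unfolding good_def by blast
qed

lemma al_expand: "al c $ j = (\<Sum>l\<in>UNIV. c $ l * al (axis l 1) $ j)" "be c $ j = (\<Sum>l\<in>UNIV. c $ l * be (axis l 1) $ j)"
proof -
  have "vdot (axis l 1) v = v $ l" for l :: 6 and v :: "'a ^ 6"
    using vdot_axis[of v l] by (simp add: vdot_def mult.commute)
  then show "al c $ j = (\<Sum>l\<in>UNIV. c $ l * al (axis l 1) $ j)" "be c $ j = (\<Sum>l\<in>UNIV. c $ l * be (axis l 1) $ j)"
    by (simp_all add: al_def be_def) (simp_all add: vdot_def)
qed

lemma cv_expand: "cv c s t $ j = (\<Sum>l\<in>UNIV. c $ l * cv (axis l 1) s t $ j)"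
proof -
  have h: "hl c s t $ k = (\<Sum>l\<in>UNIV. c $ l * hl (axis l 1) s t $ k)" for k
  proof -
    have "(\<Sum>l\<in>UNIV. c $ l * hl (axis l 1) s t $ k) =
        s * (\<Sum>l\<in>UNIV. c $ l * al (axis l 1) $ k) + t * (\<Sum>l\<in>UNIV. c $ l * be (axis l 1) $ k)"
      by (simp add: hl_def sum_distrib_left sum.distrib distrib_left mult.left_commute)
    then show ?thesis unfolding al_expand(1)[symmetric] al_expand(2)[symmetric] by (simp add: hl_def)
  qed
  show ?thesis
    using exhaust_3[of j] h
    by (elim disjE) (simp_all add: cv_def cr_nth sum_distrib_left sum_subtractf[symmetric] algebra_simps)
qed

text \<open>If the forms \<open>cv c0\<close> have no common zero, then they generate all binary forms of some degree \<open>M\<close>.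
  Using the same cofactors for other \<open>c\<close>, the determinant of the resulting system of binary forms is a
  form in \<open>c\<close> whose nonvanishing excludes common zeros.\<close>

lemma good_open:
  assumes g: "good c0"
  obtains F n where "F \<in> forms n" "n \<ge> 1" "mp_value F c0 \<noteq> 0" "\<And>c. mp_value F c \<noteq> 0 \<Longrightarrow> good c"
proof -
  define Q where "Q = {G. \<exists>h. G = (\<Sum>j\<in>UNIV. Cb c0 $ j * h j)}"
  have Q: "ideal.subspace Q"
    unfolding ideal.subspace_def
  proof (intro conjI ballI allI)
    show "0 \<in> Q" unfolding Q_def mem_Collect_eq by (rule exI[of _ "\<lambda>_. 0"]) simp
    fix A B assume "A \<in> Q" "B \<in> Q"
    then obtain h h' where "A = (\<Sum>j\<in>UNIV. Cb c0 $ j * h j)" "B = (\<Sum>j\<in>UNIV. Cb c0 $ j * h' j)" by (auto simp: Q_def)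
    then show "A + B \<in> Q" unfolding Q_def mem_Collect_eq
      by (intro exI[of _ "\<lambda>j. h j + h' j"]) (simp add: distrib_left sum.distrib)
  next
    fix r A assume "A \<in> Q"
    then obtain h where "A = (\<Sum>j\<in>UNIV. Cb c0 $ j * h j)" by (auto simp: Q_def)
    then show "r * A \<in> Q" unfolding Q_def mem_Collect_eq
      by (intro exI[of _ "\<lambda>j. r * h j"]) (simp add: sum_distrib_left mult.left_commute)
  qed
  have CQ: "Cb c0 $ i \<in> Q" for i
    unfolding Q_def mem_Collect_eq
    by (rule exI[of _ "\<lambda>j. if j = i then 1 else 0"]) (simp add: if_distrib cong: if_cong)
  have "\<exists>j. ev (Cb c0 $ j) (bp s t 0) \<noteq> 0" if "(s, t) \<noteq> (0, 0)" for s t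
    using g that by (auto simp: good_def Finite_Cartesian_Product.vec_eq_iff ev_Cb)
  then obtain M1 M2 where M1: "mp_var vT ^ M1 \<in> Q" and M2: "mp_var vS ^ M2 \<in> Q"
    by (rule common_powers_in_ideal[OF Q bih_Cb CQ])
  \<comment> \<open>A monomial of degree at least M1 + M2 is divisible by t^M1 or by s^M2. The
    summand d makes M at least d - 1, so cofactors of degree M - (d - 1) exist.\<close>
  define M where "M = M1 + M2 + d"
  define mon :: "nat \<Rightarrow> 'a bipoly" where "mon k = mp_var vS ^ k * mp_var vT ^ (M - k)" for k
  have "mon k \<in> Q" for k
  proof (cases "M2 \<le> k")
    case True
    then have "mon k = (mp_var vS ^ (k - M2) * mp_var vT ^ (M - k)) * mp_var vS ^ M2"
      by (simp add: mon_def mult_ac flip: power_add)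
    then show ?thesis using ideal.subspace_scale[OF Q M2] by simp
  next
    case False
    then have "M - k = (M - k - M1) + M1" by (simp add: M_def)
    then have "mp_var vT ^ (M - k) = mp_var vT ^ (M - k - M1) * (mp_var vT ^ M1 :: 'a bipoly)" by (metis power_add)
    then have "mon k = (mp_var vS ^ k * mp_var vT ^ (M - k - M1)) * mp_var vT ^ M1"
      by (simp only: mon_def mult.assoc)
    then show ?thesis using ideal.subspace_scale[OF Q M1] by simp
  qed
  then have "\<forall>k. \<exists>h. mon k = (\<Sum>j\<in>UNIV. Cb c0 $ j * h j)" by (auto simp: Q_def)
  then obtain h where h: "\<And>k. mon k = (\<Sum>j\<in>UNIV. Cb c0 $ j * h k j)" by metis
  \<comment> \<open>Only the component of the right degree matters, so that
    \<open>\<Psi> c k\<close> is a binary form of degree M for every \<open>c\<close> and not only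
    for \<open>c0\<close>.\<close>
  define h' where "h' k j = bihc (M - (d - 1)) 0 (h k j)" for k j
  have bmon: "bih M 0 (mon k)" if k: "k \<le> M" for k
  proof -
    have "bih (1 * k + 1 * (M - k)) (0 * k + 0 * (M - k)) (mon k)"
      unfolding mon_def by (intro bih_mult bih_power bih_var)
    then show ?thesis using k by simp
  qed
  define \<Psi> where "\<Psi> c k = (\<Sum>j\<in>UNIV. Cb c $ j * h' k j)" for c k
  have dM: "d - 1 \<le> M" by (simp add: M_def)
  have b\<Psi>: "bih M 0 (\<Psi> c k)" for c k
  proof -
    have "bih ((d - 1) + (M - (d - 1))) (0 + 0) (Cb c $ j * h' k j)" for j
      unfolding h'_def by (intro bih_mult bih_Cb bih_bihc)
    then show ?thesis unfolding \<Psi>_def using dM by (intro bih_sum) simp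
  qed
  have \<Psi>0: "\<Psi> c0 k = mon k" if k: "k \<le> M" for k
  proof -
    have "mon k = bihc M 0 (mon k)" by (rule bihc_bih[OF bmon[OF k], symmetric])
    also have "\<dots> = (\<Sum>j\<in>UNIV. bihc M 0 (Cb c0 $ j * h k j))" unfolding h by (simp add: sum_3 bihc_add)
    also have "\<dots> = \<Psi> c0 k" unfolding \<Psi>_def h'_def by (simp only: bihc_mult[OF bih_Cb] dM order_refl if_True simp_thms diff_zero)
    finally show ?thesis ..
  qed
  interpret D: comm_ring_hom "dehom (0 :: 'a ^ 3)" by (rule dehom_hom)
  \<comment> \<open>The coefficient matrix of the forms \<open>\<Psi> c k\<close> in the monomials
    of degree M. It depends linearly on \<open>c\<close> and is the identity at
    \<open>c0\<close>.\<close>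
  define E where "E c k i = coeff (dehom 0 (\<Psi> c k)) i" for c k i
  have \<Psi>_lin: "\<Psi> c k = (\<Sum>l\<in>UNIV. mp_const (c $ l) * \<Psi> (axis l 1) k)" for c k
  proof (rule bipoly_eqI)
    fix s t x
    have "ev (\<Psi> c k) (bp s t x) = (\<Sum>j\<in>UNIV. (\<Sum>l\<in>UNIV. c $ l * cv (axis l 1) s t $ j) * ev (h' k j) (bp s t x))"
      unfolding \<Psi>_def by (simp add: ev_Cb cv_expand[of c])
    also have "\<dots> = (\<Sum>l\<in>UNIV. \<Sum>j\<in>UNIV. c $ l * cv (axis l 1) s t $ j * ev (h' k j) (bp s t x))"
      unfolding sum_distrib_right by (rule sum.swap)
    also have "\<dots> = ev (\<Sum>l\<in>UNIV. mp_const (c $ l) * \<Psi> (axis l 1) k) (bp s t x)"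
      unfolding \<Psi>_def by (simp add: ev_Cb sum_distrib_left mult.assoc)
    finally show "ev (\<Psi> c k) (bp s t x) = ev (\<Sum>l\<in>UNIV. mp_const (c $ l) * \<Psi> (axis l 1) k) (bp s t x)" .
  qed
  have dc: "dehom 0 (mp_const e) = [:e:]" for e :: 'a
    unfolding dehom_def by (rule mp_eval_const[OF pCons_hom])
  have E_lin: "E c k i = (\<Sum>l\<in>UNIV. c $ l * E (axis l 1) k i)" for c k i
    unfolding E_def by (subst \<Psi>_lin[of c k]) (simp add: D.hom_sum D.hom_mult dc coeff_sum)
  have E0: "E c0 k i = (if k = i then 1 else 0)" if k: "k \<le> M" for k i
  proof -
    have "dehom 0 (mp_var vS) = [:0, 1 :: 'a:]" "dehom 0 (mp_var vT) = (1 :: 'a poly)"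
      unfolding dehom_def by (simp_all add: mp_eval_var[OF pCons_hom])
    then have "dehom 0 (mon k) = monom 1 k" by (simp add: mon_def D.hom_mult D.hom_power monom_altdef)
    then show ?thesis unfolding E_def \<Psi>0[OF k] by simp
  qed
  have Ev: "(\<Sum>i\<le>M. E c k i * s ^ i * t ^ (M - i)) = (\<Sum>j\<in>UNIV. cv c s t $ j * ev (h' k j) (bp s t 0))" for c k s t
  proof -
    have "whom wS M (\<Psi> c k)" using b\<Psi> by (simp add: bih_def)
    from dehom_bform(2)[OF this] have "bform M (dehom 0 (\<Psi> c k)) s t = ev (\<Psi> c k) (bp s t 0)" by metis
    then show ?thesis by (simp add: bform_def E_def \<Psi>_def ev_Cb)
  qed
  define e where "e k i = (\<Sum>l\<in>UNIV. mp_const (E (axis l 1) k i) * mp_var l)" for k i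
  have e: "e k i \<in> forms 1" "mp_value (e k i) c = E c k i" for k i c
    unfolding e_def by (rule linear_form) (simp add: E_lin[of c] mult.commute)
  define F :: "(6, 'a) mpoly" where "F = Determinant.det (Matrix.mat (M + 1) (M + 1) (\<lambda>(k, i). e k i))"
  have F: "F \<in> forms (M + 1)" unfolding F_def by (rule det_forms[OF e(1)])
  have F_val: "mp_value F c = Determinant.det (Matrix.mat (M + 1) (M + 1) (\<lambda>(k, i). E c k i))" for c
  proof -
    interpret C: comm_ring_hom "\<lambda>G :: (6, 'a) mpoly. mp_value G c"
      unfolding mp_value_ev by (rule ev_hom)
    have "map_mat (\<lambda>G. mp_value G c) (Matrix.mat (M + 1) (M + 1) (\<lambda>(k, i). e k i)) = Matrix.mat (M + 1) (M + 1) (\<lambda>(k, i). E c k i)"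
      by (rule eq_matI) (auto simp: e(2))
    then show ?thesis unfolding F_def C.hom_det[symmetric] by simp
  qed
  have "Matrix.mat (M + 1) (M + 1) (\<lambda>(k, i). E c0 k i) = 1\<^sub>m (M + 1)"
    by (rule eq_matI) (auto simp: E0)
  then have F0: "mp_value F c0 \<noteq> 0" unfolding F_val by simp
  have "good c" if Fc: "mp_value F c \<noteq> 0" for c
    unfolding good_def
  proof (intro allI impI notI)
    fix s t assume st: "(s, t) \<noteq> (0, 0)" and z: "cv c s t = 0"
    let ?A = "Matrix.mat (M + 1) (M + 1) (\<lambda>(k, i). E c k i)"
    \<comment> \<open>At a common zero (s, t) of the cross product all forms
      \<open>\<Psi> c k\<close> vanish, so the vector of monomials of degree M at (s, t) lies in the
      kernel of the matrix.\<close>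
    let ?v = "Matrix.vec (M + 1) (\<lambda>i. s ^ i * t ^ (M - i))"
    have "?A *\<^sub>v ?v = 0\<^sub>v (M + 1)"
    proof (rule eq_vecI)
      fix k assume k: "k < dim_vec (0\<^sub>v (M + 1) :: 'a Matrix.vec)"
      have "vec_index (?A *\<^sub>v ?v) k = (\<Sum>i=0..<M + 1. E c k i * (s ^ i * t ^ (M - i)))"
        using k by (simp add: scalar_prod_def del: sum.op_ivl_Suc)
      also have "{0..<M + 1} = {..M}" by auto
      also have "(\<Sum>i\<le>M. E c k i * (s ^ i * t ^ (M - i))) = 0"
        using Ev[of c k s t] by (simp add: z mult.assoc)
      finally show "vec_index (?A *\<^sub>v ?v) k = vec_index (0\<^sub>v (M + 1)) k" using k by simp
    qed simp
    moreover have "?v \<noteq> 0\<^sub>v (M + 1)"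
    proof
      assume v0: "?v = 0\<^sub>v (M + 1)"
      have "s ^ i * t ^ (M - i) = 0" if i: "i \<le> M" for i
        using arg_cong[OF v0, of "\<lambda>v. vec_index v i"] i by simp
      from this[of 0] this[of M] show False using st by simp
    qed
    ultimately have "Determinant.det ?A = 0"
      by (subst det_0_iff_vec_prod_zero_field[of _ "M + 1"]) (auto intro!: exI[of _ ?v])
    then show False using Fc F_val by simp
  qed
  with F F0 show thesis by (intro that[of F "M + 1"]) auto
qed

end


locale extremal_surface = type_I_surface a b f d for a b :: "3 \<Rightarrow> 'a::alg_closed_field ^ 6" and f d +
  fixes U :: "('a ^ 6) set set"
  assumes U: "openin hyperplane_topology U" "U \<noteq> {}"
    and reg: "\<And>\<Lambda>. \<Lambda> \<in> U \<Longrightarrow> has_regularity_in \<Lambda> (hyperplane_section (V f) \<Lambda>) (int d - 2)"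
begin

abbreviation EH :: "('a ^ 6) set set" where "EH \<equiv> extremal_hyperplanes (V f) d"

text \<open>The points x of P^2, up to scaling, whose lines \<open>Lx x\<close> arise as extremal
  lines of admissible hyperplanes.\<close>

definition axes :: "('a ^ 3) set" where
  "axes = {cr (al c) (be c) | c. good c \<and> hyp c \<in> EH}"

lemma EH_E:
  assumes "\<Lambda> \<in> EH"
  obtains c where "good c" "\<Lambda> = hyp c"
proof -
  obtain U' where U': "openin hyperplane_topology U'" "\<Lambda> \<in> U'" "integral_curve (hyperplane_section (V f) \<Lambda>)"
    using assms unfolding extremal_hyperplanes_def by blast
  then have "\<Lambda> \<in> Gr 4" unfolding hyperplane_topology_def openin_pullback_topology by blast
  then obtain c where c: "c \<noteq> 0" "\<Lambda> = hyp c" by (rule Gr4E)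
  then have "good c" using U'(3) integral_iff_good[OF c(1)] by simp
  with c(2) that show thesis by blast
qed

lemma extremal_lines: "extremal_line (V f) d ` EH = Lx ` axes"
proof (intro equalityI subsetI)
  fix L assume "L \<in> extremal_line (V f) d ` EH"
  then obtain \<Lambda> where L: "\<Lambda> \<in> EH" "L = extremal_line (V f) d \<Lambda>" by blast
  obtain c where c: "good c" "\<Lambda> = hyp c" by (rule EH_E[OF L(1)])
  have "cr (al c) (be c) \<in> axes" unfolding axes_def using c L(1) by blast
  then show "L \<in> Lx ` axes" using L(2) c(2) extremal_line_eq[OF c(1)] by blast
next
  fix L assume "L \<in> Lx ` axes"
  then obtain c where c: "good c" "hyp c \<in> EH" "L = Lx (cr (al c) (be c))" unfolding axes_def by blast
  then show "L \<in> extremal_line (V f) d ` EH" using extremal_line_eq[OF c(1)] by blast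
qed

lemma axes_nonzero: "x \<in> axes \<Longrightarrow> x \<noteq> 0"
  using good_cr by (auto simp: axes_def)

text \<open>Three conditions on the equation \<open>c\<close> are combined: \<open>F1\<close> keeps
  the hyperplane inside \<open>U\<close>, where the regularity is known, \<open>F2\<close> makes the
  section integral, and \<open>g\<close> is nonzero at \<open>cr (al c) (be c)\<close>. Each holds
  for some \<open>c\<close>, so all three hold for a common one; \<open>F1\<close> and
  \<open>F2\<close> also hold nearby, which gives the open set demanded of extremal
  hyperplanes.\<close>

lemma axes_dense: "zdense axes"
  unfolding zdense_def
proof (intro allI impI)
  fix g :: "'a ^ 3 \<Rightarrow> 'a" assume g: "polyfun g" "\<exists>x. g x \<noteq> 0"
  obtain \<Lambda> where \<Lambda>: "\<Lambda> \<in> U" using U(2) by blast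
  then have "\<Lambda> \<in> Gr 4" using U(1) unfolding hyperplane_topology_def openin_pullback_topology by blast
  then obtain c1 where c1: "c1 \<noteq> 0" "\<Lambda> = hyp c1" by (rule Gr4E)
  obtain F1 where F1: "homogeneous F1" "mp_value F1 c1 \<noteq> 0" "annihilator -` nonvanishing F1 \<inter> Gr 4 \<subseteq> U"
    by (rule openin_hyperplane_basis[OF U(1) c1(1)]) (use \<Lambda> c1(2) in auto)
  obtain c0 where "good c0" using good_exists by blast
  then obtain F2 n where F2: "F2 \<in> forms n" "n \<ge> 1" "mp_value F2 c0 \<noteq> 0" "\<And>c. mp_value F2 c \<noteq> 0 \<Longrightarrow> good c"
    by (rule good_open) (rule that)
  have F2h: "homogeneous F2" using F2(1) by (auto simp: homogeneous_def)
  \<comment> \<open>The third entry must be nonzero for \<open>cr_surj\<close> to realize the point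
    as a cross product, hence as \<open>cr (al c) (be c)\<close> for some \<open>c\<close>.\<close>
  have "(axis 3 1 :: 'a ^ 3) $ 3 \<noteq> 0" by (simp add: axis_def)
  moreover obtain x where "g x \<noteq> 0" using g(2) by blast
  ultimately obtain y where y: "y $ 3 \<noteq> 0" "g y \<noteq> 0" by (rule polyfun_nonzero_mult[OF polyfun_coord g(1)])
  obtain p q where pq: "cr p q = y" by (rule cr_surj[OF y(1)])
  let ?g = "\<lambda>c. g (cr (al c) (be c))"
  have g': "polyfun ?g" by (rule polyfun_compose[OF g(1) polyfun_cr])
  have "?g (cov p q) \<noteq> 0" using y(2) by (simp add: al_cov be_cov pq)
  then obtain c2 where c2: "mp_value F2 c2 \<noteq> 0" "?g c2 \<noteq> 0"
    by (rule polyfun_nonzero_mult[OF polyfun_mp_value g' F2(3)])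
  have "polyfun (\<lambda>c. mp_value F2 c * ?g c)" by (intro polyfun_mult polyfun_mp_value g')
  moreover have "mp_value F2 c2 * ?g c2 \<noteq> 0" using c2 by simp
  ultimately obtain c where c: "mp_value F1 c \<noteq> 0" "mp_value F2 c * ?g c \<noteq> 0"
    using polyfun_nonzero_mult[OF polyfun_mp_value _ F1(2), of "\<lambda>c. mp_value F2 c * ?g c"] by blast
  then have c': "mp_value F2 c \<noteq> 0" "?g c \<noteq> 0" by auto
  have gc: "good c" by (rule F2(4)[OF c'(1)])
  have c0: "c \<noteq> 0" by (rule good_nonzero[OF gc])
  let ?N = "\<lambda>F. annihilator -` nonvanishing F \<inter> Gr 4"
  have "hyp c \<in> EH"
    unfolding extremal_hyperplanes_def
  proof (rule UnionI, rule CollectI, intro conjI ballI)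
    show "openin hyperplane_topology (?N F1 \<inter> ?N F2)"
      by (intro openin_Int openin_hyperplanes F1(1) F2h)
    show "hyp c \<in> ?N F1 \<inter> ?N F2" using hyp_nonvanishing[OF _ c0] F1(1) F2h c(1) c'(1) by blast
    fix \<Lambda> assume L: "\<Lambda> \<in> ?N F1 \<inter> ?N F2"
    then have "\<Lambda> \<in> U" using F1(3) by blast
    then show "has_regularity_in \<Lambda> (hyperplane_section (V f) \<Lambda>) (int d - 2)" by (rule reg)
    obtain e where e: "e \<noteq> 0" "\<Lambda> = hyp e" by (rule Gr4E[of \<Lambda>]) (use L in blast)+
    then have "mp_value F2 e \<noteq> 0" using L hyp_nonvanishing[OF F2h e(1)] by blast
    then have "good e" by (rule F2(4))
    then show "integral_curve (hyperplane_section (V f) \<Lambda>)" using integral_iff_good[OF e(1)] e(2) by simp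
  qed
  then have "cr (al c) (be c) \<in> axes" unfolding axes_def using gc by blast
  then show "\<exists>x\<in>axes. g x \<noteq> 0" using c'(2) by blast
qed

lemma special_extremal_secant_locus_eq: "special_extremal_secant_locus (V f) d = {Lx x | x. x \<noteq> 0}"
  unfolding special_extremal_secant_locus_def extremal_lines by (rule closure_of_lines[OF axes_dense axes_nonzero])

lemma extremal_variety_eq: "extremal_variety (V f) d = V 0"
proof -
  have "(\<Union>\<Lambda>\<in>EH. points (extremal_line (V f) d \<Lambda>)) = (\<Union>L\<in>extremal_line (V f) d ` EH. points L)" by simp
  also have "\<dots> = (\<Union>x\<in>axes. points (Lx x))" unfolding extremal_lines by simp
  finally show ?thesis
    unfolding extremal_variety_def by (simp only: closure_of_union[OF axes_dense axes_nonzero])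
qed

end

theorem proposition4p5:
  fixes X W :: "('a::alg_closed_field ^ 6) set set" and d :: nat
  assumes "d > 5"
    and "maximal_sectional_regularity X d"
    and "type_I X d W"
  shows "(extended_extremal_variety X d = extremal_variety X d \<and> extremal_variety X d = W) \<and>
    special_extremal_secant_locus X d = extremal_secant_locus X d \<and>
    (\<exists>V \<in> Gr 5. is_veronese_surface V (plucker ` extremal_secant_locus X d))"
proof -
  obtain a b s t l where ab: "is_scroll_111 a b W" "prime_divisor W X" "(s, t) \<noteq> (0, 0)" "l \<in> forms 1 - vanishing_ideal W"
     "linearly_equivalent W (single_divisor X)
       (\<lambda>Y. form_divisor W l Y + (int d - 3) * single_divisor (ruling_plane a b s t) Y)"
    using assms(3) unfolding type_I_def by blast
  interpret scroll a b by unfold_locales (use ab(1) in \<open>simp add: is_scroll_111_def\<close>)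
  have W: "W = V 0" using ab(1) scroll_eq_V by (simp only: is_scroll_111_def)
  have "krull_dim zariski X = 2"
    using assms(2) by (simp add: maximal_sectional_regularity_def surface_of_degree_def)
  moreover have "d \<ge> 3" using assms(1) by simp
  ultimately obtain f where f: "prime_elem f" "bih (d - 2) 1 f" "X = V f"
    by (rule type_I_equation[OF ab(2)[unfolded W] _ _ ab(3) ab(4)[unfolded W] ab(5)[unfolded W]])
  obtain U where U: "openin hyperplane_topology U" "U \<noteq> {}"
    "\<And>\<Lambda>. \<Lambda> \<in> U \<Longrightarrow> has_regularity_in \<Lambda> (hyperplane_section X \<Lambda>) (int d - 2)"
    using assms(2) unfolding maximal_sectional_regularity_def by blast
  interpret extremal_surface a b f d U
    by unfold_locales (use f assms(1) U in auto)
  have "\<exists>V \<in> Gr 5. is_veronese_surface V (plucker ` extremal_secant_locus X d)"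
    using ver_mat_Gr veronese_Lx unfolding f(3) extremal_secant_locus_eq by blast
  then show ?thesis
    unfolding W f(3) extended_extremal_variety_eq extremal_variety_eq special_extremal_secant_locus_eq
      extremal_secant_locus_eq by simp
qed

end
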